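(* Let $s>\frac12$. There exist $\varepsilon_0>0$ and a constant $K>0$ such that for every $\varepsilon\in(0,\varepsilon_0)$, every $\lambda_0>0$, and every global real-valued solution $(u,\partial_t u)(t)$, $t\in\mathbb{R}$, of the Born-Infeld equation $$(1- (\partial_t u)^2)\, \partial_x^2 u + 2\,\partial_x u\, \partial_t u \, \partial_{t}\partial_x u - (1+(\partial_x u)^2)\, \partial_t^2 u = 0,\qquad (t,x)\in\mathbb{R}\times\mathbb{R},$$ with $$\sup_{t\in\mathbb{R}}\|(u,\partial_t u)(t)\|_{(H^{s+1}\times H^s)(\mathbb{R})} <\varepsilon ,$$ one has $$\int_2^\infty \int_{\mathbb{R}} \operatorname{sech}^2 \Big(\frac{x}{\lambda_0}\Big) \big( (\partial_x u)^2 + (\partial_t u)^2\big) (t,x)\,dx\, dt \le K\, \lambda_0\, \varepsilon^2.$$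
   Context: A global solution at regularity $H^{s+1}\times H^s$ ($s>\frac12$) is a function $u=u(t,x)\in\mathbb{R}$ with $(u,\partial_t u)\in C(\mathbb{R};H^{s+1}(\mathbb{R})\times H^s(\mathbb{R}))$ satisfying the equation in the sense of distributions (the products being well defined since multiplication $H^s\times H^{s-1}\to H^{s-1}$ is bounded for $s>\frac12$). *)

theory Defs
  imports "HOL-Analysis.Analysis"
begin

section \<open>Schwartz functions and distributions on the line\<close>

abbreviation vderiv :: "(real \<Rightarrow> complex) \<Rightarrow> real \<Rightarrow> complex" where
  "vderiv f \<equiv> (\<lambda>x. vector_derivative f (at x))"

definition schwartz :: "(real \<Rightarrow> complex) set" where
  "schwartz = {\<phi>. \<forall>n. (\<forall>x. (vderiv ^^ n) \<phi> differentiable (at x)) \<and>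
     (\<forall>k. bounded (range (\<lambda>x. (x ^ k) *\<^sub>R (vderiv ^^ n) \<phi> x)))}"

text \<open>A distribution is a functional on test functions; only its values on
  \<^const>\<open>schwartz\<close> matter.\<close>

type_synonym distribution = "(real \<Rightarrow> complex) \<Rightarrow> complex"

definition reg_dist :: "(real \<Rightarrow> real) \<Rightarrow> distribution" where
  "reg_dist f = (\<lambda>\<phi>. LINT x|lborel. complex_of_real (f x) * \<phi> x)"

definition dist_deriv :: "distribution \<Rightarrow> distribution" where
  "dist_deriv T = (\<lambda>\<phi>. - T (vderiv \<phi>))"

definition dist_diff :: "distribution \<Rightarrow> distribution \<Rightarrow> distribution" where
  "dist_diff S T = (\<lambda>\<phi>. S \<phi> - T \<phi>)"

definition square_integrable :: "(real \<Rightarrow> real) \<Rightarrow> bool" where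
  "square_integrable f \<longleftrightarrow> f \<in> borel_measurable lborel \<and> integrable lborel (\<lambda>x. (f x)\<^sup>2)"

definition weak_deriv :: "(real \<Rightarrow> real) \<Rightarrow> (real \<Rightarrow> real) \<Rightarrow> bool" where
  "weak_deriv f g \<longleftrightarrow> square_integrable g \<and>
     (\<forall>\<phi>\<in>schwartz. reg_dist g \<phi> = dist_deriv (reg_dist f) \<phi>)"

section \<open>Fourier transform and Sobolev spaces\<close>

text \<open>Unitary normalisation, so that the norm of \<open>H\<^sup>0\<close> is the \<open>L\<^sup>2\<close> norm.\<close>

definition fourier :: "(real \<Rightarrow> complex) \<Rightarrow> real \<Rightarrow> complex" where
  "fourier h \<xi> = complex_of_real (1 / sqrt (2 * pi)) * (LINT x|lborel. cis (- (x * \<xi>)) * h x)"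

definition inv_fourier :: "(real \<Rightarrow> complex) \<Rightarrow> real \<Rightarrow> complex" where
  "inv_fourier h \<xi> = complex_of_real (1 / sqrt (2 * pi)) * (LINT x|lborel. cis (x * \<xi>) * h x)"

text \<open>The distributional Fourier transform \<open>\<phi> \<mapsto> T (fourier \<phi>)\<close> is the function \<open>g\<close>,
  which is then unique up to null sets.\<close>

definition has_fourier :: "distribution \<Rightarrow> (real \<Rightarrow> complex) \<Rightarrow> bool" where
  "has_fourier T g \<longleftrightarrow> g \<in> borel_measurable lborel \<and>
     (\<forall>\<phi>\<in>schwartz. integrable lborel (\<lambda>\<xi>. g \<xi> * \<phi> \<xi>) \<and>
        T (fourier \<phi>) = (LINT \<xi>|lborel. g \<xi> * \<phi> \<xi>))"

definition dist_fourier :: "distribution \<Rightarrow> real \<Rightarrow> complex" where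
  "dist_fourier T = (SOME g. has_fourier T g)"

text \<open>Membership in \<open>H\<^sup>\<sigma>(\<real>)\<close>, for any real \<open>\<sigma>\<close>. Linearity and continuity of \<open>T\<close> on
  \<^const>\<open>schwartz\<close> need not be demanded: they follow from the existence of \<open>g\<close>, because
  the Fourier transform is a bijection of \<^const>\<open>schwartz\<close>.\<close>

definition sobolev :: "real \<Rightarrow> distribution \<Rightarrow> bool" where
  "sobolev \<sigma> T \<longleftrightarrow> (\<exists>g. has_fourier T g \<and>
     integrable lborel (\<lambda>\<xi>. (1 + \<xi>\<^sup>2) powr \<sigma> * (cmod (g \<xi>))\<^sup>2))"

definition sobolev_norm :: "real \<Rightarrow> distribution \<Rightarrow> real" where
  "sobolev_norm \<sigma> T = sqrt (LINT \<xi>|lborel. (1 + \<xi>\<^sup>2) powr \<sigma> * (cmod (dist_fourier T \<xi>))\<^sup>2)"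

definition pair_norm :: "real \<Rightarrow> (real \<Rightarrow> real) \<Rightarrow> (real \<Rightarrow> real) \<Rightarrow> real" where
  "pair_norm s f g =
     sqrt ((sobolev_norm (s + 1) (reg_dist f))\<^sup>2 + (sobolev_norm s (reg_dist g))\<^sup>2)"

text \<open>\<open>C(\<real>; H\<^sup>\<sigma>)\<close> for \<open>\<sigma> \<ge> 0\<close>, the elements of \<open>H\<^sup>\<sigma>\<close> being given by arbitrary
  representatives of their classes.\<close>

definition sobolev_continuous :: "real \<Rightarrow> (real \<Rightarrow> real \<Rightarrow> real) \<Rightarrow> bool" where
  "sobolev_continuous \<sigma> f \<longleftrightarrow>
     (\<forall>t. square_integrable (f t) \<and> sobolev \<sigma> (reg_dist (f t))) \<and>
     (\<forall>t0. ((\<lambda>t. sobolev_norm \<sigma> (dist_diff (reg_dist (f t)) (reg_dist (f t0)))) \<longlongrightarrow> 0) (at t0))"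

text \<open>\<open>L\<^sup>1\<^sub>l\<^sub>o\<^sub>c(\<real>; H\<^sup>\<sigma>)\<close>; weak measurability suffices since \<open>H\<^sup>\<sigma>\<close> is separable.\<close>

definition sobolev_loc_integrable :: "real \<Rightarrow> (real \<Rightarrow> distribution) \<Rightarrow> bool" where
  "sobolev_loc_integrable \<sigma> A \<longleftrightarrow>
     (\<forall>t. sobolev \<sigma> (A t)) \<and>
     (\<forall>\<phi>\<in>schwartz. (\<lambda>t. A t \<phi>) \<in> borel_measurable lborel) \<and>
     (\<forall>R. (\<integral>\<^sup>+t\<in>{-R..R}. ennreal (sobolev_norm \<sigma> (A t)) \<partial>lborel) < \<infinity>)"

text \<open>The product \<open>\<langle>f T, \<phi>\<rangle> = \<langle>T, f \<phi>\<rangle>\<close> of \<open>T \<in> H\<^sup>s\<^sup>-\<^sup>1\<close> with a function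
  \<open>f \<in> H\<^sup>s\<close> (or constant plus \<open>H\<^sup>s\<close>), \<open>s > 1/2\<close>. As \<open>f \<phi> \<in> H\<^sup>s \<subseteq> H\<^sup>1\<^sup>-\<^sup>s\<close> need
  not be Schwartz, \<open>T\<close> is extended to it by the duality of \<open>H\<^sup>s\<^sup>-\<^sup>1\<close> and \<open>H\<^sup>1\<^sup>-\<^sup>s\<close>, that is,
  by Parseval's formula, whose integral converges absolutely. This is the continuous extension
  \<open>H\<^sup>s \<times> H\<^sup>s\<^sup>-\<^sup>1 \<rightarrow> H\<^sup>s\<^sup>-\<^sup>1\<close> of the pointwise product.\<close>

definition dist_pairing :: "distribution \<Rightarrow> (real \<Rightarrow> complex) \<Rightarrow> complex" where
  "dist_pairing T h = (LINT \<xi>|lborel. dist_fourier T \<xi> * inv_fourier h \<xi>)"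

definition dist_mult :: "(real \<Rightarrow> real) \<Rightarrow> distribution \<Rightarrow> distribution" where
  "dist_mult f T = (\<lambda>\<phi>. dist_pairing T (\<lambda>x. complex_of_real (f x) * \<phi> x))"

section \<open>Distributions on space-time\<close>

definition pd_t :: "(real \<Rightarrow> real \<Rightarrow> complex) \<Rightarrow> real \<Rightarrow> real \<Rightarrow> complex" where
  "pd_t \<phi> t x = vector_derivative (\<lambda>\<tau>. \<phi> \<tau> x) (at t)"

definition pd_x :: "(real \<Rightarrow> real \<Rightarrow> complex) \<Rightarrow> real \<Rightarrow> real \<Rightarrow> complex" where
  "pd_x \<phi> t x = vector_derivative (\<phi> t) (at x)"

inductive_set partials :: "(real \<Rightarrow> real \<Rightarrow> complex) \<Rightarrow> (real \<Rightarrow> real \<Rightarrow> complex) set"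
  for \<phi> where
  self: "\<phi> \<in> partials \<phi>"
| dt: "\<psi> \<in> partials \<phi> \<Longrightarrow> pd_t \<psi> \<in> partials \<phi>"
| dx: "\<psi> \<in> partials \<phi> \<Longrightarrow> pd_x \<psi> \<in> partials \<phi>"

definition test_functions :: "(real \<Rightarrow> real \<Rightarrow> complex) set" where
  "test_functions = {\<phi>.
     (\<forall>\<psi>\<in>partials \<phi>. continuous_on UNIV (\<lambda>(t, x). \<psi> t x) \<and>
        (\<forall>t x. (\<lambda>\<tau>. \<psi> \<tau> x) differentiable (at t) \<and> \<psi> t differentiable (at x))) \<and>
     (\<exists>R. \<forall>t x. R < \<bar>t\<bar> \<or> R < \<bar>x\<bar> \<longrightarrow> \<phi> t x = 0)}"

text \<open>The distribution on \<open>\<real> \<times> \<real>\<close> defined by a curve of distributions in \<open>x\<close>.\<close>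

definition spacetime :: "(real \<Rightarrow> distribution) \<Rightarrow> (real \<Rightarrow> real \<Rightarrow> complex) \<Rightarrow> complex" where
  "spacetime A \<phi> = (LINT t|lborel. A t (\<phi> t))"

definition dist_deriv_t :: "(real \<Rightarrow> distribution) \<Rightarrow> (real \<Rightarrow> distribution) \<Rightarrow> bool" where
  "dist_deriv_t A B \<longleftrightarrow> (\<forall>\<phi>\<in>test_functions. spacetime B \<phi> = - spacetime A (pd_t \<phi>))"

section \<open>Global solutions of the Born-Infeld equation\<close>

text \<open>Here \<open>ux\<close> and \<open>ut\<close> are the distributional derivatives \<open>\<partial>\<^sub>x u\<close> and \<open>\<partial>\<^sub>t u\<close>, while
  \<open>utt\<close> is \<open>\<partial>\<^sub>t\<^sup>2 u\<close>; it has to take values in \<open>H\<^sup>s\<^sup>-\<^sup>1\<close> for its product with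
  \<open>1 + (\<partial>\<^sub>x u)\<^sup>2\<close> to be defined. The mixed derivative is \<open>\<partial>\<^sub>x (\<partial>\<^sub>t u)\<close>.\<close>

definition born_infeld_solution ::
  "real \<Rightarrow> (real \<Rightarrow> real \<Rightarrow> real) \<Rightarrow> (real \<Rightarrow> real \<Rightarrow> real) \<Rightarrow> (real \<Rightarrow> real \<Rightarrow> real) \<Rightarrow> bool" where
  "born_infeld_solution s u ux ut \<longleftrightarrow>
     sobolev_continuous (s + 1) u \<and> sobolev_continuous s ut \<and>
     (\<forall>t. weak_deriv (u t) (ux t)) \<and>
     dist_deriv_t (\<lambda>t. reg_dist (u t)) (\<lambda>t. reg_dist (ut t)) \<and>
     (\<exists>utt. sobolev_loc_integrable (s - 1) utt \<and>
        dist_deriv_t (\<lambda>t. reg_dist (ut t)) utt \<and>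
        (\<forall>\<phi>\<in>test_functions.
           spacetime (\<lambda>t. dist_mult (\<lambda>x. 1 - (ut t x)\<^sup>2) (dist_deriv (dist_deriv (reg_dist (u t))))) \<phi>
           + 2 * spacetime (\<lambda>t. dist_mult (\<lambda>x. ux t x * ut t x) (dist_deriv (reg_dist (ut t)))) \<phi>
           - spacetime (\<lambda>t. dist_mult (\<lambda>x. 1 + (ux t x)\<^sup>2) (utt t)) \<phi> = 0))"

end

(*
  With a = u_x, b = u_t and q = sqrt (1 + a^2 - b^2), the momentum density a b / q and the flux
  (1 - b^2) / q - 1 satisfy a conservation law.  For small a and b the flux is comparable to
  -(a^2 + b^2).  Integrating the law in time against the bounded weight tanh (x / lam), whose
  derivative is sech^2 (x / lam) / lam, therefore bounds the local energy by lam times the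
  supremum of the momentum, which is at most a^2 + b^2 in L^1.
  For H^(s+1) x H^s solutions a_x and b_x are only distributions in H^(s-1).  The law is derived
  by mollifying a and b in space, and the commutators vanish in the limit because functions with
  an L^2 modulus of continuity of order r = min s 1 > 1/2 are bounded in the dual space
  H^(1-r), so that products with H^(r-1) pass to the limit weakly.
*)
theory Submission
  imports Defs "HOL-Probability.Probability"
begin

section \<open>Smooth functions of compact support\<close>

text \<open>Density and flux are the components, belonging to translations in x, of the stress
  tensor of the Lagrangian sqrt (1 + u_x^2 - u_t^2), which is why their law survives for large
  gradients of a and b. Two obstacles shape the argument. The law multiplies rough derivatives by
  nonlinear functions of a and b. Fubini moves the mollifier from the derivative onto the
  multiplier; at fixed t one fixed distribution then meets multipliers whose pointwise limits cancel
  identically. This asks for a class of multipliers that is stable, with uniform constants, under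
  products, quotients, roots and mollification, and moduli of continuity give such stability by
  pointwise Lipschitz bounds. Secondly, u_tt is only locally integrable in time with values in
  H^(s-1). The equation is therefore solved for u_tt at almost every t; the right side found there
  is continuous in t when tested in x, so mollifications of b are differentiable at every time. The
  exponent is capped at 1 because first differences see no higher order. Smallness enters by making
  |a| and |b| at most 1/4, and K = 8 is 4 from the flux times 2 for the two ends of the time
  interval.\<close>

definition smooth_cs :: "(real \<Rightarrow> complex) set" where
  "smooth_cs = {f. (\<forall>n x. (vderiv ^^ n) f differentiable (at x)) \<and> (\<exists>R. \<forall>x. R < \<bar>x\<bar> \<longrightarrow> f x = 0)}"

text \<open>Smoothness by coinduction: iterated derivatives need no closed form, only a family of
  functions that contains f and is stable under differentiation.\<close>

lemma smooth_coinduct: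
  assumes "f \<in> S" and "\<And>g. g \<in> S \<Longrightarrow> (\<forall>x. g differentiable (at x)) \<and> vderiv g \<in> S"
  shows "(vderiv ^^ n) f \<in> S" "(vderiv ^^ n) f differentiable (at x)"
proof -
  show "(vderiv ^^ n) f \<in> S" by (induction n) (use assms in auto)
  then show "(vderiv ^^ n) f differentiable (at x)" using assms(2) by blast
qed

lemma vderiv_eqI:
  assumes "\<And>x. (f has_vector_derivative f' x) (at x)"
  shows "vderiv f = f'"
  using assms by (auto intro: vector_derivative_at)

lemma smooth_cs_has_vderiv:
  assumes "f \<in> smooth_cs"
  shows "(f has_vector_derivative vderiv f x) (at x)"
  using assms unfolding smooth_cs_def
  by (metis (mono_tags, lifting) funpow_0 mem_Collect_eq vector_derivative_works)

lemma smooth_cs_vderiv: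
  assumes "f \<in> smooth_cs"
  shows "vderiv f \<in> smooth_cs"
proof -
  obtain R where R: "\<And>x. R < \<bar>x\<bar> \<Longrightarrow> f x = 0"
    using assms unfolding smooth_cs_def by blast
  have "vderiv f x = 0" if "R < \<bar>x\<bar>" for x
  proof -
    have "open {x. R < \<bar>x::real\<bar>}"
      by (intro open_Collect_less continuous_intros)
    then have "(f has_vector_derivative 0) (at x)"
      by (rule has_vector_derivative_transform_within_open[of "\<lambda>_. 0", rotated])
        (use that R in auto)
    then show ?thesis by (rule vector_derivative_at)
  qed
  moreover have "(vderiv ^^ n) (vderiv f) differentiable (at x)" for n x
  proof -
    have "(vderiv ^^ Suc n) f differentiable (at x)" using assms unfolding smooth_cs_def by blast
    then show ?thesis by (simp add: funpow_Suc_right del: funpow.simps)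
  qed
  ultimately show ?thesis unfolding smooth_cs_def by blast
qed

lemma smooth_cs_coinduct:
  assumes "f \<in> S" and "\<And>g. g \<in> S \<Longrightarrow> \<exists>g'\<in>S. \<forall>x. (g has_vector_derivative g' x) (at x)"
    and "\<And>x. R < \<bar>x\<bar> \<Longrightarrow> f x = 0"
  shows "f \<in> smooth_cs"
proof -
  have "(\<forall>x. g differentiable (at x)) \<and> vderiv g \<in> S" if "g \<in> S" for g
    using assms(2)[OF that] vderiv_eqI[of g] by (metis differentiableI_vector)
  from smooth_coinduct[OF assms(1) this] show ?thesis
    using assms(3) unfolding smooth_cs_def by blast
qed

lemma smooth_cs_support:
  assumes "f \<in> smooth_cs"
  obtains R where "R > 0" "\<And>x. R < \<bar>x\<bar> \<Longrightarrow> f x = 0"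
proof -
  obtain R where "\<And>x. R < \<bar>x\<bar> \<Longrightarrow> f x = 0"
    using assms unfolding smooth_cs_def by blast
  then show thesis by (intro that[of "max R 1"]) auto
qed

lemma smooth_cs_continuous:
  assumes "f \<in> smooth_cs"
  shows "continuous_on UNIV f"
  by (meson assms continuous_at_imp_continuous_on has_vector_derivative_continuous smooth_cs_has_vderiv)

lemma integrable_compact_support:
  fixes f :: "real \<Rightarrow> 'b::{banach, second_countable_topology}"
  assumes "continuous_on UNIV f" "\<And>x. R < \<bar>x\<bar> \<Longrightarrow> f x = 0"
  shows "integrable lborel f"
proof -
  have "integrable lborel (\<lambda>x. indicator {-R..R} x *\<^sub>R f x)"
    using assms(1) by (intro borel_integrable_compact) (auto intro: continuous_on_subset)
  also have "(\<lambda>x. indicator {-R..R} x *\<^sub>R f x) = f"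
    using assms(2) by (force simp: indicator_def abs_le_iff not_le)
  finally show ?thesis .
qed

lemma bounded_compact_support:
  fixes f :: "real \<Rightarrow> 'b::real_normed_vector"
  assumes "continuous_on UNIV f" "\<And>x. R < \<bar>x\<bar> \<Longrightarrow> f x = 0"
  obtains M where "M > 0" "\<And>x. norm (f x) \<le> M"
proof -
  have "bounded (f ` {-R..R})"
    using assms(1) by (intro compact_imp_bounded compact_continuous_image) (auto intro: continuous_on_subset)
  then obtain M where M: "M > 0" "\<And>x. x \<in> {-R..R} \<Longrightarrow> norm (f x) \<le> M"
    unfolding bounded_pos by auto
  have "norm (f x) \<le> M" for x
    using M assms(2)[of x] by (cases "R < \<bar>x\<bar>") (auto simp: abs_le_iff not_less)
  with M(1) show thesis by (rule that)
qed

lemma smooth_cs_integrable: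
  assumes "f \<in> smooth_cs"
  shows "integrable lborel f"
proof -
  obtain R where "\<And>x. R < \<bar>x\<bar> \<Longrightarrow> f x = 0" using smooth_cs_support[OF assms] by blast
  then show ?thesis by (rule integrable_compact_support[OF smooth_cs_continuous[OF assms]])
qed

lemma smooth_cs_bounded:
  assumes "f \<in> smooth_cs"
  obtains M where "M > 0" "\<And>x. norm (f x) \<le> M"
proof -
  obtain R where "\<And>x. R < \<bar>x\<bar> \<Longrightarrow> f x = 0" using smooth_cs_support[OF assms] by blast
  from bounded_compact_support[OF smooth_cs_continuous[OF assms] this] that show thesis by blast
qed

lemma smooth_cs_measurable:
  assumes "f \<in> smooth_cs"
  shows "f \<in> borel_measurable borel"
  by (simp add: assms borel_measurable_continuous_onI smooth_cs_continuous)

lemma smooth_cs_add: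
  assumes "f \<in> smooth_cs" "g \<in> smooth_cs"
  shows "(\<lambda>x. f x + g x) \<in> smooth_cs"
proof -
  define S where "S = {\<lambda>x. f x + g x | f g. f \<in> smooth_cs \<and> g \<in> smooth_cs}"
  obtain R1 where R1: "\<And>x. R1 < \<bar>x\<bar> \<Longrightarrow> f x = 0" using smooth_cs_support assms(1) by blast
  obtain R2 where R2: "\<And>x. R2 < \<bar>x\<bar> \<Longrightarrow> g x = 0" using smooth_cs_support assms(2) by blast
  show ?thesis
  proof (rule smooth_cs_coinduct[where S = S and R = "max R1 R2"])
    show "(\<lambda>x. f x + g x) \<in> S" using assms S_def by blast
    fix h assume "h \<in> S"
    then obtain f g where fg: "f \<in> smooth_cs" "g \<in> smooth_cs" "h = (\<lambda>x. f x + g x)"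
      unfolding S_def by blast
    then have d: "(h has_vector_derivative vderiv f x + vderiv g x) (at x)" for x
      by (auto intro!: derivative_eq_intros smooth_cs_has_vderiv)
    have "(\<lambda>x. vderiv f x + vderiv g x) \<in> S"
      unfolding S_def mem_Collect_eq
      by (intro exI[of _ "vderiv f"] exI[of _ "vderiv g"]) (simp add: smooth_cs_vderiv fg)
    with d show "\<exists>g'\<in>S. \<forall>x. (h has_vector_derivative g' x) (at x)"
      by (intro bexI[where x = "\<lambda>x. vderiv f x + vderiv g x"]) auto
  qed (use R1 R2 in auto)
qed

lemma smooth_cs_affine:
  assumes "f \<in> smooth_cs" "c \<noteq> 0"
  shows "(\<lambda>x. C * f (c * x + d)) \<in> smooth_cs"
proof -
  define S where "S = {\<lambda>x. C * f (c * x + d) | C f. f \<in> smooth_cs}"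
  obtain R where R: "\<And>x. R < \<bar>x\<bar> \<Longrightarrow> f x = 0" using smooth_cs_support assms(1) by blast
  show ?thesis
  proof (rule smooth_cs_coinduct[where S = S and R = "(\<bar>R\<bar> + \<bar>d\<bar>) / \<bar>c\<bar>"])
    show "(\<lambda>x. C * f (c * x + d)) \<in> S" using assms S_def by blast
    show "C * f (c * x + d) = 0" if "(\<bar>R\<bar> + \<bar>d\<bar>) / \<bar>c\<bar> < \<bar>x\<bar>" for x
    proof -
      have "\<bar>R\<bar> + \<bar>d\<bar> < \<bar>c * x\<bar>" using that assms(2) by (simp add: field_simps abs_mult)
      then show ?thesis using R[of "c * x + d"] by simp
    qed
    fix h assume "h \<in> S"
    then obtain C f where fg: "f \<in> smooth_cs" "h = (\<lambda>x. C * f (c * x + d))"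
      unfolding S_def by blast
    have d: "(h has_vector_derivative (C * of_real c) * vderiv f (c * x + d)) (at x)" for x
    proof -
      have 1: "((\<lambda>x. c * x + d) has_vector_derivative c) (at x)"
        by (auto intro!: derivative_eq_intros)
      have "((f \<circ> (\<lambda>x. c * x + d)) has_vector_derivative c *\<^sub>R vderiv f (c * x + d)) (at x)"
        by (intro vector_diff_chain_at[OF 1] smooth_cs_has_vderiv fg(1))
      from has_vector_derivative_mult_right[OF this, of C] show ?thesis
        unfolding fg(2) o_def by (simp add: scaleR_conv_of_real mult_ac)
    qed
    have "(\<lambda>x. (C * of_real c) * vderiv f (c * x + d)) \<in> S"
      unfolding S_def mem_Collect_eq
      by (intro exI[of _ "C * of_real c"] exI[of _ "vderiv f"]) (simp add: smooth_cs_vderiv[OF fg(1)])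
    with d show "\<exists>g'\<in>S. \<forall>x. (h has_vector_derivative g' x) (at x)"
      by (intro bexI[where x = "\<lambda>x. (C * of_real c) * vderiv f (c * x + d)"]) auto
  qed
qed

lemma smooth_cs_cmult:
  assumes "f \<in> smooth_cs"
  shows "(\<lambda>x. C * f x) \<in> smooth_cs"
  using smooth_cs_affine[OF assms, of 1 C 0] by simp

lemma smooth_cs_times_x:
  assumes "f \<in> smooth_cs"
  shows "(\<lambda>x. of_real x * f x) \<in> smooth_cs"
proof -
  \<comment> \<open>Differentiating x g produces the extra term g, so the products alone are not
    stable; adding an arbitrary test function f closes the family.\<close>
  define S where "S = {\<lambda>x. f x + of_real x * g x | f g. f \<in> smooth_cs \<and> g \<in> smooth_cs}"
  obtain R where R: "\<And>x. R < \<bar>x\<bar> \<Longrightarrow> f x = 0" using smooth_cs_support assms(1) by blast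
  show ?thesis
  proof (rule smooth_cs_coinduct[where S = S and R = R])
    have "(\<lambda>x. 0 * f x) \<in> smooth_cs" using assms by (rule smooth_cs_cmult)
    then show "(\<lambda>x. of_real x * f x) \<in> S" using assms unfolding S_def by force
    fix h assume "h \<in> S"
    then obtain f g where fg: "f \<in> smooth_cs" "g \<in> smooth_cs" "h = (\<lambda>x. f x + of_real x * g x)"
      unfolding S_def by blast
    then have d: "(h has_vector_derivative (vderiv f x + g x) + of_real x * vderiv g x) (at x)" for x
      by (auto intro!: derivative_eq_intros smooth_cs_has_vderiv)
    have "(\<lambda>x. (vderiv f x + g x) + of_real x * vderiv g x) \<in> S"
      unfolding S_def mem_Collect_eq
      by (intro exI[of _ "\<lambda>x. vderiv f x + g x"] exI[of _ "vderiv g"])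
        (simp add: smooth_cs_add smooth_cs_vderiv fg)
    with d show "\<exists>g'\<in>S. \<forall>x. (h has_vector_derivative g' x) (at x)"
      by (intro bexI[where x = "\<lambda>x. (vderiv f x + g x) + of_real x * vderiv g x"]) auto
  qed (use R in auto)
qed

lemma smooth_cs_subset_schwartz: "smooth_cs \<subseteq> schwartz"
proof
  fix f assume f: "f \<in> smooth_cs"
  have cs: "(vderiv ^^ n) f \<in> smooth_cs" for n
    by (induction n) (auto simp: f smooth_cs_vderiv)
  have "bounded (range (\<lambda>x. x ^ k *\<^sub>R (vderiv ^^ n) f x))" for n k
  proof -
    obtain R where "\<And>x. R < \<bar>x\<bar> \<Longrightarrow> (vderiv ^^ n) f x = 0" using smooth_cs_support cs by blast
    then have z: "\<And>x. R < \<bar>x\<bar> \<Longrightarrow> x ^ k *\<^sub>R (vderiv ^^ n) f x = 0" by simp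
    have "continuous_on UNIV (\<lambda>x. x ^ k *\<^sub>R (vderiv ^^ n) f x)"
      by (intro continuous_intros smooth_cs_continuous cs)
    from bounded_compact_support[OF this z] obtain M
      where "\<And>x. norm (x ^ k *\<^sub>R (vderiv ^^ n) f x) \<le> M" by blast
    then show ?thesis unfolding bounded_iff by auto
  qed
  then show "f \<in> schwartz"
    using f unfolding schwartz_def smooth_cs_def by blast
qed

subsection \<open>A smooth bump\<close>

text \<open>The standard bump is the case p = 1, n = 0. Polynomials times powers of 1 / (1 - x^2)
  are included so that the family is stable under differentiation.\<close>

definition bump_term :: "real poly \<Rightarrow> nat \<Rightarrow> real \<Rightarrow> real" where
  "bump_term p n x = (if \<bar>x\<bar> < 1 then poly p x * (1 / (1 - x\<^sup>2)) ^ n * exp (- (1 / (1 - x\<^sup>2))) else 0)"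

text \<open>With y = 1 / (1 - x^2) one has y' = 2 x y^2. This is the polynomial left in the
  derivative of p y^n exp (- y) after y^(n+2) exp (- y) is factored out.\<close>

definition bump_next :: "real poly \<Rightarrow> nat \<Rightarrow> real poly" where
  "bump_next p n = pderiv p * [:1, 0, -1:]\<^sup>2 + smult (2 * real n) ([:0, 1:] * p * [:1, 0, -1:])
     - smult 2 ([:0, 1:] * p)"

text \<open>A single term of the exponential series is at most exp y.\<close>

lemma power_times_exp_le:
  fixes y :: real assumes "y \<ge> 0"
  shows "y ^ m * exp (- y) \<le> fact m"
proof -
  have "y ^ m / fact m \<le> exp y"
  proof -
    have s: "(\<lambda>n. y ^ n /\<^sub>R fact n) sums exp y" by (rule exp_converges)
    have "sum (\<lambda>n. y ^ n /\<^sub>R fact n) {m} \<le> exp y"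
      unfolding sums_unique[OF s] using s assms
      by (intro sum_le_suminf) (auto simp: sums_iff)
    then show ?thesis by (simp add: field_simps)
  qed
  then show ?thesis by (simp add: exp_minus field_simps)
qed

text \<open>Inside the interval this is the product rule. For |x| at least 1 the exponential beats
  every power of 1 / (1 - z^2), which makes the value at z at most C (z - x)^2; the derivative at x
  is therefore 0, the endpoints included.\<close>

lemma bump_term_DERIV:
  "(bump_term p n has_real_derivative bump_term (bump_next p n) (n + 2) x) (at x)"
proof (cases "\<bar>x\<bar> < 1")
  case True
  then have x2: "1 - x\<^sup>2 > 0" by (simp add: abs_square_less_1)
  have o: "open {x. \<bar>x::real\<bar> < 1}" by (intro open_Collect_less continuous_intros)
  define Y where "Y = (\<lambda>x::real. 1 / (1 - x\<^sup>2))"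
  define y where "y = Y x"
  have y: "y > 0" "1 - x\<^sup>2 = 1 / y" using x2 by (auto simp: y_def Y_def)
  have dY: "(Y has_real_derivative 2 * x * y\<^sup>2) (at x)"
    unfolding Y_def y_def
    by (rule derivative_eq_intros refl)+ (use x2 in \<open>auto simp: power2_eq_square field_simps\<close>)
  note D = DERIV_mult[OF DERIV_mult[OF poly_DERIV[of p x] DERIV_power[OF dY, of n]] DERIV_chain2[OF DERIV_exp DERIV_minus[OF dY]]]
  have 1: "poly (bump_next p n) x = poly (pderiv p) x * (1 / y)\<^sup>2 + 2 * real n * x * poly p x * (1 / y) - 2 * x * poly p x"
    unfolding bump_next_def y(2)[symmetric] by (simp add: power2_eq_square algebra_simps)
  have 2: "real n * (2 * x * y\<^sup>2 * y ^ (n - Suc 0)) = 2 * x * real n * y ^ n * y"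
    by (cases n) (auto simp: power2_eq_square)
  have "bump_term (bump_next p n) (n + 2) x = poly (bump_next p n) x * y ^ (n + 2) * exp (- y)"
    using True by (simp add: bump_term_def y_def Y_def)
  also have "\<dots> = (poly (pderiv p) x * y ^ n + 2 * x * real n * y ^ n * y * poly p x) * exp (- y)
      + exp (- y) * - (2 * x * y\<^sup>2) * (poly p x * y ^ n)"
    unfolding 1 using y(1) by (simp add: field_simps power2_eq_square)
  finally have "((\<lambda>x. poly p x * Y x ^ n * exp (- Y x)) has_real_derivative
      bump_term (bump_next p n) (n + 2) x) (at x)"
    using D unfolding y_def[symmetric] 2 by simp
  then show ?thesis
    by (rule has_field_derivative_transform_within_open[OF _ o]) (use True in \<open>auto simp: bump_term_def Y_def\<close>)
next
  case False
  \<comment> \<open>The factorial bounds y^(n+2) exp (- y), the sum of coefficients bounds p on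
    [-1, 1], and 4 is the square of the 2 in 1 - z^2 <= 2 |z - x|.\<close>
  define C where "C = fact (n + 2) * (\<Sum>i\<le>degree p. \<bar>coeff p i\<bar>) * 4"
  have C: "C \<ge> 0" unfolding C_def by (intro mult_nonneg_nonneg sum_nonneg) auto
  have b: "\<bar>bump_term p n z\<bar> \<le> C * (z - x)\<^sup>2" for z
  proof (cases "\<bar>z\<bar> < 1")
    case True
    define y where "y = 1 / (1 - z\<^sup>2)"
    have z2: "1 - z\<^sup>2 > 0" using True by (simp add: abs_square_less_1)
    then have y: "y > 0" by (simp add: y_def)
    have "y ^ n * exp (- y) * y\<^sup>2 \<le> fact (n + 2)"
    proof -
      have "y ^ n * exp (- y) * y\<^sup>2 = y ^ (n + 2) * exp (- y)"
        by (simp add: power_add power2_eq_square)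
      also have "\<dots> \<le> fact (n + 2)" using y by (intro power_times_exp_le) simp
      finally show ?thesis .
    qed
    then have 1: "y ^ n * exp (- y) \<le> fact (n + 2) * (1 - z\<^sup>2)\<^sup>2"
      using y z2 by (simp add: y_def field_simps)
    have 2: "\<bar>poly p z\<bar> \<le> (\<Sum>i\<le>degree p. \<bar>coeff p i\<bar>)"
      unfolding poly_altdef
    proof (rule order_trans[OF sum_abs], rule sum_mono)
      fix i
      have "\<bar>z\<bar> ^ i \<le> 1" using True by (intro power_le_one) auto
      then show "\<bar>coeff p i * z ^ i\<bar> \<le> \<bar>coeff p i\<bar>"
        by (simp add: abs_mult power_abs mult_left_le)
    qed
    have 3: "1 - z\<^sup>2 \<le> 2 * \<bar>z - x\<bar>"
    proof -
      have "1 - z\<^sup>2 = (1 - \<bar>z\<bar>) * (1 + \<bar>z\<bar>)" by (simp add: algebra_simps power2_eq_square)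
      also have "\<dots> \<le> \<bar>z - x\<bar> * 2"
        using True False by (intro mult_mono) auto
      finally show ?thesis by simp
    qed
    have "(1 - z\<^sup>2)\<^sup>2 \<le> (2 * \<bar>z - x\<bar>)\<^sup>2" using 3 z2 by (intro power_mono) auto
    then have 4: "(1 - z\<^sup>2)\<^sup>2 \<le> 4 * (z - x)\<^sup>2" by (simp add: power_mult_distrib)
    have "\<bar>bump_term p n z\<bar> = \<bar>poly p z\<bar> * (y ^ n * exp (- y))"
      using True y by (simp add: bump_term_def y_def abs_mult power_abs)
    also have "\<dots> \<le> (\<Sum>i\<le>degree p. \<bar>coeff p i\<bar>) * (fact (n + 2) * (4 * (z - x)\<^sup>2))"
      using 1 2 4 y by (intro mult_mono order_trans[OF 1] sum_nonneg) auto
    finally show ?thesis by (simp add: C_def mult_ac)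
  qed (use C in \<open>simp add: bump_term_def\<close>)
  have x0: "bump_term q k x = 0" for q k using False by (simp add: bump_term_def)
  have "(\<lambda>h. (bump_term p n (x + h) - bump_term p n x) / h) \<midarrow>0\<rightarrow> 0"
  proof (rule Lim_null_comparison)
    show "\<forall>\<^sub>F h in at 0. norm ((bump_term p n (x + h) - bump_term p n x) / h) \<le> C * \<bar>h\<bar>"
      unfolding eventually_at_filter
    proof (intro always_eventually allI impI)
      fix h :: real assume h: "h \<noteq> 0"
      show "norm ((bump_term p n (x + h) - bump_term p n x) / h) \<le> C * \<bar>h\<bar>"
        using b[of "x + h"] h by (simp add: x0 field_simps power2_eq_square)
    qed
    show "((\<lambda>h. C * \<bar>h\<bar>) \<longlongrightarrow> 0) (at 0)" by (auto intro!: tendsto_eq_intros)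
  qed
  then show ?thesis by (simp add: DERIV_def x0)
qed

lemma bump_term_smooth: "(\<lambda>x. complex_of_real (bump_term p n x)) \<in> smooth_cs"
proof -
  define S where "S = {\<lambda>x. complex_of_real (bump_term p n x) | p n. True}"
  show ?thesis
  proof (rule smooth_cs_coinduct[where S = S and R = 1])
    show "(\<lambda>x. complex_of_real (bump_term p n x)) \<in> S" unfolding S_def by blast
    fix g assume "g \<in> S"
    then obtain p n where g: "g = (\<lambda>x. complex_of_real (bump_term p n x))" unfolding S_def by blast
    have d: "(g has_vector_derivative complex_of_real (bump_term (bump_next p n) (n + 2) x)) (at x)" for x
      unfolding g by (intro has_vector_derivative_of_real bump_term_DERIV)
    have "(\<lambda>x. complex_of_real (bump_term (bump_next p n) (n + 2) x)) \<in> S"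
      unfolding S_def by blast
    with d show "\<exists>g'\<in>S. \<forall>x. (g has_vector_derivative g' x) (at x)"
      by (intro bexI[where x = "\<lambda>x. complex_of_real (bump_term (bump_next p n) (n + 2) x)"]) auto
  qed (auto simp: bump_term_def)
qed

section \<open>Differentiation under the integral sign\<close>

lemma has_vector_derivative_iff_quotient:
  fixes f :: "real \<Rightarrow> 'b::real_normed_vector"
  shows "(f has_vector_derivative f') (at x) \<longleftrightarrow> ((\<lambda>h. (f (x + h) - f x) /\<^sub>R h) \<longlongrightarrow> f') (at 0)"
proof -
  have "norm (f (x + h) - f x - h *\<^sub>R f') / norm h = norm ((f (x + h) - f x) /\<^sub>R h - f')" if "h \<noteq> 0" for h
  proof -
    have "(f (x + h) - f x) /\<^sub>R h - f' = (f (x + h) - f x - h *\<^sub>R f') /\<^sub>R h"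
      using that by (simp add: scaleR_right_diff_distrib)
    then show ?thesis by (simp add: divide_inverse mult.commute)
  qed
  then have "((\<lambda>h. norm (f (x + h) - f x - h *\<^sub>R f') / norm h) \<longlongrightarrow> 0) (at 0) \<longleftrightarrow>
      ((\<lambda>h. norm ((f (x + h) - f x) /\<^sub>R h - f')) \<longlongrightarrow> 0) (at 0)"
    by (intro filterlim_cong refl) (auto simp: eventually_at_filter)
  then show ?thesis
    unfolding has_vector_derivative_def has_derivative_at
    by (simp add: tendsto_norm_zero_iff LIM_zero_iff bounded_linear_scaleR_left)
qed

text \<open>The mean value inequality bounds all difference quotients by D, so dominated convergence
  applies along every null sequence.\<close>

lemma has_vector_derivative_integral:
  fixes f :: "real \<Rightarrow> 'a \<Rightarrow> 'b::{banach, second_countable_topology}"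
  assumes e: "e > 0"
    and int: "\<And>y. \<bar>y - y0\<bar> < e \<Longrightarrow> integrable M (f y)"
    and der: "\<And>x y. \<bar>y - y0\<bar> < e \<Longrightarrow> ((\<lambda>y. f y x) has_vector_derivative f' y x) (at y)"
    and bd: "\<And>x y. \<bar>y - y0\<bar> < e \<Longrightarrow> norm (f' y x) \<le> D x"
    and D: "integrable M D"
  shows "integrable M (f' y0)"
    and "((\<lambda>y. \<integral>x. f y x \<partial>M) has_vector_derivative (\<integral>x. f' y0 x \<partial>M)) (at y0)"
proof -
  define q where "q h x = (f (y0 + h) x - f y0 x) /\<^sub>R h" for h x
  have q_lim: "((\<lambda>h. q h x) \<longlongrightarrow> f' y0 x) (at 0)" for x
    using der[of y0 x] e unfolding has_vector_derivative_iff_quotient q_def by simp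
  have q_int: "integrable M (q h)" if "\<bar>h\<bar> < e" for h
    unfolding q_def using int[of "y0 + h"] int[of y0] that e by auto
  have q_bd: "norm (q h x) \<le> D x" if h: "\<bar>h\<bar> < e" for h x
  proof -
    have "norm (f (y0 + h) x - f y0 x) \<le> D x * norm (y0 + h - y0)"
    proof (rule differentiable_bound[where S = "ball y0 e" and f' = "\<lambda>y t. t *\<^sub>R f' y x"])
      fix y assume "y \<in> ball y0 e"
      then have y: "\<bar>y - y0\<bar> < e" by (auto simp: dist_real_def)
      show "((\<lambda>y. f y x) has_derivative (\<lambda>t. t *\<^sub>R f' y x)) (at y within ball y0 e)"
        using der[OF y, of x] unfolding has_vector_derivative_def by (rule has_derivative_at_withinI)
      show "onorm (\<lambda>t. t *\<^sub>R f' y x) \<le> D x"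
        using bd[OF y, of x] by (intro onorm_le) (auto simp: mult.commute[of "D x"] intro: mult_left_mono)
    qed (use h e in \<open>auto simp: dist_real_def\<close>)
    moreover have "0 \<le> D x" using bd[of y0 x] e norm_ge_zero[of "f' y0 x"] by linarith
    ultimately show ?thesis
      unfolding q_def norm_scaleR by (cases "h = 0") (auto simp: field_simps)
  qed
  \<comment> \<open>One fixed null sequence of nonzero steps; \<open>f' y0\<close> is measurable as
    the limit of difference quotients along it. The summand 2 keeps already the first step strictly
    below e.\<close>
  define h0 where "h0 n = e / (real n + 2)" for n
  have h0_lim: "h0 \<longlonglongrightarrow> 0" unfolding h0_def by real_asymp
  have h0_less: "\<bar>h0 n\<bar> < e" and h0_nz: "h0 n \<noteq> 0" for n
    using e by (auto simp: h0_def field_simps add_pos_nonneg)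
  note h0 = h0_lim h0_less h0_nz
  have m: "f' y0 \<in> borel_measurable M"
  proof (rule borel_measurable_LIMSEQ_metric[where f = "\<lambda>n. q (h0 n)"])
    show "q (h0 n) \<in> borel_measurable M" for n using q_int[OF h0(2)] by auto
    show "(\<lambda>n. q (h0 n) x) \<longlonglongrightarrow> f' y0 x" for x
      by (rule filterlim_compose[OF q_lim]) (use h0 in \<open>simp add: filterlim_at\<close>)
  qed
  show "integrable M (f' y0)"
  proof (rule Bochner_Integration.integrable_bound[OF D m], rule AE_I2)
    show "norm (f' y0 x) \<le> norm (D x)" for x using bd[of y0 x] e by (auto intro: order_trans)
  qed
  show "((\<lambda>y. \<integral>x. f y x \<partial>M) has_vector_derivative (\<integral>x. f' y0 x \<partial>M)) (at y0)"
    unfolding has_vector_derivative_iff_quotient tendsto_at_iff_sequentially o_def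
  proof (intro allI impI)
    fix X :: "nat \<Rightarrow> real" assume X: "\<forall>i. X i \<in> UNIV - {0}" "X \<longlonglongrightarrow> 0"
    from X(2) e have "\<forall>\<^sub>F n in sequentially. \<bar>X n\<bar> < e"
      by (auto dest!: tendstoD[of X 0 _ e] simp: dist_real_def)
    then obtain N where N: "\<And>n. n \<ge> N \<Longrightarrow> \<bar>X n\<bar> < e" by (auto simp: eventually_sequentially)
    have "(\<lambda>n. \<integral>x. q (X (n + N)) x \<partial>M) \<longlonglongrightarrow> (\<integral>x. f' y0 x \<partial>M)"
    proof (rule integral_dominated_convergence[OF m _ D])
      show "q (X (n + N)) \<in> borel_measurable M" for n using q_int[OF N] by auto
      show "AE x in M. (\<lambda>n. q (X (n + N)) x) \<longlonglongrightarrow> f' y0 x"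
        by (intro AE_I2 filterlim_compose[OF q_lim])
          (use X LIMSEQ_ignore_initial_segment[OF X(2), of N] in \<open>simp add: filterlim_at\<close>)
      show "AE x in M. norm (q (X (n + N)) x) \<le> D x" for n using q_bd[OF N] by auto
    qed
    then have "(\<lambda>n. \<integral>x. q (X n) x \<partial>M) \<longlonglongrightarrow> (\<integral>x. f' y0 x \<partial>M)" by (rule LIMSEQ_offset)
    moreover have "\<forall>\<^sub>F n in sequentially. (\<integral>x. q (X n) x \<partial>M) = ((\<integral>x. f (y0 + X n) x \<partial>M) - (\<integral>x. f y0 x \<partial>M)) /\<^sub>R X n"
      using \<open>\<forall>\<^sub>F n in sequentially. \<bar>X n\<bar> < e\<close>
    proof eventually_elim
      case (elim n)
      then show ?case unfolding q_def using int[of "y0 + X n"] int[of y0] e by simp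
    qed
    ultimately show "(\<lambda>n. ((\<integral>x. f (y0 + X n) x \<partial>M) - (\<integral>x. f y0 x \<partial>M)) /\<^sub>R X n) \<longlonglongrightarrow> (\<integral>x. f' y0 x \<partial>M)"
      by (rule Lim_transform_eventually)
  qed
qed

subsection \<open>Mollifiers\<close>

definition bump_mass :: real where "bump_mass = (LINT y|lborel. bump_term 1 0 y)"

definition bump :: "real \<Rightarrow> real" where "bump = bump_term [:1 / bump_mass:] 0"

definition dbump :: "real \<Rightarrow> real" where "dbump = bump_term (bump_next [:1 / bump_mass:] 0) 2"

definition kern :: "real \<Rightarrow> real \<Rightarrow> real" where "kern d x = bump (x / d) / d"

lemma bump_term_continuous: "continuous_on UNIV (bump_term p n)"
  by (rule DERIV_continuous_on[OF bump_term_DERIV])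

lemma bump_term_integrable: "integrable lborel (bump_term p n)"
  by (rule integrable_compact_support[where R = 1, OF bump_term_continuous]) (simp add: bump_term_def)

lemma bump_mass_pos: "bump_mass > 0"
proof -
  have "exp (-2) * indicator {-1/2..1/2} y \<le> bump_term 1 0 y" for y :: real
  proof (cases "y \<in> {-1/2..1/2}")
    case True
    then have "\<bar>y\<bar> \<le> 1/2" by auto
    then have "y\<^sup>2 \<le> (1/2)\<^sup>2" by (metis abs_ge_zero power2_abs power_mono)
    then have "1 / (1 - y\<^sup>2) \<le> 2" by (simp add: power2_eq_square field_simps)
    then show ?thesis using True by (auto simp: bump_term_def)
  qed (simp add: bump_term_def)
  then have "(LINT y|lborel. exp (-2) * indicator {-1/2..1/2::real} y) \<le> bump_mass"
    unfolding bump_mass_def by (intro integral_mono bump_term_integrable) auto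
  then show ?thesis using exp_gt_zero[of "-2::real"] by (simp del: exp_gt_zero)
qed

lemma bump_eq: "bump x = bump_term 1 0 x / bump_mass"
  by (simp add: bump_def bump_term_def)

lemma bump_nonneg: "bump x \<ge> 0"
  using bump_mass_pos by (simp add: bump_eq bump_term_def)

lemma bump_even: "bump (- x) = bump x"
  by (simp add: bump_def bump_term_def)

lemma bump_zero: "1 \<le> \<bar>x\<bar> \<Longrightarrow> bump x = 0"
  by (simp add: bump_def bump_term_def)

lemma bump_continuous: "continuous_on UNIV bump"
  unfolding bump_def by (rule bump_term_continuous)

lemma bump_measurable [measurable]: "bump \<in> borel_measurable borel"
  by (rule borel_measurable_continuous_onI[OF bump_continuous])

lemma bump_integrable: "integrable lborel bump"
  unfolding bump_def by (rule bump_term_integrable)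

lemma bump_integral: "(LINT x|lborel. bump x) = 1"
  unfolding bump_eq using bump_mass_pos by (simp add: bump_mass_def)

lemma kern_nonneg: "d > 0 \<Longrightarrow> kern d x \<ge> 0"
  by (simp add: kern_def bump_nonneg)

lemma kern_even: "kern d (- x) = kern d x"
  using bump_even[of "x / d"] by (simp add: kern_def)

lemma kern_zero: "0 < d \<Longrightarrow> d \<le> \<bar>x\<bar> \<Longrightarrow> kern d x = 0"
  by (simp add: kern_def bump_zero field_simps)

lemma kern_DERIV: "d > 0 \<Longrightarrow> (kern d has_real_derivative dbump (x / d) / d\<^sup>2) (at x)"
proof -
  assume "d > 0"
  have "((\<lambda>x. x / d) has_real_derivative 1 / d) (at x)"
    by (rule DERIV_cdivide[OF DERIV_ident])
  from DERIV_cdivide[OF DERIV_chain2[OF bump_term_DERIV this, of "[:1 / bump_mass:]" 0], of d]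
  show ?thesis
    unfolding kern_def[abs_def] dbump_def bump_def by (simp add: power2_eq_square numeral_2_eq_2)
qed

lemma kern_continuous: "d > 0 \<Longrightarrow> continuous_on S (kern d)"
  by (rule DERIV_continuous_on[OF has_field_derivative_at_within[OF kern_DERIV]])

lemma kern_measurable [measurable]: "kern d \<in> borel_measurable borel"
  unfolding kern_def[abs_def] by measurable

lemma kern_smooth_cs:
  assumes "d > 0"
  shows "(\<lambda>x. complex_of_real (kern d (x - y))) \<in> smooth_cs"
proof -
  have "(\<lambda>x. complex_of_real (1 / d) * complex_of_real (bump ((1 / d) * x + (- y / d)))) \<in> smooth_cs"
    unfolding bump_def using assms
    by (intro smooth_cs_affine[where f = "\<lambda>x. complex_of_real (bump_term _ _ x)"] bump_term_smooth) auto
  also have "(\<lambda>x. complex_of_real (1 / d) * complex_of_real (bump ((1 / d) * x + (- y / d)))) =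
      (\<lambda>x. complex_of_real (kern d (x - y)))"
    by (rule ext) (simp add: kern_def diff_divide_distrib)
  finally show ?thesis .
qed

text \<open>A smoothed Heaviside function. Differences of its rescaled translates will be smooth
  approximations of indicators of intervals.\<close>

lemma bump_primitive:
  obtains K where "\<And>x. (K has_real_derivative bump x) (at x)" "\<And>x. 0 \<le> K x" "\<And>x. K x \<le> 1"
    "\<And>x. x \<le> -1 \<Longrightarrow> K x = 0" "\<And>x. x \<ge> 1 \<Longrightarrow> K x = 1"
proof -
  have "isCont bump x" for x using bump_continuous by (simp add: continuous_on_eq_continuous_at)
  then obtain F where "\<And>x. (F has_vector_derivative bump x) (at x)"
    using einterval_antiderivative[of "-\<infinity>" "\<infinity>" bump] by auto
  then have F: "(F has_real_derivative bump x) (at x)" for x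
    by (simp add: has_real_derivative_iff_has_vector_derivative)
  define K where "K x = F x - F (-1)" for x
  have K: "(K has_real_derivative bump x) (at x)" for x
    unfolding K_def by (auto intro!: derivative_eq_intros F)
  have mono: "K x \<le> K y" if "x \<le> y" for x y
    using DERIV_nonneg_imp_nondecreasing[OF that, of K] K bump_nonneg by blast
  have flat: "K x = K y" if "x < y" "\<And>z. x < z \<Longrightarrow> z < y \<Longrightarrow> 1 \<le> \<bar>z\<bar>" for x y
  proof -
    have "K y = K x"
    proof (rule DERIV_isconst_end[OF that(1)])
      show "continuous_on {x..y} K" by (rule DERIV_continuous_on[OF has_field_derivative_at_within[OF K]])
      show "(K has_real_derivative 0) (at z)" if z: "x < z" "z < y" for z
        using K[of z] bump_zero[OF \<open>\<And>z. x < z \<Longrightarrow> z < y \<Longrightarrow> 1 \<le> \<bar>z\<bar>\<close>[OF z]] by simp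
    qed
    then show ?thesis by simp
  qed
  have m1: "K x = 0" if "x \<le> -1" for x
    using flat[of x "-1"] that by (cases "x = -1") (auto simp: K_def)
  have "(LINT x|lborel. bump x * indicator {-1..1} x) = K 1 - K (-1)"
    using K bump_continuous by (intro integral_FTC_Icc_real) (auto simp: continuous_on_eq_continuous_at)
  moreover have "(\<lambda>x. bump x * indicator {-1..1} x) = bump"
  proof
    show "bump x * indicator {-1..1} x = bump x" for x
      using bump_zero[of x] by (cases "x \<in> {-1..1}") auto
  qed
  ultimately have "K 1 = 1" using bump_integral m1[of "-1"] by simp
  then have p1: "K x = 1" if "x \<ge> 1" for x
    using flat[of 1 x] that by (cases "x = 1") auto
  show thesis
  proof (rule that[OF K _ _ m1 p1])
    show "0 \<le> K x" for x using m1[of x] mono[of "-1" x] m1[of "-1"] by (cases "x \<le> -1") auto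
    show "K x \<le> 1" for x using p1[of x] mono[of x 1] p1[of 1] by (cases "x \<ge> 1") auto
  qed
qed

text \<open>Convolution with \<open>kern d\<close> in rescaled variables: the weight
  \<open>bump\<close> no longer depends on d, so the limit d to 0 is a dominated convergence. The
  sign in the argument is immaterial as \<open>bump\<close> is even.\<close>

definition conv :: "real \<Rightarrow> (real \<Rightarrow> 'b) \<Rightarrow> real \<Rightarrow> 'b::{banach, second_countable_topology}" where
  "conv d f y = (LINT z|lborel. bump z *\<^sub>R f (y + d * z))"

lemma conv_kern:
  assumes "d > 0"
  shows "conv d f y = (LINT x|lborel. kern d (x - y) *\<^sub>R f x)"
proof -
  have "(LINT x|lborel. kern d (x - y) *\<^sub>R f x) = \<bar>d\<bar> *\<^sub>R (LINT z|lborel. kern d (y + d * z - y) *\<^sub>R f (y + d * z))"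
    using assms by (intro lborel_integral_real_affine) auto
  also have "\<dots> = conv d f y"
    unfolding conv_def integral_scaleR_right[symmetric] using assms by (auto simp: kern_def)
  finally show ?thesis by simp
qed

lemma conv_integrable:
  fixes f :: "real \<Rightarrow> 'b::{banach, second_countable_topology}"
  assumes "continuous_on UNIV f"
  shows "integrable lborel (\<lambda>z. bump z *\<^sub>R f (y + d * z))"
proof (rule integrable_compact_support[where R = 1])
  show "continuous_on UNIV (\<lambda>z. bump z *\<^sub>R f (y + d * z))"
    by (intro continuous_intros continuous_on_compose2[OF assms] bump_continuous) auto
qed (simp add: bump_zero)

lemma kern_mult_integrable:
  fixes f :: "real \<Rightarrow> 'b::{banach, second_countable_topology}"
  assumes "continuous_on UNIV f" "d > 0"
  shows "integrable lborel (\<lambda>x. kern d (x - y) *\<^sub>R f x)"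
proof (rule integrable_compact_support[where R = "\<bar>y\<bar> + d"])
  show "continuous_on UNIV (\<lambda>x. kern d (x - y) *\<^sub>R f x)"
    by (intro continuous_intros continuous_on_compose2[OF kern_continuous[OF assms(2), of UNIV]] assms) auto
qed (use assms in \<open>auto intro!: disjI1 kern_zero\<close>)

text \<open>Functions, base points and scales may all vary with n; convergence along every sequence
  tending to \<open>y0\<close> is the mode of convergence that suffices. The generality is used when
  densities built from already mollified functions are mollified again.\<close>

lemma conv_tendsto:
  fixes f :: "nat \<Rightarrow> real \<Rightarrow> 'b::{banach, second_countable_topology}"
  assumes cont: "\<And>n. continuous_on UNIV (f n)"
    and conv: "\<And>x. x \<longlonglongrightarrow> y0 \<Longrightarrow> (\<lambda>n. f n (x n)) \<longlonglongrightarrow> l"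
    and bd: "\<And>n z. \<bar>z\<bar> \<le> 1 \<Longrightarrow> norm (f n (y n + d n * z)) \<le> L"
    and y: "y \<longlonglongrightarrow> y0" and d: "d \<longlonglongrightarrow> 0"
  shows "(\<lambda>n. conv (d n) (f n) (y n)) \<longlonglongrightarrow> l"
proof -
  have "(\<lambda>n. LINT z|lborel. bump z *\<^sub>R f n (y n + d n * z)) \<longlonglongrightarrow> (LINT z|lborel. bump z *\<^sub>R l)"
  proof (rule integral_dominated_convergence[where w = "\<lambda>z. bump z * L"])
    show "(\<lambda>z. bump z *\<^sub>R f n (y n + d n * z)) \<in> borel_measurable lborel" for n
      using conv_integrable[OF cont[of n], of "y n" "d n"] by auto
    show "AE z in lborel. norm (bump z *\<^sub>R f n (y n + d n * z)) \<le> bump z * L" for n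
    proof (rule AE_I2)
      fix z show "norm (bump z *\<^sub>R f n (y n + d n * z)) \<le> bump z * L"
        using bd[of z n] bump_zero[of z] bump_nonneg[of z]
        by (cases "\<bar>z\<bar> \<le> 1") (auto intro!: mult_mono)
    qed
    show "AE z in lborel. (\<lambda>n. bump z *\<^sub>R f n (y n + d n * z)) \<longlonglongrightarrow> bump z *\<^sub>R l"
    proof (intro AE_I2 tendsto_intros conv)
      fix z show "(\<lambda>n. y n + d n * z) \<longlonglongrightarrow> y0"
        using tendsto_add[OF y tendsto_mult[OF d tendsto_const[of z]]] by simp
    qed
  qed (use bump_integrable in auto)
  also have "(LINT z|lborel. bump z *\<^sub>R l) = l"
    using bump_integral bump_integrable by simp
  finally show ?thesis by (simp add: conv_def)
qed

section \<open>The fundamental lemma of the calculus of variations, and weak derivatives in one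
  variable\<close>

lemma interval_test_functions:
  fixes p q :: real
  assumes "p < q"
  obtains \<eta> :: "nat \<Rightarrow> real \<Rightarrow> real" where
    "\<And>n. (\<lambda>t. complex_of_real (\<eta> n t)) \<in> smooth_cs"
    "\<And>n t. ((\<lambda>t. complex_of_real (\<eta> n t)) has_vector_derivative
        of_real (kern (1 / (real n + 1)) (t - p)) - of_real (kern (1 / (real n + 1)) (t - q))) (at t)"
    "\<And>n t. \<bar>\<eta> n t\<bar> \<le> indicator {p - 1..q + 1} t"
    "\<And>t. t \<noteq> p \<Longrightarrow> t \<noteq> q \<Longrightarrow> (\<lambda>n. \<eta> n t) \<longlonglongrightarrow> indicator {p<..<q} t"
proof -
  obtain K where K: "\<And>x. (K has_real_derivative bump x) (at x)" "\<And>x. 0 \<le> K x" "\<And>x. K x \<le> 1"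
    "\<And>x. x \<le> -1 \<Longrightarrow> K x = 0" "\<And>x. x \<ge> 1 \<Longrightarrow> K x = 1"
    using bump_primitive by metis
  define d where "d n = 1 / (real n + 1)" for n
  have d: "d n > 0" "d n \<le> 1" for n by (auto simp: d_def)
  define \<eta> where "\<eta> n t = K ((t - p) / d n) - K ((t - q) / d n)" for n t
  have der: "((\<lambda>t. complex_of_real (\<eta> n t)) has_vector_derivative
        of_real (kern (d n) (t - p)) - of_real (kern (d n) (t - q))) (at t)" for n t
  proof -
    have 1: "((\<lambda>t. K ((t - a) / d n)) has_real_derivative kern (d n) (t - a)) (at t)" for a
    proof -
      have "((\<lambda>t. (t - a) / d n) has_real_derivative 1 / d n) (at t)"
        using d(1)[of n] by (auto intro!: derivative_eq_intros)
      from DERIV_chain2[OF K(1) this] show ?thesis by (simp add: kern_def)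
    qed
    have "(\<eta> n has_real_derivative kern (d n) (t - p) - kern (d n) (t - q)) (at t)"
      unfolding \<eta>_def by (intro DERIV_diff 1)
    from has_vector_derivative_of_real[OF this] show ?thesis by simp
  qed
  have supp: "\<eta> n t = 0" if t: "t \<notin> {p - 1..q + 1}" for n t
  proof -
    consider "t < p - 1" | "t > q + 1" using t by force
    then show ?thesis
    proof cases
      case 1
      then have "(t - p) / d n \<le> -1" "(t - q) / d n \<le> -1" using d[of n] assms by (auto simp: divide_le_eq)
      then show ?thesis using K(4) by (simp add: \<eta>_def)
    next
      case 2
      then have "(t - p) / d n \<ge> 1" "(t - q) / d n \<ge> 1" using d[of n] assms by (auto simp: le_divide_eq)
      then show ?thesis using K(5) by (simp add: \<eta>_def)
    qed
  qed
  show thesis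
  proof (rule that)
    fix n
    show "(\<lambda>t. complex_of_real (\<eta> n t)) \<in> smooth_cs"
    \<comment> \<open>The derivative of \<eta> is a difference of two kernels and hence already a
      test function, so adjoining this one function to \<open>smooth_cs\<close> gives a stable
      family.\<close>
    proof (rule smooth_cs_coinduct[where S = "insert (\<lambda>t. complex_of_real (\<eta> n t)) smooth_cs" and R = "\<bar>p\<bar> + \<bar>q\<bar> + 1"])
      show "complex_of_real (\<eta> n x) = 0" if "\<bar>p\<bar> + \<bar>q\<bar> + 1 < \<bar>x\<bar>" for x
      proof -
        have "x \<notin> {p - 1..q + 1}" using that by auto
        then show ?thesis using supp[of x n] by simp
      qed
      fix g assume g: "g \<in> insert (\<lambda>t. complex_of_real (\<eta> n t)) smooth_cs"
      show "\<exists>g'\<in>insert (\<lambda>t. complex_of_real (\<eta> n t)) smooth_cs. \<forall>x. (g has_vector_derivative g' x) (at x)"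
      proof (cases "g \<in> smooth_cs")
        case True
        then show ?thesis
          by (intro bexI[of _ "vderiv g"]) (simp_all add: smooth_cs_vderiv smooth_cs_has_vderiv)
      next
        case False
        then have "g = (\<lambda>t. complex_of_real (\<eta> n t))" using g by simp
        moreover have "(\<lambda>t. of_real (kern (d n) (t - p)) + (- 1) * of_real (kern (d n) (t - q))) \<in> smooth_cs"
          by (intro smooth_cs_add smooth_cs_cmult kern_smooth_cs d)
        ultimately show ?thesis using der[of n]
          by (intro bexI[of _ "\<lambda>t. of_real (kern (d n) (t - p)) + (- 1) * of_real (kern (d n) (t - q))"]) auto
      qed
    qed auto
    show "((\<lambda>t. complex_of_real (\<eta> n t)) has_vector_derivative
        of_real (kern (1 / (real n + 1)) (t - p)) - of_real (kern (1 / (real n + 1)) (t - q))) (at t)" for t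
      using der[of n t] by (simp add: d_def)
    show "\<bar>\<eta> n t\<bar> \<le> indicator {p - 1..q + 1} t" for t
    proof (cases "t \<in> {p - 1..q + 1}")
      case True
      then show ?thesis using K(2,3)[of "(t - p) / d n"] K(2,3)[of "(t - q) / d n"] by (simp add: \<eta>_def)
    qed (simp add: supp)
  next
    fix t assume t: "t \<noteq> p" "t \<noteq> q"
    have lim: "(\<lambda>n. K ((t - a) / d n)) \<longlonglongrightarrow> indicator {a<..} t" if "t \<noteq> a" for a
    proof -
      have "\<forall>\<^sub>F n in sequentially. \<bar>t - a\<bar> * (real n + 1) \<ge> 1" using that by real_asymp
      then have "\<forall>\<^sub>F n in sequentially. K ((t - a) / d n) = indicator {a<..} t"
      proof eventually_elim
        case (elim n)
        show ?case
        proof (cases "t > a")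
          case True
          then show ?thesis using elim K(5) by (simp add: d_def)
        next
          case False
          with that have "\<bar>t - a\<bar> = - (t - a)" by simp
          then have "(t - a) * (real n + 1) \<le> -1" using elim by (simp add: left_diff_distrib)
          then show ?thesis using False K(4) by (simp add: d_def)
        qed
      qed
      then show ?thesis by (rule tendsto_eventually)
    qed
    have "indicator {p<..<q} t = (indicator {p<..} t - indicator {q<..} t :: real)"
      using assms t by (auto simp: indicator_def)
    then show "(\<lambda>n. \<eta> n t) \<longlonglongrightarrow> indicator {p<..<q} t"
      unfolding \<eta>_def using tendsto_diff[OF lim[OF t(1)] lim[OF t(2)]] by simp
  qed
qed

text \<open>The positive and the negative part of G have equal finite mass on every ray. They are
  therefore densities of the same measure, and densities are unique almost everywhere.\<close>

lemma AE_zero_of_ray_integrals: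
  fixes G :: "real \<Rightarrow> real"
  assumes G: "integrable lborel G" and zero: "\<And>x. (LINT t|lborel. indicator {x<..} t * G t) = 0"
  shows "AE t in lborel. G t = 0"
proof -
  have [measurable]: "G \<in> borel_measurable borel" using G by auto
  have fin: "(\<integral>\<^sup>+t. ennreal (s * G t) * indicator {x<..} t \<partial>lborel) < \<infinity>" if "\<bar>s\<bar> = 1" for s x
  proof -
    have "(\<integral>\<^sup>+t. ennreal (s * G t) * indicator {x<..} t \<partial>lborel) \<le> (\<integral>\<^sup>+t. ennreal (norm (G t)) \<partial>lborel)"
      using that by (intro nn_integral_mono) (auto simp: indicator_def abs_if split: if_splits intro!: ennreal_leI)
    also have "\<dots> < \<infinity>" using G by (simp add: integrable_iff_bounded)
    finally show ?thesis .
  qed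
  have eq: "(\<integral>\<^sup>+t. ennreal (G t) * indicator {x<..} t \<partial>lborel) = (\<integral>\<^sup>+t. ennreal (- G t) * indicator {x<..} t \<partial>lborel)" for x
  proof -
    have i: "integrable lborel (\<lambda>t. indicator {x<..} t * G t)"
      using integrable_mult_indicator[OF _ G, of "{x<..}"] by simp
    have 1: "(\<lambda>t. ennreal (indicator {x<..} t * G t)) = (\<lambda>t. ennreal (G t) * indicator {x<..} t)"
      "(\<lambda>t. ennreal (- (indicator {x<..} t * G t))) = (\<lambda>t. ennreal (- G t) * indicator {x<..} t)"
      by (auto simp: indicator_def)
    show ?thesis
    proof -
      let ?a = "\<integral>\<^sup>+t. ennreal (G t) * indicator {x<..} t \<partial>lborel"
      let ?b = "\<integral>\<^sup>+t. ennreal (- G t) * indicator {x<..} t \<partial>lborel"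
      have "enn2real ?a - enn2real ?b = 0"
        using zero[of x] unfolding real_lebesgue_integral_def[OF i] 1 .
      moreover have "?a = ennreal (enn2real ?a)" "?b = ennreal (enn2real ?b)"
        using fin[of 1 x] fin[of "-1" x] by (simp_all add: less_top)
      ultimately show ?thesis by (metis eq_iff_diff_eq_0)
    qed
  qed
  have "density lborel (\<lambda>t. ennreal (G t)) = density lborel (\<lambda>t. ennreal (- G t))"
    by (rule measure_eqI_lessThan) (use eq fin[of 1] in \<open>auto simp: emeasure_density\<close>)
  then have "AE t in lborel. ennreal (G t) = ennreal (- G t)"
    by (intro sigma_finite_measure.density_unique[OF lborel.sigma_finite_measure_axioms]) auto
  then show ?thesis
  proof eventually_elim
    case (elim t)
    then show ?case by (cases "G t \<ge> 0") (auto simp: ennreal_neg ennreal_eq_0_iff)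
  qed
qed

lemma AE_zero_of_interval_integrals:
  fixes F :: "real \<Rightarrow> complex"
  assumes F: "\<And>p q. p < q \<Longrightarrow> integrable lborel (\<lambda>t. indicator {p<..<q} t * F t)"
    and zero: "\<And>p q. p < q \<Longrightarrow> (LINT t|lborel. indicator {p<..<q} t * F t) = 0"
  shows "AE t in lborel. F t = 0"
proof -
  define I where "I n = {- (real n + 1)<..<real n + 1}" for n
  \<comment> \<open>A ray cut by the window \<open>I n\<close> is again an open interval, or empty
    when the ray starts beyond the window; hence the case distinction.\<close>
  have ind: "indicator {x<..} t * (indicator (I n) t * F t) =
      (if max x (- (real n + 1)) < real n + 1 then indicator {max x (- (real n + 1))<..<real n + 1} t * F t else 0)" for x n t
    by (auto simp: I_def indicator_def)
  have int0: "integrable lborel (\<lambda>t. indicator (I n) t * F t)" for n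
    unfolding I_def by (rule F) simp
  have int: "integrable lborel (\<lambda>t. indicator {x<..} t * (indicator (I n) t * F t))" for n x
    unfolding ind by (cases "max x (- (real n + 1)) < real n + 1") (auto intro: F)
  have z: "(LINT t|lborel. indicator {x<..} t * (indicator (I n) t * F t)) = 0" for n x
    unfolding ind by (cases "max x (- (real n + 1)) < real n + 1") (auto intro!: zero)
  have "AE t in lborel. Re (indicator (I n) t * F t) = 0" for n
  proof (rule AE_zero_of_ray_integrals)
    show "integrable lborel (\<lambda>t. Re (indicator (I n) t * F t))" using int0 by (rule integrable_Re)
    fix x
    have "(LINT t|lborel. indicator {x<..} t * Re (indicator (I n) t * F t)) =
        (LINT t|lborel. Re (indicator {x<..} t * (indicator (I n) t * F t)))"
      by (intro Bochner_Integration.integral_cong) (auto simp: indicator_def)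
    also have "\<dots> = 0" unfolding integral_Re[OF int] z by simp
    finally show "(LINT t|lborel. indicator {x<..} t * Re (indicator (I n) t * F t)) = 0" .
  qed
  moreover have "AE t in lborel. Im (indicator (I n) t * F t) = 0" for n
  proof (rule AE_zero_of_ray_integrals)
    show "integrable lborel (\<lambda>t. Im (indicator (I n) t * F t))" using int0 by (rule integrable_Im)
    fix x
    have "(LINT t|lborel. indicator {x<..} t * Im (indicator (I n) t * F t)) =
        (LINT t|lborel. Im (indicator {x<..} t * (indicator (I n) t * F t)))"
      by (intro Bochner_Integration.integral_cong) (auto simp: indicator_def)
    also have "\<dots> = 0" unfolding integral_Im[OF int] z by simp
    finally show "(LINT t|lborel. indicator {x<..} t * Im (indicator (I n) t * F t)) = 0" .
  qed
  ultimately have "AE t in lborel. \<forall>n. indicator (I n) t * F t = 0"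
    unfolding AE_all_countable by (auto simp: complex_eq_iff elim: AE_mp)
  then show ?thesis
  proof eventually_elim
    case (elim t)
    obtain n where "\<bar>t\<bar> < real n" using reals_Archimedean2 by blast
    then have "t \<in> I n" by (auto simp: I_def)
    then show ?case using elim[rule_format, of n] by simp
  qed
qed

lemma indicator_interval_AE_lim:
  assumes "\<And>t. t \<noteq> p \<Longrightarrow> t \<noteq> q \<Longrightarrow> P (t::real)"
  shows "AE t in lborel. P t"
  using AE_lborel_singleton[of p] AE_lborel_singleton[of q] by eventually_elim (use assms in auto)

lemma test_integrals_tendsto:
  fixes F :: "real \<Rightarrow> complex"
  assumes F: "\<And>R. integrable lborel (\<lambda>t. indicator {-R..R} t * F t)"
    and \<eta>: "\<And>n. (\<lambda>t. complex_of_real (\<eta> n t)) \<in> smooth_cs"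
    "\<And>n t. \<bar>\<eta> n t\<bar> \<le> indicator {p - 1..q + 1} t"
    "\<And>t. t \<noteq> p \<Longrightarrow> t \<noteq> q \<Longrightarrow> (\<lambda>n. \<eta> n t) \<longlonglongrightarrow> indicator {p<..<q} t"
  shows "integrable lborel (\<lambda>t. indicator {p<..<q} t * F t)"
    "(\<lambda>n. LINT t|lborel. F t * of_real (\<eta> n t)) \<longlonglongrightarrow> (LINT t|lborel. indicator {p<..<q} t * F t)"
proof -
  define R where "R = \<bar>p\<bar> + \<bar>q\<bar> + 1"
  define w where "w t = norm (indicator {-R..R} t * F t)" for t
  have w: "integrable lborel w" unfolding w_def using F by (rule integrable_norm)
  have sub: "{p - 1..q + 1} \<subseteq> {-R..R}" by (auto simp: R_def)
  have bd: "norm (F t * of_real (\<eta> n t)) \<le> w t" for n t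
  proof (cases "t \<in> {p - 1..q + 1}")
    case True
    then have "\<bar>\<eta> n t\<bar> \<le> 1" "t \<in> {-R..R}" using \<eta>(2)[of n t] sub by auto
    then show ?thesis by (simp add: w_def norm_mult mult_left_le)
  next
    case False
    then have "\<eta> n t = 0" using \<eta>(2)[of n t] by simp
    then show ?thesis by (simp add: w_def)
  qed
  have meas: "(\<lambda>t. F t * of_real (\<eta> n t)) \<in> borel_measurable borel" for n
  proof -
    have "(\<lambda>t. (indicator {-R..R} t * F t) * complex_of_real (\<eta> n t)) \<in> borel_measurable borel"
      using borel_measurable_integrable[OF F[of R]] smooth_cs_measurable[OF \<eta>(1)[of n]] by simp
    also have "(\<lambda>t. (indicator {-R..R} t * F t) * complex_of_real (\<eta> n t)) = (\<lambda>t. F t * of_real (\<eta> n t))"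
    proof
      fix t show "(indicator {-R..R} t * F t) * complex_of_real (\<eta> n t) = F t * of_real (\<eta> n t)"
        using bd[of t n] by (cases "t \<in> {-R..R}") (auto simp: w_def)
    qed
    finally show ?thesis .
  qed
  have lim: "AE t in lborel. (\<lambda>n. F t * of_real (\<eta> n t)) \<longlonglongrightarrow> indicator {p<..<q} t * F t"
  proof (rule indicator_interval_AE_lim)
    fix t assume "t \<noteq> p" "t \<noteq> q"
    from tendsto_mult[OF tendsto_const tendsto_of_real[OF \<eta>(3)[OF this]], of "F t"]
    show "(\<lambda>n. F t * of_real (\<eta> n t)) \<longlonglongrightarrow> indicator {p<..<q} t * F t"
      by (cases "t \<in> {p<..<q}") auto
  qed
  have "integrable lborel (\<lambda>t. indicator {p<..<q} t *\<^sub>R (indicator {-R..R} t * F t))"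
    by (intro integrable_mult_indicator F) auto
  also have "(\<lambda>t. indicator {p<..<q} t *\<^sub>R (indicator {-R..R} t * F t)) = (\<lambda>t. indicator {p<..<q} t * F t)"
    by (auto simp: R_def indicator_def fun_eq_iff)
  finally show int: "integrable lborel (\<lambda>t. indicator {p<..<q} t * F t)" .
  show "(\<lambda>n. LINT t|lborel. F t * of_real (\<eta> n t)) \<longlonglongrightarrow> (LINT t|lborel. indicator {p<..<q} t * F t)"
    by (rule integral_dominated_convergence[OF _ _ w lim]) (use int meas bd in auto)
qed

text \<open>Smoothed indicators are admissible tests, and in the limit the vanishing passes to
  integrals over intervals.\<close>

lemma AE_zero_of_test_integrals:
  fixes F :: "real \<Rightarrow> complex"
  assumes F: "\<And>R. integrable lborel (\<lambda>t. indicator {-R..R} t * F t)"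
    and zero: "\<And>\<eta>. \<eta> \<in> smooth_cs \<Longrightarrow> (LINT t|lborel. F t * \<eta> t) = 0"
  shows "AE t in lborel. F t = 0"
proof (rule AE_zero_of_interval_integrals)
  fix p q :: real assume pq: "p < q"
  obtain \<eta> :: "nat \<Rightarrow> real \<Rightarrow> real" where \<eta>: "\<And>n. (\<lambda>t. complex_of_real (\<eta> n t)) \<in> smooth_cs"
    "\<And>n t. \<bar>\<eta> n t\<bar> \<le> indicator {p - 1..q + 1} t"
    "\<And>t. t \<noteq> p \<Longrightarrow> t \<noteq> q \<Longrightarrow> (\<lambda>n. \<eta> n t) \<longlonglongrightarrow> indicator {p<..<q} t"
    using interval_test_functions[OF pq] by metis
  show "integrable lborel (\<lambda>t. indicator {p<..<q} t * F t)"
    using F \<eta> by (rule test_integrals_tendsto(1))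
  have "(\<lambda>n. LINT t|lborel. F t * of_real (\<eta> n t)) \<longlonglongrightarrow> (LINT t|lborel. indicator {p<..<q} t * F t)"
    using F \<eta> by (rule test_integrals_tendsto(2))
  then show "(LINT t|lborel. indicator {p<..<q} t * F t) = 0"
    using zero[OF \<eta>(1)] by (simp add: LIMSEQ_const_iff)
qed

text \<open>Test with smoothed indicators of (p, q). Their derivatives are mollifiers at p minus
  mollifiers at q, so by continuity of \<alpha> the right side tends to the increment, while the
  left side tends to the integral of \<beta>.\<close>

lemma weak_derivative_increment:
  fixes \<alpha> \<beta> :: "real \<Rightarrow> complex"
  assumes \<alpha>: "continuous_on UNIV \<alpha>"
    and \<beta>: "\<And>R. integrable lborel (\<lambda>t. indicator {-R..R} t * \<beta> t)"
    and weak: "\<And>\<eta>. \<eta> \<in> smooth_cs \<Longrightarrow> (LINT t|lborel. \<beta> t * \<eta> t) = - (LINT t|lborel. \<alpha> t * vderiv \<eta> t)"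
    and pq: "p < q"
  shows "\<alpha> q - \<alpha> p = (LINT t|lborel. indicator {p<..<q} t * \<beta> t)"
proof -
  obtain \<eta> :: "nat \<Rightarrow> real \<Rightarrow> real" where \<eta>: "\<And>n. (\<lambda>t. complex_of_real (\<eta> n t)) \<in> smooth_cs"
    "\<And>n t. ((\<lambda>t. complex_of_real (\<eta> n t)) has_vector_derivative
        of_real (kern (1 / (real n + 1)) (t - p)) - of_real (kern (1 / (real n + 1)) (t - q))) (at t)"
    "\<And>n t. \<bar>\<eta> n t\<bar> \<le> indicator {p - 1..q + 1} t"
    "\<And>t. t \<noteq> p \<Longrightarrow> t \<noteq> q \<Longrightarrow> (\<lambda>n. \<eta> n t) \<longlonglongrightarrow> indicator {p<..<q} t"
    using interval_test_functions[OF pq] by metis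
  have vd: "vderiv (\<lambda>t. complex_of_real (\<eta> n t)) t =
      of_real (kern (1 / (real n + 1)) (t - p)) - of_real (kern (1 / (real n + 1)) (t - q))" for n t
    by (rule vector_derivative_at) (rule \<eta>(2))
  have conv_a: "(LINT t|lborel. of_real (kern (1 / (real n + 1)) (t - a)) * \<alpha> t) = conv (1 / (real n + 1)) \<alpha> a" for n a
    by (subst conv_kern) (auto simp: scaleR_conv_of_real)
  have lim: "(\<lambda>n. conv (1 / (real n + 1)) \<alpha> a) \<longlonglongrightarrow> \<alpha> a" for a
  proof -
    have "bounded (\<alpha> ` {a - 1..a + 1})"
      using \<alpha> by (intro compact_imp_bounded compact_continuous_image) (auto intro: continuous_on_subset)
    then obtain L where L: "\<And>x. x \<in> {a - 1..a + 1} \<Longrightarrow> norm (\<alpha> x) \<le> L" unfolding bounded_iff by blast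
    show ?thesis
    proof (rule conv_tendsto[where f = "\<lambda>_. \<alpha>" and L = L and ?y0.0 = a])
      show "(\<lambda>n. \<alpha> (x n)) \<longlonglongrightarrow> \<alpha> a" if "x \<longlonglongrightarrow> a" for x
        using \<alpha> that by (auto simp: continuous_on_eq_continuous_at intro: isCont_tendsto_compose)
      show "norm (\<alpha> (a + 1 / (real n + 1) * z)) \<le> L" if "\<bar>z\<bar> \<le> 1" for n z
      proof (rule L)
        define w where "w = 1 / (real n + 1) * z"
        have "\<bar>w\<bar> \<le> 1 * 1" unfolding w_def abs_mult using that by (intro mult_mono) auto
        then show "a + 1 / (real n + 1) * z \<in> {a - 1..a + 1}" unfolding w_def[symmetric] by auto
      qed
      show "(\<lambda>n. 1 / (real n + 1)) \<longlonglongrightarrow> 0" by real_asymp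
    qed (use \<alpha> in auto)
  qed
  have int: "integrable lborel (\<lambda>t. \<alpha> t * of_real (kern (1 / (real n + 1)) (t - a)))" for n a
    using kern_mult_integrable[OF \<alpha>, of "1 / (real n + 1)" a] by (simp add: scaleR_conv_of_real mult.commute)
  have l1: "(\<lambda>n. LINT t|lborel. \<beta> t * of_real (\<eta> n t)) \<longlonglongrightarrow> (LINT t|lborel. indicator {p<..<q} t * \<beta> t)"
    using \<beta> \<eta>(1,3,4) by (rule test_integrals_tendsto(2))
  have e: "(LINT t|lborel. \<beta> t * of_real (\<eta> n t)) = conv (1 / (real n + 1)) \<alpha> q - conv (1 / (real n + 1)) \<alpha> p" for n
    unfolding weak[OF \<eta>(1)] vd conv_a[symmetric] using int[of n p] int[of n q]
    by (simp add: right_diff_distrib mult.commute)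
  show ?thesis
    by (rule LIMSEQ_unique[OF tendsto_diff[OF lim lim] l1[unfolded e]])
qed

section \<open>The Fourier transform\<close>

lemma inv_fourier_measurable [measurable]:
  assumes [measurable]: "h \<in> borel_measurable borel"
  shows "inv_fourier h \<in> borel_measurable borel"
  unfolding inv_fourier_def[abs_def] cis_conv_exp by measurable

lemma fourier_eq_inv_fourier: "fourier h \<xi> = inv_fourier h (- \<xi>)"
  by (simp add: fourier_def inv_fourier_def)

lemma cis_measurable [measurable]: "cis \<in> borel_measurable borel"
  by (intro borel_measurable_continuous_onI continuous_intros)

lemma integrable_cis_mult:
  assumes "integrable lborel h"
  shows "integrable lborel (\<lambda>x. cis (x * \<xi>) * h x)"
proof (rule Bochner_Integration.integrable_bound[OF assms])
  have [measurable]: "h \<in> borel_measurable borel" using assms by auto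
  show "(\<lambda>x. cis (x * \<xi>) * h x) \<in> borel_measurable lborel" by measurable
qed (simp add: norm_mult)

lemma inv_fourier_norm_le: "norm (inv_fourier h \<xi>) \<le> (LINT x|lborel. norm (h x))"
proof -
  have "1 \<le> sqrt (2 * pi)" using pi_gt3 by (intro real_le_rsqrt) auto
  then have "1 / sqrt (2 * pi) \<le> 1" by simp
  moreover have "norm (LINT x|lborel. cis (x * \<xi>) * h x) \<le> (LINT x|lborel. norm (cis (x * \<xi>) * h x))"
    by (rule integral_norm_bound)
  ultimately have "1 / sqrt (2 * pi) * norm (LINT x|lborel. cis (x * \<xi>) * h x) \<le> 1 * (LINT x|lborel. norm (h x))"
    by (intro mult_mono) (auto simp: norm_mult)
  then show ?thesis by (simp add: inv_fourier_def norm_mult norm_divide)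
qed

lemma inv_fourier_tendsto:
  fixes h :: "nat \<Rightarrow> real \<Rightarrow> complex"
  assumes "\<And>n. h n \<in> borel_measurable borel" "h0 \<in> borel_measurable borel" "integrable lborel w"
    and "\<And>x. (\<lambda>n. h n x) \<longlonglongrightarrow> h0 x" "\<And>n x. norm (h n x) \<le> w x" "X \<longlonglongrightarrow> \<xi>"
  shows "(\<lambda>n. inv_fourier (h n) (X n)) \<longlonglongrightarrow> inv_fourier h0 \<xi>"
proof -
  note [measurable] = assms(1,2)
  have "(\<lambda>n. LINT x|lborel. cis (x * X n) * h n x) \<longlonglongrightarrow> (LINT x|lborel. cis (x * \<xi>) * h0 x)"
  proof (rule integral_dominated_convergence[OF _ _ assms(3)])
    show "AE x in lborel. (\<lambda>n. cis (x * X n) * h n x) \<longlonglongrightarrow> cis (x * \<xi>) * h0 x"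
      by (intro AE_I2 tendsto_intros assms)
    show "AE x in lborel. cmod (cis (x * X n) * h n x) \<le> w x" for n
      using assms(5) by (simp add: norm_mult)
  qed auto
  then show ?thesis unfolding inv_fourier_def by (intro tendsto_intros)
qed

lemma inv_fourier_continuous:
  assumes "integrable lborel h"
  shows "continuous_on UNIV (inv_fourier h)"
proof -
  have m: "h \<in> borel_measurable borel" using assms by auto
  have "(\<lambda>n. inv_fourier h (X n)) \<longlonglongrightarrow> inv_fourier h \<xi>" if "X \<longlonglongrightarrow> \<xi>" for X \<xi>
    by (rule inv_fourier_tendsto[where h = "\<lambda>_. h" and w = "\<lambda>x. norm (h x)"])
      (use m assms that in auto)
  then show ?thesis
    unfolding continuous_on_sequentially by (auto simp: o_def)
qed

lemma integrable_product_lborel: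
  fixes h k :: "real \<Rightarrow> complex" and c :: "real \<Rightarrow> real \<Rightarrow> complex"
  assumes "integrable lborel h" "integrable lborel k"
    and [measurable]: "(\<lambda>(x, y). c x y) \<in> borel_measurable (borel \<Otimes>\<^sub>M borel)"
    and c: "\<And>x y. norm (c x y) \<le> 1"
  shows "integrable (lborel \<Otimes>\<^sub>M lborel) (\<lambda>(x, y). c x y * (h x * k y))"
proof (rule lborel_pair.Fubini_integrable)
  have [measurable]: "h \<in> borel_measurable borel" "k \<in> borel_measurable borel" using assms by auto
  show m: "(\<lambda>(x, y). c x y * (h x * k y)) \<in> borel_measurable (lborel \<Otimes>\<^sub>M lborel)"
    by measurable
  have b: "norm (c x y * (h x * k y)) \<le> norm (h x) * norm (k y)" for x y
    using c[of x y] by (simp add: norm_mult mult_left_le_one_le)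
  have i: "integrable lborel (\<lambda>y. c x y * (h x * k y))" for x
    by (rule Bochner_Integration.integrable_bound[where f = "\<lambda>y. norm (h x) * norm (k y)"])
      (use b assms in \<open>auto intro!: AE_I2\<close>)
  then show "AE x in lborel. integrable lborel (\<lambda>y. case (x, y) of (x, y) \<Rightarrow> c x y * (h x * k y))"
    by simp
  show "integrable lborel (\<lambda>x. LINT y|lborel. norm (case (x, y) of (x, y) \<Rightarrow> c x y * (h x * k y)))"
  proof (rule Bochner_Integration.integrable_bound[where f = "\<lambda>x. norm (h x) * (LINT y|lborel. norm (k y))"])
    show "(\<lambda>x. LINT y|lborel. norm (case (x, y) of (x, y) \<Rightarrow> c x y * (h x * k y))) \<in> borel_measurable lborel"
      by measurable
    have "(LINT y|lborel. norm (c x y * (h x * k y))) \<le> (LINT y|lborel. norm (h x) * norm (k y))" for x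
      using i assms b by (intro integral_mono) auto
    then show "AE x in lborel. norm (LINT y|lborel. norm (case (x, y) of (x, y) \<Rightarrow> c x y * (h x * k y)))
        \<le> norm (norm (h x) * (LINT y|lborel. norm (k y)))"
      by (simp add: abs_mult)
  qed (use assms in auto)
qed

text \<open>Fubini, since the Fourier kernel is symmetric in its two variables. All later passages
  between a function and its transform go through this formula.\<close>

lemma fourier_multiplication:
  assumes "integrable lborel h" "integrable lborel k"
  shows "(LINT \<xi>|lborel. k \<xi> * inv_fourier h \<xi>) = (LINT x|lborel. h x * inv_fourier k x)"
proof -
  define C where "C = complex_of_real (1 / sqrt (2 * pi))"
  have "integrable (lborel \<Otimes>\<^sub>M lborel) (\<lambda>(x, \<xi>). cis (x * \<xi>) * (h x * k \<xi>))"
    using assms by (intro integrable_product_lborel) auto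
  from lborel_pair.Fubini_integral[OF this]
  have "(LINT \<xi>|lborel. LINT x|lborel. k \<xi> * (cis (x * \<xi>) * h x)) = (LINT x|lborel. LINT \<xi>|lborel. h x * (cis (\<xi> * x) * k \<xi>))"
    by (simp add: mult_ac)
  then have "(LINT \<xi>|lborel. k \<xi> * (LINT x|lborel. cis (x * \<xi>) * h x)) = (LINT x|lborel. h x * (LINT \<xi>|lborel. cis (\<xi> * x) * k \<xi>))"
    by simp
  then have "C * (LINT \<xi>|lborel. k \<xi> * (LINT x|lborel. cis (x * \<xi>) * h x)) = C * (LINT x|lborel. h x * (LINT \<xi>|lborel. cis (\<xi> * x) * k \<xi>))"
    by simp
  then show ?thesis
    unfolding inv_fourier_def C_def[symmetric]
    by (simp add: mult.left_commute[of _ C] flip: integral_mult_right_zero)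
qed

subsection \<open>Gaussian regularisation\<close>

definition gauss_weight :: "real \<Rightarrow> real \<Rightarrow> complex" where
  "gauss_weight d \<xi> = of_real (exp (- (d * \<xi>)\<^sup>2 / 2))"

definition gauss_kern :: "real \<Rightarrow> real \<Rightarrow> real" where
  "gauss_kern d x = std_normal_density (x / d) / d"

text \<open>The characteristic function of the normal distribution is the one explicit transform on
  which Bessel's inequality and Fourier inversion both rest.\<close>

lemma std_normal_fourier:
  "(LINT z|lborel. cis (z * t) * of_real (std_normal_density z)) = of_real (exp (- t\<^sup>2 / 2))"
proof -
  have "char std_normal_distribution t = (LINT z|lborel. std_normal_density z *\<^sub>R iexp (t * z))"
    unfolding char_def by (intro integral_density) auto
  then show ?thesis
    unfolding char_std_normal_distribution
    by (simp add: scaleR_conv_of_real cis_conv_exp mult_ac)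
qed

lemma std_normal_integrable: "integrable lborel std_normal_density"
  and std_normal_integral: "(LINT z|lborel. std_normal_density z) = 1"
  by (auto simp: integrable_normal_density integral_normal_density)

lemma gauss_weight_eq:
  "gauss_weight d \<xi> = of_real (sqrt (2 * pi)) * of_real (std_normal_density (d * \<xi>))"
proof -
  have "sqrt (2 * pi) * std_normal_density (d * \<xi>) = exp (- (d * \<xi>)\<^sup>2 / 2)"
    by (simp add: std_normal_density_def)
  then show ?thesis unfolding gauss_weight_def of_real_mult[symmetric] by simp
qed

lemma gauss_weight_measurable [measurable]: "gauss_weight d \<in> borel_measurable borel"
  unfolding gauss_weight_def[abs_def] by measurable

lemma gauss_weight_norm: "norm (gauss_weight d \<xi>) \<le> 1"
  unfolding gauss_weight_def by simp

lemma gauss_weight_integrable: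
  assumes "d > 0" shows "integrable lborel (gauss_weight d)"
proof -
  have "integrable lborel (\<lambda>\<xi>. std_normal_density (0 + d * \<xi>))"
    using lborel_integrable_real_affine[OF std_normal_integrable, of d 0] assms by simp
  then show ?thesis unfolding gauss_weight_eq[abs_def] by simp
qed

lemma inv_fourier_gauss_weight:
  assumes "d > 0"
  shows "inv_fourier (\<lambda>\<xi>. cis (a * \<xi>) * gauss_weight d \<xi>) x = of_real (sqrt (2 * pi)) * of_real (gauss_kern d (x + a))"
proof -
  define t where "t = (x + a) / d"
  have "of_real (exp (- t\<^sup>2 / 2)) = (LINT z|lborel. cis (z * t) * of_real (std_normal_density z))"
    by (rule std_normal_fourier[symmetric])
  also have "\<dots> = \<bar>d\<bar> *\<^sub>R (LINT \<xi>|lborel. cis ((0 + d * \<xi>) * t) * of_real (std_normal_density (0 + d * \<xi>)))"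
    using assms by (intro lborel_integral_real_affine) auto
  also have "(\<lambda>\<xi>. cis ((0 + d * \<xi>) * t) * of_real (std_normal_density (0 + d * \<xi>))) =
      (\<lambda>\<xi>. (cis (\<xi> * x) * (cis (a * \<xi>) * gauss_weight d \<xi>)) / of_real (sqrt (2 * pi)))"
  proof
    fix \<xi>
    have "(0 + d * \<xi>) * t = \<xi> * x + a * \<xi>" using assms by (simp add: t_def field_simps)
    then have "cis ((0 + d * \<xi>) * t) = cis (\<xi> * x) * cis (a * \<xi>)" by (simp add: cis_mult)
    then show "cis ((0 + d * \<xi>) * t) * of_real (std_normal_density (0 + d * \<xi>)) =
        (cis (\<xi> * x) * (cis (a * \<xi>) * gauss_weight d \<xi>)) / of_real (sqrt (2 * pi))"
      by (simp add: gauss_weight_eq)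
  qed
  also have "\<bar>d\<bar> *\<^sub>R (LINT \<xi>|lborel. (cis (\<xi> * x) * (cis (a * \<xi>) * gauss_weight d \<xi>)) / of_real (sqrt (2 * pi)))
      = of_real d * inv_fourier (\<lambda>\<xi>. cis (a * \<xi>) * gauss_weight d \<xi>) x"
    using assms by (simp add: inv_fourier_def scaleR_conv_of_real)
  finally have "inv_fourier (\<lambda>\<xi>. cis (a * \<xi>) * gauss_weight d \<xi>) x = of_real (exp (- t\<^sup>2 / 2) / d)"
    using assms by (simp add: field_simps)
  also have "exp (- t\<^sup>2 / 2) / d = sqrt (2 * pi) * gauss_kern d (x + a)"
    by (simp add: gauss_kern_def std_normal_density_def t_def)
  finally show ?thesis by simp
qed

lemma gauss_exp_tendsto:
  fixes \<xi> :: real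
  shows "(\<lambda>n. exp (- (1 / (real n + 1) * \<xi>)\<^sup>2 / 2)) \<longlonglongrightarrow> 1"
proof -
  have "(\<lambda>n. 1 / (real n + 1)) \<longlonglongrightarrow> 0" by real_asymp
  then have "(\<lambda>n. exp (- (1 / (real n + 1) * \<xi>)\<^sup>2 / 2)) \<longlonglongrightarrow> exp (- (0 * \<xi>)\<^sup>2 / 2)"
    by (intro tendsto_intros) auto
  then show ?thesis by simp
qed

lemma gauss_weight_tendsto:
  "(\<lambda>n. gauss_weight (1 / (real n + 1)) \<xi>) \<longlonglongrightarrow> 1"
proof -
  from tendsto_of_real[OF gauss_exp_tendsto[of \<xi>]] show ?thesis by (simp add: gauss_weight_def)
qed

lemma gauss_kern_nn_integral:
  assumes "d > 0"
  shows "(\<integral>\<^sup>+y. ennreal (gauss_kern d (x + y)) \<partial>lborel) = 1"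
proof -
  have "(\<integral>\<^sup>+y. ennreal (gauss_kern d (x + y)) \<partial>lborel) = ennreal d * (\<integral>\<^sup>+z. ennreal (gauss_kern d (x + (- x + d * z))) \<partial>lborel)"
    using assms nn_integral_real_affine[of "\<lambda>y. ennreal (gauss_kern d (x + y))" d "- x"]
    by (simp add: gauss_kern_def)
  also have "\<dots> = (\<integral>\<^sup>+z. ennreal (std_normal_density z) \<partial>lborel)"
    using assms by (subst nn_integral_cmult[symmetric]) (auto simp: gauss_kern_def ennreal_mult[symmetric])
  also have "\<dots> = 1"
    using std_normal_integrable std_normal_integral by (subst nn_integral_eq_integral) auto
  finally show ?thesis .
qed

lemma gauss_kern_nonneg: "d > 0 \<Longrightarrow> gauss_kern d x \<ge> 0"
  by (simp add: gauss_kern_def)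

lemma gauss_kern_measurable [measurable]: "gauss_kern d \<in> borel_measurable borel"
  unfolding gauss_kern_def[abs_def] by measurable

lemma norm_integral_le_nn_integral:
  fixes f :: "'a \<Rightarrow> 'b::{banach, second_countable_topology}"
  shows "ennreal (norm (integral\<^sup>L M f)) \<le> (\<integral>\<^sup>+x. ennreal (norm (f x)) \<partial>M)"
  by (cases "integrable M f") (auto simp: integral_norm_bound_ennreal not_integrable_integral_eq)

text \<open>The Gaussian makes |inv_fourier h|^2 integrable for merely integrable h. The
  multiplication formula then turns its integral into a double integral of h against a probability
  kernel, to which the arithmetic-geometric mean inequality applies.\<close>

lemma bessel_gauss:
  assumes h: "integrable lborel h" and d: "d > 0"
  shows "(\<integral>\<^sup>+\<xi>. ennreal ((norm (inv_fourier h \<xi>))\<^sup>2 * exp (- (d * \<xi>)\<^sup>2 / 2)) \<partial>lborel) \<le> (\<integral>\<^sup>+x. ennreal ((norm (h x))\<^sup>2) \<partial>lborel)"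
proof -
  have [measurable]: "h \<in> borel_measurable borel" using h by auto
  \<comment> \<open>Reflection and conjugation conjugate the transform, so the squared modulus
    becomes a product of two transforms.\<close>
  define h' where "h' y = cnj (h (- y))" for y
  have h': "integrable lborel h'"
  proof -
    have "integrable lborel (\<lambda>y. h (0 + (- 1) * y))" by (rule lborel_integrable_real_affine[OF h]) simp
    then show ?thesis unfolding h'_def by simp
  qed
  have [measurable]: "h' \<in> borel_measurable borel" using h' by auto
  have cnj: "inv_fourier h' \<xi> = cnj (inv_fourier h \<xi>)" for \<xi>
  proof -
    have "(LINT y|lborel. cis (y * \<xi>) * h' y) = \<bar>-1\<bar> *\<^sub>R (LINT y|lborel. cis ((0 + (-1) * y) * \<xi>) * h' (0 + (-1) * y))"
      by (rule lborel_integral_real_affine) simp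
    also have "\<dots> = (LINT y|lborel. cnj (cis (y * \<xi>) * h y))"
      unfolding abs_minus_cancel abs_one scaleR_one
      by (rule Bochner_Integration.integral_cong) (simp_all add: h'_def cis_cnj)
    also have "\<dots> = cnj (LINT y|lborel. cis (y * \<xi>) * h y)" by (rule Bochner_Integration.integral_cnj)
    finally show ?thesis by (simp add: inv_fourier_def)
  qed
  define k where "k \<xi> = gauss_weight d \<xi> * inv_fourier h' \<xi>" for \<xi>
  have bdd: "norm (inv_fourier h' \<xi>) \<le> (LINT x|lborel. norm (h' x))" for \<xi> by (rule inv_fourier_norm_le)
  have k: "integrable lborel k"
  proof (rule Bochner_Integration.integrable_bound[where f = "\<lambda>\<xi>. (LINT x|lborel. norm (h' x)) * norm (gauss_weight d \<xi>)"])
    show "integrable lborel (\<lambda>\<xi>. (LINT x|lborel. norm (h' x)) * norm (gauss_weight d \<xi>))"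
      using gauss_weight_integrable[OF d] by auto
    show "k \<in> borel_measurable lborel" unfolding k_def[abs_def] by measurable
    show "AE x in lborel. norm (k x) \<le> norm ((LINT x|lborel. norm (h' x)) * norm (gauss_weight d x))"
    proof (rule AE_I2)
      fix x
      have "norm (k x) \<le> (LINT x|lborel. norm (h' x)) * norm (gauss_weight d x)"
        using mult_right_mono[OF bdd[of x] norm_ge_zero, of "gauss_weight d x"] by (simp add: k_def norm_mult mult.commute)
      also have "\<dots> \<le> norm ((LINT x|lborel. norm (h' x)) * norm (gauss_weight d x))" by simp
      finally show "norm (k x) \<le> norm ((LINT x|lborel. norm (h' x)) * norm (gauss_weight d x))" .
    qed
  qed
  have ik: "inv_fourier k x = (LINT y|lborel. h' y * of_real (gauss_kern d (x + y)))" for x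
  proof -
    have gi: "integrable lborel (\<lambda>\<xi>. cis (x * \<xi>) * gauss_weight d \<xi>)"
      using integrable_cis_mult[OF gauss_weight_integrable[OF d], of x] by (simp add: mult.commute)
    have "(LINT \<xi>|lborel. cis (\<xi> * x) * k \<xi>) = (LINT \<xi>|lborel. (cis (x * \<xi>) * gauss_weight d \<xi>) * inv_fourier h' \<xi>)"
      by (simp add: k_def mult_ac)
    also have "\<dots> = (LINT y|lborel. h' y * inv_fourier (\<lambda>\<xi>. cis (x * \<xi>) * gauss_weight d \<xi>) y)"
      by (rule fourier_multiplication[OF h' gi])
    also have "\<dots> = of_real (sqrt (2 * pi)) * (LINT y|lborel. h' y * of_real (gauss_kern d (x + y)))"
      unfolding inv_fourier_gauss_weight[OF d] by (simp add: mult.left_commute add.commute flip: integral_mult_right_zero)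
    finally show ?thesis by (simp add: inv_fourier_def)
  qed
  define I where "I = (LINT \<xi>|lborel. k \<xi> * inv_fourier h \<xi>)"
  have re: "k \<xi> * inv_fourier h \<xi> = of_real ((norm (inv_fourier h \<xi>))\<^sup>2 * exp (- (d * \<xi>)\<^sup>2 / 2))" for \<xi>
    unfolding k_def cnj gauss_weight_def
    using complex_norm_square[of "inv_fourier h \<xi>"] by (simp add: mult_ac)
  have "integrable lborel (\<lambda>\<xi>. k \<xi> * inv_fourier h \<xi>)"
  proof (rule Bochner_Integration.integrable_bound[where f = "\<lambda>\<xi>. (LINT x|lborel. norm (h x)) * norm (k \<xi>)"])
    show "AE \<xi> in lborel. norm (k \<xi> * inv_fourier h \<xi>) \<le> norm ((LINT x|lborel. norm (h x)) * norm (k \<xi>))"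
    proof (rule AE_I2)
      fix x
      have "norm (k x * inv_fourier h x) \<le> (LINT x|lborel. norm (h x)) * norm (k x)"
        using mult_right_mono[OF inv_fourier_norm_le[of h x] norm_ge_zero, of "k x"] by (simp add: norm_mult mult.commute)
      also have "\<dots> \<le> norm ((LINT x|lborel. norm (h x)) * norm (k x))" by simp
      finally show "norm (k x * inv_fourier h x) \<le> norm ((LINT x|lborel. norm (h x)) * norm (k x))" .
    qed
    show "(\<lambda>\<xi>. k \<xi> * inv_fourier h \<xi>) \<in> borel_measurable lborel"
      unfolding k_def[abs_def] by measurable
  qed (use k in auto)
  then have int: "integrable lborel (\<lambda>\<xi>. (norm (inv_fourier h \<xi>))\<^sup>2 * exp (- (d * \<xi>)\<^sup>2 / 2))"
    unfolding re by (simp only: complex_of_real_integrable_eq)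
  have "(\<integral>\<^sup>+\<xi>. ennreal ((norm (inv_fourier h \<xi>))\<^sup>2 * exp (- (d * \<xi>)\<^sup>2 / 2)) \<partial>lborel) =
      ennreal (LINT \<xi>|lborel. (norm (inv_fourier h \<xi>))\<^sup>2 * exp (- (d * \<xi>)\<^sup>2 / 2))"
    using int by (intro nn_integral_eq_integral) auto
  also have "\<dots> \<le> ennreal (norm I)"
    unfolding I_def re by (intro ennreal_leI) (simp add: integral_complex_of_real del: of_real_mult of_real_power)
  also have "I = (LINT x|lborel. h x * inv_fourier k x)"
    unfolding I_def by (rule fourier_multiplication[OF h k])
  also have "ennreal (norm \<dots>) \<le> (\<integral>\<^sup>+x. ennreal (norm (h x * inv_fourier k x)) \<partial>lborel)"
    by (rule norm_integral_le_nn_integral)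
  also have "\<dots> \<le> (\<integral>\<^sup>+x. \<integral>\<^sup>+y. ennreal (((norm (h x))\<^sup>2 + (norm (h' y))\<^sup>2) / 2 * gauss_kern d (x + y)) \<partial>lborel \<partial>lborel)"
  proof (rule nn_integral_mono)
    fix x
    have "ennreal (norm (h x * inv_fourier k x)) \<le> ennreal (norm (h x)) * (\<integral>\<^sup>+y. ennreal (norm (h' y * of_real (gauss_kern d (x + y)))) \<partial>lborel)"
    proof -
      have "ennreal (norm (h x * inv_fourier k x)) = ennreal (norm (h x)) * ennreal (norm (inv_fourier k x))"
        by (simp add: norm_mult ennreal_mult)
      also have "\<dots> \<le> ennreal (norm (h x)) * (\<integral>\<^sup>+y. ennreal (norm (h' y * of_real (gauss_kern d (x + y)))) \<partial>lborel)"
        unfolding ik by (rule mult_left_mono[OF norm_integral_le_nn_integral]) simp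
      finally show ?thesis .
    qed
    also have "\<dots> = (\<integral>\<^sup>+y. ennreal (norm (h x) * (norm (h' y) * gauss_kern d (x + y))) \<partial>lborel)"
      using gauss_kern_nonneg[OF d] by (subst nn_integral_cmult[symmetric]) (auto simp: norm_mult ennreal_mult)
    also have "\<dots> \<le> (\<integral>\<^sup>+y. ennreal (((norm (h x))\<^sup>2 + (norm (h' y))\<^sup>2) / 2 * gauss_kern d (x + y)) \<partial>lborel)"
    proof (intro nn_integral_mono ennreal_leI)
      fix y
      \<comment> \<open>The two squares separate the variables. The kernel has mass one in x and in
        y, so each of them contributes half of the squared L^2 norm.\<close>
      have "norm (h x) * norm (h' y) \<le> ((norm (h x))\<^sup>2 + (norm (h' y))\<^sup>2) / 2"
        using sum_squares_bound[of "norm (h x)" "norm (h' y)"] by simp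
      from mult_right_mono[OF this gauss_kern_nonneg[OF d]]
      show "norm (h x) * (norm (h' y) * gauss_kern d (x + y)) \<le> ((norm (h x))\<^sup>2 + (norm (h' y))\<^sup>2) / 2 * gauss_kern d (x + y)"
        by (simp add: mult.assoc)
    qed
    finally show "ennreal (norm (h x * inv_fourier k x)) \<le>
        (\<integral>\<^sup>+y. ennreal (((norm (h x))\<^sup>2 + (norm (h' y))\<^sup>2) / 2 * gauss_kern d (x + y)) \<partial>lborel)" .
  qed
  also have "\<dots> = (\<integral>\<^sup>+x. \<integral>\<^sup>+y. ennreal ((norm (h x))\<^sup>2 / 2) * ennreal (gauss_kern d (x + y)) +
      ennreal ((norm (h' y))\<^sup>2 / 2) * ennreal (gauss_kern d (y + x)) \<partial>lborel \<partial>lborel)"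
    using gauss_kern_nonneg[OF d]
    by (intro nn_integral_cong) (auto simp: ennreal_mult[symmetric] ennreal_plus[symmetric] add_divide_distrib distrib_right add.commute simp del: ennreal_plus)
  also have "\<dots> = (\<integral>\<^sup>+x. \<integral>\<^sup>+y. ennreal ((norm (h x))\<^sup>2 / 2) * ennreal (gauss_kern d (x + y)) \<partial>lborel \<partial>lborel) +
      (\<integral>\<^sup>+x. \<integral>\<^sup>+y. ennreal ((norm (h' y))\<^sup>2 / 2) * ennreal (gauss_kern d (y + x)) \<partial>lborel \<partial>lborel)"
    by (simp add: nn_integral_add)
  also have "(\<integral>\<^sup>+x. \<integral>\<^sup>+y. ennreal ((norm (h' y))\<^sup>2 / 2) * ennreal (gauss_kern d (y + x)) \<partial>lborel \<partial>lborel) =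
      (\<integral>\<^sup>+y. \<integral>\<^sup>+x. ennreal ((norm (h' y))\<^sup>2 / 2) * ennreal (gauss_kern d (y + x)) \<partial>lborel \<partial>lborel)"
    by (rule lborel_pair.Fubini') measurable
  also have "\<dots> = (\<integral>\<^sup>+y. ennreal ((norm (h' y))\<^sup>2 / 2) \<partial>lborel)"
    by (simp add: nn_integral_cmult gauss_kern_nn_integral[OF d])
  also have "\<dots> = (\<integral>\<^sup>+y. ennreal ((norm (h y))\<^sup>2 / 2) \<partial>lborel)"
    using nn_integral_real_affine[of "\<lambda>y. ennreal ((norm (h y))\<^sup>2 / 2)" "-1" 0] by (simp add: h'_def)
  also have "(\<integral>\<^sup>+x. \<integral>\<^sup>+y. ennreal ((norm (h x))\<^sup>2 / 2) * ennreal (gauss_kern d (x + y)) \<partial>lborel \<partial>lborel) = (\<integral>\<^sup>+y. ennreal ((norm (h y))\<^sup>2 / 2) \<partial>lborel)"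
    by (simp add: nn_integral_cmult gauss_kern_nn_integral[OF d])
  also have "(\<integral>\<^sup>+y. ennreal ((norm (h y))\<^sup>2 / 2) \<partial>lborel) + (\<integral>\<^sup>+y. ennreal ((norm (h y))\<^sup>2 / 2) \<partial>lborel) = (\<integral>\<^sup>+y. ennreal ((norm (h y))\<^sup>2) \<partial>lborel)"
    by (subst nn_integral_add[symmetric]) (auto simp: ennreal_plus[symmetric] simp del: ennreal_plus)
  finally show ?thesis .
qed

text \<open>Fatou's lemma removes the Gaussian. This is the inequality half of Plancherel's theorem
  for integrable h; all later uses are upper bounds.\<close>

lemma bessel:
  assumes "integrable lborel h"
  shows "(\<integral>\<^sup>+\<xi>. ennreal ((norm (inv_fourier h \<xi>))\<^sup>2) \<partial>lborel) \<le> (\<integral>\<^sup>+x. ennreal ((norm (h x))\<^sup>2) \<partial>lborel)"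
proof -
  have [measurable]: "h \<in> borel_measurable borel" using assms by auto
  define u where "u n \<xi> = ennreal ((norm (inv_fourier h \<xi>))\<^sup>2 * exp (- (1 / (real n + 1) * \<xi>)\<^sup>2 / 2))" for n \<xi>
  have "liminf (\<lambda>n. u n \<xi>) = ennreal ((norm (inv_fourier h \<xi>))\<^sup>2)" for \<xi>
  proof -
    from tendsto_mult[OF tendsto_const gauss_exp_tendsto[of \<xi>], of "(norm (inv_fourier h \<xi>))\<^sup>2"]
    have "(\<lambda>n. u n \<xi>) \<longlonglongrightarrow> ennreal ((norm (inv_fourier h \<xi>))\<^sup>2)" unfolding u_def by (intro tendsto_ennrealI) simp
    then show ?thesis by (rule lim_imp_Liminf[OF sequentially_bot])
  qed
  then have "(\<integral>\<^sup>+\<xi>. ennreal ((norm (inv_fourier h \<xi>))\<^sup>2) \<partial>lborel) = (\<integral>\<^sup>+\<xi>. liminf (\<lambda>n. u n \<xi>) \<partial>lborel)" by simp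
  also have "\<dots> \<le> liminf (\<lambda>n. \<integral>\<^sup>+\<xi>. u n \<xi> \<partial>lborel)"
    by (rule nn_integral_liminf) (unfold u_def, measurable)
  also have "\<dots> \<le> liminf (\<lambda>n::nat. \<integral>\<^sup>+x. ennreal ((norm (h x))\<^sup>2) \<partial>lborel)"
    unfolding u_def by (intro Liminf_mono always_eventually allI bessel_gauss assms) simp
  also have "\<dots> = (\<integral>\<^sup>+x. ennreal ((norm (h x))\<^sup>2) \<partial>lborel)" by (simp add: Liminf_const)
  finally show ?thesis .
qed

section \<open>Schwartz functions and Fourier inversion\<close>

lemma integral_derivative_zero:
  fixes f :: "real \<Rightarrow> 'b::euclidean_space"
  assumes der: "\<And>x. (f has_vector_derivative f' x) (at x)" and cont: "continuous_on UNIV f'"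
    and supp: "\<And>x. R < \<bar>x\<bar> \<Longrightarrow> f x = 0"
  shows "(LINT x|lborel. f' x) = 0"
proof -
  define a where "a = \<bar>R\<bar> + 1"
  have f'0: "f' x = 0" if "R < \<bar>x\<bar>" for x
  proof -
    have "open {x. R < \<bar>x::real\<bar>}"
      by (intro open_Collect_less continuous_intros)
    then have "(f has_vector_derivative 0) (at x)"
      by (rule has_vector_derivative_transform_within_open[of "\<lambda>_. 0", rotated])
        (use that supp in auto)
    then show ?thesis using der vector_derivative_at by metis
  qed
  have "(LINT x|lborel. indicator {-a..a} x *\<^sub>R f' x) = f a - f (- a)"
    by (rule integral_FTC_atLeastAtMost)
      (use der cont in \<open>auto simp: a_def intro: has_vector_derivative_at_within continuous_on_subset\<close>)
  also have "f a - f (- a) = 0" using supp[of a] supp[of "- a"] by (simp add: a_def)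
  also have "(\<lambda>x. indicator {-a..a} x *\<^sub>R f' x) = f'"
  proof
    fix x show "indicator {-a..a} x *\<^sub>R f' x = f' x"
      using f'0[of x] by (cases "x \<in> {-a..a}") (auto simp: a_def)
  qed
  finally show ?thesis .
qed

lemma cis_has_vector_derivative:
  "((\<lambda>\<xi>. cis (x * \<xi>)) has_vector_derivative (\<i> * of_real x) * cis (x * \<xi>)) (at \<xi>)"
proof -
  have "((\<lambda>z. exp (\<i> * of_real x * z)) has_field_derivative (\<i> * of_real x) * exp (\<i> * of_real x * of_real \<xi>)) (at (of_real \<xi>))"
    by (auto intro!: derivative_eq_intros)
  from has_vector_derivative_real_field[OF this] show ?thesis
    by (simp add: cis_conv_exp mult.assoc)
qed

lemma inv_fourier_has_derivative:
  assumes "integrable lborel \<phi>" "integrable lborel (\<lambda>x. of_real x * \<phi> x)"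
  shows "(inv_fourier \<phi> has_vector_derivative inv_fourier (\<lambda>x. \<i> * (of_real x * \<phi> x)) \<xi>) (at \<xi>)"
proof -
  have "((\<lambda>\<xi>. LINT x|lborel. cis (x * \<xi>) * \<phi> x) has_vector_derivative
      (LINT x|lborel. cis (x * \<xi>) * (\<i> * (of_real x * \<phi> x)))) (at \<xi>)"
  proof (rule has_vector_derivative_integral(2)[where e = 1 and f' = "\<lambda>\<xi> x. cis (x * \<xi>) * (\<i> * (of_real x * \<phi> x))"])
    show "integrable lborel (\<lambda>x. cis (x * y) * \<phi> x)" for y by (rule integrable_cis_mult[OF assms(1)])
    show "((\<lambda>y. cis (x * y) * \<phi> x) has_vector_derivative cis (x * y) * (\<i> * (of_real x * \<phi> x))) (at y)" for x y
      using has_vector_derivative_mult_left[OF cis_has_vector_derivative[of x y], of "\<phi> x"] by (simp add: mult_ac)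
    show "integrable lborel (\<lambda>x. norm (of_real x * \<phi> x))" using assms(2) by (rule integrable_norm)
  qed (auto simp: norm_mult)
  from has_vector_derivative_mult_right[OF this, of "of_real (1 / sqrt (2 * pi))"]
  show ?thesis unfolding inv_fourier_def[abs_def] by simp
qed

lemma inv_fourier_cmult: "inv_fourier (\<lambda>x. c * h x) \<xi> = c * inv_fourier h \<xi>"
  by (simp add: inv_fourier_def mult.left_commute)

lemma inv_fourier_add:
  assumes "integrable lborel h" "integrable lborel k"
  shows "inv_fourier (\<lambda>x. h x + k x) \<xi> = inv_fourier h \<xi> + inv_fourier k \<xi>"
  using integrable_cis_mult[OF assms(1), of \<xi>] integrable_cis_mult[OF assms(2), of \<xi>]
  by (simp add: inv_fourier_def distrib_left)

lemma inv_fourier_diff: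
  assumes "integrable lborel h" "integrable lborel k"
  shows "inv_fourier (\<lambda>x. h x - k x) \<xi> = inv_fourier h \<xi> - inv_fourier k \<xi>"
  using integrable_cis_mult[OF assms(1), of \<xi>] integrable_cis_mult[OF assms(2), of \<xi>]
  by (simp add: inv_fourier_def right_diff_distrib)

lemma inv_fourier_vderiv:
  assumes \<rho>: "\<rho> \<in> smooth_cs"
  shows "inv_fourier (vderiv \<rho>) \<xi> = - (\<i> * of_real \<xi>) * inv_fourier \<rho> \<xi>"
proof -
  obtain R where R: "\<And>x. R < \<bar>x\<bar> \<Longrightarrow> \<rho> x = 0" using smooth_cs_support[OF \<rho>] by blast
  have cis: "continuous_on UNIV (\<lambda>x::real. cis (x * \<xi>))" by (intro continuous_intros)
  have d: "((\<lambda>x. cis (x * \<xi>) * \<rho> x) has_vector_derivative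
      cis (x * \<xi>) * vderiv \<rho> x + (\<i> * of_real \<xi>) * (cis (x * \<xi>) * \<rho> x)) (at x)" for x
    using has_vector_derivative_mult[OF cis_has_vector_derivative[of \<xi> x] smooth_cs_has_vderiv[OF \<rho>, of x]]
    by (simp add: mult_ac)
  have "(LINT x|lborel. cis (x * \<xi>) * vderiv \<rho> x + (\<i> * of_real \<xi>) * (cis (x * \<xi>) * \<rho> x)) = 0"
  proof (rule integral_derivative_zero[OF d])
    show "continuous_on UNIV (\<lambda>x. cis (x * \<xi>) * vderiv \<rho> x + (\<i> * of_real \<xi>) * (cis (x * \<xi>) * \<rho> x))"
      by (intro continuous_intros cis smooth_cs_continuous[OF \<rho>] smooth_cs_continuous[OF smooth_cs_vderiv[OF \<rho>]])
  qed (use R in auto)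
  then have "(LINT x|lborel. cis (x * \<xi>) * vderiv \<rho> x) = - (\<i> * of_real \<xi>) * (LINT x|lborel. cis (x * \<xi>) * \<rho> x)"
    using integrable_cis_mult[OF smooth_cs_integrable[OF \<rho>], of \<xi>]
      integrable_cis_mult[OF smooth_cs_integrable[OF smooth_cs_vderiv[OF \<rho>]], of \<xi>]
    by (simp add: add_eq_0_iff)
  then show ?thesis by (simp add: inv_fourier_def)
qed

text \<open>Every power of \<xi> is traded for a derivative of \<rho>, and transforms of integrable
  functions are bounded.\<close>

lemma inv_fourier_smooth_decay:
  assumes "\<rho> \<in> smooth_cs"
  shows "\<exists>M. \<forall>\<xi>. norm (\<xi> ^ k *\<^sub>R inv_fourier \<rho> \<xi>) \<le> M"
  using assms
proof (induction k arbitrary: \<rho>)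
  case 0
  then show ?case using inv_fourier_norm_le by auto
next
  case (Suc k)
  then obtain M where M: "\<And>\<xi>. norm (\<xi> ^ k *\<^sub>R inv_fourier (vderiv \<rho>) \<xi>) \<le> M"
    using smooth_cs_vderiv by blast
  have "norm (\<xi> ^ Suc k *\<^sub>R inv_fourier \<rho> \<xi>) \<le> M" for \<xi>
    using M[of \<xi>] unfolding inv_fourier_vderiv[OF Suc.prems] by (simp add: norm_mult abs_mult mult_ac)
  then show ?case by blast
qed

lemma integrable_of_square_decay:
  fixes f :: "real \<Rightarrow> complex"
  assumes "f \<in> borel_measurable borel" "\<And>x. norm (f x) \<le> M" "\<And>x. x\<^sup>2 * norm (f x) \<le> M"
  shows "integrable lborel f"
proof -
  have "integrable lborel (\<lambda>x::real. inverse (1 + x\<^sup>2))"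
    using integrable_inverse_1_plus_square unfolding set_integrable_def by simp
  then have "integrable lborel (\<lambda>x::real. 2 * M * inverse (1 + x\<^sup>2))" by simp
  then show ?thesis
  proof (rule Bochner_Integration.integrable_bound)
    show "AE x in lborel. norm (f x) \<le> norm (2 * M * inverse (1 + x\<^sup>2))"
    proof (rule AE_I2)
      fix x :: real
      have "(1 + x\<^sup>2) * norm (f x) \<le> 2 * M" using assms(2,3)[of x] by (simp add: distrib_right)
      moreover have "1 + x\<^sup>2 > 0" by (simp add: add_pos_nonneg)
      ultimately have "norm (f x) \<le> 2 * M * inverse (1 + x\<^sup>2)" by (simp add: field_simps)
      then show "norm (f x) \<le> norm (2 * M * inverse (1 + x\<^sup>2))" by simp
    qed
  qed (use assms(1) in simp)
qed

lemma schwartz_has_vderiv: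
  assumes "f \<in> schwartz"
  shows "((vderiv ^^ n) f has_vector_derivative (vderiv ^^ Suc n) f x) (at x)"
  using assms unfolding schwartz_def by (simp add: vector_derivative_works)

lemma schwartz_bound:
  assumes "f \<in> schwartz"
  obtains M where "\<And>x. norm (x ^ k *\<^sub>R (vderiv ^^ n) f x) \<le> M"
  using assms unfolding schwartz_def bounded_iff by blast

lemma schwartz_measurable:
  assumes "f \<in> schwartz"
  shows "f \<in> borel_measurable borel"
proof -
  have "continuous_on UNIV f"
    using has_vector_derivative_continuous[OF schwartz_has_vderiv[OF assms, of 0]]
    by (simp add: continuous_at_imp_continuous_on)
  then show ?thesis by (rule borel_measurable_continuous_onI)
qed

lemma schwartz_integrable:
  assumes "f \<in> schwartz"
  shows "integrable lborel f"
proof -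
  obtain M1 where M1: "\<And>x. norm (x ^ 0 *\<^sub>R (vderiv ^^ 0) f x) \<le> M1" using schwartz_bound[OF assms] by blast
  obtain M2 where M2: "\<And>x. norm (x ^ 2 *\<^sub>R (vderiv ^^ 0) f x) \<le> M2" using schwartz_bound[OF assms] by blast
  show ?thesis
  proof (rule integrable_of_square_decay[where M = "max M1 M2"])
    show "f \<in> borel_measurable borel" by (rule schwartz_measurable[OF assms])
    show "norm (f x) \<le> max M1 M2" for x using M1[of x] by simp
    show "x\<^sup>2 * norm (f x) \<le> max M1 M2" for x using M2[of x] by simp
  qed
qed

lemma schwartz_times_x:
  assumes f: "f \<in> schwartz"
  shows "(\<lambda>x. of_real x * f x) \<in> schwartz"
proof -
  \<comment> \<open>Leibniz for x f: the second term is n times the derivative of order n - 1. At n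
    = 0 the truncated index is harmless because of the factor n.\<close>
  have d: "((\<lambda>x. of_real x * (vderiv ^^ n) f x + of_nat n * (vderiv ^^ (n - 1)) f x) has_vector_derivative
      of_real x * (vderiv ^^ Suc n) f x + of_nat (Suc n) * (vderiv ^^ n) f x) (at x)" for n x
  proof -
    have "((\<lambda>x. of_nat n * (vderiv ^^ (n - 1)) f x) has_vector_derivative of_nat n * (vderiv ^^ n) f x) (at x)"
      using has_vector_derivative_mult_right[OF schwartz_has_vderiv[OF f, of "n - 1" x], of "of_nat n"]
      by (cases n) auto
    moreover have "((\<lambda>x. of_real x * (vderiv ^^ n) f x) has_vector_derivative
        of_real x * (vderiv ^^ Suc n) f x + 1 * (vderiv ^^ n) f x) (at x)"
      by (intro has_vector_derivative_mult schwartz_has_vderiv f) (auto intro!: derivative_eq_intros)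
    ultimately show ?thesis
      using has_vector_derivative_add by (fastforce simp: algebra_simps)
  qed
  have eq: "(vderiv ^^ n) (\<lambda>x. of_real x * f x) = (\<lambda>x. of_real x * (vderiv ^^ n) f x + of_nat n * (vderiv ^^ (n - 1)) f x)" for n
  proof (induction n)
    case (Suc n)
    show ?case
      unfolding funpow.simps(2) o_apply Suc
      using vderiv_eqI[OF d, of n] by simp
  qed simp
  have "bounded (range (\<lambda>x. x ^ k *\<^sub>R (vderiv ^^ n) (\<lambda>x. of_real x * f x) x))" for n k
  proof -
    obtain M1 where M1: "\<And>x. norm (x ^ Suc k *\<^sub>R (vderiv ^^ n) f x) \<le> M1" using schwartz_bound[OF f] by blast
    obtain M2 where M2: "\<And>x. norm (x ^ k *\<^sub>R (vderiv ^^ (n - 1)) f x) \<le> M2" using schwartz_bound[OF f] by blast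
    have "norm (x ^ k *\<^sub>R (vderiv ^^ n) (\<lambda>x. of_real x * f x) x) \<le> M1 + real n * M2" for x
    proof -
      have "x ^ k *\<^sub>R (vderiv ^^ n) (\<lambda>x. of_real x * f x) x =
          x ^ Suc k *\<^sub>R (vderiv ^^ n) f x + of_nat n * (x ^ k *\<^sub>R (vderiv ^^ (n - 1)) f x)"
        unfolding eq by (simp add: scaleR_conv_of_real algebra_simps)
      also have "norm \<dots> \<le> norm (x ^ Suc k *\<^sub>R (vderiv ^^ n) f x) + real n * norm (x ^ k *\<^sub>R (vderiv ^^ (n - 1)) f x)"
        by (rule order_trans[OF norm_triangle_ineq]) (simp add: norm_mult)
      also have "\<dots> \<le> M1 + real n * M2" by (intro add_mono mult_left_mono M1 M2) auto
      finally show ?thesis .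
    qed
    then show ?thesis unfolding bounded_iff by auto
  qed
  moreover have "(vderiv ^^ n) (\<lambda>x. of_real x * f x) differentiable (at x)" for n x
    unfolding eq using d by (rule differentiableI_vector)
  ultimately show ?thesis unfolding schwartz_def by blast
qed

text \<open>Differentiating the transform multiplies \<rho> by i x, which keeps it a test function.
  The transforms of test functions thus form a stable family each of whose members decays
  rapidly.\<close>

lemma inv_fourier_schwartz:
  assumes "\<rho> \<in> smooth_cs"
  shows "inv_fourier \<rho> \<in> schwartz"
proof -
  define S where "S = {inv_fourier \<rho> | \<rho>. \<rho> \<in> smooth_cs}"
  have "(\<forall>x. g differentiable (at x)) \<and> vderiv g \<in> S" if gS: "g \<in> S" for g
  proof -
    obtain \<rho> where \<rho>: "\<rho> \<in> smooth_cs" "g = inv_fourier \<rho>" using gS unfolding S_def by blast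
    have x: "(\<lambda>x. of_real x * \<rho> x) \<in> smooth_cs" by (rule smooth_cs_times_x[OF \<rho>(1)])
    have d: "(g has_vector_derivative inv_fourier (\<lambda>x. \<i> * (of_real x * \<rho> x)) \<xi>) (at \<xi>)" for \<xi>
      unfolding \<rho>(2) by (intro inv_fourier_has_derivative smooth_cs_integrable \<rho> x)
    have "(\<lambda>x. \<i> * (of_real x * \<rho> x)) \<in> smooth_cs" by (rule smooth_cs_cmult[OF x])
    then have "inv_fourier (\<lambda>x. \<i> * (of_real x * \<rho> x)) \<in> S" unfolding S_def by blast
    with vderiv_eqI[OF d] show ?thesis using d differentiableI_vector by auto
  qed
  moreover have "inv_fourier \<rho> \<in> S" unfolding S_def using assms by blast
  ultimately have s: "(vderiv ^^ n) (inv_fourier \<rho>) \<in> S" "(vderiv ^^ n) (inv_fourier \<rho>) differentiable (at x)" for n x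
    using smooth_coinduct[of "inv_fourier \<rho>" S] by blast+
  have "bounded (range (\<lambda>x. x ^ k *\<^sub>R (vderiv ^^ n) (inv_fourier \<rho>) x))" for n k
  proof -
    obtain \<rho>' where "\<rho>' \<in> smooth_cs" "(vderiv ^^ n) (inv_fourier \<rho>) = inv_fourier \<rho>'"
      using s(1)[of n] unfolding S_def by blast
    then show ?thesis using inv_fourier_smooth_decay[of \<rho>' k] unfolding bounded_iff by auto
  qed
  with s(2) show ?thesis unfolding schwartz_def by blast
qed

text \<open>A Gaussian factor is inserted and removed in two ways. On the frequency side it
  disappears by dominated convergence; by the multiplication formula it also becomes an average of
  \<rho> over a normal law shrinking to x.\<close>

lemma fourier_inversion:
  assumes \<rho>: "\<rho> \<in> smooth_cs"
  shows "fourier (inv_fourier \<rho>) x = \<rho> x"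
proof -
  define \<psi> where "\<psi> = inv_fourier \<rho>"
  have \<psi>: "integrable lborel \<psi>" unfolding \<psi>_def by (intro schwartz_integrable inv_fourier_schwartz \<rho>)
  have [measurable]: "\<psi> \<in> borel_measurable borel" "\<rho> \<in> borel_measurable borel"
    using \<psi> smooth_cs_measurable[OF \<rho>] by auto
  define d where "d n = 1 / (real n + 1)" for n
  have d: "d n > 0" for n by (simp add: d_def)
  define C where "C = complex_of_real (sqrt (2 * pi))"
  obtain M where M: "\<And>x. norm (\<rho> x) \<le> M" using smooth_cs_bounded[OF \<rho>] by blast
  have 1: "(\<lambda>n. LINT \<xi>|lborel. (cis (- x * \<xi>) * gauss_weight (d n) \<xi>) * \<psi> \<xi>) \<longlonglongrightarrow> (LINT \<xi>|lborel. cis (- (\<xi> * x)) * \<psi> \<xi>)"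
  proof (rule integral_dominated_convergence[where w = "\<lambda>\<xi>. norm (\<psi> \<xi>)"])
    show "AE \<xi> in lborel. (\<lambda>n. (cis (- x * \<xi>) * gauss_weight (d n) \<xi>) * \<psi> \<xi>) \<longlonglongrightarrow> cis (- (\<xi> * x)) * \<psi> \<xi>"
    proof (rule AE_I2)
      fix \<xi>
      have "(\<lambda>n. (cis (- x * \<xi>) * gauss_weight (d n) \<xi>) * \<psi> \<xi>) \<longlonglongrightarrow> (cis (- x * \<xi>) * 1) * \<psi> \<xi>"
        unfolding d_def by (intro tendsto_mult tendsto_const gauss_weight_tendsto)
      then show "(\<lambda>n. (cis (- x * \<xi>) * gauss_weight (d n) \<xi>) * \<psi> \<xi>) \<longlonglongrightarrow> cis (- (\<xi> * x)) * \<psi> \<xi>"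
        by (simp add: mult.commute)
    qed
    show "AE \<xi> in lborel. norm ((cis (- x * \<xi>) * gauss_weight (d n) \<xi>) * \<psi> \<xi>) \<le> norm (\<psi> \<xi>)" for n
      using gauss_weight_norm by (auto simp: norm_mult mult_left_le_one_le)
  qed (use \<psi> in auto)
  have 2: "(LINT \<xi>|lborel. (cis (- x * \<xi>) * gauss_weight (d n) \<xi>) * \<psi> \<xi>) =
      C * (LINT z|lborel. std_normal_density z *\<^sub>R \<rho> (x + d n * z))" for n
  proof -
    have "integrable lborel (\<lambda>\<xi>. cis (- x * \<xi>) * gauss_weight (d n) \<xi>)"
      using integrable_cis_mult[OF gauss_weight_integrable[OF d], of "- x"] by (simp add: mult.commute)
    from fourier_multiplication[OF smooth_cs_integrable[OF \<rho>] this]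
    have "(LINT \<xi>|lborel. (cis (- x * \<xi>) * gauss_weight (d n) \<xi>) * \<psi> \<xi>) =
        (LINT y|lborel. C * (\<rho> y * of_real (gauss_kern (d n) (y - x))))"
      unfolding \<psi>_def inv_fourier_gauss_weight[OF d] C_def by (simp add: mult_ac)
    also have "\<dots> = C * (LINT y|lborel. \<rho> y * of_real (gauss_kern (d n) (y - x)))" by simp
    also have "(LINT y|lborel. \<rho> y * of_real (gauss_kern (d n) (y - x))) =
        \<bar>d n\<bar> *\<^sub>R (LINT z|lborel. \<rho> (x + d n * z) * of_real (gauss_kern (d n) (x + d n * z - x)))"
      using d[of n] by (intro lborel_integral_real_affine) auto
    also have "\<dots> = (LINT z|lborel. std_normal_density z *\<^sub>R \<rho> (x + d n * z))"
      unfolding integral_scaleR_right[symmetric]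
      using d[of n] by (intro Bochner_Integration.integral_cong) (auto simp: gauss_kern_def scaleR_conv_of_real)
    finally show ?thesis .
  qed
  have 3: "(\<lambda>n. LINT z|lborel. std_normal_density z *\<^sub>R \<rho> (x + d n * z)) \<longlonglongrightarrow> (LINT z|lborel. std_normal_density z *\<^sub>R \<rho> x)"
  proof (rule integral_dominated_convergence[where w = "\<lambda>z. std_normal_density z * M"])
    have "isCont \<rho> x" using smooth_cs_continuous[OF \<rho>] by (simp add: continuous_on_eq_continuous_at)
    moreover have "(\<lambda>n. x + d n * z) \<longlonglongrightarrow> x" for z unfolding d_def by real_asymp
    ultimately show "AE z in lborel. (\<lambda>n. std_normal_density z *\<^sub>R \<rho> (x + d n * z)) \<longlonglongrightarrow> std_normal_density z *\<^sub>R \<rho> x"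
      by (intro AE_I2 tendsto_intros isCont_tendsto_compose[of x \<rho>])
    show "AE z in lborel. norm (std_normal_density z *\<^sub>R \<rho> (x + d n * z)) \<le> std_normal_density z * M" for n
      using M by (auto intro!: AE_I2 mult_left_mono)
  qed (use std_normal_integrable in auto)
  have "(LINT \<xi>|lborel. cis (- (\<xi> * x)) * \<psi> \<xi>) = C * (LINT z|lborel. std_normal_density z *\<^sub>R \<rho> x)"
    by (rule LIMSEQ_unique[OF 1[unfolded 2] tendsto_mult[OF tendsto_const 3]])
  also have "\<dots> = C * \<rho> x" using std_normal_integrable std_normal_integral by simp
  finally show ?thesis by (simp add: fourier_def \<psi>_def C_def)
qed

section \<open>Distributions with a Fourier transform\<close>

text \<open>One kernel of width |R| + 1 suffices as a test: it has a positive minimum on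
  [-|R|, |R|].\<close>

lemma locally_integrable_of_tests:
  assumes g [measurable]: "g \<in> borel_measurable borel"
    and int: "\<And>\<eta>. \<eta> \<in> smooth_cs \<Longrightarrow> integrable lborel (\<lambda>x. g x * \<eta> x)"
  shows "integrable lborel (\<lambda>x. indicator {-R..R} x * g x)"
proof -
  define d where "d = \<bar>R\<bar> + 1"
  have d: "d > 0" by (simp add: d_def)
  have "\<exists>x\<in>{-\<bar>R\<bar>..\<bar>R\<bar>}. \<forall>y\<in>{-\<bar>R\<bar>..\<bar>R\<bar>}. kern d x \<le> kern d y"
    by (intro continuous_attains_inf kern_continuous d) auto
  then obtain x0 where x0': "x0 \<in> {-\<bar>R\<bar>..\<bar>R\<bar>}" "\<And>y. y \<in> {-\<bar>R\<bar>..\<bar>R\<bar>} \<Longrightarrow> kern d x0 \<le> kern d y"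
    by blast
  have x0: "\<bar>x0\<bar> \<le> \<bar>R\<bar>" "\<And>y. \<bar>y\<bar> \<le> \<bar>R\<bar> \<Longrightarrow> kern d x0 \<le> kern d y"
    using x0' by (force simp: abs_le_iff)+
  have "\<bar>x0 / d\<bar> < 1" using x0(1) d by (simp add: d_def)
  then have pos: "kern d x0 > 0"
    using bump_mass_pos d by (simp add: kern_def bump_eq bump_term_def)
  have "(\<lambda>x. complex_of_real (kern d (x - 0))) \<in> smooth_cs" by (rule kern_smooth_cs[OF d])
  from int[OF this] have "integrable lborel (\<lambda>x. norm (g x * complex_of_real (kern d x)) / kern d x0)" by simp
  then show ?thesis
  proof (rule Bochner_Integration.integrable_bound)
    show "AE x in lborel. norm (indicator {-R..R} x * g x) \<le> norm (norm (g x * complex_of_real (kern d x)) / kern d x0)"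
    proof (rule AE_I2)
      fix x
      show "norm (indicator {-R..R} x * g x) \<le> norm (norm (g x * complex_of_real (kern d x)) / kern d x0)"
      proof (cases "x \<in> {-R..R}")
        case True
        then have "kern d x0 \<le> kern d x" by (intro x0(2)) auto
        then have "norm (g x) * kern d x0 \<le> norm (g x) * kern d x" by (intro mult_left_mono) auto
        then show ?thesis using True pos kern_nonneg[OF d, of x] by (simp add: norm_mult field_simps)
      qed simp
    qed
  qed measurable
qed

lemma has_fourier_integrable:
  assumes "has_fourier T g" "\<phi> \<in> schwartz"
  shows "integrable lborel (\<lambda>\<xi>. g \<xi> * \<phi> \<xi>)" "T (fourier \<phi>) = (LINT \<xi>|lborel. g \<xi> * \<phi> \<xi>)"
  using assms unfolding has_fourier_def by blast+

lemma has_fourier_measurable: "has_fourier T g \<Longrightarrow> g \<in> borel_measurable borel"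
  unfolding has_fourier_def by simp

text \<open>This makes the arbitrary choice in \<open>dist_fourier\<close> irrelevant up to null
  sets.\<close>

lemma has_fourier_unique:
  assumes "has_fourier T g1" "has_fourier T g2"
  shows "AE \<xi> in lborel. g1 \<xi> = g2 \<xi>"
proof -
  note [measurable] = has_fourier_measurable[OF assms(1)] has_fourier_measurable[OF assms(2)]
  have int: "integrable lborel (\<lambda>\<xi>. (g1 \<xi> - g2 \<xi>) * \<eta> \<xi>)" and zero: "(LINT \<xi>|lborel. (g1 \<xi> - g2 \<xi>) * \<eta> \<xi>) = 0"
    if "\<eta> \<in> smooth_cs" for \<eta>
  proof -
    have "\<eta> \<in> schwartz" using smooth_cs_subset_schwartz that by blast
    note 1 = has_fourier_integrable[OF assms(1) this] and 2 = has_fourier_integrable[OF assms(2) this]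
    show "integrable lborel (\<lambda>\<xi>. (g1 \<xi> - g2 \<xi>) * \<eta> \<xi>)" using 1 2 by (simp add: left_diff_distrib)
    show "(LINT \<xi>|lborel. (g1 \<xi> - g2 \<xi>) * \<eta> \<xi>) = 0" using 1 2 by (simp add: left_diff_distrib)
  qed
  have "AE \<xi> in lborel. g1 \<xi> - g2 \<xi> = 0"
    by (rule AE_zero_of_test_integrals[OF locally_integrable_of_tests zero]) (use int in auto)
  then show ?thesis by eventually_elim simp
qed

text \<open>\<open>has_fourier\<close> prescribes T on Fourier transforms only; inversion exhibits a
  test function as the transform of a Schwartz function.\<close>

lemma has_fourier_test:
  assumes T: "has_fourier T g" and \<rho>: "\<rho> \<in> smooth_cs"
  shows "integrable lborel (\<lambda>\<xi>. g \<xi> * inv_fourier \<rho> \<xi>)"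
    "T \<rho> = (LINT \<xi>|lborel. g \<xi> * inv_fourier \<rho> \<xi>)"
proof -
  have "fourier (inv_fourier \<rho>) = \<rho>" using fourier_inversion[OF \<rho>] by auto
  then show "integrable lborel (\<lambda>\<xi>. g \<xi> * inv_fourier \<rho> \<xi>)" "T \<rho> = (LINT \<xi>|lborel. g \<xi> * inv_fourier \<rho> \<xi>)"
    using has_fourier_integrable[OF T inv_fourier_schwartz[OF \<rho>]] by simp_all
qed

lemma schwartz_cmult:
  assumes f: "f \<in> schwartz"
  shows "(\<lambda>x. c * f x) \<in> schwartz"
proof -
  have d: "((\<lambda>x. c * (vderiv ^^ n) f x) has_vector_derivative c * (vderiv ^^ Suc n) f x) (at x)" for n x
    by (intro has_vector_derivative_mult_right schwartz_has_vderiv f)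
  have eq: "(vderiv ^^ n) (\<lambda>x. c * f x) = (\<lambda>x. c * (vderiv ^^ n) f x)" for n
  proof (induction n)
    case (Suc n)
    show ?case unfolding funpow.simps(2) o_apply Suc using vderiv_eqI[OF d, of n] by simp
  qed simp
  have "bounded (range (\<lambda>x. x ^ k *\<^sub>R (vderiv ^^ n) (\<lambda>x. c * f x) x))" for n k
  proof -
    obtain M where M: "\<And>x. norm (x ^ k *\<^sub>R (vderiv ^^ n) f x) \<le> M" using schwartz_bound[OF f] by blast
    have "norm (x ^ k *\<^sub>R (vderiv ^^ n) (\<lambda>x. c * f x) x) \<le> norm c * M" for x
      using mult_left_mono[OF M[of x] norm_ge_zero[of c]] unfolding eq by (simp add: norm_mult mult_ac)
    then show ?thesis unfolding bounded_iff by auto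
  qed
  moreover have "(vderiv ^^ n) (\<lambda>x. c * f x) differentiable (at x)" for n x
    unfolding eq using d by (rule differentiableI_vector)
  ultimately show ?thesis unfolding schwartz_def by blast
qed

text \<open>The derivative of \<open>fourier \<phi>\<close> is the transform of - i x \<phi>;
  together with the sign in \<open>dist_deriv\<close> the factor reappears as i \<xi> on g.\<close>

lemma has_fourier_deriv:
  assumes T: "has_fourier T g"
  shows "has_fourier (dist_deriv T) (\<lambda>\<xi>. \<i> * of_real \<xi> * g \<xi>)"
  unfolding has_fourier_def
proof (intro conjI ballI)
  note [measurable] = has_fourier_measurable[OF T]
  show "(\<lambda>\<xi>. \<i> * of_real \<xi> * g \<xi>) \<in> borel_measurable lborel" by measurable
  fix \<phi> assume \<phi>: "\<phi> \<in> schwartz"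
  have x\<phi>: "(\<lambda>x. of_real x * \<phi> x) \<in> schwartz" by (rule schwartz_times_x[OF \<phi>])
  note i = has_fourier_integrable[OF T x\<phi>]
  have e: "(\<lambda>\<xi>. \<i> * of_real \<xi> * g \<xi> * \<phi> \<xi>) = (\<lambda>\<xi>. \<i> * (g \<xi> * (of_real \<xi> * \<phi> \<xi>)))" by (simp add: mult_ac)
  show "integrable lborel (\<lambda>\<xi>. \<i> * of_real \<xi> * g \<xi> * \<phi> \<xi>)" unfolding e using i(1) by simp
  have vd: "vderiv (fourier \<phi>) = (\<lambda>\<xi>. - \<i> * fourier (\<lambda>x. of_real x * \<phi> x) \<xi>)"
  proof (rule vderiv_eqI)
    fix \<xi>
    have 1: "((\<lambda>\<xi>. - \<xi>) has_vector_derivative (-1)) (at \<xi>)" by (auto intro!: derivative_eq_intros)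
    have "((inv_fourier \<phi> \<circ> (\<lambda>\<xi>. - \<xi>)) has_vector_derivative (-1) *\<^sub>R inv_fourier (\<lambda>x. \<i> * (of_real x * \<phi> x)) (- \<xi>)) (at \<xi>)"
      by (rule vector_diff_chain_at[OF 1 inv_fourier_has_derivative]) (intro schwartz_integrable \<phi> x\<phi>)+
    then show "(fourier \<phi> has_vector_derivative - \<i> * fourier (\<lambda>x. of_real x * \<phi> x) \<xi>) (at \<xi>)"
      unfolding inv_fourier_cmult o_def fourier_eq_inv_fourier[abs_def] by simp
  qed
  have sc: "(\<lambda>\<xi>. - \<i> * fourier (\<lambda>x. of_real x * \<phi> x) \<xi>) = fourier (\<lambda>x. - \<i> * (of_real x * \<phi> x))"
    by (rule ext) (simp only: fourier_eq_inv_fourier inv_fourier_cmult)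
  have "dist_deriv T (fourier \<phi>) = - T (fourier (\<lambda>x. - \<i> * (of_real x * \<phi> x)))"
    unfolding dist_deriv_def vd sc ..
  also have "T (fourier (\<lambda>x. - \<i> * (of_real x * \<phi> x))) = (LINT \<xi>|lborel. g \<xi> * (- \<i> * (of_real \<xi> * \<phi> \<xi>)))"
  proof (rule has_fourier_integrable(2)[OF T])
    show "(\<lambda>x. - \<i> * (of_real x * \<phi> x)) \<in> schwartz"
      by (rule schwartz_cmult[OF x\<phi>])
  qed
  also have "(LINT \<xi>|lborel. g \<xi> * (- \<i> * (of_real \<xi> * \<phi> \<xi>))) = (LINT \<xi>|lborel. - (\<i> * of_real \<xi> * g \<xi> * \<phi> \<xi>))"
    by (intro Bochner_Integration.integral_cong) (auto simp: mult_ac)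
  finally show "dist_deriv T (fourier \<phi>) = (LINT \<xi>|lborel. \<i> * of_real \<xi> * g \<xi> * \<phi> \<xi>)" by simp
qed

lemma has_fourier_diff:
  assumes S: "has_fourier S f" and T: "has_fourier T g"
  shows "has_fourier (dist_diff S T) (\<lambda>\<xi>. f \<xi> - g \<xi>)"
  unfolding has_fourier_def
proof (intro conjI ballI)
  note [measurable] = has_fourier_measurable[OF S] has_fourier_measurable[OF T]
  show "(\<lambda>\<xi>. f \<xi> - g \<xi>) \<in> borel_measurable lborel" by measurable
  fix \<phi> assume \<phi>: "\<phi> \<in> schwartz"
  note i = has_fourier_integrable[OF S \<phi>] has_fourier_integrable[OF T \<phi>]
  show "integrable lborel (\<lambda>\<xi>. (f \<xi> - g \<xi>) * \<phi> \<xi>)" using i by (simp add: left_diff_distrib)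
  show "dist_diff S T (fourier \<phi>) = (LINT \<xi>|lborel. (f \<xi> - g \<xi>) * \<phi> \<xi>)"
    using i by (simp add: left_diff_distrib dist_diff_def)
qed

lemma has_fourier_dist_fourier: "has_fourier T g \<Longrightarrow> has_fourier T (dist_fourier T)"
  unfolding dist_fourier_def by (rule someI[of "has_fourier T"])

lemma dist_fourier_AE: "has_fourier T g \<Longrightarrow> AE \<xi> in lborel. dist_fourier T \<xi> = g \<xi>"
  by (rule has_fourier_unique[OF has_fourier_dist_fourier])

lemma sobolev_integrable:
  assumes "sobolev \<sigma> T" "has_fourier T g"
  shows "integrable lborel (\<lambda>\<xi>. (1 + \<xi>\<^sup>2) powr \<sigma> * (cmod (g \<xi>))\<^sup>2)"
    "(sobolev_norm \<sigma> T)\<^sup>2 = (LINT \<xi>|lborel. (1 + \<xi>\<^sup>2) powr \<sigma> * (cmod (g \<xi>))\<^sup>2)"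
proof -
  obtain g' where g': "has_fourier T g'" "integrable lborel (\<lambda>\<xi>. (1 + \<xi>\<^sup>2) powr \<sigma> * (cmod (g' \<xi>))\<^sup>2)"
    using assms(1) unfolding sobolev_def by blast
  note [measurable] = has_fourier_measurable[OF assms(2)] has_fourier_measurable[OF g'(1)]
    has_fourier_measurable[OF has_fourier_dist_fourier[OF assms(2)]]
  have "AE \<xi> in lborel. (1 + \<xi>\<^sup>2) powr \<sigma> * (cmod (g' \<xi>))\<^sup>2 = (1 + \<xi>\<^sup>2) powr \<sigma> * (cmod (g \<xi>))\<^sup>2"
    using has_fourier_unique[OF g'(1) assms(2)] by eventually_elim simp
  then show i: "integrable lborel (\<lambda>\<xi>. (1 + \<xi>\<^sup>2) powr \<sigma> * (cmod (g \<xi>))\<^sup>2)"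
    using g'(2) by (subst (asm) integrable_cong_AE) auto
  have "(LINT \<xi>|lborel. (1 + \<xi>\<^sup>2) powr \<sigma> * (cmod (dist_fourier T \<xi>))\<^sup>2) = (LINT \<xi>|lborel. (1 + \<xi>\<^sup>2) powr \<sigma> * (cmod (g \<xi>))\<^sup>2)"
    using dist_fourier_AE[OF assms(2)] by (intro integral_cong_AE) auto
  then show "(sobolev_norm \<sigma> T)\<^sup>2 = (LINT \<xi>|lborel. (1 + \<xi>\<^sup>2) powr \<sigma> * (cmod (g \<xi>))\<^sup>2)"
    unfolding sobolev_norm_def by (simp add: integral_nonneg_AE)
qed

lemma square_integrable_locally:
  assumes "square_integrable f"
  shows "integrable lborel (\<lambda>x. indicator {-R..R} x * complex_of_real (f x))"
proof -
  have [measurable]: "f \<in> borel_measurable borel" and i: "integrable lborel (\<lambda>x. (f x)\<^sup>2)"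
    using assms unfolding square_integrable_def by auto
  have "integrable lborel (\<lambda>x. indicator {-R..R} x + (f x)\<^sup>2 :: real)"
    by (intro Bochner_Integration.integrable_add i integrable_real_indicator) (auto simp: emeasure_lborel_Icc_eq)
  then show ?thesis
  proof (rule Bochner_Integration.integrable_bound)
    show "AE x in lborel. norm (indicator {-R..R} x * complex_of_real (f x)) \<le> norm (indicator {-R..R} x + (f x)\<^sup>2)"
    proof (rule AE_I2)
      fix x
      have "\<bar>f x\<bar> \<le> 1 + (f x)\<^sup>2" using sum_squares_bound[of "\<bar>f x\<bar>" 1] by (simp add: power2_eq_square)
      then show "norm (indicator {-R..R} x * complex_of_real (f x)) \<le> norm (indicator {-R..R} x + (f x)\<^sup>2)"
        by (cases "x \<in> {-R..R}") auto
    qed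
  qed measurable
qed

text \<open>As g is integrable, the multiplication formula moves the transform from the test
  function to g, and the fundamental lemma compares the two functions. This supplies the continuous
  representatives of u_x and u_t.\<close>

lemma AE_eq_inv_fourier:
  assumes f: "square_integrable f" and g: "integrable lborel g"
    and eq: "\<And>\<rho>. \<rho> \<in> smooth_cs \<Longrightarrow> reg_dist f \<rho> = (LINT \<xi>|lborel. g \<xi> * inv_fourier \<rho> \<xi>)"
  shows "AE x in lborel. complex_of_real (f x) = inv_fourier g x"
proof -
  note loc = square_integrable_locally[OF f]
  have [measurable]: "f \<in> borel_measurable borel" "g \<in> borel_measurable borel"
    using f g unfolding square_integrable_def by auto
  have "AE x in lborel. complex_of_real (f x) - inv_fourier g x = 0"
  proof (rule AE_zero_of_test_integrals)
    have ig: "integrable lborel (\<lambda>x. indicator {-R..R} x *\<^sub>R inv_fourier g x)" for R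
      by (intro borel_integrable_compact continuous_on_subset[OF inv_fourier_continuous[OF g]]) auto
    show "integrable lborel (\<lambda>x. indicator {-R..R} x * (complex_of_real (f x) - inv_fourier g x))" for R
    proof -
      have "(\<lambda>x. indicator {-R..R} x * (complex_of_real (f x) - inv_fourier g x)) =
          (\<lambda>x. indicator {-R..R} x * complex_of_real (f x) - indicator {-R..R} x *\<^sub>R inv_fourier g x)"
        by (auto simp: indicator_def fun_eq_iff)
      then show ?thesis using Bochner_Integration.integrable_diff[OF loc[of R] ig[of R]] by simp
    qed
    fix \<eta> assume \<eta>: "\<eta> \<in> smooth_cs"
    have [measurable]: "\<eta> \<in> borel_measurable borel" by (rule smooth_cs_measurable[OF \<eta>])
    obtain R where R: "\<And>x. R < \<bar>x\<bar> \<Longrightarrow> \<eta> x = 0" using smooth_cs_support[OF \<eta>] by blast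
    obtain M where M: "\<And>x. norm (\<eta> x) \<le> M" using smooth_cs_bounded[OF \<eta>] by blast
    have i1: "integrable lborel (\<lambda>x. complex_of_real (f x) * \<eta> x)"
    proof (rule Bochner_Integration.integrable_bound)
      show "integrable lborel (\<lambda>x. M * norm (indicator {-R..R} x * complex_of_real (f x)))"
        using loc[of R] by (intro integrable_mult_right integrable_norm)
      show "AE x in lborel. norm (complex_of_real (f x) * \<eta> x) \<le> norm (M * norm (indicator {-R..R} x * complex_of_real (f x)))"
      proof (rule AE_I2)
        fix x
        show "norm (complex_of_real (f x) * \<eta> x) \<le> norm (M * norm (indicator {-R..R} x * complex_of_real (f x)))"
        proof (cases "R < \<bar>x\<bar>")
          case False
          then have "x \<in> {-R..R}" by auto
          moreover have "\<bar>f x\<bar> * norm (\<eta> x) \<le> \<bar>f x\<bar> * \<bar>M\<bar>"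
            using M[of x] by (intro mult_left_mono) auto
          ultimately show ?thesis by (simp add: norm_mult abs_mult mult.commute)
        qed (simp add: R)
      qed
    qed measurable
    have i2: "integrable lborel (\<lambda>x. inv_fourier g x * \<eta> x)"
      by (rule integrable_compact_support[where R = R])
        (intro continuous_intros inv_fourier_continuous g smooth_cs_continuous \<eta>, simp add: R)
    have "(LINT x|lborel. complex_of_real (f x) * \<eta> x) = (LINT \<xi>|lborel. g \<xi> * inv_fourier \<eta> \<xi>)"
      using eq[OF \<eta>] by (simp add: reg_dist_def)
    also have "\<dots> = (LINT x|lborel. \<eta> x * inv_fourier g x)"
      by (rule fourier_multiplication[OF smooth_cs_integrable[OF \<eta>] g])
    finally show "(LINT x|lborel. (complex_of_real (f x) - inv_fourier g x) * \<eta> x) = 0"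
    proof -
      assume e: "(LINT x|lborel. complex_of_real (f x) * \<eta> x) = (LINT x|lborel. \<eta> x * inv_fourier g x)"
      have "(LINT x|lborel. (complex_of_real (f x) - inv_fourier g x) * \<eta> x) =
          (LINT x|lborel. complex_of_real (f x) * \<eta> x) - (LINT x|lborel. inv_fourier g x * \<eta> x)"
        unfolding left_diff_distrib by (rule Bochner_Integration.integral_diff[OF i1 i2])
      then show ?thesis unfolding e by (simp add: mult.commute)
    qed
  qed
  then show ?thesis by eventually_elim simp
qed

section \<open>Fractional regularity\<close>

text \<open>Squared weighted norms and moduli take values in \<open>ennreal\<close>, so that an
  upper bound proves finiteness at the same time.\<close>

definition wsq :: "real \<Rightarrow> (real \<Rightarrow> complex) \<Rightarrow> ennreal" where
  "wsq \<sigma> g = (\<integral>\<^sup>+\<xi>. ennreal ((1 + \<xi>\<^sup>2) powr \<sigma> * (cmod (g \<xi>))\<^sup>2) \<partial>lborel)"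

definition modulus_sq :: "(real \<Rightarrow> 'b::real_normed_vector) \<Rightarrow> real \<Rightarrow> ennreal" where
  "modulus_sq f \<tau> = (\<integral>\<^sup>+x. ennreal ((norm (f (x + \<tau>) - f x))\<^sup>2) \<partial>lborel)"

lemma cmod_cis_diff_one: "(cmod (cis \<theta> - 1))\<^sup>2 = 2 - 2 * cos \<theta>"
proof -
  have "(cmod (cis \<theta> - 1))\<^sup>2 = (cos \<theta> - 1)\<^sup>2 + (sin \<theta>)\<^sup>2" by (simp add: cmod_power2)
  also have "\<dots> = ((cos \<theta>)\<^sup>2 + (sin \<theta>)\<^sup>2) + 1 - 2 * cos \<theta>" by (simp add: power2_eq_square algebra_simps)
  finally show ?thesis by simp
qed

lemma inv_fourier_shift:
  assumes "integrable lborel h"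
  shows "inv_fourier (\<lambda>x. h (x + \<tau>)) \<xi> = cis (- (\<tau> * \<xi>)) * inv_fourier h \<xi>"
proof -
  have "(LINT x|lborel. cis (x * \<xi>) * h x) = \<bar>1\<bar> *\<^sub>R (LINT x|lborel. cis ((\<tau> + 1 * x) * \<xi>) * h (\<tau> + 1 * x))"
    by (rule lborel_integral_real_affine) simp
  also have "\<dots> = (LINT x|lborel. cis (\<tau> * \<xi>) * (cis (x * \<xi>) * h (x + \<tau>)))"
    by (rule trans[OF _ Bochner_Integration.integral_cong[OF refl]], simp)
      (simp add: cis_mult distrib_right add.commute flip: mult.assoc)
  also have "\<dots> = cis (\<tau> * \<xi>) * (LINT x|lborel. cis (x * \<xi>) * h (x + \<tau>))" by simp
  finally have "cis (- (\<tau> * \<xi>)) * (LINT x|lborel. cis (x * \<xi>) * h x) =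
      (cis (- (\<tau> * \<xi>)) * cis (\<tau> * \<xi>)) * (LINT x|lborel. cis (x * \<xi>) * h (x + \<tau>))"
    by (simp add: mult.assoc)
  then show ?thesis by (simp add: inv_fourier_def cis_mult)
qed

text \<open>Translation by \<tau> becomes multiplication by a character; this is Bessel's inequality
  for the difference of h and its translate.\<close>

lemma inv_fourier_modulus:
  assumes h: "integrable lborel h"
  shows "(\<integral>\<^sup>+\<xi>. ennreal ((cmod (cis (- (\<tau> * \<xi>)) - 1))\<^sup>2 * (cmod (inv_fourier h \<xi>))\<^sup>2) \<partial>lborel) \<le> modulus_sq h \<tau>"
proof -
  have hs: "integrable lborel (\<lambda>x. h (x + \<tau>))"
    using lborel_integrable_real_affine[OF h, of 1 \<tau>] by (simp add: add.commute)
  have "(\<integral>\<^sup>+\<xi>. ennreal ((cmod (inv_fourier (\<lambda>x. h (x + \<tau>) - h x) \<xi>))\<^sup>2) \<partial>lborel) \<le> modulus_sq h \<tau>"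
    unfolding modulus_sq_def by (rule bessel) (use h hs in auto)
  also have "(\<lambda>\<xi>. inv_fourier (\<lambda>x. h (x + \<tau>) - h x) \<xi>) = (\<lambda>\<xi>. (cis (- (\<tau> * \<xi>)) - 1) * inv_fourier h \<xi>)"
    by (rule ext) (simp add: inv_fourier_diff[OF hs h] inv_fourier_shift[OF h] left_diff_distrib)
  finally show ?thesis by (simp add: norm_mult power_mult_distrib)
qed

text \<open>Here r is min s 1. The bound r > 1/2 gives the embedding of H^r into bounded functions
  and makes a modulus of order r stronger than H^(1-r); r <= 1 lets Lipschitz functions of compact
  support qualify.\<close>

locale exponent =
  fixes r :: real
  assumes r: "1 / 2 < r" "r \<le> 1"
begin

text \<open>The first 2 pays for |\<xi>| <= 1. In the rest, 2 - 2 cos (1/2) is the least value of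
  |cis \<theta> - 1|^2 for 1/2 <= \<theta> <= 1, and a geometric series of ratio 4^(1-2r) is summed
  over the dyadic scales.\<close>

definition besov_const :: real where
  "besov_const = 2 + 2 / (2 - 2 * cos (1 / 2)) * (1 / (1 - 4 powr (1 - 2 * r)))"

lemma cos_half_less: "cos (1 / 2 :: real) < 1"
  using cos_monotone_0_pi[of 0 "1/2 :: real"] pi_gt3 by simp

lemma geom_less: "4 powr (1 - 2 * r) < 1"
  using r powr_less_mono[of "1 - 2 * r" 0 4] by simp

lemma besov_const_pos: "besov_const > 0"
  unfolding besov_const_def using cos_half_less geom_less by (intro add_pos_nonneg) auto

text \<open>For |\<xi>| > 1 take the least k with |\<xi>| <= 2^k. Then |\<xi>| / 2^k lies in (1/2,
  1], where the character stays away from 1, and this one term of the series already dominates the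
  weight.\<close>

lemma weight_le_dyadic:
  fixes \<xi> :: real
  shows "ennreal ((1 + \<xi>\<^sup>2) powr (1 - r)) \<le> 2 + ennreal (2 / (2 - 2 * cos (1 / 2))) *
    (\<Sum>k. ennreal ((4 powr (1 - r)) ^ k * (cmod (cis (- ((1/2) ^ k * \<xi>)) - 1))\<^sup>2))"
proof (cases "\<bar>\<xi>\<bar> \<le> 1")
  case True
  then have "\<xi>\<^sup>2 \<le> 1" by (simp add: abs_square_le_1)
  then have "(1 + \<xi>\<^sup>2) powr (1 - r) \<le> 2 powr 1"
    using r by (intro order_trans[OF powr_mono[of "1 - r" 1]] powr_mono2) auto
  then have "ennreal ((1 + \<xi>\<^sup>2) powr (1 - r)) \<le> 2" by (simp add: ennreal_leI flip: ennreal_numeral)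
  then show ?thesis by (rule order_trans) simp
next
  case False
  define P where "P k \<longleftrightarrow> \<bar>\<xi>\<bar> \<le> 2 ^ k" for k :: nat
  obtain k0 where "P k0" using real_arch_pow[of 2 "\<bar>\<xi>\<bar>"] by (auto simp: P_def intro: less_imp_le)
  define k where "k = (LEAST k. P k)"
  have k: "P k" unfolding k_def by (rule LeastI[of P, OF \<open>P k0\<close>])
  have "k \<noteq> 0" using k False by (auto simp: P_def intro: ccontr)
  then have "\<not> P (k - 1)" using not_less_Least[of "k - 1" P] unfolding k_def by simp
  then have "2 ^ (k - 1) < \<bar>\<xi>\<bar>" by (simp add: P_def)
  then have lower: "2 ^ k < 2 * \<bar>\<xi>\<bar>" using \<open>k \<noteq> 0\<close> by (cases k) auto
  define \<theta> where "\<theta> = (1/2) ^ k * \<bar>\<xi>\<bar>"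
  have \<theta>: "1 / 2 < \<theta>" "\<theta> \<le> 1"
    using lower k by (auto simp: \<theta>_def P_def power_divide field_simps)
  have cos: "cos ((1/2) ^ k * \<xi>) = cos \<theta>" by (cases "\<xi> \<ge> 0") (auto simp: \<theta>_def)
  have "cos \<theta> \<le> cos (1 / 2)" using \<theta> pi_gt3 by (intro cos_monotone_0_pi_le) auto
  then have c1: "2 - 2 * cos (1 / 2) \<le> (cmod (cis (- ((1/2) ^ k * \<xi>)) - 1))\<^sup>2"
    unfolding cmod_cis_diff_one cos_minus cos by simp
  have "\<xi>\<^sup>2 \<le> (2 ^ k)\<^sup>2" using k unfolding P_def by (metis abs_ge_zero power2_abs power_mono)
  then have x4: "\<xi>\<^sup>2 \<le> 4 ^ k" by (simp add: power2_eq_square flip: power_mult_distrib)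
  have "1 \<le> \<xi>\<^sup>2" using power_mono[of 1 "\<bar>\<xi>\<bar>" 2] False by simp
  then have "(1 + \<xi>\<^sup>2) powr (1 - r) \<le> (2 * 4 ^ k) powr (1 - r)" using x4 r by (intro powr_mono2) auto
  also have "\<dots> = 2 powr (1 - r) * (4 powr (1 - r)) ^ k"
    by (simp add: powr_mult powr_powr mult.commute flip: powr_realpow)
  also have "\<dots> \<le> 2 * (4 powr (1 - r)) ^ k"
    using r powr_mono[of "1 - r" 1 2] by (intro mult_right_mono) auto
  also have "\<dots> = 2 / (2 - 2 * cos (1 / 2)) * ((4 powr (1 - r)) ^ k * (2 - 2 * cos (1 / 2)))"
    using cos_half_less by simp
  also have "\<dots> \<le> 2 / (2 - 2 * cos (1 / 2)) * ((4 powr (1 - r)) ^ k * (cmod (cis (- ((1/2) ^ k * \<xi>)) - 1))\<^sup>2)"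
    using c1 cos_half_less by (intro mult_left_mono) auto
  finally have "ennreal ((1 + \<xi>\<^sup>2) powr (1 - r)) \<le> ennreal (2 / (2 - 2 * cos (1 / 2))) *
      ennreal ((4 powr (1 - r)) ^ k * (cmod (cis (- ((1/2) ^ k * \<xi>)) - 1))\<^sup>2)"
    using cos_half_less by (subst ennreal_mult[symmetric]) (auto intro!: ennreal_leI)
  also have "\<dots> \<le> ennreal (2 / (2 - 2 * cos (1 / 2))) *
      (\<Sum>k. ennreal ((4 powr (1 - r)) ^ k * (cmod (cis (- ((1/2) ^ k * \<xi>)) - 1))\<^sup>2))"
    by (intro mult_left_mono order_trans[OF _ sum_le_suminf[where I = "{k}"]]) auto
  finally show ?thesis by (rule order_trans) simp
qed

text \<open>Integrated against the squared transform, the dyadic term of index k is at most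
  4^(k(1-r)) times the squared modulus at 2^(-k), that is M 4^(k(1-2r)). Summability over k is
  exactly r > 1/2.\<close>

lemma wsq_inv_fourier_le:
  assumes h: "integrable lborel h" and M: "M \<ge> 0"
    and sq: "(\<integral>\<^sup>+x. ennreal ((norm (h x))\<^sup>2) \<partial>lborel) \<le> ennreal M"
    and mod: "\<And>\<tau>. 0 < \<tau> \<Longrightarrow> \<tau> \<le> 1 \<Longrightarrow> modulus_sq h \<tau> \<le> ennreal (M * \<tau> powr (2 * r))"
  shows "wsq (1 - r) (inv_fourier h) \<le> ennreal (besov_const * M)"
proof -
  have [measurable]: "h \<in> borel_measurable borel" using h by auto
  define H where "H \<xi> = ennreal ((cmod (inv_fourier h \<xi>))\<^sup>2)" for \<xi>
  have [measurable]: "H \<in> borel_measurable borel" unfolding H_def[abs_def] by measurable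
  define c where "c = 2 / (2 - 2 * cos (1 / 2 :: real))"
  have c: "c \<ge> 0" using cos_half_less by (simp add: c_def)
  define D where "D k \<xi> = ennreal ((4 powr (1 - r)) ^ k * (cmod (cis (- ((1/2) ^ k * \<xi>)) - 1))\<^sup>2)" for k :: nat and \<xi>
  have [measurable]: "D k \<in> borel_measurable borel" for k unfolding D_def[abs_def] by measurable
  define q where "q = 4 powr (1 - 2 * r)"
  have q: "0 \<le> q" "q < 1" using geom_less by (auto simp: q_def)
  have term_le: "(\<integral>\<^sup>+\<xi>. D k \<xi> * H \<xi> \<partial>lborel) \<le> ennreal (M * q ^ k)" for k
  proof -
    have "(\<integral>\<^sup>+\<xi>. D k \<xi> * H \<xi> \<partial>lborel) = (\<integral>\<^sup>+\<xi>. ennreal ((4 powr (1 - r)) ^ k) *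
        ennreal ((cmod (cis (- ((1/2) ^ k * \<xi>)) - 1))\<^sup>2 * (cmod (inv_fourier h \<xi>))\<^sup>2) \<partial>lborel)"
      by (intro nn_integral_cong) (simp add: D_def H_def ennreal_mult[symmetric] mult.assoc)
    also have "\<dots> = ennreal ((4 powr (1 - r)) ^ k) *
        (\<integral>\<^sup>+\<xi>. ennreal ((cmod (cis (- ((1/2) ^ k * \<xi>)) - 1))\<^sup>2 * (cmod (inv_fourier h \<xi>))\<^sup>2) \<partial>lborel)"
      by (rule nn_integral_cmult) measurable
    also have "\<dots> \<le> ennreal ((4 powr (1 - r)) ^ k) * ennreal (M * ((1/2) ^ k) powr (2 * r))"
      by (intro mult_left_mono order_trans[OF inv_fourier_modulus[OF h] mod]) (auto simp: power_le_one)
    also have "\<dots> = ennreal ((4 powr (1 - r)) ^ k * (M * ((1/2) ^ k) powr (2 * r)))"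
      using M by (simp add: ennreal_mult)
    also have "((1/2) ^ k) powr (2 * r) = (4 powr (- r)) ^ k"
    proof -
      have "((1/2::real) ^ k) powr (2 * r) = ((1/2) powr (2 * r)) ^ k"
        by (simp add: powr_power powr_realpow[symmetric] powr_powr mult.commute del: powr_realpow)
      also have "(1/2::real) powr (2 * r) = 4 powr (- r)"
        by (simp add: powr_divide powr_minus_divide powr_powr[symmetric])
      finally show ?thesis .
    qed
    also have "(4 powr (1 - r)) ^ k * (M * (4 powr (- r)) ^ k) = M * q ^ k"
      by (simp add: q_def power_mult_distrib[symmetric] powr_add[symmetric] mult.left_commute)
    finally show ?thesis .
  qed
  have "wsq (1 - r) (inv_fourier h) = (\<integral>\<^sup>+\<xi>. ennreal ((1 + \<xi>\<^sup>2) powr (1 - r)) * H \<xi> \<partial>lborel)"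
    unfolding wsq_def H_def by (simp add: ennreal_mult)
  also have "\<dots> \<le> (\<integral>\<^sup>+\<xi>. (2 + ennreal c * (\<Sum>k. D k \<xi>)) * H \<xi> \<partial>lborel)"
    unfolding c_def D_def by (intro nn_integral_mono mult_right_mono weight_le_dyadic) auto
  also have "\<dots> = (\<integral>\<^sup>+\<xi>. 2 * H \<xi> + ennreal c * (\<Sum>k. D k \<xi> * H \<xi>) \<partial>lborel)"
    by (simp add: distrib_right mult.assoc ennreal_suminf_multc)
  also have "\<dots> = 2 * (\<integral>\<^sup>+\<xi>. H \<xi> \<partial>lborel) + ennreal c * (\<Sum>k. \<integral>\<^sup>+\<xi>. D k \<xi> * H \<xi> \<partial>lborel)"
  proof -
    have "(\<integral>\<^sup>+\<xi>. (\<Sum>k. D k \<xi> * H \<xi>) \<partial>lborel) = (\<Sum>k. \<integral>\<^sup>+\<xi>. D k \<xi> * H \<xi> \<partial>lborel)"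
      by (rule nn_integral_suminf) measurable
    moreover have "(\<integral>\<^sup>+\<xi>. 2 * H \<xi> + ennreal c * (\<Sum>k. D k \<xi> * H \<xi>) \<partial>lborel) =
        (\<integral>\<^sup>+\<xi>. 2 * H \<xi> \<partial>lborel) + (\<integral>\<^sup>+\<xi>. ennreal c * (\<Sum>k. D k \<xi> * H \<xi>) \<partial>lborel)"
      by (rule nn_integral_add) measurable
    moreover have "(\<integral>\<^sup>+\<xi>. 2 * H \<xi> \<partial>lborel) = 2 * (\<integral>\<^sup>+\<xi>. H \<xi> \<partial>lborel)"
      by (rule nn_integral_cmult) measurable
    moreover have "(\<integral>\<^sup>+\<xi>. ennreal c * (\<Sum>k. D k \<xi> * H \<xi>) \<partial>lborel) = ennreal c * (\<integral>\<^sup>+\<xi>. (\<Sum>k. D k \<xi> * H \<xi>) \<partial>lborel)"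
      by (rule nn_integral_cmult) measurable
    ultimately show ?thesis by simp
  qed
  also have "\<dots> \<le> 2 * ennreal M + ennreal c * (\<Sum>k. ennreal (M * q ^ k))"
  proof (intro add_mono mult_left_mono suminf_le term_le)
    show "(\<integral>\<^sup>+\<xi>. H \<xi> \<partial>lborel) \<le> ennreal M" unfolding H_def by (rule order_trans[OF bessel[OF h] sq])
  qed auto
  also have "(\<Sum>k. ennreal (M * q ^ k)) = ennreal (M * (1 / (1 - q)))"
    using q M by (intro suminf_ennreal_eq sums_mult geometric_sums) auto
  also have "2 * ennreal M + ennreal c * ennreal (M * (1 / (1 - q))) = ennreal (2 * M + c * (M * (1 / (1 - q))))"
  proof -
    have "ennreal (2 * M + c * (M * (1 / (1 - q)))) = ennreal (2 * M) + ennreal (c * (M * (1 / (1 - q))))"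
      using q M c by (intro ennreal_plus) auto
    also have "ennreal (2 * M) = ennreal 2 * ennreal M" using M by (intro ennreal_mult) auto
    also have "ennreal (c * (M * (1 / (1 - q)))) = ennreal c * ennreal (M * (1 / (1 - q)))"
      using q M c by (intro ennreal_mult) auto
    finally show ?thesis by simp
  qed
  also have "2 * M + c * (M * (1 / (1 - q))) = besov_const * M"
    by (simp add: besov_const_def c_def q_def algebra_simps)
  finally show ?thesis .
qed

text \<open>The functions playing the role of multipliers in \<open>H\<^sup>s\<close>: bounded, with an \<open>L\<^sup>2\<close> modulus
  of continuity of order \<open>r\<close> (a Besov-Nikolskii condition).\<close>

definition cls :: "real \<Rightarrow> real \<Rightarrow> (real \<Rightarrow> real) \<Rightarrow> bool" where
  "cls L M f \<longleftrightarrow> continuous_on UNIV f \<and> (\<forall>x. \<bar>f x\<bar> \<le> L) \<and>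
     (\<forall>\<tau>. 0 < \<tau> \<and> \<tau> \<le> 1 \<longrightarrow> modulus_sq f \<tau> \<le> ennreal (M * \<tau> powr (2 * r)))"

text \<open>The constants are hidden but common to the whole family: closure rules need not compute
  them, and they are still uniform when the index tends to a limit.\<close>

definition ucls :: "'i set \<Rightarrow> ('i \<Rightarrow> real \<Rightarrow> real) \<Rightarrow> bool" where
  "ucls I f \<longleftrightarrow> (\<exists>L\<ge>0. \<exists>M\<ge>0. \<forall>i\<in>I. cls L M (f i))"

lemma cls_one: "cls 1 0 (\<lambda>x. 1)"
  by (simp add: cls_def modulus_sq_def)

lemma cls_mono:
  assumes "cls L M f" "L \<le> L'" "M \<le> M'"
  shows "cls L' M' f"
proof -
  have "modulus_sq f \<tau> \<le> ennreal (M' * \<tau> powr (2 * r))" if "0 < \<tau>" "\<tau> \<le> 1" for \<tau>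
  proof -
    have "modulus_sq f \<tau> \<le> ennreal (M * \<tau> powr (2 * r))" using assms(1) that by (simp add: cls_def)
    also have "\<dots> \<le> ennreal (M' * \<tau> powr (2 * r))" using assms(3) by (intro ennreal_leI mult_right_mono) auto
    finally show ?thesis .
  qed
  then show ?thesis using assms(1,2) unfolding cls_def by (auto intro: order_trans)
qed

lemma uclsE:
  assumes "ucls I f"
  obtains L M where "L \<ge> 0" "M \<ge> 0" "\<And>i. i \<in> I \<Longrightarrow> cls L M (f i)"
  using assms unfolding ucls_def by blast

lemma uclsI: "L \<ge> 0 \<Longrightarrow> M \<ge> 0 \<Longrightarrow> (\<And>i. i \<in> I \<Longrightarrow> cls L M (f i)) \<Longrightarrow> ucls I f"
  unfolding ucls_def by blast

lemma ucls_cont: "ucls I f \<Longrightarrow> i \<in> I \<Longrightarrow> continuous_on UNIV (f i)"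
  unfolding ucls_def cls_def by blast

lemma ucls_reindex: "ucls I f \<Longrightarrow> (\<And>j. j \<in> J \<Longrightarrow> g j \<in> I) \<Longrightarrow> ucls J (\<lambda>j. f (g j))"
  unfolding ucls_def by blast

lemma ucls_const: "ucls I (\<lambda>i x. c)"
  by (rule uclsI[of "\<bar>c\<bar>" 0]) (auto simp: cls_def modulus_sq_def)

text \<open>A pointwise Lipschitz bound passes directly to L^2 moduli. The algebraic closure rules
  below are instances with suitable bounds.\<close>

lemma ucls_bilipschitz:
  assumes f: "ucls I f" and g: "ucls I g"
    and cont: "\<And>i. i \<in> I \<Longrightarrow> continuous_on UNIV (h i)"
    and bd: "\<And>i x. i \<in> I \<Longrightarrow> \<bar>h i x\<bar> \<le> B"
    and lip: "\<And>i x y. i \<in> I \<Longrightarrow> \<bar>h i x - h i y\<bar> \<le> K * (\<bar>f i x - f i y\<bar> + \<bar>g i x - g i y\<bar>)"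
  shows "ucls I h"
proof -
  obtain Lf Mf where f': "Lf \<ge> 0" "Mf \<ge> 0" "\<And>i. i \<in> I \<Longrightarrow> cls Lf Mf (f i)" using f by (rule uclsE) auto
  obtain Lg Mg where g': "Lg \<ge> 0" "Mg \<ge> 0" "\<And>i. i \<in> I \<Longrightarrow> cls Lg Mg (g i)" using g by (rule uclsE) auto
  \<comment> \<open>The 2 comes from (a + b)^2 <= 2 (a^2 + b^2).\<close>
  define A where "A = 2 * K\<^sup>2"
  have A: "A \<ge> 0" by (simp add: A_def)
  show ?thesis
  proof (rule uclsI[of "\<bar>B\<bar>" "A * Mf + A * Mg"])
    fix i assume i: "i \<in> I"
    have [measurable]: "f i \<in> borel_measurable borel" "g i \<in> borel_measurable borel"
      using f'(3)[OF i] g'(3)[OF i] by (auto simp: cls_def intro: borel_measurable_continuous_onI)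
    have "modulus_sq (h i) \<tau> \<le> ennreal ((A * Mf + A * Mg) * \<tau> powr (2 * r))" if \<tau>: "0 < \<tau>" "\<tau> \<le> 1" for \<tau>
    proof -
      have pt: "(norm (h i (x + \<tau>) - h i x))\<^sup>2 \<le> A * (norm (f i (x + \<tau>) - f i x))\<^sup>2 + A * (norm (g i (x + \<tau>) - g i x))\<^sup>2" for x
      proof -
        define a b where "a = \<bar>f i (x + \<tau>) - f i x\<bar>" "b = \<bar>g i (x + \<tau>) - g i x\<bar>"
        have "\<bar>h i (x + \<tau>) - h i x\<bar>\<^sup>2 \<le> (K * (a + b))\<^sup>2"
          using lip[OF i, of "x + \<tau>" x] unfolding a_b_def by (intro power_mono) auto
        also have "\<dots> \<le> K\<^sup>2 * (2 * (a\<^sup>2 + b\<^sup>2))"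
          unfolding power_mult_distrib
          using sum_squares_bound[of a b] by (intro mult_left_mono) (auto simp: power2_eq_square algebra_simps)
        finally show ?thesis by (simp add: a_b_def A_def algebra_simps)
      qed
      have "modulus_sq (h i) \<tau> \<le> (\<integral>\<^sup>+x. ennreal A * ennreal ((norm (f i (x + \<tau>) - f i x))\<^sup>2) + ennreal A * ennreal ((norm (g i (x + \<tau>) - g i x))\<^sup>2) \<partial>lborel)"
        unfolding modulus_sq_def
      proof (rule nn_integral_mono)
        fix x show "ennreal ((norm (h i (x + \<tau>) - h i x))\<^sup>2) \<le> ennreal A * ennreal ((norm (f i (x + \<tau>) - f i x))\<^sup>2) + ennreal A * ennreal ((norm (g i (x + \<tau>) - g i x))\<^sup>2)"
          using ennreal_leI[OF pt[of x]] A by (simp add: ennreal_mult ennreal_plus)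
      qed
      also have "\<dots> = ennreal A * modulus_sq (f i) \<tau> + ennreal A * modulus_sq (g i) \<tau>"
        unfolding modulus_sq_def by (simp add: nn_integral_add nn_integral_cmult)
      also have "\<dots> \<le> ennreal A * ennreal (Mf * \<tau> powr (2 * r)) + ennreal A * ennreal (Mg * \<tau> powr (2 * r))"
        using f'(3)[OF i] g'(3)[OF i] \<tau> by (intro add_mono mult_left_mono) (auto simp: cls_def)
      also have "\<dots> = ennreal ((A * Mf + A * Mg) * \<tau> powr (2 * r))"
        using A f'(2) g'(2) by (simp add: ennreal_mult[symmetric] ennreal_plus[symmetric] algebra_simps del: ennreal_plus)
      finally show ?thesis .
    qed
    moreover have "\<bar>h i x\<bar> \<le> \<bar>B\<bar>" for x using bd[OF i, of x] by simp
    ultimately show "cls \<bar>B\<bar> (A * Mf + A * Mg) (h i)" unfolding cls_def using cont[OF i] by blast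
  qed (use A f' g' in auto)
qed

lemma ucls_bounded: "ucls I f \<Longrightarrow> \<exists>L\<ge>0. \<forall>i\<in>I. \<forall>x. \<bar>f i x\<bar> \<le> L"
  unfolding ucls_def cls_def by blast

lemma ucls_add:
  assumes f: "ucls I f" and g: "ucls I g"
  shows "ucls I (\<lambda>i x. f i x + g i x)"
proof -
  obtain Lf where "Lf \<ge> 0" and Lf: "\<And>i x. i \<in> I \<Longrightarrow> \<bar>f i x\<bar> \<le> Lf" using ucls_bounded[OF f] by blast
  obtain Lg where "Lg \<ge> 0" and Lg: "\<And>i x. i \<in> I \<Longrightarrow> \<bar>g i x\<bar> \<le> Lg" using ucls_bounded[OF g] by blast
  show ?thesis
  proof (rule ucls_bilipschitz[OF f g, where B = "Lf + Lg" and K = 1])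
    fix i assume i: "i \<in> I"
    show "continuous_on UNIV (\<lambda>x. f i x + g i x)" using ucls_cont[OF f i] ucls_cont[OF g i] by (intro continuous_intros)
    show "\<bar>f i x + g i x\<bar> \<le> Lf + Lg" for x using Lf[OF i, of x] Lg[OF i, of x] by linarith
    fix x y
    have "f i x + g i x - (f i y + g i y) = (f i x - f i y) + (g i x - g i y)" by simp
    then show "\<bar>f i x + g i x - (f i y + g i y)\<bar> \<le> 1 * (\<bar>f i x - f i y\<bar> + \<bar>g i x - g i y\<bar>)"
      using abs_triangle_ineq[of "f i x - f i y" "g i x - g i y"] by simp
  qed
qed

lemma ucls_mult:
  assumes f: "ucls I f" and g: "ucls I g"
  shows "ucls I (\<lambda>i x. f i x * g i x)"
proof -
  obtain Lf where Lf: "Lf \<ge> 0" "\<And>i x. i \<in> I \<Longrightarrow> \<bar>f i x\<bar> \<le> Lf" using ucls_bounded[OF f] by blast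
  obtain Lg where Lg: "Lg \<ge> 0" "\<And>i x. i \<in> I \<Longrightarrow> \<bar>g i x\<bar> \<le> Lg" using ucls_bounded[OF g] by blast
  show ?thesis
  proof (rule ucls_bilipschitz[OF f g, where B = "Lf * Lg" and K = "Lf + Lg"])
    fix i assume i: "i \<in> I"
    show "continuous_on UNIV (\<lambda>x. f i x * g i x)" using ucls_cont[OF f i] ucls_cont[OF g i] by (intro continuous_intros)
    show "\<bar>f i x * g i x\<bar> \<le> Lf * Lg" for x
      unfolding abs_mult using Lf(2)[OF i] Lg(2)[OF i] Lf(1) by (intro mult_mono) auto
    fix x y
    have "f i x * g i x - f i y * g i y = f i x * (g i x - g i y) + g i y * (f i x - f i y)" by (simp add: algebra_simps)
    also have "\<bar>\<dots>\<bar> \<le> \<bar>f i x\<bar> * \<bar>g i x - g i y\<bar> + \<bar>g i y\<bar> * \<bar>f i x - f i y\<bar>"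
      by (metis abs_mult abs_triangle_ineq)
    also have "\<dots> \<le> (Lf + Lg) * \<bar>g i x - g i y\<bar> + (Lf + Lg) * \<bar>f i x - f i y\<bar>"
      using Lf(2)[OF i, of x] Lg(2)[OF i, of y] Lf(1) Lg(1) by (intro add_mono mult_right_mono) auto
    finally show "\<bar>f i x * g i x - f i y * g i y\<bar> \<le> (Lf + Lg) * (\<bar>f i x - f i y\<bar> + \<bar>g i x - g i y\<bar>)"
      by (simp add: algebra_simps)
  qed
qed

lemma ucls_cmult: "ucls I f \<Longrightarrow> ucls I (\<lambda>i x. c * f i x)"
  by (rule ucls_mult[OF ucls_const])

lemma ucls_diff: "ucls I f \<Longrightarrow> ucls I g \<Longrightarrow> ucls I (\<lambda>i x. f i x - g i x)"
  using ucls_add[OF _ ucls_cmult[of I g "-1"], of f] by simp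

lemma ucls_power: "ucls I f \<Longrightarrow> ucls I (\<lambda>i x. f i x ^ n)"
proof (induction n)
  case 0
  show ?case using ucls_const[of I 1] by simp
next
  case (Suc n)
  show ?case using ucls_mult[OF Suc.prems Suc.IH[OF Suc.prems]] by simp
qed

lemma ucls_inverse:
  assumes f: "ucls I f" and c: "c > 0" "\<And>i x. i \<in> I \<Longrightarrow> c \<le> f i x"
  shows "ucls I (\<lambda>i x. 1 / f i x)"
proof (rule ucls_bilipschitz[OF f f, where B = "1 / c" and K = "1 / c\<^sup>2"])
  fix i assume i: "i \<in> I"
  have pos: "f i x > 0" for x using c(1) c(2)[OF i, of x] by linarith
  show "continuous_on UNIV (\<lambda>x. 1 / f i x)"
    using ucls_cont[OF f i] pos by (intro continuous_intros) (auto simp: less_imp_neq[symmetric] dest: less_imp_neq)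
  show "\<bar>1 / f i x\<bar> \<le> 1 / c" for x using c(1) c(2)[OF i, of x] pos[of x] by (simp add: frac_le)
  fix x y
  have "1 / f i x - 1 / f i y = (f i y - f i x) / (f i x * f i y)" using pos[of x] pos[of y] by (simp add: field_simps)
  also have "\<bar>\<dots>\<bar> = \<bar>f i x - f i y\<bar> / (f i x * f i y)" using pos[of x] pos[of y] by (simp add: abs_mult abs_minus_commute)
  also have "\<dots> \<le> \<bar>f i x - f i y\<bar> / (c * c)"
    using c(1) c(2)[OF i, of x] c(2)[OF i, of y] by (intro divide_left_mono mult_mono mult_pos_pos pos) auto
  also have "\<dots> \<le> 1 / c\<^sup>2 * (\<bar>f i x - f i y\<bar> + \<bar>f i x - f i y\<bar>)"
    using c(1) by (simp add: power2_eq_square field_simps)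
  finally show "\<bar>1 / f i x - 1 / f i y\<bar> \<le> 1 / c\<^sup>2 * (\<bar>f i x - f i y\<bar> + \<bar>f i x - f i y\<bar>)" .
qed

lemma ucls_sqrt:
  assumes f: "ucls I f" and c: "\<And>i x. i \<in> I \<Longrightarrow> 1 / 4 \<le> f i x"
  shows "ucls I (\<lambda>i x. sqrt (f i x))"
proof -
  obtain L where "L \<ge> 0" and L: "\<And>i x. i \<in> I \<Longrightarrow> \<bar>f i x\<bar> \<le> L" using ucls_bounded[OF f] by blast
  show ?thesis
  proof (rule ucls_bilipschitz[OF f f, where B = "sqrt L" and K = 1])
    fix i assume i: "i \<in> I"
    show "continuous_on UNIV (\<lambda>x. sqrt (f i x))" using ucls_cont[OF f i] by (intro continuous_intros)
    show "\<bar>sqrt (f i x)\<bar> \<le> sqrt L" for x using L[OF i, of x] c[OF i, of x] by simp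
    fix x y
    \<comment> \<open>Two roots of at least 1/2 sum to at least 1, so on [1/4, oo) the square root
      is Lipschitz with constant 1.\<close>
    have half: "sqrt (f i z) \<ge> 1 / 2" for z
      using c[OF i, of z] by (intro real_le_rsqrt) (simp add: power2_eq_square)
    have "f i x - f i y = (sqrt (f i x) - sqrt (f i y)) * (sqrt (f i x) + sqrt (f i y))"
      using c[OF i, of x] c[OF i, of y] by (simp add: algebra_simps)
    then have "\<bar>f i x - f i y\<bar> = \<bar>sqrt (f i x) - sqrt (f i y)\<bar> * (sqrt (f i x) + sqrt (f i y))"
      using half[of x] half[of y] by (simp add: abs_mult)
    moreover have "\<bar>sqrt (f i x) - sqrt (f i y)\<bar> * 1 \<le> \<bar>sqrt (f i x) - sqrt (f i y)\<bar> * (sqrt (f i x) + sqrt (f i y))"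
      using half[of x] half[of y] by (intro mult_left_mono) auto
    ultimately have "\<bar>sqrt (f i x) - sqrt (f i y)\<bar> \<le> \<bar>f i x - f i y\<bar>" by simp
    then show "\<bar>sqrt (f i x) - sqrt (f i y)\<bar> \<le> 1 * (\<bar>f i x - f i y\<bar> + \<bar>f i x - f i y\<bar>)"
      by (rule order_trans) simp
  qed
qed

end

section \<open>Lipschitz functions and mollifications as multipliers\<close>

context exponent
begin

text \<open>For \<tau> <= 1 and r <= 1 the square of \<tau> is at most \<tau>^(2r), and the
  difference lives on the support enlarged by 1.\<close>

lemma modulus_lipschitz_support:
  assumes lip: "\<And>x y. \<bar>h x - h y\<bar> \<le> K * \<bar>x - y\<bar>" and K: "K \<ge> 0" and R: "R \<ge> 0"
    and supp: "\<And>x. R < \<bar>x - c\<bar> \<Longrightarrow> h x = 0" and \<tau>: "0 < \<tau>" "\<tau> \<le> 1"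
  shows "modulus_sq (h :: real \<Rightarrow> real) \<tau> \<le> ennreal ((K\<^sup>2 * (2 * R + 2)) * \<tau> powr (2 * r))"
proof -
  have pt: "ennreal ((norm (h (x + \<tau>) - h x))\<^sup>2) \<le> ennreal (K\<^sup>2 * \<tau> powr (2 * r)) * indicator {c - R - 1..c + R + 1} x" for x
  proof (cases "x \<in> {c - R - 1..c + R + 1}")
    case True
    have "\<bar>h (x + \<tau>) - h x\<bar> \<le> K * \<tau>" using lip[of "x + \<tau>" x] \<tau> by simp
    then have "\<bar>h (x + \<tau>) - h x\<bar>\<^sup>2 \<le> (K * \<tau>)\<^sup>2" by (intro power_mono) auto
    also have "\<dots> = K\<^sup>2 * \<tau> powr 2" using \<tau> by (simp add: power_mult_distrib powr_numeral)
    also have "\<dots> \<le> K\<^sup>2 * \<tau> powr (2 * r)" using \<tau> r by (intro mult_left_mono powr_mono') auto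
    finally show ?thesis using True by (simp add: ennreal_leI)
  next
    case False
    then have "R < \<bar>x - c\<bar>" "R < \<bar>x + \<tau> - c\<bar>" using \<tau> R by auto
    then show ?thesis using supp by simp
  qed
  have "modulus_sq h \<tau> \<le> (\<integral>\<^sup>+x. ennreal (K\<^sup>2 * \<tau> powr (2 * r)) * indicator {c - R - 1..c + R + 1} x \<partial>lborel)"
    unfolding modulus_sq_def by (intro nn_integral_mono pt)
  also have "\<dots> = ennreal (K\<^sup>2 * \<tau> powr (2 * r)) * ennreal (2 * R + 2)"
    using R by (subst nn_integral_cmult_indicator) (auto simp: algebra_simps)
  also have "\<dots> = ennreal ((K\<^sup>2 * (2 * R + 2)) * \<tau> powr (2 * r))"
    using R by (subst ennreal_mult[symmetric]) (auto simp: mult_ac)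
  finally show ?thesis .
qed

text \<open>The centre may depend on the index, so that all translates of one kernel form a single
  family.\<close>

lemma ucls_lipschitz_support:
  assumes lip: "\<And>i x y. i \<in> I \<Longrightarrow> \<bar>h i x - h i y\<bar> \<le> K * \<bar>x - y\<bar>" and K: "K \<ge> 0" and R: "R \<ge> 0"
    and supp: "\<And>i x. i \<in> I \<Longrightarrow> R < \<bar>x - c i\<bar> \<Longrightarrow> h i x = 0" and bd: "\<And>i x. i \<in> I \<Longrightarrow> \<bar>h i x\<bar> \<le> B"
  shows "ucls I h"
proof (rule uclsI[of "\<bar>B\<bar>" "K\<^sup>2 * (2 * R + 2)"])
  fix i assume i: "i \<in> I"
  have "continuous_on UNIV (h i)"
  proof (rule continuous_on_sequentiallyI)
    fix u :: "nat \<Rightarrow> real" and a assume "u \<longlonglongrightarrow> a"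
    show "(\<lambda>n. h i (u n)) \<longlonglongrightarrow> h i a"
    proof (rule LIM_zero_cancel, rule Lim_null_comparison)
      show "\<forall>\<^sub>F n in sequentially. norm (h i (u n) - h i a) \<le> K * \<bar>u n - a\<bar>" using lip[OF i] by simp
      show "(\<lambda>n. K * \<bar>u n - a\<bar>) \<longlonglongrightarrow> 0"
        using tendsto_mult[OF tendsto_const tendsto_rabs[OF LIM_zero[OF \<open>u \<longlonglongrightarrow> a\<close>]], of K] by simp
    qed
  qed
  moreover have "\<bar>h i x\<bar> \<le> \<bar>B\<bar>" for x using bd[OF i, of x] by simp
  ultimately show "cls \<bar>B\<bar> (K\<^sup>2 * (2 * R + 2)) (h i)"
    unfolding cls_def
    using modulus_lipschitz_support[where h = "h i" and c = "c i", OF lip[OF i] K R supp[OF i]] by blast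
qed (use R in auto)

lemma DERIV_bounded_lipschitz:
  fixes h :: "real \<Rightarrow> real"
  assumes "\<And>x. (h has_real_derivative h' x) (at x)" "\<And>x. \<bar>h' x\<bar> \<le> K"
  shows "\<bar>h x - h y\<bar> \<le> K * \<bar>x - y\<bar>"
  using field_differentiable_bound[of UNIV h h' K x y] assms by simp

lemma kern_bounds:
  assumes d: "d > 0"
  obtains B where "B > 0" "\<And>x. \<bar>kern d x\<bar> \<le> B" "\<And>x y. \<bar>kern d x - kern d y\<bar> \<le> B * \<bar>x - y\<bar>"
proof -
  obtain B1 where B1: "B1 > 0" "\<And>x. norm (kern d x) \<le> B1"
    by (rule bounded_compact_support[OF kern_continuous[OF d], where R = d]) (use kern_zero[OF d] in auto)
  obtain B2 where B2: "B2 > 0" "\<And>x. norm (dbump x) \<le> B2"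
  proof (rule bounded_compact_support[of dbump 1])
    show "continuous_on UNIV dbump" unfolding dbump_def by (rule bump_term_continuous)
  qed (auto simp: dbump_def bump_term_def)
  have "\<bar>kern d x - kern d y\<bar> \<le> B2 / d\<^sup>2 * \<bar>x - y\<bar>" for x y
    by (rule DERIV_bounded_lipschitz[OF kern_DERIV[OF d]]) (use B2 d in \<open>auto intro!: divide_right_mono\<close>)
  moreover have "B2 / d\<^sup>2 * \<bar>x - y\<bar> \<le> max B1 (B2 / d\<^sup>2) * \<bar>x - y\<bar>" for x y by (intro mult_right_mono) auto
  ultimately have "\<bar>kern d x - kern d y\<bar> \<le> max B1 (B2 / d\<^sup>2) * \<bar>x - y\<bar>" for x y by (meson order_trans)
  moreover have "\<bar>kern d x\<bar> \<le> max B1 (B2 / d\<^sup>2)" for x using B1(2)[of x] by simp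
  ultimately show thesis using B1(1) by (intro that[of "max B1 (B2 / d\<^sup>2)"]) auto
qed

lemma ucls_kern:
  assumes d: "d > 0"
  shows "ucls UNIV (\<lambda>y x. kern d (x - y))"
proof -
  obtain B where B: "B > 0" "\<And>x. \<bar>kern d x\<bar> \<le> B" "\<And>x y. \<bar>kern d x - kern d y\<bar> \<le> B * \<bar>x - y\<bar>"
    by (rule kern_bounds[OF d]) blast
  show ?thesis
  proof (rule ucls_lipschitz_support[where K = B and B = B and R = d and c = "\<lambda>y. y"])
    show "\<bar>kern d (x - i) - kern d (y - i)\<bar> \<le> B * \<bar>x - y\<bar>" for i x y using B(3)[of "x - i" "y - i"] by simp
  qed (use B d kern_zero[OF d] in auto)
qed

lemma conv_continuous:
  fixes f :: "real \<Rightarrow> real"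
  assumes f: "continuous_on UNIV f" and L: "\<And>x. \<bar>f x\<bar> \<le> L"
  shows "continuous_on UNIV (conv d f)"
proof (rule continuous_on_sequentiallyI)
  fix u :: "nat \<Rightarrow> real" and a assume u: "u \<longlonglongrightarrow> a"
  show "(\<lambda>n. conv d f (u n)) \<longlonglongrightarrow> conv d f a"
    unfolding conv_def
  proof (rule integral_dominated_convergence[where w = "\<lambda>z. bump z * L"])
    show "AE z in lborel. (\<lambda>n. bump z *\<^sub>R f (u n + d * z)) \<longlonglongrightarrow> bump z *\<^sub>R f (a + d * z)"
    proof (intro AE_I2 tendsto_intros)
      fix z
      have "(\<lambda>n. u n + d * z) \<longlonglongrightarrow> a + d * z" by (intro tendsto_intros u)
      then show "(\<lambda>n. f (u n + d * z)) \<longlonglongrightarrow> f (a + d * z)"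
        using f by (auto simp: continuous_on_eq_continuous_at intro: isCont_tendsto_compose)
    qed
    show "AE z in lborel. norm (bump z *\<^sub>R f (u n + d * z)) \<le> bump z * L" for n
      using bump_nonneg L by (auto simp: abs_mult intro!: mult_left_mono)
  qed (use bump_integrable conv_integrable[OF f] in auto)
qed

lemma conv_abs_le:
  fixes f :: "real \<Rightarrow> real"
  assumes f: "continuous_on UNIV f" and L: "\<And>x. \<bar>f x\<bar> \<le> L"
  shows "\<bar>conv d f y\<bar> \<le> L"
proof -
  have "norm (conv d f y) \<le> (LINT z|lborel. norm (bump z *\<^sub>R f (y + d * z)))"
    unfolding conv_def by (rule integral_norm_bound)
  also have "\<dots> \<le> (LINT z|lborel. bump z * L)"
  proof (rule integral_mono[OF integrable_norm[OF conv_integrable[OF f]]])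
    show "norm (bump z *\<^sub>R f (y + d * z)) \<le> bump z * L" for z
      using bump_nonneg[of z] L by (auto simp: abs_mult intro!: mult_left_mono)
  qed (use bump_integrable in auto)
  also have "\<dots> = L" using bump_integral by simp
  finally show ?thesis by simp
qed

lemma conv_zero:
  fixes f :: "real \<Rightarrow> real"
  assumes supp: "\<And>x. R < \<bar>x\<bar> \<Longrightarrow> f x = 0" and d: "0 < d" and y: "R + d < \<bar>y\<bar>"
  shows "conv d f y = 0"
proof -
  have "bump z *\<^sub>R f (y + d * z) = 0" for z
  proof (cases "\<bar>z\<bar> < 1")
    case True
    then have "\<bar>d * z\<bar> < d" using d by (simp add: abs_mult)
    then have "R < \<bar>y + d * z\<bar>" using y by linarith
    then show ?thesis using supp by simp
  qed (simp add: bump_zero)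
  then show ?thesis unfolding conv_def by (simp only: Bochner_Integration.integral_zero)
qed

lemma bump_nn_integral: "(\<integral>\<^sup>+z. ennreal (bump z) \<partial>lborel) = 1"
  using bump_integrable bump_integral bump_nonneg by (subst nn_integral_eq_integral) auto

text \<open>A mollification averages translates, and moduli are translation invariant. Splitting
  \<open>bump\<close> into two square roots, Cauchy-Schwarz bounds the square of an average by the
  average of the squares; the constants do not depend on d.\<close>

lemma conv_cls:
  assumes f: "cls L M f"
  shows "cls L M (conv d f)"
proof -
  have cont: "continuous_on UNIV f" and bd: "\<And>x. \<bar>f x\<bar> \<le> L" using f by (auto simp: cls_def)
  have [measurable]: "f \<in> borel_measurable borel" by (rule borel_measurable_continuous_onI[OF cont])
  have "modulus_sq (conv d f) \<tau> \<le> modulus_sq f \<tau>" for \<tau>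
  proof -
    define D where "D x = f (x + \<tau>) - f x" for x
    have [measurable]: "D \<in> borel_measurable borel" unfolding D_def[abs_def] by measurable
    have diff: "conv d f (x + \<tau>) - conv d f x = (LINT z|lborel. bump z * D (x + d * z))" for x
      unfolding conv_def D_def
      using conv_integrable[OF cont, of "x + \<tau>" d] conv_integrable[OF cont, of x d]
      by (simp add: right_diff_distrib add_ac)
    have pt: "ennreal ((norm (conv d f (x + \<tau>) - conv d f x))\<^sup>2) \<le> (\<integral>\<^sup>+z. ennreal (bump z) * ennreal ((D (x + d * z))\<^sup>2) \<partial>lborel)" for x
    proof -
      have "ennreal (norm (conv d f (x + \<tau>) - conv d f x)) \<le> (\<integral>\<^sup>+z. ennreal (norm (bump z * D (x + d * z))) \<partial>lborel)"
        unfolding diff by (rule norm_integral_le_nn_integral)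
      also have "\<dots> = (\<integral>\<^sup>+z. ennreal (sqrt (bump z)) * ennreal (sqrt (bump z) * \<bar>D (x + d * z)\<bar>) \<partial>lborel)"
        using bump_nonneg by (intro nn_integral_cong) (simp add: ennreal_mult[symmetric] abs_mult flip: mult.assoc)
      finally have "(ennreal (norm (conv d f (x + \<tau>) - conv d f x)))\<^sup>2 \<le>
          (\<integral>\<^sup>+z. ennreal (sqrt (bump z)) * ennreal (sqrt (bump z) * \<bar>D (x + d * z)\<bar>) \<partial>lborel)\<^sup>2"
        by (intro power_mono) auto
      also have "\<dots> \<le> (\<integral>\<^sup>+z. (ennreal (sqrt (bump z)))\<^sup>2 \<partial>lborel) * (\<integral>\<^sup>+z. (ennreal (sqrt (bump z) * \<bar>D (x + d * z)\<bar>))\<^sup>2 \<partial>lborel)"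
        by (rule Cauchy_Schwarz_nn_integral) measurable
      also have "(\<integral>\<^sup>+z. (ennreal (sqrt (bump z)))\<^sup>2 \<partial>lborel) = 1"
        using bump_nonneg bump_nn_integral by (simp add: ennreal_power)
      also have "(\<integral>\<^sup>+z. (ennreal (sqrt (bump z) * \<bar>D (x + d * z)\<bar>))\<^sup>2 \<partial>lborel) = (\<integral>\<^sup>+z. ennreal (bump z) * ennreal ((D (x + d * z))\<^sup>2) \<partial>lborel)"
        using bump_nonneg by (intro nn_integral_cong) (simp add: ennreal_power power_mult_distrib ennreal_mult)
      finally show ?thesis by (simp add: ennreal_power)
    qed
    have "modulus_sq (conv d f) \<tau> \<le> (\<integral>\<^sup>+x. \<integral>\<^sup>+z. ennreal (bump z) * ennreal ((D (x + d * z))\<^sup>2) \<partial>lborel \<partial>lborel)"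
      unfolding modulus_sq_def by (intro nn_integral_mono pt)
    also have "\<dots> = (\<integral>\<^sup>+z. \<integral>\<^sup>+x. ennreal (bump z) * ennreal ((D (x + d * z))\<^sup>2) \<partial>lborel \<partial>lborel)"
      by (rule lborel_pair.Fubini') measurable
    also have "\<dots> = (\<integral>\<^sup>+z. ennreal (bump z) * modulus_sq f \<tau> \<partial>lborel)"
    proof (intro nn_integral_cong)
      fix z
      have "(\<integral>\<^sup>+x. ennreal (bump z) * ennreal ((D (x + d * z))\<^sup>2) \<partial>lborel) = ennreal (bump z) * (\<integral>\<^sup>+x. ennreal ((D (x + d * z))\<^sup>2) \<partial>lborel)"
        by (rule nn_integral_cmult) measurable
      also have "(\<integral>\<^sup>+x. ennreal ((D (x + d * z))\<^sup>2) \<partial>lborel) = modulus_sq f \<tau>"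
        using nn_integral_real_affine[of "\<lambda>x. ennreal ((D x)\<^sup>2)" 1 "d * z"]
        by (simp add: modulus_sq_def D_def add_ac)
      finally show "(\<integral>\<^sup>+x. ennreal (bump z) * ennreal ((D (x + d * z))\<^sup>2) \<partial>lborel) = ennreal (bump z) * modulus_sq f \<tau>" .
    qed
    also have "\<dots> = modulus_sq f \<tau>" by (simp add: nn_integral_multc bump_nn_integral)
    finally show ?thesis .
  qed
  then have "modulus_sq (conv d f) \<tau> \<le> ennreal (M * \<tau> powr (2 * r))" if "0 < \<tau>" "\<tau> \<le> 1" for \<tau>
    using f that unfolding cls_def by (meson order_trans)
  then show ?thesis
    using conv_continuous[OF cont bd] conv_abs_le[OF cont bd] unfolding cls_def by blast
qed

lemma ucls_conv: "ucls I f \<Longrightarrow> ucls I (\<lambda>i. conv (d i) (f i))"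
  unfolding ucls_def using conv_cls by blast

subsection \<open>The duality pairing\<close>

definition hat :: "(real \<Rightarrow> real) \<Rightarrow> real \<Rightarrow> complex" where
  "hat h = inv_fourier (\<lambda>x. complex_of_real (h x))"

text \<open>The value at h of the distribution whose Fourier transform is G, by Parseval's formula.
  For test functions h it agrees with \<open>has_fourier_test\<close>.\<close>

definition pairing :: "(real \<Rightarrow> complex) \<Rightarrow> (real \<Rightarrow> real) \<Rightarrow> complex" where
  "pairing G h = (LINT \<xi>|lborel. G \<xi> * hat h \<xi>)"

text \<open>The Fourier side of H^(r-1), the dual of H^(1-r); \<open>nrm\<close> is its
  norm.\<close>

definition dual :: "(real \<Rightarrow> complex) \<Rightarrow> bool" where
  "dual G \<longleftrightarrow> G \<in> borel_measurable borel \<and> integrable lborel (\<lambda>\<xi>. (1 + \<xi>\<^sup>2) powr (r - 1) * (cmod (G \<xi>))\<^sup>2)"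

definition nrm :: "(real \<Rightarrow> complex) \<Rightarrow> real" where
  "nrm G = sqrt (LINT \<xi>|lborel. (1 + \<xi>\<^sup>2) powr (r - 1) * (cmod (G \<xi>))\<^sup>2)"

text \<open>Multipliers with explicit constants and support. Compact support adds the L^2 bound that
  \<open>cls\<close> lacks, and with it a bound in H^(1-r).\<close>

definition adm :: "real \<Rightarrow> real \<Rightarrow> real \<Rightarrow> (real \<Rightarrow> real) \<Rightarrow> bool" where
  "adm R L M h \<longleftrightarrow> R \<ge> 0 \<and> L \<ge> 0 \<and> M \<ge> 0 \<and> cls L M h \<and> (\<forall>x. R < \<bar>x\<bar> \<longrightarrow> h x = 0)"

text \<open>A bound for the H^(1-r) norm: M controls the modulus, and 2 R L^2 the squared L^2 norm
  of a function bounded by L on [-R, R].\<close>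

definition adm_const :: "real \<Rightarrow> real \<Rightarrow> real \<Rightarrow> real" where
  "adm_const R L M = sqrt (besov_const * (M + 2 * R * L\<^sup>2))"

lemma nrm_nonneg: "nrm G \<ge> 0"
  unfolding nrm_def by (intro real_sqrt_ge_zero integral_nonneg_AE) auto

lemma wsq_dual: "dual G \<Longrightarrow> wsq (r - 1) G = ennreal ((nrm G)\<^sup>2)"
  unfolding wsq_def nrm_def dual_def
  by (subst nn_integral_eq_integral) (auto simp: integral_nonneg_AE)

lemma admD:
  assumes "adm R L M h"
  shows "continuous_on UNIV h" "h \<in> borel_measurable borel" "\<And>x. \<bar>h x\<bar> \<le> L" "\<And>x. R < \<bar>x\<bar> \<Longrightarrow> h x = 0"
    "cls L M h" "integrable lborel (\<lambda>x. complex_of_real (h x))" "R \<ge> 0" "L \<ge> 0" "M \<ge> 0"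
proof -
  show c: "continuous_on UNIV h" using assms by (simp add: adm_def cls_def)
  show "h \<in> borel_measurable borel" by (rule borel_measurable_continuous_onI[OF c])
  show s: "\<And>x. R < \<bar>x\<bar> \<Longrightarrow> h x = 0" using assms by (simp add: adm_def)
  show "integrable lborel (\<lambda>x. complex_of_real (h x))"
    by (rule integrable_compact_support[where R = R]) (auto intro!: continuous_intros c s)
qed (use assms in \<open>auto simp: adm_def cls_def\<close>)

lemma adm_abs_le_indicator: "adm R L M h \<Longrightarrow> \<bar>h x\<bar> \<le> L * indicator {-R..R} x"
  using admD(3,4)[of R L M h] by (cases "x \<in> {-R..R}") (auto simp: abs_le_iff not_le)

lemma hat_measurable [measurable]: "h \<in> borel_measurable borel \<Longrightarrow> hat h \<in> borel_measurable borel"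
  unfolding hat_def by measurable

lemma hat_bound:
  assumes h: "adm R L M h"
  shows "cmod (hat h \<xi>) \<le> L * (2 * R)"
proof -
  note a = admD[OF h]
  have "cmod (hat h \<xi>) \<le> (LINT x|lborel. norm (complex_of_real (h x)))" unfolding hat_def by (rule inv_fourier_norm_le)
  also have "\<dots> \<le> (LINT x|lborel. L * indicator {-R..R} x)"
    using adm_abs_le_indicator[OF h] a(6) by (intro integral_mono integrable_norm) (auto simp: emeasure_lborel_Icc_eq)
  also have "\<dots> = L * (2 * R)" using a(7) by simp
  finally show ?thesis .
qed

lemma adm_wsq:
  assumes h: "adm R L M h"
  shows "wsq (1 - r) (hat h) \<le> ennreal ((adm_const R L M)\<^sup>2)" "adm_const R L M \<ge> 0"
proof -
  note a = admD[OF h]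
  have [measurable]: "h \<in> borel_measurable borel" by (rule a)
  have pos: "M + 2 * R * L\<^sup>2 \<ge> 0" using a by simp
  have "wsq (1 - r) (hat h) \<le> ennreal (besov_const * (M + 2 * R * L\<^sup>2))"
    unfolding hat_def
  proof (rule wsq_inv_fourier_le[OF a(6) pos])
    have "(\<integral>\<^sup>+x. ennreal ((norm (complex_of_real (h x)))\<^sup>2) \<partial>lborel) \<le> (\<integral>\<^sup>+x. ennreal (L\<^sup>2) * indicator {-R..R} x \<partial>lborel)"
    proof (rule nn_integral_mono)
      fix x
      have "\<bar>h x\<bar>\<^sup>2 \<le> (L * indicator {-R..R} x)\<^sup>2" by (intro power_mono adm_abs_le_indicator[OF h]) auto
      then show "ennreal ((norm (complex_of_real (h x)))\<^sup>2) \<le> ennreal (L\<^sup>2) * indicator {-R..R} x"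
        by (cases "x \<in> {-R..R}") (auto intro!: ennreal_leI)
    qed
    also have "\<dots> = ennreal (L\<^sup>2) * ennreal (2 * R)" using a(7) by (subst nn_integral_cmult_indicator) auto
    also have "\<dots> = ennreal (2 * R * L\<^sup>2)" using a(7) by (subst ennreal_mult[symmetric]) (auto simp: mult_ac)
    also have "\<dots> \<le> ennreal (M + 2 * R * L\<^sup>2)" using a by (intro ennreal_leI) auto
    finally show "(\<integral>\<^sup>+x. ennreal ((norm (complex_of_real (h x)))\<^sup>2) \<partial>lborel) \<le> ennreal (M + 2 * R * L\<^sup>2)" .
    fix \<tau> :: real assume \<tau>: "0 < \<tau>" "\<tau> \<le> 1"
    have "modulus_sq (\<lambda>x. complex_of_real (h x)) \<tau> = modulus_sq h \<tau>"
      by (simp add: modulus_sq_def norm_of_real flip: of_real_diff)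
    also have "\<dots> \<le> ennreal (M * \<tau> powr (2 * r))" using a(5) \<tau> by (simp add: cls_def)
    also have "\<dots> \<le> ennreal ((M + 2 * R * L\<^sup>2) * \<tau> powr (2 * r))"
      using a by (intro ennreal_leI mult_right_mono) auto
    finally show "modulus_sq (\<lambda>x. complex_of_real (h x)) \<tau> \<le> ennreal ((M + 2 * R * L\<^sup>2) * \<tau> powr (2 * r))" .
  qed
  also have "besov_const * (M + 2 * R * L\<^sup>2) = (adm_const R L M)\<^sup>2"
    using pos besov_const_pos by (simp add: adm_const_def)
  finally show "wsq (1 - r) (hat h) \<le> ennreal ((adm_const R L M)\<^sup>2)" .
  show "adm_const R L M \<ge> 0" using pos besov_const_pos by (simp add: adm_const_def)
qed

text \<open>Cauchy-Schwarz after inserting the weights with exponents (r-1)/2 and (1-r)/2, whose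
  product is 1.\<close>

lemma pairing_nn_bound:
  assumes G: "dual G" and h: "adm R L M h"
  shows "(\<integral>\<^sup>+\<xi>. ennreal (cmod (G \<xi> * hat h \<xi>)) \<partial>lborel) \<le> ennreal (nrm G * adm_const R L M)"
proof -
  have [measurable]: "G \<in> borel_measurable borel" "h \<in> borel_measurable borel"
    using G admD[OF h] by (auto simp: dual_def)
  let ?I = "\<integral>\<^sup>+\<xi>. ennreal (cmod (G \<xi> * hat h \<xi>)) \<partial>lborel"
  have sqw: "((1 + \<xi>\<^sup>2) powr (a / 2))\<^sup>2 = (1 + \<xi>\<^sup>2) powr a" for \<xi> a :: real
    by (simp add: power2_eq_square powr_add[symmetric])
  have "?I = (\<integral>\<^sup>+\<xi>. ennreal ((1 + \<xi>\<^sup>2) powr ((r - 1) / 2) * cmod (G \<xi>)) * ennreal ((1 + \<xi>\<^sup>2) powr ((1 - r) / 2) * cmod (hat h \<xi>)) \<partial>lborel)"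
  proof (intro nn_integral_cong)
    fix \<xi> :: real
    have "(1 + \<xi>\<^sup>2) powr ((r - 1) / 2) * (1 + \<xi>\<^sup>2) powr ((1 - r) / 2) = (1 + \<xi>\<^sup>2) powr 0"
      unfolding powr_add[symmetric] by (simp add: field_simps)
    also have "\<dots> = 1" by (simp add: add_nonneg_eq_0_iff)
    finally have w: "(1 + \<xi>\<^sup>2) powr ((r - 1) / 2) * (1 + \<xi>\<^sup>2) powr ((1 - r) / 2) = 1" .
    have "((1 + \<xi>\<^sup>2) powr ((r - 1) / 2) * cmod (G \<xi>)) * ((1 + \<xi>\<^sup>2) powr ((1 - r) / 2) * cmod (hat h \<xi>)) =
        ((1 + \<xi>\<^sup>2) powr ((r - 1) / 2) * (1 + \<xi>\<^sup>2) powr ((1 - r) / 2)) * cmod (G \<xi> * hat h \<xi>)"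
      by (simp only: norm_mult mult_ac)
    then show "ennreal (cmod (G \<xi> * hat h \<xi>)) = ennreal ((1 + \<xi>\<^sup>2) powr ((r - 1) / 2) * cmod (G \<xi>)) * ennreal ((1 + \<xi>\<^sup>2) powr ((1 - r) / 2) * cmod (hat h \<xi>))"
      unfolding w by (subst ennreal_mult[symmetric]) auto
  qed
  then have "?I\<^sup>2 \<le> (\<integral>\<^sup>+\<xi>. (ennreal ((1 + \<xi>\<^sup>2) powr ((r - 1) / 2) * cmod (G \<xi>)))\<^sup>2 \<partial>lborel) *
      (\<integral>\<^sup>+\<xi>. (ennreal ((1 + \<xi>\<^sup>2) powr ((1 - r) / 2) * cmod (hat h \<xi>)))\<^sup>2 \<partial>lborel)"
    using Cauchy_Schwarz_nn_integral[of "\<lambda>\<xi>. ennreal ((1 + \<xi>\<^sup>2) powr ((r - 1) / 2) * cmod (G \<xi>))" lborel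
        "\<lambda>\<xi>. ennreal ((1 + \<xi>\<^sup>2) powr ((1 - r) / 2) * cmod (hat h \<xi>))"] by simp
  also have "\<dots> = wsq (r - 1) G * wsq (1 - r) (hat h)"
    unfolding wsq_def by (simp add: ennreal_power power_mult_distrib sqw)
  also have "\<dots> \<le> ennreal ((nrm G)\<^sup>2) * ennreal ((adm_const R L M)\<^sup>2)"
    unfolding wsq_dual[OF G] by (intro mult_left_mono adm_wsq[OF h]) auto
  also have "\<dots> = ennreal ((nrm G * adm_const R L M)\<^sup>2)"
    by (simp add: ennreal_mult power_mult_distrib)
  finally have le: "?I\<^sup>2 \<le> ennreal ((nrm G * adm_const R L M)\<^sup>2)" .
  have nn: "nrm G * adm_const R L M \<ge> 0" using nrm_nonneg adm_wsq(2)[OF h] by simp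
  show ?thesis
  proof (cases ?I)
    case (real x)
    then have "x\<^sup>2 \<le> (nrm G * adm_const R L M)\<^sup>2" using le by (simp add: ennreal_power ennreal_le_iff)
    then have "x \<le> nrm G * adm_const R L M" using nn by (rule power2_le_imp_le)
    then show ?thesis using real by (simp add: ennreal_leI)
  next
    case top
    then show ?thesis using le by (simp add: top_unique)
  qed
qed

lemma pairing_integrable:
  assumes G: "dual G" and h: "adm R L M h"
  shows "integrable lborel (\<lambda>\<xi>. G \<xi> * hat h \<xi>)"
proof -
  have [measurable]: "G \<in> borel_measurable borel" "h \<in> borel_measurable borel"
    using G admD[OF h] by (auto simp: dual_def)
  have "(\<integral>\<^sup>+\<xi>. ennreal (cmod (G \<xi> * hat h \<xi>)) \<partial>lborel) < \<infinity>"
    by (rule le_less_trans[OF pairing_nn_bound[OF G h]]) simp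
  then show ?thesis by (subst integrable_iff_bounded) (simp, measurable)
qed

lemma pairing_bound:
  assumes G: "dual G" and h: "adm R L M h"
  shows "cmod (pairing G h) \<le> nrm G * adm_const R L M"
proof -
  have "ennreal (cmod (pairing G h)) \<le> ennreal (nrm G * adm_const R L M)"
    unfolding pairing_def by (rule order_trans[OF norm_integral_le_nn_integral pairing_nn_bound[OF G h]])
  then show ?thesis using nrm_nonneg adm_wsq(2)[OF h] by (simp add: ennreal_le_iff)
qed

end

section \<open>Continuity of the duality pairing\<close>

context exponent
begin

lemma adm_of_ucls:
  assumes "ucls I h" "R \<ge> 0" "\<And>i x. i \<in> I \<Longrightarrow> R < \<bar>x\<bar> \<Longrightarrow> h i x = 0"
  obtains L M where "\<And>i. i \<in> I \<Longrightarrow> adm R L M (h i)"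
proof -
  obtain L M where LM: "L \<ge> 0" "M \<ge> 0" "\<forall>i\<in>I. cls L M (h i)" using assms(1) unfolding ucls_def by blast
  show thesis by (rule that[of L M]) (use LM assms in \<open>auto simp: adm_def\<close>)
qed

lemma hat_cmult: "hat (\<lambda>x. c * h x) \<xi> = of_real c * hat h \<xi>"
  unfolding hat_def by (simp add: inv_fourier_cmult)

lemma pairing_cmult: "pairing G (\<lambda>x. c * h x) = of_real c * pairing G h"
  unfolding pairing_def hat_cmult mult.left_commute[of "G _" "of_real c"] by (rule integral_mult_right_zero)

lemma pairing_add:
  assumes "dual G" "adm R L M h" "adm R' L' M' k"
  shows "pairing G (\<lambda>x. h x + k x) = pairing G h + pairing G k"
proof -
  have "hat (\<lambda>x. h x + k x) \<xi> = hat h \<xi> + hat k \<xi>" for \<xi>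
    unfolding hat_def using inv_fourier_add[OF admD(6)[OF assms(2)] admD(6)[OF assms(3)], of \<xi>] by simp
  then show ?thesis
    unfolding pairing_def using pairing_integrable[OF assms(1,2)] pairing_integrable[OF assms(1,3)]
    by (simp add: distrib_left)
qed

lemma dual_diff:
  assumes "dual F" "dual G"
  shows "dual (\<lambda>\<xi>. F \<xi> - G \<xi>)"
proof -
  have [measurable]: "F \<in> borel_measurable borel" "G \<in> borel_measurable borel" using assms by (auto simp: dual_def)
  have "integrable lborel (\<lambda>\<xi>. 2 * ((1 + \<xi>\<^sup>2) powr (r - 1) * (cmod (F \<xi>))\<^sup>2) + 2 * ((1 + \<xi>\<^sup>2) powr (r - 1) * (cmod (G \<xi>))\<^sup>2))"
    using assms by (auto simp: dual_def)
  then have "integrable lborel (\<lambda>\<xi>. (1 + \<xi>\<^sup>2) powr (r - 1) * (cmod (F \<xi> - G \<xi>))\<^sup>2)"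
  proof (rule Bochner_Integration.integrable_bound)
    show "AE \<xi> in lborel. norm ((1 + \<xi>\<^sup>2) powr (r - 1) * (cmod (F \<xi> - G \<xi>))\<^sup>2) \<le>
        norm (2 * ((1 + \<xi>\<^sup>2) powr (r - 1) * (cmod (F \<xi>))\<^sup>2) + 2 * ((1 + \<xi>\<^sup>2) powr (r - 1) * (cmod (G \<xi>))\<^sup>2))"
    proof (rule AE_I2)
      fix \<xi> :: real
      have "(cmod (F \<xi> - G \<xi>))\<^sup>2 \<le> (cmod (F \<xi>) + cmod (G \<xi>))\<^sup>2" by (intro power_mono norm_triangle_ineq4) auto
      also have "\<dots> \<le> 2 * (cmod (F \<xi>))\<^sup>2 + 2 * (cmod (G \<xi>))\<^sup>2"
        using sum_squares_bound[of "cmod (F \<xi>)" "cmod (G \<xi>)"] by (simp add: power2_sum)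
      finally have "(1 + \<xi>\<^sup>2) powr (r - 1) * (cmod (F \<xi> - G \<xi>))\<^sup>2 \<le> (1 + \<xi>\<^sup>2) powr (r - 1) * (2 * (cmod (F \<xi>))\<^sup>2 + 2 * (cmod (G \<xi>))\<^sup>2)"
        by (rule mult_left_mono) auto
      also have "\<dots> = 2 * ((1 + \<xi>\<^sup>2) powr (r - 1) * (cmod (F \<xi>))\<^sup>2) + 2 * ((1 + \<xi>\<^sup>2) powr (r - 1) * (cmod (G \<xi>))\<^sup>2)"
        by (simp add: algebra_simps)
      finally show "norm ((1 + \<xi>\<^sup>2) powr (r - 1) * (cmod (F \<xi> - G \<xi>))\<^sup>2) \<le>
        norm (2 * ((1 + \<xi>\<^sup>2) powr (r - 1) * (cmod (F \<xi>))\<^sup>2) + 2 * ((1 + \<xi>\<^sup>2) powr (r - 1) * (cmod (G \<xi>))\<^sup>2))"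
        by simp
    qed
  qed measurable
  then show ?thesis unfolding dual_def by simp
qed

lemma pairing_diff_left:
  assumes "dual F" "dual G" "adm R L M h"
  shows "pairing (\<lambda>\<xi>. F \<xi> - G \<xi>) h = pairing F h - pairing G h"
  unfolding pairing_def using pairing_integrable[OF assms(1,3)] pairing_integrable[OF assms(2,3)]
  by (simp add: left_diff_distrib)

text \<open>A sharp frequency cutoff. The low part is integrable, so uniform bounds on the
  transforms of the multipliers give dominated convergence; the high part is small in
  \<open>nrm\<close>.\<close>

definition low_part :: "nat \<Rightarrow> (real \<Rightarrow> complex) \<Rightarrow> real \<Rightarrow> complex" where
  "low_part N G \<xi> = (if \<bar>\<xi>\<bar> \<le> real N then G \<xi> else 0)"

lemma low_part_measurable [measurable]:
  assumes [measurable]: "G \<in> borel_measurable borel"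
  shows "low_part N G \<in> borel_measurable borel"
  unfolding low_part_def[abs_def] by measurable

lemma low_part_dual:
  assumes "dual G" shows "dual (low_part N G)"
proof -
  have [measurable]: "G \<in> borel_measurable borel" using assms by (simp add: dual_def)
  have "integrable lborel (\<lambda>\<xi>. (1 + \<xi>\<^sup>2) powr (r - 1) * (cmod (G \<xi>))\<^sup>2)" using assms by (simp add: dual_def)
  then have "integrable lborel (\<lambda>\<xi>. (1 + \<xi>\<^sup>2) powr (r - 1) * (cmod (low_part N G \<xi>))\<^sup>2)"
    by (rule Bochner_Integration.integrable_bound) (measurable, simp add: low_part_def)
  then show ?thesis unfolding dual_def by simp
qed

lemma low_part_integrable:
  assumes "dual G" shows "integrable lborel (low_part N G)"
proof -
  have [measurable]: "G \<in> borel_measurable borel" using assms by (simp add: dual_def)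
  define C where "C = (1 + (real N)\<^sup>2) powr (1 - r)"
  have "integrable lborel (\<lambda>\<xi>. indicator {-real N..real N} \<xi> + C * ((1 + \<xi>\<^sup>2) powr (r - 1) * (cmod (G \<xi>))\<^sup>2))"
    using assms by (intro Bochner_Integration.integrable_add integrable_real_indicator) (auto simp: dual_def emeasure_lborel_Icc_eq)
  then show ?thesis
  proof (rule Bochner_Integration.integrable_bound)
    show "AE \<xi> in lborel. norm (low_part N G \<xi>) \<le> norm (indicator {-real N..real N} \<xi> + C * ((1 + \<xi>\<^sup>2) powr (r - 1) * (cmod (G \<xi>))\<^sup>2))"
    proof (rule AE_I2)
      fix \<xi> :: real
      show "norm (low_part N G \<xi>) \<le> norm (indicator {-real N..real N} \<xi> + C * ((1 + \<xi>\<^sup>2) powr (r - 1) * (cmod (G \<xi>))\<^sup>2))"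
      proof (cases "\<bar>\<xi>\<bar> \<le> real N")
        case True
        then have "\<xi>\<^sup>2 \<le> (real N)\<^sup>2" by (metis abs_ge_zero power2_abs power_mono)
        then have "(1 + \<xi>\<^sup>2) powr (1 - r) \<le> C" unfolding C_def using r by (intro powr_mono2) auto
        then have "(1 + \<xi>\<^sup>2) powr (1 - r) * (1 + \<xi>\<^sup>2) powr (r - 1) \<le> C * (1 + \<xi>\<^sup>2) powr (r - 1)" by (rule mult_right_mono) simp
        moreover have "(1 + \<xi>\<^sup>2) powr (1 - r) * (1 + \<xi>\<^sup>2) powr (r - 1) = 1"
          unfolding powr_add[symmetric] by (simp add: add_nonneg_eq_0_iff)
        ultimately have "1 * (cmod (G \<xi>))\<^sup>2 \<le> C * (1 + \<xi>\<^sup>2) powr (r - 1) * (cmod (G \<xi>))\<^sup>2" by (intro mult_right_mono) auto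
        moreover have "cmod (G \<xi>) \<le> 1 + (cmod (G \<xi>))\<^sup>2"
          using sum_squares_bound[of "cmod (G \<xi>)" 1] norm_ge_zero[of "G \<xi>"]
          unfolding one_power2 mult_1_right by linarith
        ultimately have "cmod (G \<xi>) \<le> 1 + C * ((1 + \<xi>\<^sup>2) powr (r - 1) * (cmod (G \<xi>))\<^sup>2)" by (simp add: mult.assoc)
        moreover have "\<xi> \<in> {-real N..real N}" using True by auto
        ultimately show ?thesis using True by (simp add: low_part_def)
      qed (simp add: low_part_def)
    qed
  qed measurable
qed

lemma nrm_high_part_tendsto:
  assumes "dual G"
  shows "(\<lambda>N. nrm (\<lambda>\<xi>. G \<xi> - low_part N G \<xi>)) \<longlonglongrightarrow> 0"
proof -
  have [measurable]: "G \<in> borel_measurable borel" using assms by (simp add: dual_def)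
  have "(\<lambda>N. LINT \<xi>|lborel. (1 + \<xi>\<^sup>2) powr (r - 1) * (cmod (G \<xi> - low_part N G \<xi>))\<^sup>2) \<longlonglongrightarrow> (LINT \<xi>::real|lborel. 0)"
  proof (rule integral_dominated_convergence[where w = "\<lambda>\<xi>. (1 + \<xi>\<^sup>2) powr (r - 1) * (cmod (G \<xi>))\<^sup>2"])
    show "AE \<xi> in lborel. (\<lambda>N. (1 + \<xi>\<^sup>2) powr (r - 1) * (cmod (G \<xi> - low_part N G \<xi>))\<^sup>2) \<longlonglongrightarrow> 0"
    proof (rule AE_I2)
      fix \<xi> :: real
      obtain N0 where N0: "\<bar>\<xi>\<bar> \<le> real N0" using real_arch_simple by blast
      have "\<forall>\<^sub>F N in sequentially. (1 + \<xi>\<^sup>2) powr (r - 1) * (cmod (G \<xi> - low_part N G \<xi>))\<^sup>2 = 0"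
        using eventually_ge_at_top[of N0]
      proof eventually_elim
        case (elim N)
        then have "\<bar>\<xi>\<bar> \<le> real N" using N0 by simp
        then show ?case by (simp add: low_part_def)
      qed
      then show "(\<lambda>N. (1 + \<xi>\<^sup>2) powr (r - 1) * (cmod (G \<xi> - low_part N G \<xi>))\<^sup>2) \<longlonglongrightarrow> 0" by (rule tendsto_eventually)
    qed
  qed (use assms in \<open>auto simp: dual_def low_part_def\<close>)
  from tendsto_real_sqrt[OF this] show ?thesis by (simp add: nrm_def)
qed

text \<open>Weak convergence: pointwise limits together with common constants suffice, and
  convergence in H^(1-r) is not claimed. For the low frequencies the transforms converge pointwise
  and boundedly; the high frequencies are small uniformly in n because all multipliers share one
  constant.\<close>

lemma pairing_tendsto_right:
  assumes G: "dual G" and h: "\<And>n. adm R L M (h n)" "adm R L M h0" and lim: "\<And>x. (\<lambda>n. h n x) \<longlonglongrightarrow> h0 x"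
  shows "(\<lambda>n. pairing G (h n)) \<longlonglongrightarrow> pairing G h0"
proof -
  have [measurable]: "G \<in> borel_measurable borel" "h0 \<in> borel_measurable borel" "h n \<in> borel_measurable borel" for n
    using G admD(2)[OF h(1)] admD(2)[OF h(2)] by (auto simp: dual_def)
  have R: "R \<ge> 0" using admD[OF h(2)] by blast
  have hat: "(\<lambda>n. hat (h n) \<xi>) \<longlonglongrightarrow> hat h0 \<xi>" for \<xi>
    unfolding hat_def
  proof (rule inv_fourier_tendsto[where w = "\<lambda>x. L * indicator {-R..R} x"])
    show "integrable lborel (\<lambda>x. L * indicator {- R..R} x)" by (auto simp: emeasure_lborel_Icc_eq)
    show "norm (complex_of_real (h n x)) \<le> L * indicator {- R..R} x" for n x
      using adm_abs_le_indicator[OF h(1)] by simp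
  qed (use lim in \<open>auto intro: tendsto_of_real\<close>)
  have low: "(\<lambda>n. pairing (low_part N G) (h n)) \<longlonglongrightarrow> pairing (low_part N G) h0" for N
    unfolding pairing_def
  proof (rule integral_dominated_convergence[where w = "\<lambda>\<xi>. cmod (low_part N G \<xi>) * (L * (2 * R))"])
    show "AE \<xi> in lborel. (\<lambda>n. low_part N G \<xi> * hat (h n) \<xi>) \<longlonglongrightarrow> low_part N G \<xi> * hat h0 \<xi>"
      by (intro AE_I2 tendsto_intros hat)
    show "AE \<xi> in lborel. norm (low_part N G \<xi> * hat (h n) \<xi>) \<le> cmod (low_part N G \<xi>) * (L * (2 * R))" for n
      using hat_bound[OF h(1)] by (auto simp: norm_mult intro!: mult_left_mono)
    show "integrable lborel (\<lambda>\<xi>. cmod (low_part N G \<xi>) * (L * (2 * R)))"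
      using low_part_integrable[OF G, of N] by (intro integrable_mult_left integrable_norm)
  qed measurable
  define K where "K = adm_const R L M"
  have K: "K \<ge> 0" unfolding K_def by (rule adm_wsq(2)[OF h(2)])
  show ?thesis
  proof (rule LIMSEQ_I)
    fix e :: real assume e: "e > 0"
    have "(\<lambda>N. nrm (\<lambda>\<xi>. G \<xi> - low_part N G \<xi>) * K) \<longlonglongrightarrow> 0 * K"
      by (intro tendsto_mult tendsto_const nrm_high_part_tendsto G)
    then obtain N where N: "nrm (\<lambda>\<xi>. G \<xi> - low_part N G \<xi>) * K < e / 3"
      using order_tendstoD(2)[of _ "0 * K" sequentially "e / 3"] e by (auto simp: eventually_sequentially)
    have dd: "dual (\<lambda>\<xi>. G \<xi> - low_part N G \<xi>)" by (intro dual_diff low_part_dual G)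
    have high: "cmod (pairing G k - pairing (low_part N G) k) < e / 3" if "adm R L M k" for k
      using pairing_bound[OF dd that] N unfolding pairing_diff_left[OF G low_part_dual[OF G] that] K_def by simp
    obtain n0 where n0: "\<And>n. n \<ge> n0 \<Longrightarrow> cmod (pairing (low_part N G) (h n) - pairing (low_part N G) h0) < e / 3"
      using LIMSEQ_D[OF low, of "e / 3" N] e by auto
    show "\<exists>n0. \<forall>n\<ge>n0. norm (pairing G (h n) - pairing G h0) < e"
    proof (intro exI allI impI)
      fix n assume n: "n \<ge> n0"
      have *: "norm (a - b) < e" if "norm (a - a') < e / 3" "norm (a' - b') < e / 3" "norm (b - b') < e / 3" for a b a' b' :: complex
      proof -
        have "a - b = (a - a') + (a' - b') - (b - b')" by simp
        then have "norm (a - b) \<le> norm (a - a') + norm (a' - b') + norm (b - b')"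
          by (metis add_mono_thms_linordered_semiring(3) norm_triangle_ineq norm_triangle_ineq4 order_trans)
        then show ?thesis using that by linarith
      qed
      show "norm (pairing G (h n) - pairing G h0) < e" by (rule *[OF high[OF h(1)] n0[OF n] high[OF h(2)]])
    qed
  qed
qed

lemma pairing_tendsto:
  assumes G: "\<And>n. dual (G n)" "dual G0" and nrm: "(\<lambda>n. nrm (\<lambda>\<xi>. G n \<xi> - G0 \<xi>)) \<longlonglongrightarrow> 0"
    and h: "\<And>n. adm R L M (h n)" "adm R L M h0" and lim: "\<And>x. (\<lambda>n. h n x) \<longlonglongrightarrow> h0 x"
  shows "(\<lambda>n. pairing (G n) (h n)) \<longlonglongrightarrow> pairing G0 h0"
proof -
  have "(\<lambda>n. pairing (\<lambda>\<xi>. G n \<xi> - G0 \<xi>) (h n)) \<longlonglongrightarrow> 0"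
  proof (rule Lim_null_comparison)
    show "\<forall>\<^sub>F n in sequentially. norm (pairing (\<lambda>\<xi>. G n \<xi> - G0 \<xi>) (h n)) \<le> nrm (\<lambda>\<xi>. G n \<xi> - G0 \<xi>) * adm_const R L M"
      by (intro always_eventually allI pairing_bound dual_diff G h)
    show "(\<lambda>n. nrm (\<lambda>\<xi>. G n \<xi> - G0 \<xi>) * adm_const R L M) \<longlonglongrightarrow> 0"
      using tendsto_mult[OF nrm tendsto_const] by simp
  qed
  from tendsto_add[OF this pairing_tendsto_right[OF G(2) h lim]]
  show ?thesis unfolding pairing_diff_left[OF G(1) G(2) h(1)] by simp
qed

lemma hat_conv:
  assumes f: "continuous_on UNIV f" and w: "continuous_on UNIV w" "\<And>y. R < \<bar>y\<bar> \<Longrightarrow> w y = 0" and d: "d > 0"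
  shows "(LINT y|lborel. of_real (w y) * hat (\<lambda>x. f x * kern d (x - y)) \<xi>) = hat (\<lambda>x. f x * conv d w x) \<xi>"
proof -
  obtain B where B: "B > 0" "\<And>x. \<bar>kern d x\<bar> \<le> B" by (rule kern_bounds[OF d]) blast
  define R' where "R' = R + d"
  \<comment> \<open>Beyond R + d no point of the support of w is closer than d, so truncating f
    leaves the products unchanged and makes the factor integrable.\<close>
  define h where "h x = complex_of_real (indicator {-R'..R'} x * f x)" for x
  have h: "integrable lborel h"
  proof -
    have "integrable lborel (\<lambda>x. indicator {-R'..R'} x *\<^sub>R f x)"
      using f by (intro borel_integrable_compact) (auto intro: continuous_on_subset)
    then show ?thesis unfolding h_def by (intro integrable_of_real) simp
  qed
  have [measurable]: "f \<in> borel_measurable borel" "w \<in> borel_measurable borel"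
    using f w(1) by (auto intro: borel_measurable_continuous_onI)
  have wi: "integrable lborel (\<lambda>y. complex_of_real (w y))"
    by (rule integrable_compact_support[where R = R]) (auto intro!: continuous_intros w)
  \<comment> \<open>The division by B brings the kernel below 1, as
    \<open>integrable_product_lborel\<close> requires.\<close>
  define c where "c x y = cis (x * \<xi>) * of_real (kern d (x - y) / B)" for x y
  have eq: "c x y * (h x * of_real (w y)) = (cis (x * \<xi>) * of_real (f x * (kern d (x - y) * w y))) / of_real B" for x y
  proof (cases "\<bar>x\<bar> \<le> R'")
    case True
    then have "x \<in> {-R'..R'}" by auto
    then show ?thesis by (simp add: c_def h_def mult_ac)
  next
    case False
    have "kern d (x - y) * w y = 0"
    proof (cases "R < \<bar>y\<bar>")
      case nf: False
      then have "d \<le> \<bar>x - y\<bar>" using False by (auto simp: R'_def)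
      then show ?thesis using kern_zero[OF d] by simp
    qed (simp add: w)
    moreover have "h x = 0" using False by (auto simp: h_def indicator_def)
    ultimately show ?thesis by simp
  qed
  have "integrable (lborel \<Otimes>\<^sub>M lborel) (\<lambda>(x, y). c x y * (h x * of_real (w y)))"
  proof (rule integrable_product_lborel[OF h wi])
    show "(\<lambda>(x, y). c x y) \<in> borel_measurable (borel \<Otimes>\<^sub>M borel)" unfolding c_def by measurable
    show "norm (c x y) \<le> 1" for x y using B(1) B(2)[of "x - y"]
      unfolding c_def norm_mult norm_cis norm_of_real by (simp add: abs_divide)
  qed
  from lborel_pair.Fubini_integral[OF this]
  have F: "(LINT y|lborel. LINT x|lborel. cis (x * \<xi>) * of_real (f x * (kern d (x - y) * w y))) =
      (LINT x|lborel. LINT y|lborel. cis (x * \<xi>) * of_real (f x * (kern d (x - y) * w y)))"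
    unfolding eq using B(1) by simp
  have "(LINT y|lborel. of_real (w y) * (LINT x|lborel. cis (x * \<xi>) * of_real (f x * kern d (x - y)))) =
      (LINT y|lborel. LINT x|lborel. cis (x * \<xi>) * of_real (f x * (kern d (x - y) * w y)))"
  proof (intro Bochner_Integration.integral_cong refl)
    fix y
    have "of_real (w y) * (LINT x|lborel. cis (x * \<xi>) * of_real (f x * kern d (x - y))) =
        (LINT x|lborel. of_real (w y) * (cis (x * \<xi>) * of_real (f x * kern d (x - y))))"
      by (rule integral_mult_right_zero[symmetric])
    also have "\<dots> = (LINT x|lborel. cis (x * \<xi>) * of_real (f x * (kern d (x - y) * w y)))"
      by (intro Bochner_Integration.integral_cong refl) (simp add: mult_ac)
    finally show "of_real (w y) * (LINT x|lborel. cis (x * \<xi>) * of_real (f x * kern d (x - y))) =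
        (LINT x|lborel. cis (x * \<xi>) * of_real (f x * (kern d (x - y) * w y)))" .
  qed
  also note F
  also have "(LINT x|lborel. LINT y|lborel. cis (x * \<xi>) * of_real (f x * (kern d (x - y) * w y))) =
      (LINT x|lborel. cis (x * \<xi>) * of_real (f x * conv d w x))"
  proof (intro Bochner_Integration.integral_cong refl)
    fix x
    have "conv d w x = (LINT y|lborel. kern d (x - y) * w y)"
      unfolding conv_kern[OF d]
    proof (intro Bochner_Integration.integral_cong refl)
      fix y show "kern d (y - x) *\<^sub>R w y = kern d (x - y) * w y" using kern_even[of d "x - y"] by simp
    qed
    then show "(LINT y|lborel. cis (x * \<xi>) * of_real (f x * (kern d (x - y) * w y))) = cis (x * \<xi>) * of_real (f x * conv d w x)"
    proof -
      assume c: "conv d w x = (LINT y|lborel. kern d (x - y) * w y)"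
      have "(LINT y|lborel. cis (x * \<xi>) * of_real (f x * (kern d (x - y) * w y))) =
          cis (x * \<xi>) * (LINT y|lborel. complex_of_real (f x * (kern d (x - y) * w y)))"
        by (rule integral_mult_right_zero)
      also have "(LINT y|lborel. complex_of_real (f x * (kern d (x - y) * w y))) = of_real (LINT y|lborel. f x * (kern d (x - y) * w y))"
        by (rule integral_complex_of_real)
      also have "(LINT y|lborel. f x * (kern d (x - y) * w y)) = f x * conv d w x"
        unfolding c by (rule integral_mult_right_zero)
      finally show ?thesis .
    qed
  qed
  finally have "(LINT y|lborel. of_real (w y) * (LINT x|lborel. cis (x * \<xi>) * of_real (f x * kern d (x - y)))) =
     (LINT x|lborel. cis (x * \<xi>) * of_real (f x * conv d w x))" .
  then show ?thesis unfolding hat_def inv_fourier_def by (simp add: mult.left_commute)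
qed

text \<open>By Fubini the mollifier passes from the rough product to the weight. Integrating the
  mollified product of f and G against w is pairing G with f times the mollified w, so mollification
  and multiplication by f never have to be commuted.\<close>

lemma pairing_conv:
  assumes G: "dual G" and f: "cls Lf Mf f" "Lf \<ge> 0" "Mf \<ge> 0"
    and w: "continuous_on UNIV w" "\<And>y. R < \<bar>y\<bar> \<Longrightarrow> w y = 0" "R \<ge> 0" and d: "d > 0"
  shows "integrable lborel (\<lambda>y. of_real (w y) * pairing G (\<lambda>x. f x * kern d (x - y)))"
    "(LINT y|lborel. of_real (w y) * pairing G (\<lambda>x. f x * kern d (x - y))) = pairing G (\<lambda>x. f x * conv d w x)"
proof -
  have fc: "continuous_on UNIV f" using f by (simp add: cls_def)
  have [measurable]: "f \<in> borel_measurable borel" "w \<in> borel_measurable borel" "G \<in> borel_measurable borel"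
    using fc w(1) G by (auto intro: borel_measurable_continuous_onI simp: dual_def)
  have "ucls {-R..R} (\<lambda>y. f)" using f by (intro uclsI) auto
  moreover have "ucls {-R..R} (\<lambda>y x. kern d (x - y))" by (rule ucls_reindex[OF ucls_kern[OF d], where g = "\<lambda>y. y"]) auto
  ultimately have "ucls {-R..R} (\<lambda>y x. f x * kern d (x - y))" by (rule ucls_mult)
  then obtain L M where a: "\<And>y. y \<in> {-R..R} \<Longrightarrow> adm (R + d) L M (\<lambda>x. f x * kern d (x - y))"
  proof (rule adm_of_ucls)
    show "R + d \<ge> 0" using w d by simp
    show "f x * kern d (x - y) = 0" if "y \<in> {-R..R}" "R + d < \<bar>x\<bar>" for y x
    proof -
      have "\<bar>y\<bar> \<le> R" using that by auto
      then have "d \<le> \<bar>x - y\<bar>" using that(2) by linarith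
      then show ?thesis using kern_zero[OF d, of "x - y"] by simp
    qed
  qed blast
  define H where "H y \<xi> = hat (\<lambda>x. f x * kern d (x - y)) \<xi>" for y \<xi>
  have Hm [measurable]: "(\<lambda>(y, \<xi>). H y \<xi>) \<in> borel_measurable (borel \<Otimes>\<^sub>M borel)"
    unfolding H_def hat_def inv_fourier_def by measurable
  define K where "K = nrm G * adm_const (R + d) L M"
  have int: "integrable (lborel \<Otimes>\<^sub>M lborel) (\<lambda>(y, \<xi>). of_real (w y) * (G \<xi> * H y \<xi>))"
  proof (subst integrable_iff_bounded, intro conjI)
    show m: "(\<lambda>(y, \<xi>). of_real (w y) * (G \<xi> * H y \<xi>)) \<in> borel_measurable (lborel \<Otimes>\<^sub>M lborel)"
      by measurable
    have "(\<integral>\<^sup>+p. ennreal (norm (case p of (y, \<xi>) \<Rightarrow> of_real (w y) * (G \<xi> * H y \<xi>))) \<partial>(lborel \<Otimes>\<^sub>M lborel)) =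
        (\<integral>\<^sup>+y. \<integral>\<^sup>+\<xi>. ennreal (norm (of_real (w y) * (G \<xi> * H y \<xi>))) \<partial>lborel \<partial>lborel)"
      by (subst lborel.nn_integral_fst[symmetric]) auto
    also have "\<dots> \<le> (\<integral>\<^sup>+y. ennreal \<bar>w y\<bar> * ennreal K \<partial>lborel)"
    proof (rule nn_integral_mono)
      fix y
      show "(\<integral>\<^sup>+\<xi>. ennreal (norm (of_real (w y) * (G \<xi> * H y \<xi>))) \<partial>lborel) \<le> ennreal \<bar>w y\<bar> * ennreal K"
      proof (cases "R < \<bar>y\<bar>")
        case False
        then have y: "y \<in> {-R..R}" by auto
        have "(\<integral>\<^sup>+\<xi>. ennreal (norm (of_real (w y) * (G \<xi> * H y \<xi>))) \<partial>lborel) = ennreal \<bar>w y\<bar> * (\<integral>\<^sup>+\<xi>. ennreal (cmod (G \<xi> * H y \<xi>)) \<partial>lborel)"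
          by (subst nn_integral_cmult[symmetric]) (auto simp: norm_mult ennreal_mult)
        also have "\<dots> \<le> ennreal \<bar>w y\<bar> * ennreal K"
          unfolding H_def K_def by (intro mult_left_mono pairing_nn_bound[OF G a[OF y]]) auto
        finally show ?thesis .
      qed (simp add: w)
    qed
    also have "\<dots> = (\<integral>\<^sup>+y. ennreal \<bar>w y\<bar> \<partial>lborel) * ennreal K" by (rule nn_integral_multc) measurable
    also have "\<dots> < \<infinity>"
    proof -
      have "integrable lborel w" by (rule integrable_compact_support[OF w(1,2)])
      then show ?thesis by (simp add: integrable_iff_bounded ennreal_mult_less_top)
    qed
    finally show "(\<integral>\<^sup>+p. ennreal (norm (case p of (y, \<xi>) \<Rightarrow> of_real (w y) * (G \<xi> * H y \<xi>))) \<partial>(lborel \<Otimes>\<^sub>M lborel)) < \<infinity>" .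
  qed
  have p: "of_real (w y) * pairing G (\<lambda>x. f x * kern d (x - y)) = (LINT \<xi>|lborel. of_real (w y) * (G \<xi> * H y \<xi>))" for y
    by (simp add: pairing_def H_def)
  show "integrable lborel (\<lambda>y. of_real (w y) * pairing G (\<lambda>x. f x * kern d (x - y)))"
    unfolding p by (rule lborel_pair.integrable_fst[OF int])
  have "(LINT y|lborel. of_real (w y) * pairing G (\<lambda>x. f x * kern d (x - y))) = (LINT \<xi>|lborel. LINT y|lborel. of_real (w y) * (G \<xi> * H y \<xi>))"
    unfolding p by (rule lborel_pair.Fubini_integral[OF int, symmetric])
  also have "\<dots> = (LINT \<xi>|lborel. G \<xi> * (LINT y|lborel. of_real (w y) * H y \<xi>))"
    by (simp add: mult.left_commute)
  also have "\<dots> = pairing G (\<lambda>x. f x * conv d w x)"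
    unfolding H_def pairing_def
    by (intro Bochner_Integration.integral_cong refl arg_cong2[where f = "(*)"] hat_conv[OF fc w(1,2) d])
  finally show "(LINT y|lborel. of_real (w y) * pairing G (\<lambda>x. f x * kern d (x - y))) = pairing G (\<lambda>x. f x * conv d w x)" .
qed

end

section \<open>The momentum density\<close>

text \<open>The reciprocal of the Lagrangian density. Up to sign, \<open>mom\<close> and
  \<open>flux\<close> are the stress tensor components for translations in x; the constant -1 makes
  the flux vanish at rest.\<close>

definition iq :: "real \<Rightarrow> real \<Rightarrow> real" where "iq a b = 1 / sqrt (1 + a\<^sup>2 - b\<^sup>2)"

definition mom :: "real \<Rightarrow> real \<Rightarrow> real" where "mom a b = a * b * iq a b"

text \<open>The suffixes a and b stand for partial derivatives. The cube of \<open>iq\<close>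
  appears once all terms are brought to the same power of the root.\<close>

definition mom_a :: "real \<Rightarrow> real \<Rightarrow> real" where "mom_a a b = b * (1 - b\<^sup>2) * iq a b ^ 3"

definition mom_b :: "real \<Rightarrow> real \<Rightarrow> real" where "mom_b a b = a * (1 + a\<^sup>2) * iq a b ^ 3"

definition flux :: "real \<Rightarrow> real \<Rightarrow> real" where "flux a b = (1 - b\<^sup>2) * iq a b - 1"

definition flux_a :: "real \<Rightarrow> real \<Rightarrow> real" where "flux_a a b = - ((1 - b\<^sup>2) * a * iq a b ^ 3)"

definition flux_b :: "real \<Rightarrow> real \<Rightarrow> real" where "flux_b a b = b * (b\<^sup>2 - 1 - 2 * a\<^sup>2) * iq a b ^ 3"

lemma radicand_ge:
  fixes a b :: real assumes "\<bar>b\<bar> \<le> 1 / 4" shows "1 / 4 \<le> 1 + a\<^sup>2 - b\<^sup>2"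
proof -
  have "b\<^sup>2 \<le> (1 / 4)\<^sup>2" using power_mono[OF assms, of 2] by simp
  then have "b\<^sup>2 \<le> 1 / 16" by (simp add: power_divide)
  then show ?thesis using zero_le_power2[of a] by linarith
qed

lemma iq_facts:
  assumes "\<bar>b\<bar> \<le> 1 / 4"
  shows "iq a b > 0" "(iq a b)\<^sup>2 * (1 + a\<^sup>2 - b\<^sup>2) = 1"
proof -
  have v: "1 / 4 \<le> 1 + a\<^sup>2 - b\<^sup>2" by (rule radicand_ge[OF assms])
  then show "iq a b > 0" by (simp add: iq_def)
  show "(iq a b)\<^sup>2 * (1 + a\<^sup>2 - b\<^sup>2) = 1" using v by (simp add: iq_def power_divide)
qed

lemma iq_DERIV:
  assumes a: "(a has_real_derivative a') (at t)" and b: "(b has_real_derivative b') (at t)" and s: "\<bar>b t\<bar> \<le> 1 / 4"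
  shows "((\<lambda>t. iq (a t) (b t)) has_real_derivative - ((a t * a' - b t * b') * iq (a t) (b t) ^ 3)) (at t)"
proof -
  define v where "v = 1 + (a t)\<^sup>2 - (b t)\<^sup>2"
  have v: "v > 0" using radicand_ge[OF s, of "a t"] by (simp add: v_def)
  have d1: "((\<lambda>t. 1 + (a t)\<^sup>2 - (b t)\<^sup>2) has_real_derivative 2 * (a t * a' - b t * b')) (at t)"
    by (auto intro!: derivative_eq_intros a b simp: algebra_simps)
  have d2: "((\<lambda>t. sqrt (1 + (a t)\<^sup>2 - (b t)\<^sup>2)) has_real_derivative inverse (sqrt v) / 2 * (2 * (a t * a' - b t * b'))) (at t)"
    using DERIV_chain2[OF DERIV_real_sqrt d1] v by (simp add: v_def)
  have "((\<lambda>t. inverse (sqrt (1 + (a t)\<^sup>2 - (b t)\<^sup>2))) has_real_derivative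
      - (inverse (sqrt v) / 2 * (2 * (a t * a' - b t * b'))) * inverse ((sqrt v)\<^sup>2)) (at t)"
    using DERIV_inverse_fun[OF d2] v by (simp add: v_def power2_eq_square)
  moreover have "- (inverse (sqrt v) / 2 * (2 * (a t * a' - b t * b'))) * inverse ((sqrt v)\<^sup>2) =
      - ((a t * a' - b t * b') * (1 / sqrt v) ^ 3)"
  proof -
    have *: "- (inverse w / 2 * (2 * z)) * inverse (w\<^sup>2) = - (z * (1 / w) ^ 3)" if "w > 0" for w z :: real
      using that by (simp add: field_simps power2_eq_square power3_eq_cube)
    show ?thesis by (rule *) (use v in simp)
  qed
  ultimately show ?thesis unfolding iq_def v_def inverse_eq_divide[of "sqrt _"] by simp
qed

lemma mom_DERIV:
  assumes a: "(a has_real_derivative a') (at t)" and b: "(b has_real_derivative b') (at t)" and s: "\<bar>b t\<bar> \<le> 1 / 4"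
  shows "((\<lambda>t. mom (a t) (b t)) has_real_derivative mom_a (a t) (b t) * a' + mom_b (a t) (b t) * b') (at t)"
proof -
  define I x y where "I = iq (a t) (b t)" "x = a t" "y = b t"
  have q: "I\<^sup>2 * (1 + x\<^sup>2 - y\<^sup>2) = 1" unfolding I_x_y_def by (rule iq_facts(2)[OF s])
  have "((\<lambda>t. a t * b t * iq (a t) (b t)) has_real_derivative
      (a' * b t + b' * a t) * iq (a t) (b t) + - ((a t * a' - b t * b') * iq (a t) (b t) ^ 3) * (a t * b t)) (at t)"
    by (intro DERIV_mult a b iq_DERIV s)
  moreover have "(a' * y + b' * x) * I + - ((x * a' - y * b') * I ^ 3) * (x * y) =
      (y * (1 - y\<^sup>2) * I ^ 3) * a' + (x * (1 + x\<^sup>2) * I ^ 3) * b'"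
  proof -
    \<comment> \<open>Multiplying by I^2 (1 + x^2 - y^2) = 1 raises the term to the third power of
      I, after which the identity is polynomial.\<close>
    have "(a' * y + b' * x) * I = (a' * y + b' * x) * I * (I\<^sup>2 * (1 + x\<^sup>2 - y\<^sup>2))" unfolding q by simp
    also have "\<dots> + - ((x * a' - y * b') * I ^ 3) * (x * y) = (y * (1 - y\<^sup>2) * I ^ 3) * a' + (x * (1 + x\<^sup>2) * I ^ 3) * b'"
      by (simp add: power2_eq_square power3_eq_cube algebra_simps)
    finally show ?thesis by simp
  qed
  ultimately show ?thesis unfolding mom_def mom_a_def mom_b_def I_x_y_def by simp
qed

lemma flux_DERIV:
  assumes a: "(a has_real_derivative a') (at t)" and b: "(b has_real_derivative b') (at t)" and s: "\<bar>b t\<bar> \<le> 1 / 4"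
  shows "((\<lambda>t. flux (a t) (b t)) has_real_derivative flux_a (a t) (b t) * a' + flux_b (a t) (b t) * b') (at t)"
proof -
  define I x y where "I = iq (a t) (b t)" "x = a t" "y = b t"
  have q: "I\<^sup>2 * (1 + x\<^sup>2 - y\<^sup>2) = 1" unfolding I_x_y_def by (rule iq_facts(2)[OF s])
  have d: "((\<lambda>t. 1 - (b t)\<^sup>2) has_real_derivative - (2 * b t * b')) (at t)"
    by (auto intro!: derivative_eq_intros b)
  have "((\<lambda>t. (1 - (b t)\<^sup>2) * iq (a t) (b t) - 1) has_real_derivative
      (- (2 * b t * b') * iq (a t) (b t) + - ((a t * a' - b t * b') * iq (a t) (b t) ^ 3) * (1 - (b t)\<^sup>2)) - 0) (at t)"
    by (intro DERIV_diff DERIV_mult d iq_DERIV a b s DERIV_const)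
  moreover have "(- (2 * y * b') * I + - ((x * a' - y * b') * I ^ 3) * (1 - y\<^sup>2)) - 0 =
      - ((1 - y\<^sup>2) * x * I ^ 3) * a' + (y * (y\<^sup>2 - 1 - 2 * x\<^sup>2) * I ^ 3) * b'"
  proof -
    have "- (2 * y * b') * I = - (2 * y * b') * I * (I\<^sup>2 * (1 + x\<^sup>2 - y\<^sup>2))" unfolding q by simp
    also have "\<dots> + - ((x * a' - y * b') * I ^ 3) * (1 - y\<^sup>2) = - ((1 - y\<^sup>2) * x * I ^ 3) * a' + (y * (y\<^sup>2 - 1 - 2 * x\<^sup>2) * I ^ 3) * b'"
      by (simp add: power2_eq_square power3_eq_cube algebra_simps)
    finally show ?thesis by simp
  qed
  ultimately show ?thesis unfolding flux_def flux_a_def flux_b_def I_x_y_def by simp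
qed

lemma tendsto_iq:
  assumes "(a \<longlongrightarrow> x) F" "(b \<longlongrightarrow> y) F" "\<bar>y\<bar> \<le> 1 / 4"
  shows "((\<lambda>n. iq (a n) (b n)) \<longlongrightarrow> iq x y) F"
  unfolding iq_def using radicand_ge[OF assms(3), of x] by (intro tendsto_intros assms) auto

lemma tendsto_densities:
  assumes "(a \<longlongrightarrow> x) F" "(b \<longlongrightarrow> y) F" "\<bar>y\<bar> \<le> 1 / 4"
  shows "((\<lambda>n. mom (a n) (b n)) \<longlongrightarrow> mom x y) F" "((\<lambda>n. mom_a (a n) (b n)) \<longlongrightarrow> mom_a x y) F"
    "((\<lambda>n. mom_b (a n) (b n)) \<longlongrightarrow> mom_b x y) F" "((\<lambda>n. flux (a n) (b n)) \<longlongrightarrow> flux x y) F"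
    "((\<lambda>n. flux_a (a n) (b n)) \<longlongrightarrow> flux_a x y) F" "((\<lambda>n. flux_b (a n) (b n)) \<longlongrightarrow> flux_b x y) F"
  unfolding mom_def mom_a_def mom_b_def flux_def flux_a_def flux_b_def
  by (intro tendsto_intros tendsto_iq assms)+

text \<open>Coefficients of u_xx (here) and of the mixed derivative (\<open>drift\<close>) after the
  equation is divided by 1 + u_x^2 and solved for u_tt. The reciprocal is kept as a factor to fit
  the closure rules for multipliers.\<close>

definition speed :: "real \<Rightarrow> real \<Rightarrow> real" where "speed a b = (1 - b\<^sup>2) * (1 / (1 + a\<^sup>2))"

definition drift :: "real \<Rightarrow> real \<Rightarrow> real" where "drift a b = 2 * (a * b * (1 / (1 + a\<^sup>2)))"

text \<open>The momentum is conserved: with \<open>b\<^sub>t = speed * a\<^sub>x + drift * b\<^sub>x\<close> and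
  \<open>a\<^sub>t = b\<^sub>x\<close>, the coefficients of \<open>a\<^sub>x\<close> and \<open>b\<^sub>x\<close> in \<open>mom\<^sub>t + flux\<^sub>x\<close> vanish.\<close>

lemma momentum_cancellation:
  "speed a b * mom_b a b + flux_a a b = 0"
  "mom_a a b + drift a b * mom_b a b + flux_b a b = 0"
proof -
  have p: "1 + a\<^sup>2 > 0" by (simp add: add_pos_nonneg)
  have e: "1 / (1 + a\<^sup>2) * mom_b a b = a * iq a b ^ 3" using p by (simp add: mom_b_def)
  have "speed a b * mom_b a b = (1 - b\<^sup>2) * (1 / (1 + a\<^sup>2) * mom_b a b)" by (simp add: speed_def)
  then show "speed a b * mom_b a b + flux_a a b = 0" unfolding e by (simp add: flux_a_def)
  have "drift a b * mom_b a b = 2 * a * b * (1 / (1 + a\<^sup>2) * mom_b a b)" by (simp add: drift_def)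
  then show "mom_a a b + drift a b * mom_b a b + flux_b a b = 0"
    unfolding e by (simp add: flux_b_def mom_a_def power2_eq_square algebra_simps)
qed

context exponent
begin

lemma ucls_iq:
  assumes "ucls I f" "ucls I g" "\<And>i x. i \<in> I \<Longrightarrow> \<bar>g i x\<bar> \<le> 1 / 4"
  shows "ucls I (\<lambda>i x. iq (f i x) (g i x))"
proof -
  have u: "ucls I (\<lambda>i x. sqrt (1 + (f i x)\<^sup>2 - (g i x)\<^sup>2))"
    by (intro ucls_sqrt ucls_diff ucls_add ucls_const ucls_power assms radicand_ge)
  have "1 / 2 \<le> sqrt (1 + (f i x)\<^sup>2 - (g i x)\<^sup>2)" if "i \<in> I" for i x
    using radicand_ge[OF assms(3)[OF that, of x], of "f i x"] by (intro real_le_rsqrt) (simp add: power2_eq_square)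
  then show ?thesis unfolding iq_def by (intro ucls_inverse[OF u, of "1/2"]) auto
qed

lemma ucls_densities:
  assumes "ucls I f" "ucls I g" "\<And>i x. i \<in> I \<Longrightarrow> \<bar>g i x\<bar> \<le> 1 / 4"
  shows "ucls I (\<lambda>i x. mom (f i x) (g i x))" "ucls I (\<lambda>i x. mom_a (f i x) (g i x))"
    "ucls I (\<lambda>i x. mom_b (f i x) (g i x))" "ucls I (\<lambda>i x. flux (f i x) (g i x))"
    "ucls I (\<lambda>i x. flux_a (f i x) (g i x))" "ucls I (\<lambda>i x. flux_b (f i x) (g i x))"
proof -
  note c = ucls_mult ucls_diff ucls_add ucls_const ucls_power ucls_iq assms ucls_cmult[of _ _ "-1", simplified]
  show "ucls I (\<lambda>i x. mom (f i x) (g i x))" "ucls I (\<lambda>i x. mom_a (f i x) (g i x))"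
    "ucls I (\<lambda>i x. mom_b (f i x) (g i x))" "ucls I (\<lambda>i x. flux (f i x) (g i x))"
    "ucls I (\<lambda>i x. flux_a (f i x) (g i x))" "ucls I (\<lambda>i x. flux_b (f i x) (g i x))"
    unfolding mom_def mom_a_def mom_b_def flux_def flux_a_def flux_b_def by (intro c; assumption?)+
qed

lemma ucls_coefficients:
  assumes "ucls I f" "ucls I g"
  shows "ucls I (\<lambda>i x. 1 / (1 + (f i x)\<^sup>2))" "ucls I (\<lambda>i x. speed (f i x) (g i x))" "ucls I (\<lambda>i x. drift (f i x) (g i x))"
proof -
  show u: "ucls I (\<lambda>i x. 1 / (1 + (f i x)\<^sup>2))"
    by (rule ucls_inverse[where c = 1]) (intro ucls_add ucls_const ucls_power assms, auto)
  show "ucls I (\<lambda>i x. speed (f i x) (g i x))" "ucls I (\<lambda>i x. drift (f i x) (g i x))"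
    unfolding speed_def drift_def by (intro ucls_mult ucls_diff ucls_const ucls_power assms u)+
qed

end

section \<open>The momentum identity\<close>

lemma continuous_integral_parameter:
  fixes F :: "real \<Rightarrow> real \<Rightarrow> real"
  assumes w: "integrable lborel w"
    and m: "\<And>t. F t \<in> borel_measurable borel"
    and cont: "\<And>\<tau> t x. \<tau> \<longlonglongrightarrow> t \<Longrightarrow> (\<lambda>n. F (\<tau> n) x) \<longlonglongrightarrow> F t x"
    and bd: "\<And>t x. \<bar>F t x\<bar> \<le> w x"
  shows "continuous_on UNIV (\<lambda>t. LINT x|lborel. F t x)"
proof (rule continuous_on_sequentiallyI)
  fix \<tau> :: "nat \<Rightarrow> real" and t assume \<tau>: "\<tau> \<longlonglongrightarrow> t"
  show "(\<lambda>n. LINT x|lborel. F (\<tau> n) x) \<longlonglongrightarrow> (LINT x|lborel. F t x)"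
    by (rule integral_dominated_convergence[OF _ _ w]) (use m cont[OF \<tau>] bd in auto)
qed

lemma compact_support_deriv_zero:
  assumes "\<And>x. (f has_real_derivative f' x) (at x)" "\<And>x. R < \<bar>x\<bar> \<Longrightarrow> f x = 0" "R < \<bar>x\<bar>"
  shows "f' x = (0::real)"
proof -
  have "open {x. R < \<bar>x::real\<bar>}" by (intro open_Collect_less continuous_intros)
  then have "(f has_real_derivative 0) (at x)"
    using has_field_derivative_transform_within_open[of "\<lambda>_. 0" 0 x "{x. R < \<bar>x\<bar>}" f] assms by auto
  then show ?thesis using assms(1) DERIV_unique by blast
qed

text \<open>What the virial argument needs of a solution: uniform multiplier bounds for a and b,
  distributional derivatives \<open>Ga\<close> and \<open>Gb\<close> bounded in H^(r-1), and the
  system a_t = b_x, b_t = speed a_x + drift b_x. All derivatives are stated for mollifications,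
  where they exist classically.\<close>

locale flow = exponent +
  fixes A B :: "real \<Rightarrow> real \<Rightarrow> real" and Ga Gb :: "real \<Rightarrow> real \<Rightarrow> complex" and N :: real
  assumes uA: "ucls UNIV A" and uB: "ucls UNIV B"
    and smallA: "\<And>t x. \<bar>A t x\<bar> \<le> 1 / 4" and smallB: "\<And>t x. \<bar>B t x\<bar> \<le> 1 / 4"
    and contA: "\<And>\<tau> t x. \<tau> \<longlonglongrightarrow> t \<Longrightarrow> (\<lambda>n. A (\<tau> n) x) \<longlonglongrightarrow> A t x"
    and contB: "\<And>\<tau> t x. \<tau> \<longlonglongrightarrow> t \<Longrightarrow> (\<lambda>n. B (\<tau> n) x) \<longlonglongrightarrow> B t x"
    and dualA: "\<And>t. dual (Ga t)" and dualB: "\<And>t. dual (Gb t)"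
    and nrmA: "\<And>t. nrm (Ga t) \<le> N" and nrmB: "\<And>t. nrm (Gb t) \<le> N"
    and dxA: "\<And>d t y. d > 0 \<Longrightarrow> (conv d (A t) has_real_derivative Re (pairing (Ga t) (\<lambda>x. kern d (x - y)))) (at y)"
    and dxB: "\<And>d t y. d > 0 \<Longrightarrow> (conv d (B t) has_real_derivative Re (pairing (Gb t) (\<lambda>x. kern d (x - y)))) (at y)"
    and dtA: "\<And>d t y. d > 0 \<Longrightarrow> ((\<lambda>t. conv d (A t) y) has_real_derivative Re (pairing (Gb t) (\<lambda>x. kern d (x - y)))) (at t)"
    and dtB: "\<And>d t y. d > 0 \<Longrightarrow> ((\<lambda>t. conv d (B t) y) has_real_derivative
        Re (pairing (Ga t) (\<lambda>x. speed (A t x) (B t x) * kern d (x - y))) +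
        Re (pairing (Gb t) (\<lambda>x. drift (A t x) (B t x) * kern d (x - y)))) (at t)"
begin

definition cA :: "nat \<Rightarrow> real \<Rightarrow> real \<Rightarrow> real" where "cA n t = conv (1 / (real n + 1)) (A t)"

definition cB :: "nat \<Rightarrow> real \<Rightarrow> real \<Rightarrow> real" where "cB n t = conv (1 / (real n + 1)) (B t)"

lemma contA_x: "continuous_on UNIV (A t)" and contB_x: "continuous_on UNIV (B t)"
  using ucls_cont[OF uA] ucls_cont[OF uB] by auto

lemma cB_small: "\<bar>cB n t x\<bar> \<le> 1 / 4"
  unfolding cB_def by (rule conv_abs_le[OF contB_x smallB])

lemma cA_tendsto: "y \<longlonglongrightarrow> x \<Longrightarrow> (\<lambda>n. cA n t (y n)) \<longlonglongrightarrow> A t x"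
  and cB_tendsto: "y \<longlonglongrightarrow> x \<Longrightarrow> (\<lambda>n. cB n t (y n)) \<longlonglongrightarrow> B t x"
proof -
  assume y: "y \<longlonglongrightarrow> x"
  have d: "(\<lambda>n. 1 / (real n + 1)) \<longlonglongrightarrow> 0" by real_asymp
  show "(\<lambda>n. cA n t (y n)) \<longlonglongrightarrow> A t x"
    unfolding cA_def
    by (rule conv_tendsto[OF contA_x _ _ y d, where L = "1/4"])
      (use contA_x[of t] smallA in \<open>auto simp: continuous_on_eq_continuous_at intro: isCont_tendsto_compose\<close>)
  show "(\<lambda>n. cB n t (y n)) \<longlonglongrightarrow> B t x"
    unfolding cB_def
    by (rule conv_tendsto[OF contB_x _ _ y d, where L = "1/4"])
      (use contB_x[of t] smallB in \<open>auto simp: continuous_on_eq_continuous_at intro: isCont_tendsto_compose\<close>)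
qed

lemma cA_t: "\<tau> \<longlonglongrightarrow> t \<Longrightarrow> (\<lambda>k. cA n (\<tau> k) x) \<longlonglongrightarrow> cA n t x"
  and cB_t: "\<tau> \<longlonglongrightarrow> t \<Longrightarrow> (\<lambda>k. cB n (\<tau> k) x) \<longlonglongrightarrow> cB n t x"
proof -
  have d: "1 / (real n + 1) > 0" by simp
  assume \<tau>: "\<tau> \<longlonglongrightarrow> t"
  show "(\<lambda>k. cA n (\<tau> k) x) \<longlonglongrightarrow> cA n t x"
    unfolding cA_def by (rule isCont_tendsto_compose[OF DERIV_isCont[OF dtA[OF d]] \<tau>])
  show "(\<lambda>k. cB n (\<tau> k) x) \<longlonglongrightarrow> cB n t x"
    unfolding cB_def by (rule isCont_tendsto_compose[OF DERIV_isCont[OF dtB[OF d]] \<tau>])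
qed

lemma ucls_cA: "ucls UNIV (\<lambda>(n, t). cA n t)" and ucls_cB: "ucls UNIV (\<lambda>(n, t). cB n t)"
  unfolding cA_def cB_def case_prod_beta
  by (rule ucls_conv, rule ucls_reindex[OF uA], simp) (rule ucls_conv, rule ucls_reindex[OF uB], simp)

section \<open>The momentum weighted by a compactly supported function\<close>

context
  fixes \<psi> \<psi>' :: "real \<Rightarrow> real" and R :: real
  assumes \<psi>: "\<And>x. (\<psi> has_real_derivative \<psi>' x) (at x)" and \<psi>'_cont: "continuous_on UNIV \<psi>'"
    and R: "R > 0" and \<psi>_supp: "\<And>x. R < \<bar>x\<bar> \<Longrightarrow> \<psi> x = 0"
begin

lemma \<psi>'_supp: "R < \<bar>x\<bar> \<Longrightarrow> \<psi>' x = 0"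
  by (rule compact_support_deriv_zero[OF \<psi> \<psi>_supp])

lemma \<psi>_cont: "continuous_on UNIV \<psi>"
  by (rule DERIV_continuous_on[OF \<psi>])

lemma ucls_\<psi>: "ucls I (\<lambda>i. \<psi>)"
proof -
  obtain K where K: "K > 0" "\<And>x. norm (\<psi>' x) \<le> K" by (rule bounded_compact_support[OF \<psi>'_cont \<psi>'_supp]) auto
  obtain L where L: "L > 0" "\<And>x. norm (\<psi> x) \<le> L" by (rule bounded_compact_support[OF \<psi>_cont \<psi>_supp]) auto
  show ?thesis
    by (rule ucls_lipschitz_support[where K = K and B = L and R = R and c = "\<lambda>_. 0"])
      (use K L R \<psi>_supp DERIV_bounded_lipschitz[OF \<psi>, of K] in auto)
qed

lemma integrable_\<psi>_mult:
  fixes f :: "real \<Rightarrow> real"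
  assumes "continuous_on UNIV f"
  shows "integrable lborel (\<lambda>x. \<psi> x * f x)" "integrable lborel (\<lambda>x. \<psi>' x * f x)"
  using integrable_compact_support[where R = R and f = "\<lambda>x. \<psi> x * f x"] integrable_compact_support[where R = R and f = "\<lambda>x. \<psi>' x * f x"]
    \<psi>_supp \<psi>'_supp assms \<psi>_cont \<psi>'_cont by (auto intro: continuous_on_mult)

text \<open>The multipliers after a second mollification, as they arise from \<open>pairing_conv\<close>.\<close>

definition weight :: "(real \<Rightarrow> real \<Rightarrow> real) \<Rightarrow> nat \<Rightarrow> real \<Rightarrow> real \<Rightarrow> real" where
  "weight \<phi> n t = conv (1 / (real n + 1)) (\<lambda>x. \<psi> x * \<phi> (cA n t x) (cB n t x))"

text \<open>The time derivative of \<open>Phi n\<close> minus \<open>Flux n\<close>. It would vanish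
  if mollification commuted with the nonlinear coefficients.\<close>

definition remainder :: "nat \<Rightarrow> real \<Rightarrow> real" where
  "remainder n t = Re (pairing (Gb t) (\<lambda>x. 1 * weight mom_a n t x)) +
     (Re (pairing (Ga t) (\<lambda>x. speed (A t x) (B t x) * weight mom_b n t x)) +
      Re (pairing (Gb t) (\<lambda>x. drift (A t x) (B t x) * weight mom_b n t x))) +
     (Re (pairing (Ga t) (\<lambda>x. 1 * weight flux_a n t x)) + Re (pairing (Gb t) (\<lambda>x. 1 * weight flux_b n t x)))"

text \<open>The three facts about a density that the limit in n uses: multiplier bounds along the
  mollified pairs, continuity, and multiplier bounds for the limit.\<close>

definition good :: "(real \<Rightarrow> real \<Rightarrow> real) \<Rightarrow> bool" where
  "good \<phi> \<longleftrightarrow> ucls UNIV (\<lambda>i::nat \<times> real. \<lambda>x. \<phi> (cA (fst i) (snd i) x) (cB (fst i) (snd i) x)) \<and>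
     (\<forall>a b x y. a \<longlonglongrightarrow> x \<longrightarrow> b \<longlonglongrightarrow> y \<longrightarrow> \<bar>y\<bar> \<le> 1 / 4 \<longrightarrow> (\<lambda>n. \<phi> (a n) (b n)) \<longlonglongrightarrow> \<phi> x y) \<and>
     ucls UNIV (\<lambda>t x. \<phi> (A t x) (B t x))"

lemma good_densities: "good mom" "good mom_a" "good mom_b" "good flux" "good flux_a" "good flux_b"
proof -
  have a: "ucls UNIV (\<lambda>i::nat \<times> real. cA (fst i) (snd i))" and b: "ucls UNIV (\<lambda>i::nat \<times> real. cB (fst i) (snd i))"
    using ucls_cA ucls_cB by (simp_all add: case_prod_beta')
  note d = ucls_densities[OF a b cB_small] ucls_densities[OF uA uB smallB]
  show "good mom" "good mom_a" "good mom_b" "good flux" "good flux_a" "good flux_b"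
    unfolding good_def using d by (auto intro: tendsto_densities)
qed

lemma good_cont: "good \<phi> \<Longrightarrow> continuous_on UNIV (\<lambda>x. \<phi> (cA n t x) (cB n t x))"
  using ucls_cont[of UNIV "\<lambda>i::nat \<times> real. \<lambda>x. \<phi> (cA (fst i) (snd i) x) (cB (fst i) (snd i) x)" "(n, t)"]
  unfolding good_def by simp

lemma good_cont0: "good \<phi> \<Longrightarrow> continuous_on UNIV (\<lambda>x. \<phi> (A t x) (B t x))"
  using ucls_cont[of UNIV "\<lambda>t x. \<phi> (A t x) (B t x)" t] unfolding good_def by simp

lemma good_bound:
  assumes "good \<phi>"
  obtains C where "C \<ge> 0" "\<And>n t x. \<bar>\<phi> (cA n t x) (cB n t x)\<bar> \<le> C" "\<And>t x. \<bar>\<phi> (A t x) (B t x)\<bar> \<le> C"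
proof -
  obtain C1 where C1: "C1 \<ge> 0" "\<forall>i\<in>UNIV. \<forall>x. \<bar>\<phi> (cA (fst i) (snd i) x) (cB (fst i) (snd i) x)\<bar> \<le> C1"
    using assms ucls_bounded unfolding good_def by meson
  obtain C2 where C2: "C2 \<ge> 0" "\<forall>t\<in>UNIV. \<forall>x. \<bar>\<phi> (A t x) (B t x)\<bar> \<le> C2"
    using assms ucls_bounded unfolding good_def by meson
  show thesis
  proof (rule that[of "max C1 C2"])
    show "\<bar>\<phi> (cA n t x) (cB n t x)\<bar> \<le> max C1 C2" for n t x using C1(2)[rule_format, of "(n, t)" x] by simp
    show "\<bar>\<phi> (A t x) (B t x)\<bar> \<le> max C1 C2" for t x using C2(2)[rule_format, of t x] by simp
  qed (use C1 in simp)
qed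

lemma good_lim: "good \<phi> \<Longrightarrow> a \<longlonglongrightarrow> x \<Longrightarrow> b \<longlonglongrightarrow> y \<Longrightarrow> \<bar>y\<bar> \<le> 1 / 4 \<Longrightarrow> (\<lambda>n. \<phi> (a n) (b n)) \<longlonglongrightarrow> \<phi> x y"
  unfolding good_def by blast

text \<open>Scales 1 / (n + 1) enlarge the support by at most 1, whence R + 1. The sequence and its
  limit are given the same constants because \<open>pairing_tendsto_right\<close> asks for
  them.\<close>

lemma weight_adm:
  assumes \<phi>: "good \<phi>" and c: "ucls UNIV (\<lambda>t x. c (A t x) (B t x))"
  obtains L M where "\<And>n t. adm (R + 1) L M (\<lambda>x. c (A t x) (B t x) * weight \<phi> n t x)"
    "\<And>t. adm (R + 1) L M (\<lambda>x. c (A t x) (B t x) * (\<psi> x * \<phi> (A t x) (B t x)))"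
proof -
  have 1: "ucls UNIV (\<lambda>(n, t) x. c (A t x) (B t x) * weight \<phi> n t x)"
  proof -
    have "ucls UNIV (\<lambda>i::nat \<times> real. conv (1 / (real (fst i) + 1)) (\<lambda>x. \<psi> x * \<phi> (cA (fst i) (snd i) x) (cB (fst i) (snd i) x)))"
      using \<phi> unfolding good_def by (intro ucls_conv ucls_mult ucls_\<psi>) auto
    from ucls_mult[OF ucls_reindex[OF c, of UNIV "snd :: nat \<times> real \<Rightarrow> real"] this]
    show ?thesis by (simp add: weight_def case_prod_beta')
  qed
  have 2: "ucls UNIV (\<lambda>t x. c (A t x) (B t x) * (\<psi> x * \<phi> (A t x) (B t x)))"
    using \<phi> unfolding good_def by (intro ucls_mult ucls_\<psi> c) auto
  obtain L1 M1 where a1: "\<And>i. adm (R + 1) L1 M1 (case i of (n, t) \<Rightarrow> \<lambda>x. c (A t x) (B t x) * weight \<phi> n t x)"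
  proof (rule adm_of_ucls[OF 1])
    show "R + 1 \<ge> 0" using R by simp
    fix i :: "nat \<times> real" and x :: real assume x: "R + 1 < \<bar>x\<bar>"
    have "weight \<phi> n t x = 0" for n t
      unfolding weight_def
    proof (rule conv_zero[where R = R])
      have "1 / (real n + 1) \<le> 1" by simp
      then show "R + 1 / (real n + 1) < \<bar>x\<bar>" using x by linarith
    qed (use \<psi>_supp in auto)
    then show "(case i of (n, t) \<Rightarrow> \<lambda>x. c (A t x) (B t x) * weight \<phi> n t x) x = 0" by (simp add: case_prod_beta)
  qed auto
  obtain L2 M2 where a2: "\<And>t. adm (R + 1) L2 M2 (\<lambda>x. c (A t x) (B t x) * (\<psi> x * \<phi> (A t x) (B t x)))"
  proof (rule adm_of_ucls[OF 2])
    show "R + 1 \<ge> 0" using R by simp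
  qed (use \<psi>_supp in auto)
  have mono: "adm (R + 1) (max L1 L2) (max M1 M2) h" if "adm (R + 1) L1 M1 h \<or> adm (R + 1) L2 M2 h" for h
    using that cls_mono[of _ _ h "max L1 L2" "max M1 M2"] by (auto simp: adm_def)
  show thesis
  proof (rule that)
    show "adm (R + 1) (max L1 L2) (max M1 M2) (\<lambda>x. c (A t x) (B t x) * weight \<phi> n t x)" for n t
      using a1[of "(n, t)"] mono by simp
    show "adm (R + 1) (max L1 L2) (max M1 M2) (\<lambda>x. c (A t x) (B t x) * (\<psi> x * \<phi> (A t x) (B t x)))" for t
      using a2[of t] mono by simp
  qed
qed

lemma weight_tendsto:
  assumes \<phi>: "good \<phi>"
  shows "(\<lambda>n. weight \<phi> n t x) \<longlonglongrightarrow> \<psi> x * \<phi> (A t x) (B t x)"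
proof -
  obtain C where C: "C \<ge> 0" "\<And>n t x. \<bar>\<phi> (cA n t x) (cB n t x)\<bar> \<le> C" by (rule good_bound[OF \<phi>]) blast
  obtain L where L: "L > 0" "\<And>x. norm (\<psi> x) \<le> L" by (rule bounded_compact_support[OF \<psi>_cont \<psi>_supp]) auto
  show ?thesis
    unfolding weight_def
  proof (rule conv_tendsto[where L = "L * C" and y = "\<lambda>_. x"])
    show "continuous_on UNIV (\<lambda>x. \<psi> x * \<phi> (cA n t x) (cB n t x))" for n
      by (intro continuous_on_mult \<psi>_cont good_cont \<phi>)
    show "(\<lambda>n. \<psi> (y n) * \<phi> (cA n t (y n)) (cB n t (y n))) \<longlonglongrightarrow> \<psi> x * \<phi> (A t x) (B t x)" if y: "y \<longlonglongrightarrow> x" for y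
      by (intro tendsto_mult good_lim[OF \<phi>] cA_tendsto cB_tendsto y smallB isCont_tendsto_compose[OF _ y])
        (use \<psi>_cont in \<open>simp add: continuous_on_eq_continuous_at\<close>)
    show "norm (\<psi> z * \<phi> (cA n t z) (cB n t z)) \<le> L * C" for n z
      using L C by (simp add: abs_mult mult_mono)
    show "(\<lambda>n. 1 / (real n + 1)) \<longlonglongrightarrow> 0" by real_asymp
  qed auto
qed

lemma pairing_weight:
  assumes \<phi>: "good \<phi>" and c: "ucls UNIV (\<lambda>t x. c (A t x) (B t x))" and G: "dual G" "nrm G \<le> N"
  shows "(\<lambda>n. pairing G (\<lambda>x. c (A t x) (B t x) * weight \<phi> n t x)) \<longlonglongrightarrow> pairing G (\<lambda>x. c (A t x) (B t x) * (\<psi> x * \<phi> (A t x) (B t x)))"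
proof -
  obtain L M where "\<And>n t. adm (R + 1) L M (\<lambda>x. c (A t x) (B t x) * weight \<phi> n t x)"
    "\<And>t. adm (R + 1) L M (\<lambda>x. c (A t x) (B t x) * (\<psi> x * \<phi> (A t x) (B t x)))"
    by (rule weight_adm[OF \<phi> c]) blast
  then show ?thesis by (intro pairing_tendsto_right[OF G(1)]) (auto intro!: tendsto_mult weight_tendsto \<phi>)
qed

lemma pairing_weight_bound:
  assumes \<phi>: "good \<phi>" and c: "ucls UNIV (\<lambda>t x. c (A t x) (B t x))"
  obtains K where "\<And>G n t. dual G \<Longrightarrow> nrm G \<le> N \<Longrightarrow> \<bar>Re (pairing G (\<lambda>x. c (A t x) (B t x) * weight \<phi> n t x))\<bar> \<le> K"
proof -
  obtain L M where a: "\<And>n t. adm (R + 1) L M (\<lambda>x. c (A t x) (B t x) * weight \<phi> n t x)"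
    by (rule weight_adm[OF \<phi> c]) blast
  show thesis
  proof (rule that)
    fix G n t assume G: "dual G" "nrm G \<le> N"
    have "\<bar>Re (pairing G (\<lambda>x. c (A t x) (B t x) * weight \<phi> n t x))\<bar> \<le> cmod (pairing G (\<lambda>x. c (A t x) (B t x) * weight \<phi> n t x))"
      by (rule abs_Re_le_cmod)
    also have "\<dots> \<le> nrm G * adm_const (R + 1) L M" by (rule pairing_bound[OF G(1) a])
    also have "\<dots> \<le> N * adm_const (R + 1) L M" by (intro mult_right_mono G adm_wsq(2)[OF a])
    finally show "\<bar>Re (pairing G (\<lambda>x. c (A t x) (B t x) * weight \<phi> n t x))\<bar> \<le> N * adm_const (R + 1) L M" .
  qed
qed

lemma ucls_one: "ucls UNIV (\<lambda>t x. (\<lambda>a b. 1) (A t x) (B t x))"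
  using ucls_const[of UNIV 1] by simp

lemma remainder_bounded: "\<exists>K. \<forall>n t. \<bar>remainder n t\<bar> \<le> K"
proof -
  note c = ucls_coefficients[OF uA uB]
  obtain K1 where K1: "\<And>G n t. dual G \<Longrightarrow> nrm G \<le> N \<Longrightarrow> \<bar>Re (pairing G (\<lambda>x. 1 * weight mom_a n t x))\<bar> \<le> K1"
    by (rule pairing_weight_bound[OF good_densities(2) ucls_one]) blast
  obtain K2 where K2: "\<And>G n t. dual G \<Longrightarrow> nrm G \<le> N \<Longrightarrow> \<bar>Re (pairing G (\<lambda>x. speed (A t x) (B t x) * weight mom_b n t x))\<bar> \<le> K2"
    by (rule pairing_weight_bound[OF good_densities(3) c(2)]) blast
  obtain K3 where K3: "\<And>G n t. dual G \<Longrightarrow> nrm G \<le> N \<Longrightarrow> \<bar>Re (pairing G (\<lambda>x. drift (A t x) (B t x) * weight mom_b n t x))\<bar> \<le> K3"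
    by (rule pairing_weight_bound[OF good_densities(3) c(3)]) blast
  obtain K4 where K4: "\<And>G n t. dual G \<Longrightarrow> nrm G \<le> N \<Longrightarrow> \<bar>Re (pairing G (\<lambda>x. 1 * weight flux_a n t x))\<bar> \<le> K4"
    by (rule pairing_weight_bound[OF good_densities(5) ucls_one]) blast
  obtain K5 where K5: "\<And>G n t. dual G \<Longrightarrow> nrm G \<le> N \<Longrightarrow> \<bar>Re (pairing G (\<lambda>x. 1 * weight flux_b n t x))\<bar> \<le> K5"
    by (rule pairing_weight_bound[OF good_densities(6) ucls_one]) blast
  have "\<bar>a + (b + c) + (d + e)\<bar> \<le> k1 + k2 + k3 + k4 + k5"
    if "\<bar>a\<bar> \<le> k1" "\<bar>b\<bar> \<le> k2" "\<bar>c\<bar> \<le> k3" "\<bar>d\<bar> \<le> k4" "\<bar>e\<bar> \<le> k5" for a b c d e k1 k2 k3 k4 k5 :: real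
    using that by arith
  note * = this
  have "\<bar>remainder n t\<bar> \<le> K1 + K2 + K3 + K4 + K5" for n t
    unfolding remainder_def by (intro * K1 K2 K3 K4 K5 dualA dualB nrmA nrmB)
  then show ?thesis by blast
qed

text \<open>At fixed t the distributions do not depend on n, and the multipliers converge.
  Collecting limits by distribution, the multiplier of \<open>Ga\<close> is \<psi> times speed mom_b
  + flux_a and that of \<open>Gb\<close> is \<psi> times mom_a + drift mom_b + flux_b; both vanish
  by \<open>momentum_cancellation\<close>.\<close>

lemma remainder_tendsto: "(\<lambda>n. remainder n t) \<longlonglongrightarrow> 0"
proof -
  note c = ucls_coefficients[OF uA uB]
  define \<psi>P where "\<psi>P \<phi> x = \<psi> x * \<phi> (A t x) (B t x)" for \<phi> :: "real \<Rightarrow> real \<Rightarrow> real" and x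
  have lim: "(\<lambda>n. remainder n t) \<longlonglongrightarrow> Re (pairing (Gb t) (\<lambda>x. 1 * \<psi>P mom_a x)) +
     (Re (pairing (Ga t) (\<lambda>x. speed (A t x) (B t x) * \<psi>P mom_b x)) +
      Re (pairing (Gb t) (\<lambda>x. drift (A t x) (B t x) * \<psi>P mom_b x))) +
     (Re (pairing (Ga t) (\<lambda>x. 1 * \<psi>P flux_a x)) + Re (pairing (Gb t) (\<lambda>x. 1 * \<psi>P flux_b x)))"
    unfolding remainder_def \<psi>P_def
    using pairing_weight[OF good_densities(2) ucls_one dualB nrmB, of t t] pairing_weight[OF good_densities(3) c(2) dualA nrmA, of t t]
      pairing_weight[OF good_densities(3) c(3) dualB nrmB, of t t] pairing_weight[OF good_densities(5) ucls_one dualA nrmA, of t t]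
      pairing_weight[OF good_densities(6) ucls_one dualB nrmB, of t t]
    by (intro tendsto_add tendsto_Re)
  obtain L1 M1 where a1: "\<And>t. adm (R + 1) L1 M1 (\<lambda>x. 1 * (\<psi> x * mom_a (A t x) (B t x)))" by (rule weight_adm[OF good_densities(2) ucls_one]) blast
  obtain L2 M2 where a2: "\<And>t. adm (R + 1) L2 M2 (\<lambda>x. speed (A t x) (B t x) * (\<psi> x * mom_b (A t x) (B t x)))" by (rule weight_adm[OF good_densities(3) c(2)]) blast
  obtain L3 M3 where a3: "\<And>t. adm (R + 1) L3 M3 (\<lambda>x. drift (A t x) (B t x) * (\<psi> x * mom_b (A t x) (B t x)))" by (rule weight_adm[OF good_densities(3) c(3)]) blast
  obtain L4 M4 where a4: "\<And>t. adm (R + 1) L4 M4 (\<lambda>x. 1 * (\<psi> x * flux_a (A t x) (B t x)))" by (rule weight_adm[OF good_densities(5) ucls_one]) blast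
  obtain L5 M5 where a5: "\<And>t. adm (R + 1) L5 M5 (\<lambda>x. 1 * (\<psi> x * flux_b (A t x) (B t x)))" by (rule weight_adm[OF good_densities(6) ucls_one]) blast
  have z: "pairing G (\<lambda>x. 0) = 0" for G using pairing_cmult[of G 0 "\<lambda>x. 0"] by simp
  have "pairing (Ga t) (\<lambda>x. speed (A t x) (B t x) * \<psi>P mom_b x) + pairing (Ga t) (\<lambda>x. 1 * \<psi>P flux_a x) =
      pairing (Ga t) (\<lambda>x. speed (A t x) (B t x) * \<psi>P mom_b x + 1 * \<psi>P flux_a x)"
    unfolding \<psi>P_def by (rule pairing_add[OF dualA a2 a4, symmetric])
  also have "(\<lambda>x. speed (A t x) (B t x) * \<psi>P mom_b x + 1 * \<psi>P flux_a x) = (\<lambda>x. 0)"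
  proof
    fix x
    have "speed (A t x) (B t x) * \<psi>P mom_b x + 1 * \<psi>P flux_a x =
        \<psi> x * (speed (A t x) (B t x) * mom_b (A t x) (B t x) + flux_a (A t x) (B t x))"
      by (simp add: \<psi>P_def algebra_simps)
    then show "speed (A t x) (B t x) * \<psi>P mom_b x + 1 * \<psi>P flux_a x = 0" unfolding momentum_cancellation by simp
  qed
  finally have za: "pairing (Ga t) (\<lambda>x. speed (A t x) (B t x) * \<psi>P mom_b x) + pairing (Ga t) (\<lambda>x. 1 * \<psi>P flux_a x) = 0"
    unfolding z .
  have s13: "pairing (Gb t) (\<lambda>x. 1 * \<psi>P mom_a x) + pairing (Gb t) (\<lambda>x. drift (A t x) (B t x) * \<psi>P mom_b x) =
      pairing (Gb t) (\<lambda>x. 1 * \<psi>P mom_a x + drift (A t x) (B t x) * \<psi>P mom_b x)"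
    unfolding \<psi>P_def by (rule pairing_add[OF dualB a1 a3, symmetric])
  \<comment> \<open>Additivity of the pairing holds for admissible multipliers, so the sum of two
    must be admissible before the third is added.\<close>
  obtain L6 M6 where a6: "adm (R + 1) L6 M6 (\<lambda>x. 1 * (\<psi> x * mom_a (A t x) (B t x)) + drift (A t x) (B t x) * (\<psi> x * mom_b (A t x) (B t x)))"
  proof (rule adm_of_ucls[of "{t}" "\<lambda>t x. 1 * (\<psi> x * mom_a (A t x) (B t x)) + drift (A t x) (B t x) * (\<psi> x * mom_b (A t x) (B t x))" "R + 1"])
    have u: "ucls {t} A" "ucls {t} B" by (rule ucls_reindex[OF uA, of "{t}" "\<lambda>t. t"], simp) (rule ucls_reindex[OF uB, of "{t}" "\<lambda>t. t"], simp)
    show "ucls {t} (\<lambda>t x. 1 * (\<psi> x * mom_a (A t x) (B t x)) + drift (A t x) (B t x) * (\<psi> x * mom_b (A t x) (B t x)))"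
      by (intro ucls_add ucls_mult ucls_const ucls_\<psi> ucls_densities u smallB ucls_coefficients)
  qed (use R \<psi>_supp in auto)
  have "pairing (Gb t) (\<lambda>x. 1 * \<psi>P mom_a x + drift (A t x) (B t x) * \<psi>P mom_b x) + pairing (Gb t) (\<lambda>x. 1 * \<psi>P flux_b x) =
      pairing (Gb t) (\<lambda>x. (1 * \<psi>P mom_a x + drift (A t x) (B t x) * \<psi>P mom_b x) + 1 * \<psi>P flux_b x)"
    unfolding \<psi>P_def by (rule pairing_add[OF dualB a6 a5, symmetric])
  also have "(\<lambda>x. (1 * \<psi>P mom_a x + drift (A t x) (B t x) * \<psi>P mom_b x) + 1 * \<psi>P flux_b x) = (\<lambda>x. 0)"
  proof
    fix x
    have "(1 * \<psi>P mom_a x + drift (A t x) (B t x) * \<psi>P mom_b x) + 1 * \<psi>P flux_b x =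
        \<psi> x * (mom_a (A t x) (B t x) + drift (A t x) (B t x) * mom_b (A t x) (B t x) + flux_b (A t x) (B t x))"
      by (simp add: \<psi>P_def algebra_simps)
    then show "(1 * \<psi>P mom_a x + drift (A t x) (B t x) * \<psi>P mom_b x) + 1 * \<psi>P flux_b x = 0" unfolding momentum_cancellation by simp
  qed
  finally have zb: "pairing (Gb t) (\<lambda>x. 1 * \<psi>P mom_a x) + pairing (Gb t) (\<lambda>x. drift (A t x) (B t x) * \<psi>P mom_b x) + pairing (Gb t) (\<lambda>x. 1 * \<psi>P flux_b x) = 0"
    unfolding z s13 .
  have "Re p + (Re q + Re s) + (Re u + Re v) = Re (q + u) + Re (p + s + v)" for p q s u v :: complex by simp
  note e = this
  show ?thesis using lim unfolding e za zb by simp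
qed

lemma Re_pairing_conv:
  assumes G: "dual G" and f: "cls Lf Mf f" "Lf \<ge> 0" "Mf \<ge> 0"
    and w: "continuous_on UNIV w" "\<forall>y. R < \<bar>y\<bar> \<longrightarrow> w y = 0" and d: "d > 0"
  shows "integrable lborel (\<lambda>y. w y * Re (pairing G (\<lambda>x. f x * kern d (x - y))))"
    "(LINT y|lborel. w y * Re (pairing G (\<lambda>x. f x * kern d (x - y)))) = Re (pairing G (\<lambda>x. f x * conv d w x))"
proof -
  have R0: "R \<ge> 0" using R by simp
  have p: "integrable lborel (\<lambda>y. of_real (w y) * pairing G (\<lambda>x. f x * kern d (x - y)))"
    "(LINT y|lborel. of_real (w y) * pairing G (\<lambda>x. f x * kern d (x - y))) = pairing G (\<lambda>x. f x * conv d w x)"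
    by (rule pairing_conv[OF G f w(1) _ R0 d], use w(2) in simp)+
  show "integrable lborel (\<lambda>y. w y * Re (pairing G (\<lambda>x. f x * kern d (x - y))))"
    using integrable_Re[OF p(1)] by simp
  show "(LINT y|lborel. w y * Re (pairing G (\<lambda>x. f x * kern d (x - y)))) = Re (pairing G (\<lambda>x. f x * conv d w x))"
    using integral_Re[OF p(1)] unfolding p(2) by simp
qed

lemma kern_pairing_bound:
  assumes c: "ucls UNIV (\<lambda>t x. c (A t x) (B t x))" and d: "d > 0"
  obtains K where "K \<ge> 0" "\<And>G t y. dual G \<Longrightarrow> nrm G \<le> N \<Longrightarrow> \<bar>y\<bar> \<le> R \<Longrightarrow>
    \<bar>Re (pairing G (\<lambda>x. c (A t x) (B t x) * kern d (x - y)))\<bar> \<le> K"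
proof -
  have "ucls (UNIV \<times> {-R..R}) (\<lambda>i x. c (A (fst i) x) (B (fst i) x) * kern d (x - snd i))"
    by (rule ucls_mult[OF ucls_reindex[OF c] ucls_reindex[OF ucls_kern[OF d]]]) auto
  then obtain L M where a: "\<And>i. i \<in> UNIV \<times> {-R..R} \<Longrightarrow> adm (R + d) L M (\<lambda>x. c (A (fst i) x) (B (fst i) x) * kern d (x - snd i))"
  proof (rule adm_of_ucls)
    show "R + d \<ge> 0" using R d by simp
    fix i :: "real \<times> real" and x :: real assume i: "i \<in> UNIV \<times> {-R..R}" "R + d < \<bar>x\<bar>"
    then have "\<bar>snd i\<bar> \<le> R" by (auto simp: abs_le_iff)
    then have "d \<le> \<bar>x - snd i\<bar>" using i(2) by linarith
    then show "c (A (fst i) x) (B (fst i) x) * kern d (x - snd i) = 0" using kern_zero[OF d] by simp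
  qed blast
  show thesis
  proof (rule that[of "\<bar>N\<bar> * adm_const (R + d) L M"])
    have "adm (R + d) L M (\<lambda>x. c (A 0 x) (B 0 x) * kern d (x - 0))" using a[of "(0, 0)"] R by simp
    then show "\<bar>N\<bar> * adm_const (R + d) L M \<ge> 0" using adm_wsq(2) by (intro mult_nonneg_nonneg) auto
    fix G t y assume G: "dual G" "nrm G \<le> N" and y: "\<bar>y\<bar> \<le> R"
    have ad: "adm (R + d) L M (\<lambda>x. c (A t x) (B t x) * kern d (x - y))" using a[of "(t, y)"] y by (simp add: abs_le_iff)
    have "\<bar>Re (pairing G (\<lambda>x. c (A t x) (B t x) * kern d (x - y)))\<bar> \<le> cmod (pairing G (\<lambda>x. c (A t x) (B t x) * kern d (x - y)))"
      by (rule abs_Re_le_cmod)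
    also have "\<dots> \<le> nrm G * adm_const (R + d) L M" by (rule pairing_bound[OF G(1) ad])
    also have "\<dots> \<le> \<bar>N\<bar> * adm_const (R + d) L M" using G by (intro mult_right_mono adm_wsq(2)[OF ad]) auto
    finally show "\<bar>Re (pairing G (\<lambda>x. c (A t x) (B t x) * kern d (x - y)))\<bar> \<le> \<bar>N\<bar> * adm_const (R + d) L M" .
  qed
qed

lemma kern_pairing_continuous:
  assumes G: "dual G" and d: "d > 0"
  shows "continuous_on UNIV (\<lambda>y. Re (pairing G (\<lambda>x. kern d (x - y))))"
proof (rule continuous_on_sequentiallyI)
  fix u :: "nat \<Rightarrow> real" and a assume u: "u \<longlonglongrightarrow> a"
  then obtain b where b: "b > 0" "\<And>n. \<bar>u n\<bar> \<le> b" using convergent_imp_Bseq[of u] unfolding convergent_def Bseq_def by auto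
  then have ab: "\<bar>a\<bar> \<le> b" using u by (intro LIMSEQ_le_const2[OF tendsto_rabs[OF u]]) auto
  have uc: "ucls {-b..b} (\<lambda>y x. kern d (x - y))"
    using ucls_reindex[OF ucls_kern[OF d], of "{-b..b}" "\<lambda>y. y"] by simp
  obtain L M where ad: "\<And>y. y \<in> {-b..b} \<Longrightarrow> adm (b + d) L M (\<lambda>x. kern d (x - y))"
  proof (rule adm_of_ucls[OF uc])
    show "b + d \<ge> 0" using b d by simp
    fix y x :: real assume y: "y \<in> {-b..b}" "b + d < \<bar>x\<bar>"
    then have "\<bar>y\<bar> \<le> b" by (auto simp: abs_le_iff)
    then have "d \<le> \<bar>x - y\<bar>" using y(2) by linarith
    then show "kern d (x - y) = 0" using kern_zero[OF d] by simp
  qed blast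
  have m: "u n \<in> {-b..b}" "a \<in> {-b..b}" for n using b(2)[of n] ab by (auto simp: abs_le_iff)
  have "(\<lambda>n. pairing G (\<lambda>x. kern d (x - u n))) \<longlonglongrightarrow> pairing G (\<lambda>x. kern d (x - a))"
  proof (rule pairing_tendsto_right[OF G ad[OF m(1)] ad[OF m(2)]])
    show "(\<lambda>n. kern d (x - u n)) \<longlonglongrightarrow> kern d (x - a)" for x
      by (rule isCont_tendsto_compose[OF DERIV_isCont[OF kern_DERIV[OF d]]]) (intro tendsto_intros u)
  qed
  then show "(\<lambda>n. Re (pairing G (\<lambda>x. kern d (x - u n)))) \<longlonglongrightarrow> Re (pairing G (\<lambda>x. kern d (x - a)))"
    by (rule tendsto_Re)
qed

definition Phi :: "nat \<Rightarrow> real \<Rightarrow> real" where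
  "Phi n t = (LINT x|lborel. \<psi> x * mom (cA n t x) (cB n t x))"

definition Flux :: "nat \<Rightarrow> real \<Rightarrow> real" where
  "Flux n t = (LINT x|lborel. \<psi>' x * flux (cA n t x) (cB n t x))"

text \<open>Before the limit everything is classical: differentiate under the integral by the chain
  rule. The derivatives of the mollified a and b are pairings with a kernel at x, and integration in
  x moves the kernels onto the weights.\<close>

lemma Phi_deriv:
  "(Phi n has_real_derivative Re (pairing (Gb t) (\<lambda>x. 1 * weight mom_a n t x)) +
     (Re (pairing (Ga t) (\<lambda>x. speed (A t x) (B t x) * weight mom_b n t x)) +
      Re (pairing (Gb t) (\<lambda>x. drift (A t x) (B t x) * weight mom_b n t x)))) (at t)"
proof -
  define d where "d = 1 / (real n + 1)"
  have d: "d > 0" by (simp add: d_def)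
  note c = ucls_coefficients[OF uA uB]
  define dA where "dA t y = Re (pairing (Gb t) (\<lambda>x. 1 * kern d (x - y)))" for t y
  define dB1 where "dB1 t y = Re (pairing (Ga t) (\<lambda>x. speed (A t x) (B t x) * kern d (x - y)))" for t y
  define dB2 where "dB2 t y = Re (pairing (Gb t) (\<lambda>x. drift (A t x) (B t x) * kern d (x - y)))" for t y
  obtain K1 where K1: "K1 \<ge> 0" "\<And>G t y. dual G \<Longrightarrow> nrm G \<le> N \<Longrightarrow> \<bar>y\<bar> \<le> R \<Longrightarrow> \<bar>Re (pairing G (\<lambda>x. 1 * kern d (x - y)))\<bar> \<le> K1"
    by (rule kern_pairing_bound[OF ucls_one d]) blast
  obtain K2 where K2: "K2 \<ge> 0" "\<And>G t y. dual G \<Longrightarrow> nrm G \<le> N \<Longrightarrow> \<bar>y\<bar> \<le> R \<Longrightarrow> \<bar>Re (pairing G (\<lambda>x. speed (A t x) (B t x) * kern d (x - y)))\<bar> \<le> K2"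
    by (rule kern_pairing_bound[OF c(2) d]) blast
  obtain K3 where K3: "K3 \<ge> 0" "\<And>G t y. dual G \<Longrightarrow> nrm G \<le> N \<Longrightarrow> \<bar>y\<bar> \<le> R \<Longrightarrow> \<bar>Re (pairing G (\<lambda>x. drift (A t x) (B t x) * kern d (x - y)))\<bar> \<le> K3"
    by (rule kern_pairing_bound[OF c(3) d]) blast
  obtain Ca where Ca: "Ca \<ge> 0" "\<And>n t x. \<bar>mom_a (cA n t x) (cB n t x)\<bar> \<le> Ca" by (rule good_bound[OF good_densities(2)]) blast
  obtain Cb where Cb: "Cb \<ge> 0" "\<And>n t x. \<bar>mom_b (cA n t x) (cB n t x)\<bar> \<le> Cb" by (rule good_bound[OF good_densities(3)]) blast
  define f' where "f' t x = \<psi> x * (mom_a (cA n t x) (cB n t x) * dA t x + mom_b (cA n t x) (cB n t x) * (dB1 t x + dB2 t x))" for t x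
  have der: "((\<lambda>t. \<psi> x * mom (cA n t x) (cB n t x)) has_vector_derivative f' t x) (at t)" for t x
  proof -
    have "((\<lambda>t. cA n t x) has_real_derivative dA t x) (at t)"
      using dtA[OF d] unfolding cA_def dA_def d_def by simp
    moreover have "((\<lambda>t. cB n t x) has_real_derivative dB1 t x + dB2 t x) (at t)"
      using dtB[OF d] unfolding cB_def dB1_def dB2_def d_def by simp
    ultimately have "((\<lambda>t. mom (cA n t x) (cB n t x)) has_real_derivative
        mom_a (cA n t x) (cB n t x) * dA t x + mom_b (cA n t x) (cB n t x) * (dB1 t x + dB2 t x)) (at t)"
      by (rule mom_DERIV) (rule cB_small)
    from DERIV_cmult[OF this, of "\<psi> x"] show ?thesis
      by (simp add: f'_def has_real_derivative_iff_has_vector_derivative)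
  qed
  have "((\<lambda>t. LINT x|lborel. \<psi> x * mom (cA n t x) (cB n t x)) has_vector_derivative (LINT x|lborel. f' t x)) (at t)"
  proof (rule has_vector_derivative_integral(2)[where e = 1, OF _ _ der])
    show "integrable lborel (\<lambda>x. \<psi> x * mom (cA n y x) (cB n y x))" for y
      by (intro integrable_\<psi>_mult good_cont good_densities)
    have "integrable lborel (\<lambda>x. \<psi> x * (Ca * K1 + Cb * (K2 + K3)))" by (intro integrable_\<psi>_mult continuous_intros)
    then show "integrable lborel (\<lambda>x. norm (\<psi> x * (Ca * K1 + Cb * (K2 + K3))))" by (rule integrable_norm)
    show "norm (f' y x) \<le> norm (\<psi> x * (Ca * K1 + Cb * (K2 + K3)))" for x y
    proof (cases "R < \<bar>x\<bar>")
      case False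
      then have x: "\<bar>x\<bar> \<le> R" by simp
      have "\<bar>mom_a (cA n y x) (cB n y x) * dA y x + mom_b (cA n y x) (cB n y x) * (dB1 y x + dB2 y x)\<bar> \<le>
          \<bar>mom_a (cA n y x) (cB n y x)\<bar> * \<bar>dA y x\<bar> + \<bar>mom_b (cA n y x) (cB n y x)\<bar> * (\<bar>dB1 y x\<bar> + \<bar>dB2 y x\<bar>)"
        by (rule order_trans[OF abs_triangle_ineq]) (auto simp: abs_mult intro!: mult_left_mono)
      also have "\<dots> \<le> Ca * K1 + Cb * (K2 + K3)"
        using Ca Cb K1(1) K2(1) K3(1) K1(2)[OF dualB nrmB x] K2(2)[OF dualA nrmA x] K3(2)[OF dualB nrmB x]
        unfolding dA_def dB1_def dB2_def by (intro add_mono mult_mono) auto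
      also have "\<dots> \<le> \<bar>Ca * K1 + Cb * (K2 + K3)\<bar>" by simp
      finally show ?thesis unfolding f'_def real_norm_def abs_mult by (rule mult_left_mono) simp
    qed (simp add: \<psi>_supp f'_def)
  qed simp
  moreover have "(LINT x|lborel. f' t x) = Re (pairing (Gb t) (\<lambda>x. 1 * weight mom_a n t x)) +
     (Re (pairing (Ga t) (\<lambda>x. speed (A t x) (B t x) * weight mom_b n t x)) +
      Re (pairing (Gb t) (\<lambda>x. drift (A t x) (B t x) * weight mom_b n t x)))"
  proof -
    have wa: "continuous_on UNIV (\<lambda>x. \<psi> x * mom_a (cA n t x) (cB n t x))" "\<forall>x. R < \<bar>x\<bar> \<longrightarrow> \<psi> x * mom_a (cA n t x) (cB n t x) = 0"
      by (intro continuous_on_mult \<psi>_cont good_cont good_densities) (simp add: \<psi>_supp)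
    have wb: "continuous_on UNIV (\<lambda>x. \<psi> x * mom_b (cA n t x) (cB n t x))" "\<forall>x. R < \<bar>x\<bar> \<longrightarrow> \<psi> x * mom_b (cA n t x) (cB n t x) = 0"
      by (intro continuous_on_mult \<psi>_cont good_cont good_densities) (simp add: \<psi>_supp)
    obtain L2 M2 where c2: "L2 \<ge> 0" "M2 \<ge> 0" "\<And>t. cls L2 M2 (\<lambda>x. speed (A t x) (B t x))" using c(2) unfolding ucls_def by blast
    obtain L3 M3 where c3: "L3 \<ge> 0" "M3 \<ge> 0" "\<And>t. cls L3 M3 (\<lambda>x. drift (A t x) (B t x))" using c(3) unfolding ucls_def by blast
    note p1 = Re_pairing_conv[OF dualB cls_one zero_le_one order_refl wa d, of t]
    note p2 = Re_pairing_conv[OF dualA c2(3) c2(1,2) wb d, of t t]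
    note p3 = Re_pairing_conv[OF dualB c3(3) c3(1,2) wb d, of t t]
    have e: "f' t = (\<lambda>x. (\<psi> x * mom_a (cA n t x) (cB n t x)) * dA t x + ((\<psi> x * mom_b (cA n t x) (cB n t x)) * dB1 t x +
        (\<psi> x * mom_b (cA n t x) (cB n t x)) * dB2 t x))"
      by (rule ext) (simp add: f'_def algebra_simps)
    show ?thesis
      unfolding e dA_def dB1_def dB2_def weight_def d_def[symmetric] p1(2)[symmetric] p2(2)[symmetric] p3(2)[symmetric]
      using p1(1) p2(1) p3(1) by (simp only: Bochner_Integration.integral_add Bochner_Integration.integrable_add)
  qed
  ultimately show ?thesis unfolding Phi_def[abs_def] has_real_derivative_iff_has_vector_derivative by simp
qed

text \<open>Integration by parts: the derivative of \<psi> times the mollified flux has integral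
  zero.\<close>

lemma Flux_eq:
  "Flux n t = - (Re (pairing (Ga t) (\<lambda>x. 1 * weight flux_a n t x)) + Re (pairing (Gb t) (\<lambda>x. 1 * weight flux_b n t x)))"
proof -
  define d where "d = 1 / (real n + 1)"
  have d: "d > 0" by (simp add: d_def)
  define dA where "dA y = Re (pairing (Ga t) (\<lambda>x. 1 * kern d (x - y)))" for y
  define dB where "dB y = Re (pairing (Gb t) (\<lambda>x. 1 * kern d (x - y)))" for y
  have cont: "continuous_on UNIV dA" "continuous_on UNIV dB"
    using kern_pairing_continuous[OF dualA d] kern_pairing_continuous[OF dualB d] by (simp_all add: dA_def[abs_def] dB_def[abs_def])
  define g where "g x = \<psi>' x * flux (cA n t x) (cB n t x) + ((\<psi> x * flux_a (cA n t x) (cB n t x)) * dA x + (\<psi> x * flux_b (cA n t x) (cB n t x)) * dB x)" for x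
  have der: "((\<lambda>x. \<psi> x * flux (cA n t x) (cB n t x)) has_vector_derivative g x) (at x)" for x
  proof -
    have "(cA n t has_real_derivative dA x) (at x)" using dxA[OF d] unfolding cA_def dA_def d_def by simp
    moreover have "(cB n t has_real_derivative dB x) (at x)" using dxB[OF d] unfolding cB_def dB_def d_def by simp
    ultimately have "((\<lambda>x. flux (cA n t x) (cB n t x)) has_real_derivative
        flux_a (cA n t x) (cB n t x) * dA x + flux_b (cA n t x) (cB n t x) * dB x) (at x)"
      by (rule flux_DERIV) (rule cB_small)
    from DERIV_mult[OF \<psi> this] show ?thesis
      unfolding has_real_derivative_iff_has_vector_derivative g_def by (simp add: algebra_simps)
  qed
  have wa: "continuous_on UNIV (\<lambda>x. \<psi> x * flux_a (cA n t x) (cB n t x))" "\<forall>x. R < \<bar>x\<bar> \<longrightarrow> \<psi> x * flux_a (cA n t x) (cB n t x) = 0"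
    by (intro continuous_on_mult \<psi>_cont good_cont good_densities) (simp add: \<psi>_supp)
  have wb: "continuous_on UNIV (\<lambda>x. \<psi> x * flux_b (cA n t x) (cB n t x))" "\<forall>x. R < \<bar>x\<bar> \<longrightarrow> \<psi> x * flux_b (cA n t x) (cB n t x) = 0"
    by (intro continuous_on_mult \<psi>_cont good_cont good_densities) (simp add: \<psi>_supp)
  have "continuous_on UNIV g"
    unfolding g_def by (intro continuous_intros wa wb cont \<psi>'_cont good_cont good_densities)
  then have "(LINT x|lborel. g x) = 0"
    by (rule integral_derivative_zero[OF der, where R = R]) (simp add: \<psi>_supp)
  note p1 = Re_pairing_conv[OF dualA cls_one zero_le_one order_refl wa d, of t]
  note p2 = Re_pairing_conv[OF dualB cls_one zero_le_one order_refl wb d, of t]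
  have "integrable lborel (\<lambda>x. \<psi>' x * flux (cA n t x) (cB n t x))" by (intro integrable_\<psi>_mult good_cont good_densities)
  then have "(LINT x|lborel. g x) = Flux n t + ((LINT x|lborel. (\<psi> x * flux_a (cA n t x) (cB n t x)) * dA x) + (LINT x|lborel. (\<psi> x * flux_b (cA n t x) (cB n t x)) * dB x))"
    unfolding g_def Flux_def dA_def dB_def using p1(1) p2(1)
    by (simp only: Bochner_Integration.integral_add Bochner_Integration.integrable_add)
  also have "(LINT x|lborel. (\<psi> x * flux_a (cA n t x) (cB n t x)) * dA x) = Re (pairing (Ga t) (\<lambda>x. 1 * weight flux_a n t x))"
    unfolding dA_def weight_def d_def[symmetric] by (rule p1(2))
  also have "(LINT x|lborel. (\<psi> x * flux_b (cA n t x) (cB n t x)) * dB x) = Re (pairing (Gb t) (\<lambda>x. 1 * weight flux_b n t x))"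
    unfolding dB_def weight_def d_def[symmetric] by (rule p2(2))
  finally show ?thesis using \<open>(LINT x|lborel. g x) = 0\<close> by simp
qed

text \<open>For each n this is the fundamental theorem of calculus with an additional integral of
  the remainder. The remainder is bounded uniformly in n and t and vanishes in the limit for each t,
  so dominated convergence in t removes it.\<close>

lemma momentum_identity:
  assumes ST: "S \<le> T"
  shows "(\<lambda>t. LINT x|lborel. \<psi>' x * flux (A t x) (B t x)) integrable_on {S..T}"
    "(LINT x|lborel. \<psi> x * mom (A T x) (B T x)) - (LINT x|lborel. \<psi> x * mom (A S x) (B S x)) =
     integral {S..T} (\<lambda>t. LINT x|lborel. \<psi>' x * flux (A t x) (B t x))"
proof -
  define Phi0 where "Phi0 t = (LINT x|lborel. \<psi> x * mom (A t x) (B t x))" for t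
  define Flux0 where "Flux0 t = (LINT x|lborel. \<psi>' x * flux (A t x) (B t x))" for t
  have PhiD: "(Phi n has_real_derivative remainder n t + Flux n t) (at t)" for n t
    using Phi_deriv[of n t] unfolding remainder_def Flux_eq by simp
  obtain Cf where Cf: "Cf \<ge> 0" "\<And>n t x. \<bar>flux (cA n t x) (cB n t x)\<bar> \<le> Cf" "\<And>t x. \<bar>flux (A t x) (B t x)\<bar> \<le> Cf"
    by (rule good_bound[OF good_densities(4)]) blast
  obtain Cm where Cm: "Cm \<ge> 0" "\<And>n t x. \<bar>mom (cA n t x) (cB n t x)\<bar> \<le> Cm" "\<And>t x. \<bar>mom (A t x) (B t x)\<bar> \<le> Cm"
    by (rule good_bound[OF good_densities(1)]) blast
  have w: "integrable lborel (\<lambda>x. \<bar>\<psi>' x\<bar> * Cf)" "integrable lborel (\<lambda>x. \<bar>\<psi> x\<bar> * Cm)"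
    using integrable_\<psi>_mult[OF continuous_on_const, of 1] by auto
  have meas: "(\<lambda>x. \<psi>' x * flux (cA n t x) (cB n t x)) \<in> borel_measurable borel" "(\<lambda>x. \<psi>' x * flux (A t x) (B t x)) \<in> borel_measurable borel"
    "(\<lambda>x. \<psi> x * mom (cA n t x) (cB n t x)) \<in> borel_measurable borel" "(\<lambda>x. \<psi> x * mom (A t x) (B t x)) \<in> borel_measurable borel" for n t
    by (intro borel_measurable_continuous_onI continuous_on_mult \<psi>_cont \<psi>'_cont good_cont good_cont0 good_densities)+
  have Flux_cont: "continuous_on UNIV (Flux n)" for n
    unfolding Flux_def
  proof (rule continuous_integral_parameter[OF w(1) meas(1)])
    show "(\<lambda>k. \<psi>' x * flux (cA n (\<tau> k) x) (cB n (\<tau> k) x)) \<longlonglongrightarrow> \<psi>' x * flux (cA n t x) (cB n t x)" if "\<tau> \<longlonglongrightarrow> t" for \<tau> t x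
      by (intro tendsto_mult tendsto_const good_lim[OF good_densities(4)] cA_t cB_t that cB_small)
    show "\<bar>\<psi>' x * flux (cA n t x) (cB n t x)\<bar> \<le> \<bar>\<psi>' x\<bar> * Cf" for t x using Cf by (simp add: abs_mult mult_left_mono)
  qed
  have Flux0_cont: "continuous_on UNIV Flux0"
    unfolding Flux0_def
  proof (rule continuous_integral_parameter[OF w(1) meas(2)])
    show "(\<lambda>k. \<psi>' x * flux (A (\<tau> k) x) (B (\<tau> k) x)) \<longlonglongrightarrow> \<psi>' x * flux (A t x) (B t x)" if "\<tau> \<longlonglongrightarrow> t" for \<tau> t x
      by (intro tendsto_mult tendsto_const good_lim[OF good_densities(4)] contA contB that smallB)
    show "\<bar>\<psi>' x * flux (A t x) (B t x)\<bar> \<le> \<bar>\<psi>' x\<bar> * Cf" for t x using Cf by (simp add: abs_mult mult_left_mono)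
  qed
  show "(\<lambda>t. LINT x|lborel. \<psi>' x * flux (A t x) (B t x)) integrable_on {S..T}"
    using Flux0_cont unfolding Flux0_def by (intro integrable_continuous_real) (auto intro: continuous_on_subset)
  have Fi: "Flux n integrable_on {S..T}" for n
    using Flux_cont by (intro integrable_continuous_real) (auto intro: continuous_on_subset)
  have Flux_lim: "(\<lambda>n. Flux n t) \<longlonglongrightarrow> Flux0 t" for t
    unfolding Flux_def Flux0_def
  proof (rule integral_dominated_convergence[OF _ _ w(1)])
    show "AE x in lborel. (\<lambda>n. \<psi>' x * flux (cA n t x) (cB n t x)) \<longlonglongrightarrow> \<psi>' x * flux (A t x) (B t x)"
      by (intro AE_I2 tendsto_mult tendsto_const good_lim[OF good_densities(4)] cA_tendsto cB_tendsto smallB)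
    show "AE x in lborel. norm (\<psi>' x * flux (cA n t x) (cB n t x)) \<le> \<bar>\<psi>' x\<bar> * Cf" for n
      using Cf by (simp add: abs_mult mult_left_mono)
  qed (use meas in auto)
  have Phi_lim: "(\<lambda>n. Phi n t) \<longlonglongrightarrow> Phi0 t" for t
    unfolding Phi_def Phi0_def
  proof (rule integral_dominated_convergence[OF _ _ w(2)])
    show "AE x in lborel. (\<lambda>n. \<psi> x * mom (cA n t x) (cB n t x)) \<longlonglongrightarrow> \<psi> x * mom (A t x) (B t x)"
      by (intro AE_I2 tendsto_mult tendsto_const good_lim[OF good_densities(1)] cA_tendsto cB_tendsto smallB)
    show "AE x in lborel. norm (\<psi> x * mom (cA n t x) (cB n t x)) \<le> \<bar>\<psi> x\<bar> * Cm" for n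
      using Cm by (simp add: abs_mult mult_left_mono)
  qed (use meas in auto)
  have FluxB: "\<bar>Flux n t\<bar> \<le> (LINT x|lborel. \<bar>\<psi>' x\<bar> * Cf)" for n t
  proof -
    have i: "integrable lborel (\<lambda>x. \<psi>' x * flux (cA n t x) (cB n t x))" by (intro integrable_\<psi>_mult good_cont good_densities)
    have "norm (Flux n t) \<le> (LINT x|lborel. norm (\<psi>' x * flux (cA n t x) (cB n t x)))"
      unfolding Flux_def by (rule Bochner_Integration.integral_norm_bound)
    also have "\<dots> \<le> (LINT x|lborel. \<bar>\<psi>' x\<bar> * Cf)"
      by (rule integral_mono[OF integrable_norm[OF i] w(1)]) (use Cf in \<open>simp add: abs_mult mult_left_mono\<close>)
    finally show ?thesis by simp
  qed
  have FTC: "((\<lambda>t. remainder n t + Flux n t) has_integral Phi n T - Phi n S) {S..T}" for n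
    using ST PhiD by (intro fundamental_theorem_of_calculus)
      (auto simp: has_real_derivative_iff_has_vector_derivative[symmetric] intro: has_field_derivative_at_within)
  \<comment> \<open>The remainder is integrable in t as a derivative minus a continuous function.
    The Henstock-Kurzweil integral admits the fundamental theorem for every derivative, so no
    regularity in t of the pairings enters.\<close>
  have Ri: "(remainder n has_integral (Phi n T - Phi n S - integral {S..T} (Flux n))) {S..T}" for n
    using has_integral_diff[OF FTC[of n] integrable_integral[OF Fi[of n]]] by simp
  obtain K where K: "\<And>n t. \<bar>remainder n t\<bar> \<le> K" using remainder_bounded by blast
  have "(\<lambda>n. integral {S..T} (remainder n)) \<longlonglongrightarrow> integral {S..T} (\<lambda>t. 0)"
    by (rule dominated_convergence(2)[where h = "\<lambda>_. K"]) (use Ri K remainder_tendsto in \<open>auto simp: has_integral_integrable\<close>)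
  then have l1: "(\<lambda>n. Phi n T - Phi n S - integral {S..T} (Flux n)) \<longlonglongrightarrow> 0"
    unfolding integral_unique[OF Ri] by simp
  have "(\<lambda>n. integral {S..T} (Flux n)) \<longlonglongrightarrow> integral {S..T} Flux0"
    by (rule dominated_convergence(2)[where h = "\<lambda>_. (LINT x|lborel. \<bar>\<psi>' x\<bar> * Cf)"]) (use Fi FluxB Flux_lim in auto)
  then have l2: "(\<lambda>n. Phi n T - Phi n S - integral {S..T} (Flux n)) \<longlonglongrightarrow> Phi0 T - Phi0 S - integral {S..T} Flux0"
    by (intro tendsto_diff Phi_lim)
  from LIMSEQ_unique[OF l1 l2]
  show "(LINT x|lborel. \<psi> x * mom (A T x) (B T x)) - (LINT x|lborel. \<psi> x * mom (A S x) (B S x)) =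
     integral {S..T} (\<lambda>t. LINT x|lborel. \<psi>' x * flux (A t x) (B t x))"
    unfolding Phi0_def Flux0_def by simp
qed

end

end

section \<open>The virial estimate\<close>

lemma iq_le:
  assumes "\<bar>b\<bar> \<le> 1 / 4" shows "iq a b \<le> 2"
proof -
  have v: "1 / 4 \<le> 1 + a\<^sup>2 - b\<^sup>2" by (rule radicand_ge[OF assms])
  have "1 / 2 \<le> sqrt (1 + a\<^sup>2 - b\<^sup>2)" using v by (intro real_le_rsqrt) (simp add: power_divide)
  moreover have "0 < sqrt (1 + a\<^sup>2 - b\<^sup>2)" using v by simp
  ultimately show ?thesis by (simp add: iq_def divide_le_eq del: real_sqrt_gt_0_iff)
qed

lemma mom_le:
  assumes "\<bar>b\<bar> \<le> 1 / 4" shows "\<bar>mom a b\<bar> \<le> a\<^sup>2 + b\<^sup>2"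
proof -
  have "\<bar>mom a b\<bar> = \<bar>a\<bar> * \<bar>b\<bar> * iq a b" using iq_facts(1)[OF assms, of a] by (simp add: mom_def abs_mult)
  also have "\<dots> \<le> \<bar>a\<bar> * \<bar>b\<bar> * 2" by (intro mult_left_mono iq_le assms) auto
  also have "\<dots> \<le> a\<^sup>2 + b\<^sup>2" using sum_squares_bound[of "\<bar>a\<bar>" "\<bar>b\<bar>"] by simp
  finally show ?thesis .
qed

text \<open>In terms of \<alpha> = a^2, \<beta> = b^2 and the root s, the lower bound follows by
  squaring, the upper one from s <= 1 + (\<alpha> - \<beta>) / 2. The 1/4 in the lower bound is the
  source of the factor 4 in the final constant.\<close>

lemma flux_bounds:
  assumes a: "\<bar>a\<bar> \<le> 1 / 4" and b: "\<bar>b\<bar> \<le> 1 / 4"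
  shows "(a\<^sup>2 + b\<^sup>2) / 4 \<le> - flux a b" "- flux a b \<le> a\<^sup>2 + b\<^sup>2"
proof -
  define \<alpha> \<beta> where "\<alpha> = a\<^sup>2" "\<beta> = b\<^sup>2"
  have "a\<^sup>2 \<le> (1/4)\<^sup>2" "b\<^sup>2 \<le> (1/4)\<^sup>2" using power_mono[OF a, of 2] power_mono[OF b, of 2] by simp_all
  then have ab: "0 \<le> \<alpha>" "0 \<le> \<beta>" "\<alpha> \<le> 1/16" "\<beta> \<le> 1/16" by (auto simp: \<alpha>_\<beta>_def power_divide)
  define s where "s = sqrt (1 + \<alpha> - \<beta>)"
  have s: "s > 0" "s\<^sup>2 = 1 + \<alpha> - \<beta>" using ab by (auto simp: s_def)
  have fl: "- flux a b = 1 - (1 - \<beta>) / s" by (simp add: flux_def iq_def s_def \<alpha>_\<beta>_def)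
  have q: "\<alpha>\<^sup>2 \<le> \<alpha>" "\<beta>\<^sup>2 \<le> \<beta>" using ab by (auto simp: power2_eq_square mult_left_le)
  have lower: "1 - \<beta> \<le> (1 - (\<alpha> + \<beta>) / 4) * s"
  proof (rule power2_le_imp_le)
    have "(1 - \<beta>)\<^sup>2 \<le> (1 - (\<alpha> + \<beta>) / 2) * (1 + \<alpha> - \<beta>)"
      using q ab by (simp add: power2_eq_square field_simps)
    also have "\<dots> \<le> (1 - (\<alpha> + \<beta>) / 4)\<^sup>2 * (1 + \<alpha> - \<beta>)"
    proof (rule mult_right_mono)
      have "(1 - (\<alpha> + \<beta>) / 4)\<^sup>2 = (1 - (\<alpha> + \<beta>) / 2) + ((\<alpha> + \<beta>) / 4)\<^sup>2" by (simp add: power2_eq_square field_simps)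
      then show "1 - (\<alpha> + \<beta>) / 2 \<le> (1 - (\<alpha> + \<beta>) / 4)\<^sup>2" by simp
    qed (use ab in auto)
    finally show "(1 - \<beta>)\<^sup>2 \<le> ((1 - (\<alpha> + \<beta>) / 4) * s)\<^sup>2" by (simp add: power_mult_distrib s)
    show "0 \<le> (1 - (\<alpha> + \<beta>) / 4) * s" using ab s by (intro mult_nonneg_nonneg) auto
  qed
  then have "(1 - \<beta>) / s \<le> 1 - (\<alpha> + \<beta>) / 4" using s by (simp add: divide_le_eq)
  then have "(\<alpha> + \<beta>) / 4 \<le> 1 - (1 - \<beta>) / s" by linarith
  then show "(a\<^sup>2 + b\<^sup>2) / 4 \<le> - flux a b" unfolding fl unfolding \<alpha>_\<beta>_def .
  have "s \<le> 1 + (\<alpha> - \<beta>) / 2"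
  proof (rule power2_le_imp_le)
    have "(1 + (\<alpha> - \<beta>) / 2)\<^sup>2 = 1 + \<alpha> - \<beta> + ((\<alpha> - \<beta>) / 2)\<^sup>2" by (simp add: power2_eq_square field_simps)
    then show "s\<^sup>2 \<le> (1 + (\<alpha> - \<beta>) / 2)\<^sup>2" using s by simp
    show "0 \<le> 1 + (\<alpha> - \<beta>) / 2" using ab by (simp add: field_simps)
  qed
  then have "(1 - \<alpha> - \<beta>) * s \<le> (1 - \<alpha> - \<beta>) * (1 + (\<alpha> - \<beta>) / 2)" using ab by (intro mult_left_mono) auto
  also have "\<dots> \<le> 1 - \<beta>"
  proof -
    have "(1 - \<beta>) - (1 - \<alpha> - \<beta>) * (1 + (\<alpha> - \<beta>) / 2) = (\<alpha> + (\<beta> - \<beta>\<^sup>2) + \<alpha>\<^sup>2) / 2"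
      by (simp add: power2_eq_square field_simps)
    moreover have "0 \<le> (\<alpha> + (\<beta> - \<beta>\<^sup>2) + \<alpha>\<^sup>2) / 2" using q ab by simp
    ultimately show ?thesis by simp
  qed
  finally have "1 - \<alpha> - \<beta> \<le> (1 - \<beta>) / s" using s by (simp add: le_divide_eq)
  then have "1 - (1 - \<beta>) / s \<le> \<alpha> + \<beta>" by linarith
  then show "- flux a b \<le> a\<^sup>2 + b\<^sup>2" unfolding fl unfolding \<alpha>_\<beta>_def .
qed

section \<open>The virial weight and its cutoff\<close>

lemma pos_part_square_DERIV: "((\<lambda>u::real. (max 0 u)\<^sup>2) has_real_derivative 2 * max 0 u) (at u)"
proof -
  consider "u > 0" | "u < 0" | "u = 0" by linarith
  then show ?thesis
  proof cases
    case 1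
    have "((\<lambda>u::real. u\<^sup>2) has_real_derivative 2 * max 0 u) (at u)" using 1 by (auto intro!: derivative_eq_intros)
    then show ?thesis by (rule has_field_derivative_transform_within_open[of _ _ _ "{0<..}"]) (use 1 in auto)
  next
    case 2
    have "((\<lambda>u::real. 0) has_real_derivative 2 * max 0 u) (at u)" using 2 by (auto intro!: derivative_eq_intros)
    then show ?thesis by (rule has_field_derivative_transform_within_open[of _ _ _ "{..<0}"]) (use 2 in auto)
  next
    case 3
    have "(\<lambda>h::real. ((max 0 (0 + h))\<^sup>2 - (max 0 0)\<^sup>2) / h) \<midarrow>0\<rightarrow> 0"
    proof (rule Lim_null_comparison)
      show "\<forall>\<^sub>F h in at 0. norm (((max 0 (0 + h))\<^sup>2 - (max 0 0)\<^sup>2) / h) \<le> \<bar>h :: real\<bar>"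
        by (intro always_eventually allI) (auto simp: max_def power2_eq_square)
      show "((\<lambda>h::real. \<bar>h\<bar>) \<longlongrightarrow> 0) (at 0)" by (auto intro!: tendsto_eq_intros)
    qed
    then show ?thesis unfolding 3 DERIV_def by simp
  qed
qed

text \<open>The momentum identity asks for a weight with continuous derivative, so the square of a
  positive part is smooth enough. It tends to 1 as R grows, with derivative of order 1 / R.\<close>

definition cut :: "real \<Rightarrow> real \<Rightarrow> real" where "cut R x = (max 0 (1 - (x / R)\<^sup>2))\<^sup>2"

definition cut' :: "real \<Rightarrow> real \<Rightarrow> real" where "cut' R x = 2 * max 0 (1 - (x / R)\<^sup>2) * (- (2 * x / R\<^sup>2))"

lemma cut_DERIV: "R > 0 \<Longrightarrow> (cut R has_real_derivative cut' R x) (at x)"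
proof -
  assume R: "R > 0"
  have "((\<lambda>x. 1 - (x / R)\<^sup>2) has_real_derivative - (2 * x / R\<^sup>2)) (at x)"
    using R by (auto intro!: derivative_eq_intros simp: power2_eq_square)
  from DERIV_chain2[OF pos_part_square_DERIV this] show ?thesis unfolding cut_def cut'_def .
qed

lemma cut_support: "R > 0 \<Longrightarrow> R < \<bar>x\<bar> \<Longrightarrow> cut R x = 0"
proof -
  assume R: "R > 0" "R < \<bar>x\<bar>"
  then have "1 \<le> \<bar>x / R\<bar>" by (simp add: abs_divide)
  then have "1 \<le> (x / R)\<^sup>2" using abs_le_square_iff[of 1 "x / R"] by simp
  then show ?thesis by (simp add: cut_def)
qed

lemma cut_range: "0 \<le> cut R x" "cut R x \<le> 1"
  by (auto simp: cut_def intro!: power_le_one)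

lemma cut'_le: "R > 0 \<Longrightarrow> \<bar>cut' R x\<bar> \<le> 4 / R"
proof -
  assume R: "R > 0"
  show ?thesis
  proof (cases "\<bar>x\<bar> \<le> R")
    case True
    have "\<bar>cut' R x\<bar> = 2 * \<bar>max 0 (1 - (x / R)\<^sup>2)\<bar> * (2 * \<bar>x\<bar> / R\<^sup>2)" by (simp add: cut'_def abs_mult)
    also have "\<dots> \<le> 2 * 1 * (2 * R / R\<^sup>2)" using True R by (intro mult_mono divide_right_mono) auto
    also have "\<dots> = 4 / R" using R by (simp add: power2_eq_square)
    finally show ?thesis .
  next
    case False
    then have "1 \<le> \<bar>x / R\<bar>" using R by (simp add: abs_divide)
    then have "1 \<le> (x / R)\<^sup>2" using abs_le_square_iff[of 1 "x / R"] by simp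
    then show ?thesis using R by (simp add: cut'_def)
  qed
qed

lemma sech_square: "(1 / cosh x)\<^sup>2 = 1 - (tanh x)\<^sup>2" for x :: real
proof -
  have c: "cosh x \<noteq> 0" using cosh_real_pos[of x] by simp
  have "(1 / cosh x)\<^sup>2 = ((cosh x)\<^sup>2 - (sinh x)\<^sup>2) / (cosh x)\<^sup>2" by (simp add: power_divide cosh_square_eq)
  also have "\<dots> = 1 - (tanh x)\<^sup>2" using c by (simp add: diff_divide_distrib tanh_def power_divide)
  finally show ?thesis .
qed

context flow
begin

text \<open>The weight lam tanh (x / lam), cut off at R, has derivative sech^2 (x / lam) up to O(lam
  / R). The lower flux bound costs a factor 4, and the weighted momenta at the two ends of the time
  interval are each at most lam E, which gives 8 lam E once R and the interval tend to
  infinity.\<close>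

theorem virial:
  assumes lam: "lam > 0" and E: "E \<ge> 0"
    and int: "\<And>t. integrable lborel (\<lambda>x. (A t x)\<^sup>2 + (B t x)\<^sup>2)"
    and en: "\<And>t. (LINT x|lborel. (A t x)\<^sup>2 + (B t x)\<^sup>2) \<le> E"
  shows "(\<integral>\<^sup>+t\<in>{2..}. (\<integral>\<^sup>+x. ennreal ((1 / cosh (x / lam))\<^sup>2 * ((A t x)\<^sup>2 + (B t x)\<^sup>2)) \<partial>lborel) \<partial>lborel)
      \<le> ennreal (8 * lam * E)"
proof -
  define e where "e t x = (A t x)\<^sup>2 + (B t x)\<^sup>2" for t x
  have e_nn: "e t x \<ge> 0" for t x by (simp add: e_def)
  have e_le1: "e t x \<le> 1" for t x
  proof -
    have "(A t x)\<^sup>2 \<le> (1/4)\<^sup>2" "(B t x)\<^sup>2 \<le> (1/4)\<^sup>2"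
      using power_mono[OF smallA[of t x], of 2] power_mono[OF smallB[of t x], of 2] by simp_all
    then show ?thesis by (simp add: e_def power_divide)
  qed
  have e_cont: "continuous_on UNIV (e t)" for t unfolding e_def by (intro continuous_intros contA_x contB_x)
  have [measurable]: "e t \<in> borel_measurable borel" for t by (rule borel_measurable_continuous_onI[OF e_cont])
  have e_int: "integrable lborel (e t)" and e_E: "(LINT x|lborel. e t x) \<le> E" for t using int en unfolding e_def by auto
  define S where "S x = (1 / cosh (x / lam))\<^sup>2" for x
  have S: "0 \<le> S x" "S x \<le> 1" for x unfolding S_def by (simp, simp add: sech_square)
  have S_cont: "continuous_on UNIV S"
    unfolding S_def using lam cosh_real_pos by (intro continuous_intros) (auto simp: less_imp_neq[symmetric] dest: less_imp_neq)
  have cut_cont: "continuous_on UNIV (cut R)" if "R > 0" for R by (rule DERIV_continuous_on[OF cut_DERIV[OF that]])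
  define G where "G R t = (LINT x|lborel. cut R x * S x * e t x)" for R t
  have Gi: "integrable lborel (\<lambda>x. cut R x * S x * e t x)" if R: "R > 0" for R t
  proof (rule integrable_compact_support[where R = R])
    show "continuous_on UNIV (\<lambda>x. cut R x * S x * e t x)" by (intro continuous_intros cut_cont R S_cont e_cont)
  qed (simp add: cut_support R)
  have G_cont: "continuous_on UNIV (G R)" if R: "R > 0" for R
    unfolding G_def
  proof (rule continuous_integral_parameter)
    show "integrable lborel (cut R)" by (rule integrable_compact_support[OF cut_cont[OF R] cut_support[OF R]])
    show "(\<lambda>x. cut R x * S x * e t x) \<in> borel_measurable borel" for t using Gi[OF R, of t] by auto
    show "(\<lambda>n. cut R x * S x * e (\<tau> n) x) \<longlonglongrightarrow> cut R x * S x * e t x" if "\<tau> \<longlonglongrightarrow> t" for \<tau> t x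
      unfolding e_def by (intro tendsto_intros contA contB that)
    show "\<bar>cut R x * S x * e t x\<bar> \<le> cut R x" for t x
    proof -
      have "S x * e t x \<le> 1 * 1" using S e_nn e_le1 by (intro mult_mono) auto
      then have "cut R x * (S x * e t x) \<le> cut R x" using cut_range by (simp add: mult_left_le)
      moreover have "0 \<le> cut R x * S x * e t x" using cut_range S e_nn by simp
      ultimately show ?thesis by (simp add: mult.assoc)
    qed
  qed
  \<comment> \<open>The second summand is the cutoff error: 4 from the flux bound, 4 / R from
    \<open>cut'\<close>, lam from the weight, integrated over a time of length T - 2.\<close>
  have main: "integral {2..T} (G R) \<le> 8 * lam * E + 16 * lam * E * (T - 2) / R" if R: "R > 0" and T: "2 \<le> T" for R T
  proof -
    define \<psi> where "\<psi> x = lam * tanh (x / lam) * cut R x" for x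
    define \<psi>' where "\<psi>' x = S x * cut R x + cut' R x * (lam * tanh (x / lam))" for x
    have \<psi>_der: "(\<psi> has_real_derivative \<psi>' x) (at x)" for x
    proof -
      have "((\<lambda>x. x / lam) has_real_derivative 1 / lam) (at x)" by (rule DERIV_cdivide[OF DERIV_ident])
      then have "((\<lambda>x. lam * tanh (x / lam)) has_real_derivative lam * ((1 - (tanh (x / lam))\<^sup>2) * (1 / lam))) (at x)"
        by (intro DERIV_cmult has_field_derivative_tanh) (use cosh_real_pos in \<open>auto simp: less_imp_neq[symmetric] dest: less_imp_neq\<close>)
      moreover have "lam * ((1 - (tanh (x / lam))\<^sup>2) * (1 / lam)) = S x" using lam by (simp add: S_def sech_square)
      ultimately have "((\<lambda>x. lam * tanh (x / lam)) has_real_derivative S x) (at x)" by simp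
      from DERIV_mult[OF this cut_DERIV[OF R]] show ?thesis unfolding \<psi>_def \<psi>'_def .
    qed
    have tanh: "\<bar>tanh (x / lam)\<bar> \<le> 1" for x using tanh_real_bounds[of "x / lam"] by auto
    have tanh_cont: "continuous_on UNIV (\<lambda>x. tanh (x / lam))"
      using lam cosh_real_pos by (intro continuous_intros) (auto simp: less_imp_neq[symmetric] dest: less_imp_neq)
    have \<psi>'_cont: "continuous_on UNIV \<psi>'"
      unfolding \<psi>'_def cut'_def by (intro continuous_intros S_cont cut_cont R tanh_cont) (use R in auto)
    have \<psi>_supp: "\<psi> x = 0" if "R < \<bar>x\<bar>" for x using cut_support[OF R that] by (simp add: \<psi>_def)
    note id = momentum_identity[OF \<psi>_der \<psi>'_cont R \<psi>_supp T]
    have \<psi>_le: "\<bar>\<psi> x\<bar> \<le> lam" for x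
    proof -
      have "\<bar>\<psi> x\<bar> = lam * (\<bar>tanh (x / lam)\<bar> * cut R x)" using lam cut_range(1)[of R x] by (simp add: \<psi>_def abs_mult)
      also have "\<dots> \<le> lam * (1 * 1)" using lam tanh cut_range by (intro mult_left_mono mult_mono) auto
      finally show ?thesis by simp
    qed
    have Phi_le: "\<bar>LINT x|lborel. \<psi> x * mom (A t x) (B t x)\<bar> \<le> lam * E" for t
    proof -
      have pt: "norm (\<psi> x * mom (A t x) (B t x)) \<le> lam * e t x" for x
        unfolding e_def real_norm_def abs_mult using \<psi>_le[of x] mom_le[OF smallB[of t x], of "A t x"] lam by (intro mult_mono) auto
      have "norm (LINT x|lborel. \<psi> x * mom (A t x) (B t x)) \<le> (LINT x|lborel. lam * e t x)"
      proof (cases "integrable lborel (\<lambda>x. \<psi> x * mom (A t x) (B t x))")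
        case True
        have "norm (LINT x|lborel. \<psi> x * mom (A t x) (B t x)) \<le> (LINT x|lborel. norm (\<psi> x * mom (A t x) (B t x)))"
          by (rule Bochner_Integration.integral_norm_bound)
        also have "\<dots> \<le> (LINT x|lborel. lam * e t x)" using pt e_int by (intro integral_mono integrable_norm True) auto
        finally show ?thesis .
      next
        \<comment> \<open>The integral of a non-integrable function is 0 by convention, so the bound
          holds here too.\<close>
        case False
        have "0 \<le> (LINT x|lborel. lam * e t x)" using lam e_nn by (intro integral_nonneg_AE) auto
        then show ?thesis using False by (simp add: not_integrable_integral_eq)
      qed
      also have "\<dots> \<le> lam * E" using e_E[of t] lam by simp
      finally show ?thesis by simp
    qed
    define J where "J t = (LINT x|lborel. \<psi>' x * flux (A t x) (B t x))" for t
    have GJ: "G R t \<le> - 4 * J t + 16 * lam * E / R" for t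
    proof -
      have "continuous_on UNIV (\<lambda>x. flux (A t x) (B t x))"
        using ucls_cont[OF ucls_densities(4)[OF uA uB smallB], of t] by simp
      then have ji: "integrable lborel (\<lambda>x. \<psi>' x * flux (A t x) (B t x))"
        using compact_support_deriv_zero[OF \<psi>_der \<psi>_supp] by (intro integrable_compact_support[where R = R] continuous_on_mult \<psi>'_cont) auto
      \<comment> \<open>The part of the weight derivative with sech^2 has a sign and uses the lower
        flux bound; the part with \<open>cut'\<close> has none and is estimated by the upper flux
        bound.\<close>
      have pt: "cut R x * S x * e t x \<le> - 4 * (\<psi>' x * flux (A t x) (B t x)) + (16 * lam / R) * e t x" for x
      proof -
        define f where "f = - flux (A t x) (B t x)"
        have f: "e t x / 4 \<le> f" "f \<le> e t x" "0 \<le> f"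
          using flux_bounds[OF smallA[of t x] smallB[of t x]] e_nn[of t x] unfolding f_def e_def by auto
        have 1: "S x * cut R x * (e t x / 4) \<le> S x * cut R x * f" using S cut_range by (intro mult_left_mono f) auto
        have "\<bar>cut' R x * (lam * tanh (x / lam))\<bar> \<le> 4 / R * (lam * 1)"
          unfolding abs_mult using cut'_le[OF R] tanh lam R by (intro mult_mono) auto
        then have "\<bar>cut' R x * (lam * tanh (x / lam))\<bar> * f \<le> 4 / R * (lam * 1) * e t x" using f lam R by (intro mult_mono) auto
        moreover have "- (cut' R x * (lam * tanh (x / lam)) * f) \<le> \<bar>cut' R x * (lam * tanh (x / lam))\<bar> * f"
          using f(3) by (metis abs_ge_minus_self abs_mult abs_of_nonneg)
        ultimately have 2: "- (cut' R x * (lam * tanh (x / lam)) * f) \<le> 4 / R * lam * e t x" by simp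
        have "- 4 * (\<psi>' x * flux (A t x) (B t x)) = 4 * (S x * cut R x * f) + 4 * (cut' R x * (lam * tanh (x / lam)) * f)"
          by (simp add: \<psi>'_def f_def algebra_simps)
        moreover have "(16 * lam / R) * e t x = 4 * (4 / R * lam * e t x)" by simp
        moreover have "cut R x * S x * e t x = 4 * (S x * cut R x * (e t x / 4))" by simp
        ultimately show ?thesis using 1 2 by linarith
      qed
      have "G R t \<le> (LINT x|lborel. - 4 * (\<psi>' x * flux (A t x) (B t x)) + (16 * lam / R) * e t x)"
        unfolding G_def by (rule integral_mono[OF Gi[OF R] _ pt]) (use ji e_int in auto)
      also have "\<dots> = - 4 * J t + (16 * lam / R) * (LINT x|lborel. e t x)"
        unfolding J_def using ji e_int by simp
      also have "\<dots> \<le> - 4 * J t + (16 * lam / R) * E" using e_E lam R by (intro add_left_mono mult_left_mono) auto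
      finally show ?thesis by simp
    qed
    have Ji: "J integrable_on {2..T}" using id(1) unfolding J_def .
    have "integral {2..T} (G R) \<le> integral {2..T} (\<lambda>t. - 4 * J t + 16 * lam * E / R)"
    proof (rule Henstock_Kurzweil_Integration.integral_le)
      show "G R integrable_on {2..T}" using G_cont[OF R] by (intro integrable_continuous_real) (auto intro: continuous_on_subset)
      show "(\<lambda>t. - 4 * J t + 16 * lam * E / R) integrable_on {2..T}"
        using integrable_cmul[OF Ji, of "-4"] by (intro Henstock_Kurzweil_Integration.integrable_add integrable_const_ivl) simp
    qed (use GJ in auto)
    also have "\<dots> = - 4 * integral {2..T} J + (16 * lam * E / R) * (T - 2)"
    proof -
      have "integral {2..T} (\<lambda>t. - 4 * J t + 16 * lam * E / R) = integral {2..T} (\<lambda>t. - 4 * J t) + integral {2..T} (\<lambda>t. 16 * lam * E / R)"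
        using integrable_cmul[OF Ji, of "-4"] by (intro Henstock_Kurzweil_Integration.integral_add integrable_const_ivl) simp
      then show ?thesis using T by (simp add: mult.commute)
    qed
    finally have 1: "integral {2..T} (G R) \<le> - 4 * integral {2..T} J + (16 * lam * E / R) * (T - 2)" .
    have *: "- 4 * i \<le> 8 * c" if "p - q = i" "\<bar>p\<bar> \<le> c" "\<bar>q\<bar> \<le> c" for i c p q :: real
      using that by linarith
    have "- 4 * integral {2..T} J \<le> 8 * (lam * E)"
      unfolding J_def by (rule *[OF id(2) Phi_le Phi_le])
    then have "integral {2..T} (G R) \<le> 8 * (lam * E) + (16 * lam * E / R) * (T - 2)"
      by (rule order_trans[OF 1 add_right_mono])
    also have "8 * (lam * E) + (16 * lam * E / R) * (T - 2) = 8 * lam * E + 16 * lam * E * (T - 2) / R"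
      by (simp only: times_divide_eq_left mult.assoc)
    finally show ?thesis .
  qed
  \<comment> \<open>The radius grows like the square of the length n of the time interval, so that
    the error, of order n / (n + 1)^2, tends to 0.\<close>
  define Rn where "Rn n = (real n + 1)\<^sup>2" for n
  have Rn: "Rn n > 0" for n by (simp add: Rn_def add_pos_nonneg)
  define u where "u n t = ennreal (G (Rn n) t) * indicator {2..real n + 2} t" for n t
  have [measurable]: "G (Rn n) \<in> borel_measurable borel" for n by (rule borel_measurable_continuous_onI[OF G_cont[OF Rn]])
  have u_meas [measurable]: "u n \<in> borel_measurable borel" for n unfolding u_def by measurable
  have G_nn: "G R t \<ge> 0" for R t unfolding G_def using cut_range S e_nn by (intro integral_nonneg_AE) auto
  have u_int: "(\<integral>\<^sup>+t. u n t \<partial>lborel) \<le> ennreal (8 * lam * E + 16 * lam * E * real n / (real n + 1)\<^sup>2)" for n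
  proof -
    have "G (Rn n) integrable_on {2..real n + 2}" using G_cont[OF Rn] by (intro integrable_continuous_real) (auto intro: continuous_on_subset)
    then have "(G (Rn n) has_integral integral {2..real n + 2} (G (Rn n))) {2..real n + 2}" by (rule integrable_integral)
    then have "(\<integral>\<^sup>+t. u n t \<partial>lborel) = ennreal (integral {2..real n + 2} (G (Rn n)))"
      unfolding u_def by (intro nn_integral_has_integral_lebesgue' G_nn)
    also have "\<dots> \<le> ennreal (8 * lam * E + 16 * lam * E * real n / (real n + 1)\<^sup>2)"
      using main[OF Rn, of "real n + 2" n] by (intro ennreal_leI) (simp add: Rn_def)
    finally show ?thesis .
  qed
  \<comment> \<open>Fatou's lemma in x at fixed t removes the cutoff; a second application in t
    removes the end of the time interval.\<close>
  have inner: "(\<integral>\<^sup>+x. ennreal (S x * e t x) \<partial>lborel) * indicator {2..} t \<le> liminf (\<lambda>n. u n t)" for t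
  proof (cases "t \<ge> 2")
    case True
    have [measurable]: "S \<in> borel_measurable borel" "cut (Rn n) \<in> borel_measurable borel" for n
      using S_cont cut_cont[OF Rn] by (auto intro: borel_measurable_continuous_onI)
    have lim: "liminf (\<lambda>n. ennreal (cut (Rn n) x * S x * e t x)) = ennreal (S x * e t x)" for x
    proof -
      have "(\<lambda>n. 1 / (real n + 1)\<^sup>2) \<longlonglongrightarrow> 0" by real_asymp
      then have "(\<lambda>n. (max 0 (1 - (x * (1 / (real n + 1)\<^sup>2))\<^sup>2))\<^sup>2 * S x * e t x) \<longlonglongrightarrow> (max 0 (1 - (x * 0)\<^sup>2))\<^sup>2 * S x * e t x"
        by (intro tendsto_intros)
      then have "(\<lambda>n. cut (Rn n) x * S x * e t x) \<longlonglongrightarrow> S x * e t x" by (simp add: cut_def Rn_def)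
      from tendsto_ennrealI[OF this] show ?thesis by (rule lim_imp_Liminf[OF sequentially_bot])
    qed
    have "(\<integral>\<^sup>+x. ennreal (S x * e t x) \<partial>lborel) = (\<integral>\<^sup>+x. liminf (\<lambda>n. ennreal (cut (Rn n) x * S x * e t x)) \<partial>lborel)"
      unfolding lim ..
    also have "\<dots> \<le> liminf (\<lambda>n. \<integral>\<^sup>+x. ennreal (cut (Rn n) x * S x * e t x) \<partial>lborel)"
      by (rule nn_integral_liminf) measurable
    also have "(\<lambda>n. \<integral>\<^sup>+x. ennreal (cut (Rn n) x * S x * e t x) \<partial>lborel) = (\<lambda>n. ennreal (G (Rn n) t))"
      unfolding G_def using cut_range S e_nn by (intro ext nn_integral_eq_integral Gi Rn) auto
    also have "liminf (\<lambda>n. ennreal (G (Rn n) t)) = liminf (\<lambda>n. u n t)"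
    proof (rule Liminf_eq)
      have "\<forall>\<^sub>F n in sequentially. t \<le> real n + 2" by real_asymp
      then show "\<forall>\<^sub>F n in sequentially. ennreal (G (Rn n) t) = u n t"
        by eventually_elim (use True in \<open>simp add: u_def\<close>)
    qed
    finally show ?thesis using True by simp
  qed simp
  have "(\<integral>\<^sup>+t\<in>{2..}. (\<integral>\<^sup>+x. ennreal (S x * e t x) \<partial>lborel) \<partial>lborel) \<le> (\<integral>\<^sup>+t. liminf (\<lambda>n. u n t) \<partial>lborel)"
    by (intro nn_integral_mono inner)
  also have "\<dots> \<le> liminf (\<lambda>n. \<integral>\<^sup>+t. u n t \<partial>lborel)" by (rule nn_integral_liminf) measurable
  also have "\<dots> \<le> liminf (\<lambda>n. ennreal (8 * lam * E + 16 * lam * E * real n / (real n + 1)\<^sup>2))"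
    by (intro Liminf_mono always_eventually allI u_int)
  also have "\<dots> = ennreal (8 * lam * E)"
  proof (rule lim_imp_Liminf[OF sequentially_bot], rule tendsto_ennrealI)
    have "(\<lambda>n. real n / (real n + 1)\<^sup>2) \<longlonglongrightarrow> 0" by real_asymp
    from tendsto_add[OF tendsto_const tendsto_mult[OF tendsto_const this, of "16 * lam * E"], of "8 * lam * E"]
    show "(\<lambda>n. 8 * lam * E + 16 * lam * E * real n / (real n + 1)\<^sup>2) \<longlonglongrightarrow> 8 * lam * E" by simp
  qed
  finally show ?thesis unfolding S_def e_def .
qed

end

section \<open>From solutions to flows\<close>

lemma sobolev_norm_square:
  assumes "has_fourier T g"
  shows "(sobolev_norm \<sigma> T)\<^sup>2 = (LINT \<xi>|lborel. (1 + \<xi>\<^sup>2) powr \<sigma> * (cmod (g \<xi>))\<^sup>2)"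
proof -
  note [measurable] = has_fourier_measurable[OF assms] has_fourier_measurable[OF has_fourier_dist_fourier[OF assms]]
  have "(LINT \<xi>|lborel. (1 + \<xi>\<^sup>2) powr \<sigma> * (cmod (dist_fourier T \<xi>))\<^sup>2) = (LINT \<xi>|lborel. (1 + \<xi>\<^sup>2) powr \<sigma> * (cmod (g \<xi>))\<^sup>2)"
    using dist_fourier_AE[OF assms] by (intro integral_cong_AE) auto
  then show ?thesis unfolding sobolev_norm_def by (simp add: integral_nonneg_AE)
qed

lemma dominated_integral:
  fixes f g :: "real \<Rightarrow> real"
  assumes g: "integrable lborel g" and f: "f \<in> borel_measurable borel" and le: "\<And>x. 0 \<le> f x" "\<And>x. f x \<le> g x"
  shows "integrable lborel f" "(LINT x|lborel. f x) \<le> (LINT x|lborel. g x)"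
proof -
  show i: "integrable lborel f"
  proof (rule Bochner_Integration.integrable_bound[OF g])
    show "AE x in lborel. norm (f x) \<le> norm (g x)" proof (rule AE_I2)
      fix x
      show "norm (f x) \<le> norm (g x)" using le(1)[of x] le(2)[of x] by simp
    qed
  qed (use f in simp)
  show "(LINT x|lborel. f x) \<le> (LINT x|lborel. g x)" by (rule integral_mono[OF i g le(2)])
qed

text \<open>Products of one-variable test functions are stable under both partial derivatives. The
  equations on space-time are tested against such products: the factor in t localises in time and
  the factor in x is a kernel or its derivative.\<close>

lemma product_test_function:
  assumes "\<eta> \<in> smooth_cs" "\<rho> \<in> smooth_cs"
  shows "(\<lambda>t x. \<eta> t * \<rho> x) \<in> test_functions" "pd_t (\<lambda>t x. \<eta> t * \<rho> x) = (\<lambda>t x. vderiv \<eta> t * \<rho> x)"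
proof -
  have pt: "pd_t (\<lambda>t x. \<eta> t * \<rho> x) = (\<lambda>t x. vderiv \<eta> t * \<rho> x)"
    and dt: "((\<lambda>t. \<eta> t * \<rho> x) has_vector_derivative vderiv \<eta> t * \<rho> x) (at t)"
    and px: "pd_x (\<lambda>t x. \<eta> t * \<rho> x) = (\<lambda>t x. \<eta> t * vderiv \<rho> x)"
    and dx: "((\<lambda>x. \<eta> t * \<rho> x) has_vector_derivative \<eta> t * vderiv \<rho> x) (at x)"
    if "\<eta> \<in> smooth_cs" "\<rho> \<in> smooth_cs" for \<eta> \<rho> t x
  proof -
    show dt: "((\<lambda>t. \<eta> t * \<rho> x) has_vector_derivative vderiv \<eta> t * \<rho> x) (at t)" for t x
      by (intro has_vector_derivative_mult_left smooth_cs_has_vderiv that)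
    show dx: "((\<lambda>x. \<eta> t * \<rho> x) has_vector_derivative \<eta> t * vderiv \<rho> x) (at x)" for t x
      by (intro has_vector_derivative_mult_right smooth_cs_has_vderiv that)
    show "pd_t (\<lambda>t x. \<eta> t * \<rho> x) = (\<lambda>t x. vderiv \<eta> t * \<rho> x)"
      unfolding pd_t_def using vector_derivative_at[OF dt] by simp
    show "pd_x (\<lambda>t x. \<eta> t * \<rho> x) = (\<lambda>t x. \<eta> t * vderiv \<rho> x)"
      unfolding pd_x_def using vector_derivative_at[OF dx] by simp
  qed
  show "pd_t (\<lambda>t x. \<eta> t * \<rho> x) = (\<lambda>t x. vderiv \<eta> t * \<rho> x)" by (rule pt[OF assms])
  have P: "\<exists>\<eta>'\<in>smooth_cs. \<exists>\<rho>'\<in>smooth_cs. \<psi> = (\<lambda>t x. \<eta>' t * \<rho>' x)" if "\<psi> \<in> partials (\<lambda>t x. \<eta> t * \<rho> x)" for \<psi>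
    using that
  proof induction
    case self
    show ?case by (rule bexI[OF bexI[OF refl assms(2)] assms(1)])
  next
    case (dt \<psi>)
    then obtain \<eta>' \<rho>' where e: "\<eta>' \<in> smooth_cs" "\<rho>' \<in> smooth_cs" "\<psi> = (\<lambda>t x. \<eta>' t * \<rho>' x)" by blast
    show ?case unfolding e(3) pt[OF e(1,2)] by (rule bexI[OF bexI[OF refl e(2)] smooth_cs_vderiv[OF e(1)]])
  next
    case (dx \<psi>)
    then obtain \<eta>' \<rho>' where e: "\<eta>' \<in> smooth_cs" "\<rho>' \<in> smooth_cs" "\<psi> = (\<lambda>t x. \<eta>' t * \<rho>' x)" by blast
    show ?case unfolding e(3) px[OF e(1,2)] by (rule bexI[OF bexI[OF refl smooth_cs_vderiv[OF e(2)]] e(1)])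
  qed
  obtain R1 where R1: "\<And>x. R1 < \<bar>x\<bar> \<Longrightarrow> \<eta> x = 0" using smooth_cs_support[OF assms(1)] by blast
  obtain R2 where R2: "\<And>x. R2 < \<bar>x\<bar> \<Longrightarrow> \<rho> x = 0" using smooth_cs_support[OF assms(2)] by blast
  have "continuous_on UNIV (\<lambda>(t, x). \<psi> t x) \<and> (\<forall>t x. (\<lambda>\<tau>. \<psi> \<tau> x) differentiable (at t) \<and> \<psi> t differentiable (at x))"
    if \<psi>: "\<psi> \<in> partials (\<lambda>t x. \<eta> t * \<rho> x)" for \<psi>
  proof -
    obtain \<eta>' \<rho>' where e: "\<eta>' \<in> smooth_cs" "\<rho>' \<in> smooth_cs" "\<psi> = (\<lambda>t x. \<eta>' t * \<rho>' x)" using P[OF \<psi>] by blast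
    have "continuous_on UNIV (\<lambda>p::real \<times> real. \<eta>' (fst p) * \<rho>' (snd p))"
      by (intro continuous_on_mult continuous_on_compose2[OF smooth_cs_continuous[OF e(1)]]
          continuous_on_compose2[OF smooth_cs_continuous[OF e(2)]] continuous_on_fst continuous_on_snd continuous_on_id) auto
    then show ?thesis
      unfolding e(3) case_prod_beta
      using differentiableI_vector[OF dt[OF e(1,2)]] differentiableI_vector[OF dx[OF e(1,2)]] by blast
  qed
  moreover have "\<exists>R. \<forall>t x. R < \<bar>t\<bar> \<or> R < \<bar>x\<bar> \<longrightarrow> \<eta> t * \<rho> x = 0"
    by (rule exI[of _ "max R1 R2"]) (auto simp: R1 R2)
  ultimately show "(\<lambda>t x. \<eta> t * \<rho> x) \<in> test_functions" unfolding test_functions_def by blast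
qed

text \<open>The increments agree with those of an antiderivative of \<beta>, so \<alpha> differs
  from it by a constant.\<close>

lemma derivative_of_increment:
  fixes \<alpha> \<beta> :: "real \<Rightarrow> complex"
  assumes \<beta>: "continuous_on UNIV \<beta>"
    and inc: "\<And>p q. p < q \<Longrightarrow> \<alpha> q - \<alpha> p = (LINT t|lborel. indicator {p<..<q} t * \<beta> t)"
  shows "(\<alpha> has_vector_derivative \<beta> t) (at t)"
proof -
  have "isCont \<beta> x" for x using \<beta> by (simp add: continuous_on_eq_continuous_at)
  then obtain F where F: "\<And>x. (F has_vector_derivative \<beta> x) (at x)"
    using einterval_antiderivative[of "-\<infinity>" "\<infinity>" \<beta>] by auto
  have eq: "\<alpha> q - \<alpha> p = F q - F p" if "p < q" for p q
  proof -
    have "(LINT t|lborel. indicator {p<..<q} t * \<beta> t) = (LINT t|lborel. indicator {p..q} t *\<^sub>R \<beta> t)"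
    proof (rule integral_cong_AE)
      have [measurable]: "\<beta> \<in> borel_measurable borel" by (rule borel_measurable_continuous_onI[OF \<beta>])
      show "(\<lambda>t. indicator {p<..<q} t * \<beta> t) \<in> borel_measurable lborel" "(\<lambda>t. indicator {p..q} t *\<^sub>R \<beta> t) \<in> borel_measurable lborel"
        by measurable
      show "AE t in lborel. indicator {p<..<q} t * \<beta> t = indicator {p..q} t *\<^sub>R \<beta> t"
        by (rule indicator_interval_AE_lim[of p q]) (auto simp: indicator_def)
    qed
    also have "\<dots> = F q - F p"
      by (rule integral_FTC_atLeastAtMost)
        (use that F \<beta> in \<open>auto intro: has_vector_derivative_at_within continuous_on_subset\<close>)
    finally show ?thesis using inc[OF that] by simp
  qed
  have "\<alpha> q = F q + (\<alpha> 0 - F 0)" for q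
    using eq[of 0 q] eq[of q 0] by (cases q "0::real" rule: linorder_cases) (auto simp: algebra_simps)
  then obtain C where "\<alpha> = (\<lambda>q. F q + C)" by blast
  then show ?thesis
    using has_vector_derivative_add[OF F[of t] has_vector_derivative_const[of C "at t"]] by simp
qed

text \<open>\<open>dist_mult\<close> is built from the chosen transform of T and the given
  representative of the coefficient; both may be exchanged for versions that agree almost
  everywhere. The scalar c will be the time factor of a test function.\<close>

lemma dist_mult_eq:
  assumes T: "has_fourier T G" and f: "AE x in lborel. f x = f' x"
    and [measurable]: "f \<in> borel_measurable borel" "f' \<in> borel_measurable borel" "k \<in> borel_measurable borel"
  shows "dist_mult f T (\<lambda>x. c * complex_of_real (k x)) = c * (LINT \<xi>|lborel. G \<xi> * inv_fourier (\<lambda>x. complex_of_real (f' x * k x)) \<xi>)"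
proof -
  note [measurable] = has_fourier_measurable[OF T] has_fourier_measurable[OF has_fourier_dist_fourier[OF T]]
  have 1: "inv_fourier (\<lambda>x. complex_of_real (f x) * (c * complex_of_real (k x))) \<xi> = c * inv_fourier (\<lambda>x. complex_of_real (f' x * k x)) \<xi>" for \<xi>
  proof -
    have "(LINT x|lborel. cis (x * \<xi>) * (complex_of_real (f x) * (c * complex_of_real (k x)))) =
        (LINT x|lborel. cis (x * \<xi>) * (c * complex_of_real (f' x * k x)))"
    proof (rule integral_cong_AE)
      show "AE x in lborel. cis (x * \<xi>) * (complex_of_real (f x) * (c * complex_of_real (k x))) = cis (x * \<xi>) * (c * complex_of_real (f' x * k x))"
        using f by eventually_elim simp
    qed measurable
    then have "inv_fourier (\<lambda>x. complex_of_real (f x) * (c * complex_of_real (k x))) \<xi> = inv_fourier (\<lambda>x. c * complex_of_real (f' x * k x)) \<xi>"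
      by (simp add: inv_fourier_def)
    then show ?thesis by (simp only: inv_fourier_cmult)
  qed
  have "dist_mult f T (\<lambda>x. c * complex_of_real (k x)) = (LINT \<xi>|lborel. dist_fourier T \<xi> * (c * inv_fourier (\<lambda>x. complex_of_real (f' x * k x)) \<xi>))"
    unfolding dist_mult_def dist_pairing_def 1 ..
  also have "\<dots> = (LINT \<xi>|lborel. c * (G \<xi> * inv_fourier (\<lambda>x. complex_of_real (f' x * k x)) \<xi>))"
  proof (rule integral_cong_AE)
    show "AE \<xi> in lborel. dist_fourier T \<xi> * (c * inv_fourier (\<lambda>x. complex_of_real (f' x * k x)) \<xi>) = c * (G \<xi> * inv_fourier (\<lambda>x. complex_of_real (f' x * k x)) \<xi>)"
      using dist_fourier_AE[OF T] by eventually_elim simp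
  qed measurable
  also have "\<dots> = c * (LINT \<xi>|lborel. G \<xi> * inv_fourier (\<lambda>x. complex_of_real (f' x * k x)) \<xi>)"
    by (rule integral_mult_right_zero)
  finally show ?thesis .
qed

section \<open>Sobolev embedding, and mollifications of functions in H^r\<close>

context exponent
begin

text \<open>The L^2 norm of (1 + \<xi>^2)^(-r/2). Since \<open>enn2real\<close> sends infinity to 0,
  the definition is meaningful only with the finiteness shown next, which holds because 2r >
  1.\<close>

definition embed_const :: real where
  "embed_const = sqrt (enn2real (\<integral>\<^sup>+\<xi>. ennreal ((1 + \<xi>\<^sup>2) powr (- r)) \<partial>(lborel :: real measure)))"

lemma weight_integral_finite: "(\<integral>\<^sup>+\<xi>. ennreal ((1 + \<xi>\<^sup>2) powr (- r)) \<partial>(lborel :: real measure)) < \<infinity>"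
proof -
  define g where "g x = ennreal (x powr (- 2 * r)) * indicator {1..} x" for x :: real
  have [measurable]: "g \<in> borel_measurable borel" unfolding g_def by measurable
  have gi: "(\<integral>\<^sup>+x. g x \<partial>lborel) < \<infinity>"
  proof -
    have "((\<lambda>x::real. x powr (- 2 * r)) has_integral - (1 powr (- 2 * r + 1)) / (- 2 * r + 1)) {1..}"
      using r by (intro has_integral_powr_to_inf) auto
    from nn_integral_has_integral_lebesgue'[OF _ this] show ?thesis by (simp add: g_def)
  qed
  have "ennreal ((1 + \<xi>\<^sup>2) powr (- r)) \<le> indicator {-1..1} \<xi> + (g \<xi> + g (- \<xi>))" for \<xi> :: real
  proof (cases "\<bar>\<xi>\<bar> \<le> 1")
    case True
    have "(1 + \<xi>\<^sup>2) powr (- r) \<le> 1 powr (- r)" using r by (intro powr_mono2') auto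
    then have "ennreal ((1 + \<xi>\<^sup>2) powr (- r)) \<le> 1" by simp
    also have "1 \<le> indicator {-1..1} \<xi> + (g \<xi> + g (- \<xi>))" using True by (auto simp: abs_le_iff)
    finally show ?thesis .
  next
    case False
    have "(1 + \<xi>\<^sup>2) powr (- r) \<le> (\<bar>\<xi>\<bar>\<^sup>2) powr (- r)" using r False by (intro powr_mono2') auto
    also have "(\<bar>\<xi>\<bar>\<^sup>2) powr (- r) = \<bar>\<xi>\<bar> powr (- 2 * r)"
    proof -
      have "\<bar>\<xi>\<bar>\<^sup>2 = \<bar>\<xi>\<bar> powr 2" using False by simp
      then show ?thesis by (simp only: powr_powr) simp
    qed
    finally have "ennreal ((1 + \<xi>\<^sup>2) powr (- r)) \<le> ennreal (\<bar>\<xi>\<bar> powr (- 2 * r))" by (rule ennreal_leI)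
    also have "\<dots> \<le> g \<xi> + g (- \<xi>)" using False by (cases "\<xi> \<ge> 0") (auto simp: g_def)
    also have "\<dots> \<le> indicator {-1..1} \<xi> + (g \<xi> + g (- \<xi>))" by simp
    finally show ?thesis .
  qed
  then have "(\<integral>\<^sup>+\<xi>. ennreal ((1 + \<xi>\<^sup>2) powr (- r)) \<partial>(lborel :: real measure)) \<le> (\<integral>\<^sup>+\<xi>. indicator {-1..1} \<xi> + (g \<xi> + g (- \<xi>)) \<partial>lborel)"
    by (intro nn_integral_mono)
  also have "\<dots> = (\<integral>\<^sup>+\<xi>. indicator {-1..1} \<xi> \<partial>(lborel :: real measure)) + ((\<integral>\<^sup>+\<xi>. g \<xi> \<partial>lborel) + (\<integral>\<^sup>+\<xi>. g (- \<xi>) \<partial>lborel))"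
    by (simp add: nn_integral_add)
  also have "(\<integral>\<^sup>+\<xi>. g (- \<xi>) \<partial>lborel) = (\<integral>\<^sup>+\<xi>. g \<xi> \<partial>lborel)"
    using nn_integral_real_affine[of g "-1" 0] by simp
  also have "(\<integral>\<^sup>+\<xi>. indicator {-1..1} \<xi> \<partial>(lborel :: real measure)) + ((\<integral>\<^sup>+\<xi>. g \<xi> \<partial>lborel) + (\<integral>\<^sup>+\<xi>. g \<xi> \<partial>lborel)) < \<infinity>"
    using gi by (simp add: emeasure_lborel_Icc_eq)
  finally show ?thesis .
qed

lemma embed_const_nonneg: "embed_const \<ge> 0" by (simp add: embed_const_def)

text \<open>Cauchy-Schwarz against the weight: a function in H^r has integrable Fourier transform,
  hence is bounded and continuous.\<close>

lemma sobolev_embedding: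
  assumes g: "g \<in> borel_measurable borel" and i: "integrable lborel (\<lambda>\<xi>. (1 + \<xi>\<^sup>2) powr r * (cmod (g \<xi>))\<^sup>2)"
  shows "integrable lborel g" "(LINT \<xi>|lborel. cmod (g \<xi>)) \<le> embed_const * sqrt (LINT \<xi>|lborel. (1 + \<xi>\<^sup>2) powr r * (cmod (g \<xi>))\<^sup>2)"
proof -
  have [measurable]: "g \<in> borel_measurable borel" by (rule g)
  define n where "n = sqrt (LINT \<xi>|lborel. (1 + \<xi>\<^sup>2) powr r * (cmod (g \<xi>))\<^sup>2)"
  have n: "n \<ge> 0" "n\<^sup>2 = (LINT \<xi>|lborel. (1 + \<xi>\<^sup>2) powr r * (cmod (g \<xi>))\<^sup>2)"
    by (auto simp: n_def integral_nonneg_AE)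
  let ?I = "\<integral>\<^sup>+\<xi>. ennreal (cmod (g \<xi>)) \<partial>lborel"
  have pp: "(x powr b)\<^sup>2 = x powr (2 * b)" if "x > 0" for x b :: real
    using that by (simp add: power2_eq_square powr_add[symmetric])
  have sqw: "((1 + \<xi>\<^sup>2) powr (- (a / 2)))\<^sup>2 = (1 + \<xi>\<^sup>2) powr (- a)" "((1 + \<xi>\<^sup>2) powr (a / 2))\<^sup>2 = (1 + \<xi>\<^sup>2) powr a" for \<xi> a :: real
    using pp[of "1 + \<xi>\<^sup>2"] by (simp_all add: add_pos_nonneg)
  have "?I = (\<integral>\<^sup>+\<xi>. ennreal ((1 + \<xi>\<^sup>2) powr (- r / 2)) * ennreal ((1 + \<xi>\<^sup>2) powr (r / 2) * cmod (g \<xi>)) \<partial>lborel)"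
  proof (intro nn_integral_cong)
    fix \<xi> :: real
    have "(1 + \<xi>\<^sup>2) powr (- r / 2) * (1 + \<xi>\<^sup>2) powr (r / 2) = 1"
      unfolding powr_add[symmetric] by (simp add: add_nonneg_eq_0_iff)
    then have "(1 + \<xi>\<^sup>2) powr (- r / 2) * ((1 + \<xi>\<^sup>2) powr (r / 2) * cmod (g \<xi>)) = cmod (g \<xi>)"
      by (simp flip: mult.assoc)
    then show "ennreal (cmod (g \<xi>)) = ennreal ((1 + \<xi>\<^sup>2) powr (- r / 2)) * ennreal ((1 + \<xi>\<^sup>2) powr (r / 2) * cmod (g \<xi>))"
      by (subst ennreal_mult[symmetric]) auto
  qed
  then have "?I\<^sup>2 \<le> (\<integral>\<^sup>+\<xi>. (ennreal ((1 + \<xi>\<^sup>2) powr (- r / 2)))\<^sup>2 \<partial>lborel) * (\<integral>\<^sup>+\<xi>. (ennreal ((1 + \<xi>\<^sup>2) powr (r / 2) * cmod (g \<xi>)))\<^sup>2 \<partial>lborel)"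
    using Cauchy_Schwarz_nn_integral[of "\<lambda>\<xi>. ennreal ((1 + \<xi>\<^sup>2) powr (- r / 2))" lborel "\<lambda>\<xi>. ennreal ((1 + \<xi>\<^sup>2) powr (r / 2) * cmod (g \<xi>))"]
    by simp
  also have "(\<integral>\<^sup>+\<xi>. (ennreal ((1 + \<xi>\<^sup>2) powr (- r / 2)))\<^sup>2 \<partial>lborel) = (\<integral>\<^sup>+\<xi>. ennreal ((1 + \<xi>\<^sup>2) powr (- r)) \<partial>(lborel :: real measure))"
    by (simp add: ennreal_power sqw del: minus_divide_left)
  also have "\<dots> = ennreal (embed_const\<^sup>2)" using weight_integral_finite by (simp add: embed_const_def less_top)
  also have "(\<integral>\<^sup>+\<xi>. (ennreal ((1 + \<xi>\<^sup>2) powr (r / 2) * cmod (g \<xi>)))\<^sup>2 \<partial>lborel) = (\<integral>\<^sup>+\<xi>. ennreal ((1 + \<xi>\<^sup>2) powr r * (cmod (g \<xi>))\<^sup>2) \<partial>lborel)"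
    by (simp add: ennreal_power power_mult_distrib sqw)
  also have "\<dots> = ennreal (n\<^sup>2)" unfolding n(2) by (rule nn_integral_eq_integral[OF i]) auto
  finally have le: "?I\<^sup>2 \<le> ennreal ((embed_const * n)\<^sup>2)" by (simp add: ennreal_mult power_mult_distrib)
  have le': "?I \<le> ennreal (embed_const * n)"
  proof (cases ?I)
    case (real x)
    have "ennreal (x\<^sup>2) \<le> ennreal ((embed_const * n)\<^sup>2)"
      using le unfolding real(2) by (simp only: ennreal_power[OF real(1)])
    then have "x\<^sup>2 \<le> (embed_const * n)\<^sup>2" by (simp only: ennreal_le_iff[OF zero_le_power2])
    then have "x \<le> embed_const * n" by (rule power2_le_imp_le[OF _ mult_nonneg_nonneg[OF embed_const_nonneg n(1)]])
    then show ?thesis unfolding real(2) by (rule ennreal_leI)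
  next
    case top
    have "\<not> (top::ennreal)\<^sup>2 \<le> ennreal c" for c by (simp add: power2_eq_square top_unique)
    then show ?thesis using le unfolding top by blast
  qed
  then have "?I < \<infinity>" by (rule le_less_trans) simp
  then show gi: "integrable lborel g" by (simp add: integrable_iff_bounded)
  have "ennreal (LINT \<xi>|lborel. cmod (g \<xi>)) = ?I" using gi by (intro nn_integral_eq_integral[symmetric]) auto
  then have "ennreal (LINT \<xi>|lborel. cmod (g \<xi>)) \<le> ennreal (embed_const * n)" using le' by simp
  then show "(LINT \<xi>|lborel. cmod (g \<xi>)) \<le> embed_const * sqrt (LINT \<xi>|lborel. (1 + \<xi>\<^sup>2) powr r * (cmod (g \<xi>))\<^sup>2)"
    using n embed_const_nonneg unfolding n_def[symmetric] by (simp add: ennreal_le_iff)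
qed

text \<open>For |\<theta>| <= 1 the quadratic bound is at most the power 2r <= 2; for larger
  \<theta> the trivial bound 4 is enough.\<close>

lemma cmod_cis_le: "(cmod (cis \<theta> - 1))\<^sup>2 \<le> 4 * \<bar>\<theta>\<bar> powr (2 * r)"
proof (cases "\<bar>\<theta>\<bar> \<le> 1")
  case True
  have "(cmod (cis \<theta> - 1))\<^sup>2 = 4 * (sin (\<theta> / 2))\<^sup>2"
    unfolding cmod_cis_diff_one using cos_double_sin[of "\<theta> / 2"] by simp
  also have "\<dots> \<le> 4 * (\<theta> / 2)\<^sup>2" using abs_sin_x_le_abs_x[of "\<theta> / 2"] unfolding abs_le_square_iff by simp
  also have "\<dots> = \<bar>\<theta>\<bar>\<^sup>2" by (simp add: power_divide)
  also have "\<dots> \<le> 4 * \<bar>\<theta>\<bar> powr (2 * r)"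
  proof (cases "\<theta> = 0")
    case False
    have "\<bar>\<theta>\<bar>\<^sup>2 = \<bar>\<theta>\<bar> powr 2" using False by simp
    also have "\<dots> \<le> \<bar>\<theta>\<bar> powr (2 * r)" using True r False by (intro powr_mono') auto
    also have "\<dots> \<le> 4 * \<bar>\<theta>\<bar> powr (2 * r)" by simp
    finally show ?thesis .
  qed simp
  finally show ?thesis .
next
  case False
  have "(cmod (cis \<theta> - 1))\<^sup>2 \<le> 4" unfolding cmod_cis_diff_one using cos_ge_minus_one[of \<theta>] by linarith
  also have "\<dots> \<le> 4 * \<bar>\<theta>\<bar> powr (2 * r)" using False r by (simp add: ge_one_powr_ge_zero)
  finally show ?thesis .
qed

text \<open>Membership of H^r functions in the multiplier class. The translation difference is the
  transform of (cis (\<tau> \<xi>) - 1) g, and Bessel's inequality with the preceding bound on the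
  character yields the modulus.\<close>

lemma inv_fourier_cls:
  assumes g: "g \<in> borel_measurable borel" and i: "integrable lborel (\<lambda>\<xi>. (1 + \<xi>\<^sup>2) powr r * (cmod (g \<xi>))\<^sup>2)"
    and E: "(LINT \<xi>|lborel. (1 + \<xi>\<^sup>2) powr r * (cmod (g \<xi>))\<^sup>2) \<le> E\<^sup>2" "E \<ge> 0"
  shows "cls (embed_const * E) (4 * E\<^sup>2) (\<lambda>x. Re (inv_fourier g x))"
proof -
  note [measurable] = g
  note emb = sobolev_embedding[OF g i]
  have "continuous_on UNIV (\<lambda>x. Re (inv_fourier g x))" by (intro continuous_intros inv_fourier_continuous emb)
  moreover have "\<bar>Re (inv_fourier g x)\<bar> \<le> embed_const * E" for x
  proof -
    have "\<bar>Re (inv_fourier g x)\<bar> \<le> (LINT \<xi>|lborel. cmod (g \<xi>))" by (rule order_trans[OF abs_Re_le_cmod inv_fourier_norm_le])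
    also have "\<dots> \<le> embed_const * sqrt (LINT \<xi>|lborel. (1 + \<xi>\<^sup>2) powr r * (cmod (g \<xi>))\<^sup>2)" by (rule emb)
    also have "\<dots> \<le> embed_const * E" using E embed_const_nonneg by (intro mult_left_mono real_le_lsqrt) auto
    finally show ?thesis .
  qed
  moreover have "modulus_sq (\<lambda>x. Re (inv_fourier g x)) \<tau> \<le> ennreal (4 * E\<^sup>2 * \<tau> powr (2 * r))" if \<tau>: "0 < \<tau>" "\<tau> \<le> 1" for \<tau>
  proof -
    define h where "h \<xi> = (cis (\<tau> * \<xi>) - 1) * g \<xi>" for \<xi>
    have h: "integrable lborel h"
    proof -
      have "integrable lborel (\<lambda>\<xi>. cis (\<xi> * \<tau>) * g \<xi> - g \<xi>)" by (intro Bochner_Integration.integrable_diff integrable_cis_mult emb)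
      then show ?thesis unfolding h_def[abs_def] by (simp add: algebra_simps)
    qed
    have hd: "inv_fourier g (x + \<tau>) - inv_fourier g x = inv_fourier h x" for x
    proof -
      have "inv_fourier g (x + \<tau>) = inv_fourier (\<lambda>\<xi>. cis (\<xi> * \<tau>) * g \<xi>) x"
        by (simp add: inv_fourier_def distrib_left cis_mult[symmetric] mult_ac)
      then show ?thesis
        using inv_fourier_diff[OF integrable_cis_mult[OF emb(1)] emb(1), of \<tau> x] by (simp add: h_def[abs_def] algebra_simps)
    qed
    have "modulus_sq (\<lambda>x. Re (inv_fourier g x)) \<tau> \<le> (\<integral>\<^sup>+x. ennreal ((cmod (inv_fourier h x))\<^sup>2) \<partial>lborel)"
      unfolding modulus_sq_def
    proof (intro nn_integral_mono ennreal_leI)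
      fix x
      have "\<bar>Re (inv_fourier h x)\<bar>\<^sup>2 \<le> (cmod (inv_fourier h x))\<^sup>2" by (intro power_mono abs_Re_le_cmod) auto
      then show "(norm (Re (inv_fourier g (x + \<tau>)) - Re (inv_fourier g x)))\<^sup>2 \<le> (cmod (inv_fourier h x))\<^sup>2"
        unfolding hd[symmetric] by simp
    qed
    also have "\<dots> \<le> (\<integral>\<^sup>+\<xi>. ennreal ((cmod (h \<xi>))\<^sup>2) \<partial>lborel)" by (rule bessel[OF h])
    also have "\<dots> \<le> (\<integral>\<^sup>+\<xi>. ennreal (4 * \<tau> powr (2 * r) * ((1 + \<xi>\<^sup>2) powr r * (cmod (g \<xi>))\<^sup>2)) \<partial>lborel)"
    proof (intro nn_integral_mono ennreal_leI)
      fix \<xi> :: real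
      have "(cmod (h \<xi>))\<^sup>2 = (cmod (cis (\<tau> * \<xi>) - 1))\<^sup>2 * (cmod (g \<xi>))\<^sup>2" by (simp add: h_def norm_mult power_mult_distrib)
      also have "\<dots> \<le> 4 * \<bar>\<tau> * \<xi>\<bar> powr (2 * r) * (cmod (g \<xi>))\<^sup>2" by (intro mult_right_mono cmod_cis_le) auto
      also have "\<bar>\<tau> * \<xi>\<bar> powr (2 * r) = \<tau> powr (2 * r) * \<bar>\<xi>\<bar> powr (2 * r)" using \<tau> by (simp add: abs_mult powr_mult)
      also have "\<bar>\<xi>\<bar> powr (2 * r) = (\<xi>\<^sup>2) powr r"
      proof (cases "\<xi> = 0")
        case False
        then have "\<xi>\<^sup>2 = \<bar>\<xi>\<bar> powr 2" by simp
        then show ?thesis by (simp only: powr_powr)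
      qed simp
      also have "4 * (\<tau> powr (2 * r) * (\<xi>\<^sup>2) powr r) * (cmod (g \<xi>))\<^sup>2 \<le> 4 * (\<tau> powr (2 * r) * (1 + \<xi>\<^sup>2) powr r) * (cmod (g \<xi>))\<^sup>2"
        using r by (intro mult_right_mono mult_left_mono powr_mono2) auto
      finally show "(cmod (h \<xi>))\<^sup>2 \<le> 4 * \<tau> powr (2 * r) * ((1 + \<xi>\<^sup>2) powr r * (cmod (g \<xi>))\<^sup>2)" by (simp add: mult_ac)
    qed
    also have "\<dots> = ennreal (LINT \<xi>|lborel. 4 * \<tau> powr (2 * r) * ((1 + \<xi>\<^sup>2) powr r * (cmod (g \<xi>))\<^sup>2))"
      using i by (intro nn_integral_eq_integral) auto
    also have "\<dots> \<le> ennreal (4 * E\<^sup>2 * \<tau> powr (2 * r))"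
    proof (rule ennreal_leI)
      have "(LINT \<xi>|lborel. 4 * \<tau> powr (2 * r) * ((1 + \<xi>\<^sup>2) powr r * (cmod (g \<xi>))\<^sup>2)) = 4 * \<tau> powr (2 * r) * (LINT \<xi>|lborel. (1 + \<xi>\<^sup>2) powr r * (cmod (g \<xi>))\<^sup>2)"
        by (rule integral_mult_right_zero)
      also have "\<dots> \<le> 4 * \<tau> powr (2 * r) * E\<^sup>2" by (intro mult_left_mono E) auto
      finally show "(LINT \<xi>|lborel. 4 * \<tau> powr (2 * r) * ((1 + \<xi>\<^sup>2) powr r * (cmod (g \<xi>))\<^sup>2)) \<le> 4 * E\<^sup>2 * \<tau> powr (2 * r)" by (simp add: mult_ac)
    qed
    finally show ?thesis .
  qed
  ultimately show ?thesis unfolding cls_def by blast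
qed

lemma adm_kern:
  assumes d: "d > 0"
  obtains L M where "\<And>y. \<bar>y\<bar> \<le> R \<Longrightarrow> adm (\<bar>R\<bar> + d) L M (\<lambda>x. kern d (x - y))"
proof -
  have uc: "ucls {y. \<bar>y\<bar> \<le> R} (\<lambda>y x. kern d (x - y))"
    using ucls_reindex[OF ucls_kern[OF d], of "{y. \<bar>y\<bar> \<le> R}" "\<lambda>y. y"] by simp
  obtain L M where "\<And>y. y \<in> {y. \<bar>y\<bar> \<le> R} \<Longrightarrow> adm (\<bar>R\<bar> + d) L M (\<lambda>x. kern d (x - y))"
  proof (rule adm_of_ucls[OF uc])
    show "\<bar>R\<bar> + d \<ge> 0" using d by simp
    fix y x :: real assume y: "y \<in> {y. \<bar>y\<bar> \<le> R}" "\<bar>R\<bar> + d < \<bar>x\<bar>"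
    then have "\<bar>y\<bar> \<le> R" by simp
    then have "d \<le> \<bar>x - y\<bar>" using y(2) by linarith
    then show "kern d (x - y) = 0" using kern_zero[OF d] by simp
  qed blast
  then show thesis by (intro that) auto
qed

lemma conv_eq_pairing:
  assumes f: "AE x in lborel. complex_of_real (f x) = inv_fourier g x" and fm: "f \<in> borel_measurable borel"
    and g: "integrable lborel g" and d: "d > 0"
  shows "complex_of_real (conv d f y) = pairing g (\<lambda>x. kern d (x - y))"
proof -
  note [measurable] = fm
  have [measurable]: "g \<in> borel_measurable borel" using g by auto
  have k: "integrable lborel (\<lambda>x. complex_of_real (kern d (x - y)))"
    by (rule smooth_cs_integrable[OF kern_smooth_cs[OF d]])
  have "complex_of_real (conv d f y) = (LINT x|lborel. complex_of_real (kern d (x - y) * f x))"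
    unfolding conv_kern[OF d] integral_complex_of_real by simp
  also have "\<dots> = (LINT x|lborel. complex_of_real (kern d (x - y)) * inv_fourier g x)"
  proof (rule integral_cong_AE)
    show "AE x in lborel. complex_of_real (kern d (x - y) * f x) = complex_of_real (kern d (x - y)) * inv_fourier g x"
      using f by eventually_elim simp
  qed measurable
  also have "\<dots> = pairing g (\<lambda>x. kern d (x - y))"
    unfolding pairing_def hat_def by (rule fourier_multiplication[OF k g, symmetric])
  finally show ?thesis .
qed

lemma hat_kern_shift:
  assumes d: "d > 0" shows "hat (\<lambda>x. kern d (x - y)) \<xi> = cis (y * \<xi>) * hat (kern d) \<xi>"
proof -
  have "integrable lborel (\<lambda>x. complex_of_real (kern d x))"
    using smooth_cs_integrable[OF kern_smooth_cs[OF d, of 0]] by simp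
  from inv_fourier_shift[OF this, of "- y" \<xi>] show ?thesis by (simp add: hat_def)
qed

text \<open>On the frequency side y occurs only in the character cis (y \<xi>). Its derivative
  brings down i \<xi>, and since its modulus is 1 the derivatives are dominated independently of
  y.\<close>

lemma conv_has_derivative:
  assumes f: "AE x in lborel. complex_of_real (f x) = inv_fourier g x" and fm: "f \<in> borel_measurable borel"
    and g: "integrable lborel g" and G: "dual (\<lambda>\<xi>. \<i> * of_real \<xi> * g \<xi>)" and d: "d > 0"
  shows "(conv d f has_real_derivative Re (pairing (\<lambda>\<xi>. \<i> * of_real \<xi> * g \<xi>) (\<lambda>x. kern d (x - y)))) (at y)"
proof -
  obtain L M where a: "\<And>y. \<bar>y\<bar> \<le> 0 \<Longrightarrow> adm (\<bar>0\<bar> + d) L M (\<lambda>x. kern d (x - y))" by (rule adm_kern[OF d]) blast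
  have a0: "adm (\<bar>0\<bar> + d) L M (kern d)" using a[of 0] by simp
  have [measurable]: "g \<in> borel_measurable borel" using g by auto
  have "((\<lambda>y. LINT \<xi>|lborel. g \<xi> * hat (\<lambda>x. kern d (x - y)) \<xi>) has_vector_derivative
      (LINT \<xi>|lborel. (\<i> * of_real \<xi> * g \<xi>) * hat (\<lambda>x. kern d (x - y)) \<xi>)) (at y)"
  proof (rule has_vector_derivative_integral(2)[where e = 1 and f' = "\<lambda>y \<xi>. (\<i> * of_real \<xi> * g \<xi>) * hat (\<lambda>x. kern d (x - y)) \<xi>"])
    show "integrable lborel (\<lambda>\<xi>. g \<xi> * hat (\<lambda>x. kern d (x - y)) \<xi>)" for y
    proof (rule Bochner_Integration.integrable_bound)
      show "integrable lborel (\<lambda>\<xi>. (L * (2 * (\<bar>0\<bar> + d))) *\<^sub>R g \<xi>)" using g by auto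
      show "AE \<xi> in lborel. norm (g \<xi> * hat (\<lambda>x. kern d (x - y)) \<xi>) \<le> norm ((L * (2 * (\<bar>0\<bar> + d))) *\<^sub>R g \<xi>)"
      proof (rule AE_I2)
        fix \<xi>
        have "norm (g \<xi> * hat (\<lambda>x. kern d (x - y)) \<xi>) = norm (g \<xi>) * norm (hat (kern d) \<xi>)"
          by (simp add: hat_kern_shift[OF d] norm_mult)
        also have "\<dots> \<le> norm (g \<xi>) * \<bar>L * (2 * (\<bar>0\<bar> + d))\<bar>"
          using hat_bound[OF a0, of \<xi>] by (intro mult_left_mono) auto
        finally show "norm (g \<xi> * hat (\<lambda>x. kern d (x - y)) \<xi>) \<le> norm ((L * (2 * (\<bar>0\<bar> + d))) *\<^sub>R g \<xi>)" by (simp add: mult.commute)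
      qed
    qed measurable
    show "((\<lambda>y. g \<xi> * hat (\<lambda>x. kern d (x - y)) \<xi>) has_vector_derivative (\<i> * of_real \<xi> * g \<xi>) * hat (\<lambda>x. kern d (x - y)) \<xi>) (at y)" for \<xi> y
    proof -
      have "((\<lambda>y. (g \<xi> * hat (kern d) \<xi>) * cis (\<xi> * y)) has_vector_derivative (g \<xi> * hat (kern d) \<xi>) * ((\<i> * of_real \<xi>) * cis (\<xi> * y))) (at y)"
        by (intro has_vector_derivative_mult_right cis_has_vector_derivative)
      then show ?thesis unfolding hat_kern_shift[OF d] by (simp add: mult_ac)
    qed
    show "integrable lborel (\<lambda>\<xi>. norm ((\<i> * of_real \<xi> * g \<xi>) * hat (kern d) \<xi>))" by (intro integrable_norm pairing_integrable[OF G a0])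
    show "norm ((\<i> * of_real \<xi> * g \<xi>) * hat (\<lambda>x. kern d (x - y)) \<xi>) \<le> norm ((\<i> * of_real \<xi> * g \<xi>) * hat (kern d) \<xi>)" for \<xi> y
      by (simp add: hat_kern_shift[OF d] norm_mult)
  qed simp
  then have "((\<lambda>y. Re (complex_of_real (conv d f y))) has_vector_derivative Re (pairing (\<lambda>\<xi>. \<i> * of_real \<xi> * g \<xi>) (\<lambda>x. kern d (x - y)))) (at y)"
    unfolding conv_eq_pairing[OF f fm g d] unfolding pairing_def by (rule bounded_linear.has_vector_derivative[OF bounded_linear_Re])
  then show ?thesis by (simp add: has_real_derivative_iff_has_vector_derivative)
qed

end

section \<open>From almost every time to every time\<close>

lemma continuous_onI_sequentially:
  fixes f :: "real \<Rightarrow> 'b::topological_space"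
  assumes "\<And>\<tau> t. \<tau> \<longlonglongrightarrow> t \<Longrightarrow> (\<lambda>n. f (\<tau> n)) \<longlonglongrightarrow> f t"
  shows "continuous_on UNIV f"
  unfolding continuous_on_sequentially using assms by (simp add: comp_def)

lemma continuous_vanish_of_rational:
  fixes f :: "real \<Rightarrow> complex"
  assumes "continuous_on UNIV f" "\<And>y. y \<in> \<rat> \<Longrightarrow> f y = 0"
  shows "f y = 0"
  using continuous_constant_on_closure[of \<rat> f 0 y] assms by (simp add: Rats_closure_real)

lemma integrable_indicator_continuous:
  fixes f :: "real \<Rightarrow> complex"
  assumes "continuous_on UNIV f"
  shows "integrable lborel (\<lambda>t. indicator {-R..R} t * f t)"
proof -
  have "set_integrable lborel {-R..R} f"
    by (rule borel_integrable_atLeastAtMost') (rule continuous_on_subset[OF assms subset_UNIV])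
  moreover have "(\<lambda>t. indicator {-R..R} t *\<^sub>R f t) = (\<lambda>t. indicator {-R..R} t * f t)" by (auto simp: indicator_def)
  ultimately show ?thesis unfolding set_integrable_def by simp
qed

text \<open>Increments are integrals of the weak derivative. When that is merely measurable but
  agrees almost everywhere with a continuous W, the function is differentiable at every
  time.\<close>

lemma weak_derivative_classical:
  fixes \<alpha> \<beta> W :: "real \<Rightarrow> complex"
  assumes \<alpha>: "continuous_on UNIV \<alpha>" and W: "continuous_on UNIV W"
    and \<beta>: "\<beta> \<in> borel_measurable borel" "AE t in lborel. \<beta> t = W t"
    and weak: "\<And>\<eta>. \<eta> \<in> smooth_cs \<Longrightarrow> (LINT t|lborel. \<beta> t * \<eta> t) = - (LINT t|lborel. \<alpha> t * vderiv \<eta> t)"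
  shows "(\<alpha> has_vector_derivative W t) (at t)"
proof (rule derivative_of_increment[OF W])
  fix p q :: real assume pq: "p < q"
  have [measurable]: "W \<in> borel_measurable borel" by (rule borel_measurable_continuous_onI[OF W])
  show "\<alpha> q - \<alpha> p = (LINT t|lborel. indicator {p<..<q} t * W t)"
  proof (rule weak_derivative_increment[OF \<alpha> integrable_indicator_continuous[OF W] _ pq])
    fix \<eta> assume \<eta>: "\<eta> \<in> smooth_cs"
    note [measurable] = smooth_cs_measurable[OF \<eta>] \<beta>(1)
    have "(LINT t|lborel. W t * \<eta> t) = (LINT t|lborel. \<beta> t * \<eta> t)"
    proof (rule integral_cong_AE)
      show "AE t in lborel. W t * \<eta> t = \<beta> t * \<eta> t" using \<beta>(2) by eventually_elim simp
    qed measurable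
    then show "(LINT t|lborel. W t * \<eta> t) = - (LINT t|lborel. \<alpha> t * vderiv \<eta> t)" using weak[OF \<eta>] by simp
  qed
qed

text \<open>Rounding y down to multiples of 1 / (n + 1) leaves countably many sections, each
  measurable in t; continuity in y gives the limit.\<close>

lemma caratheodory_measurable:
  fixes P :: "real \<Rightarrow> real \<Rightarrow> complex"
  assumes cont: "\<And>t. continuous_on UNIV (P t)" and m: "\<And>y. (\<lambda>t. P t y) \<in> borel_measurable borel"
  shows "(\<lambda>(t, y). P t y) \<in> borel_measurable (borel \<Otimes>\<^sub>M borel)"
proof -
  define q where "q n y = real_of_int \<lfloor>(real n + 1) * y\<rfloor> / (real n + 1)" for n :: nat and y :: real
  have q: "(\<lambda>n. q n y) \<longlonglongrightarrow> y" for y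
  proof (rule real_tendsto_sandwich)
    show "(\<lambda>n. y - 1 / (real n + 1)) \<longlonglongrightarrow> y" by real_asymp
    show "(\<lambda>n. y) \<longlonglongrightarrow> y" by simp
    show "\<forall>\<^sub>F n in sequentially. y - 1 / (real n + 1) \<le> q n y"
    proof (rule always_eventually, rule allI)
      fix n
      have "(real n + 1) * y - 1 \<le> real_of_int \<lfloor>(real n + 1) * y\<rfloor>" by linarith
      then have "((real n + 1) * y - 1) / (real n + 1) \<le> q n y" unfolding q_def by (rule divide_right_mono) simp
      then show "y - 1 / (real n + 1) \<le> q n y" by (simp add: diff_divide_distrib)
    qed
    show "\<forall>\<^sub>F n in sequentially. q n y \<le> y"
    proof (rule always_eventually, rule allI)
      fix n show "q n y \<le> y" unfolding q_def by (simp add: divide_le_eq mult.commute of_int_floor_le)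
    qed
  qed
  show ?thesis
  proof (rule borel_measurable_LIMSEQ_metric)
    fix n
    show "(\<lambda>(t, y). P t (q n y)) \<in> borel_measurable (borel \<Otimes>\<^sub>M borel)"
    proof -
      have [measurable]: "(\<lambda>t. P t (real_of_int i / (real n + 1))) \<in> borel_measurable borel" for i by (rule m)
      have "(\<lambda>p. P (fst p) (real_of_int \<lfloor>(real n + 1) * snd p\<rfloor> / (real n + 1))) \<in> borel_measurable (borel \<Otimes>\<^sub>M borel)"
      proof (rule measurable_compose_countable[where f = "\<lambda>i p. P (fst p) (real_of_int i / (real n + 1))" and g = "\<lambda>p. \<lfloor>(real n + 1) * snd p\<rfloor>"])
        show "(\<lambda>p. P (fst p) (real_of_int i / (real n + 1))) \<in> borel_measurable (borel \<Otimes>\<^sub>M borel)" for i by measurable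
        show "(\<lambda>p::real \<times> real. \<lfloor>(real n + 1) * snd p\<rfloor>) \<in> borel \<Otimes>\<^sub>M borel \<rightarrow>\<^sub>M count_space UNIV" by measurable
      qed
      then show ?thesis by (simp add: q_def case_prod_beta')
    qed
    show "(\<lambda>n. case p of (t, y) \<Rightarrow> P t (q n y)) \<longlonglongrightarrow> (case p of (t, y) \<Rightarrow> P t y)" for p
      unfolding case_prod_beta
      by (rule continuous_on_tendsto_compose[OF cont q]) auto
  qed
qed

text \<open>\<open>dual\<close> and \<open>nrm\<close> with a free exponent, since the orders s + 1,
  s, s - 1, r and r - 1 all occur in the passage from a solution to a flow.\<close>

definition weighted :: "real \<Rightarrow> (real \<Rightarrow> complex) \<Rightarrow> bool" where
  "weighted \<sigma> g \<longleftrightarrow> g \<in> borel_measurable borel \<and> integrable lborel (\<lambda>\<xi>. (1 + \<xi>\<^sup>2) powr \<sigma> * (cmod (g \<xi>))\<^sup>2)"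

definition weighted_sq :: "real \<Rightarrow> (real \<Rightarrow> complex) \<Rightarrow> real" where
  "weighted_sq \<sigma> g = (LINT \<xi>|lborel. (1 + \<xi>\<^sup>2) powr \<sigma> * (cmod (g \<xi>))\<^sup>2)"

lemma weighted_sq_nonneg: "0 \<le> weighted_sq p h" by (simp add: weighted_sq_def integral_nonneg_AE)

lemma weighted_dominated:
  assumes g: "weighted q g" and f: "f \<in> borel_measurable borel"
    and le: "\<And>\<xi>. (1 + \<xi>\<^sup>2) powr p * (cmod (f \<xi>))\<^sup>2 \<le> (1 + \<xi>\<^sup>2) powr q * (cmod (g \<xi>))\<^sup>2"
  shows "weighted p f" "weighted_sq p f \<le> weighted_sq q g"
proof -
  note [measurable] = f
  have i: "integrable lborel (\<lambda>\<xi>. (1 + \<xi>\<^sup>2) powr q * (cmod (g \<xi>))\<^sup>2)" using g by (simp add: weighted_def)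
  have m: "(\<lambda>\<xi>. (1 + \<xi>\<^sup>2) powr p * (cmod (f \<xi>))\<^sup>2) \<in> borel_measurable borel" by measurable
  have p: "0 \<le> (1 + \<xi>\<^sup>2) powr p * (cmod (f \<xi>))\<^sup>2" for \<xi> by simp
  show "weighted p f" "weighted_sq p f \<le> weighted_sq q g"
    using dominated_integral[OF i m p le] f by (simp_all add: weighted_def weighted_sq_def)
qed

lemma weighted_mono:
  assumes g: "weighted q g" and pq: "p \<le> q"
  shows "weighted p g" "weighted_sq p g \<le> weighted_sq q g"
proof -
  have "g \<in> borel_measurable borel" using g by (simp add: weighted_def)
  moreover have "(1 + \<xi>\<^sup>2) powr p * (cmod (g \<xi>))\<^sup>2 \<le> (1 + \<xi>\<^sup>2) powr q * (cmod (g \<xi>))\<^sup>2" for \<xi>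
    by (intro mult_right_mono powr_mono pq) auto
  ultimately show "weighted p g" "weighted_sq p g \<le> weighted_sq q g"
    by (auto intro!: weighted_dominated[OF g])
qed

lemma weighted_deriv:
  assumes g: "weighted q g" and pq: "p + 1 \<le> q"
  shows "weighted p (\<lambda>\<xi>. \<i> * of_real \<xi> * g \<xi>)" "weighted_sq p (\<lambda>\<xi>. \<i> * of_real \<xi> * g \<xi>) \<le> weighted_sq q g"
proof -
  have [measurable]: "g \<in> borel_measurable borel" using g by (simp add: weighted_def)
  have m: "(\<lambda>\<xi>. \<i> * of_real \<xi> * g \<xi>) \<in> borel_measurable borel" by measurable
  have le: "(1 + \<xi>\<^sup>2) powr p * (cmod (\<i> * of_real \<xi> * g \<xi>))\<^sup>2 \<le> (1 + \<xi>\<^sup>2) powr q * (cmod (g \<xi>))\<^sup>2" for \<xi>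
  proof -
    have "(1 + \<xi>\<^sup>2) powr p * \<xi>\<^sup>2 \<le> (1 + \<xi>\<^sup>2) powr p * (1 + \<xi>\<^sup>2)" by (intro mult_left_mono) auto
    also have "(1 + \<xi>\<^sup>2) powr p * (1 + \<xi>\<^sup>2) = (1 + \<xi>\<^sup>2) powr (p + 1)" by (simp add: powr_add add_pos_nonneg)
    also have "\<dots> \<le> (1 + \<xi>\<^sup>2) powr q" by (intro powr_mono pq) auto
    finally have "(1 + \<xi>\<^sup>2) powr p * \<xi>\<^sup>2 * (cmod (g \<xi>))\<^sup>2 \<le> (1 + \<xi>\<^sup>2) powr q * (cmod (g \<xi>))\<^sup>2"
      by (rule mult_right_mono) simp
    then show ?thesis by (simp add: norm_mult power_mult_distrib mult.assoc)
  qed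
  show "weighted p (\<lambda>\<xi>. \<i> * of_real \<xi> * g \<xi>)" "weighted_sq p (\<lambda>\<xi>. \<i> * of_real \<xi> * g \<xi>) \<le> weighted_sq q g"
    by (rule weighted_dominated[OF g m le])+
qed

lemma weighted_diff:
  assumes f: "weighted q f" and g: "weighted q g"
  shows "weighted q (\<lambda>\<xi>. f \<xi> - g \<xi>)"
proof -
  have m: "f \<in> borel_measurable borel" "g \<in> borel_measurable borel" using f g by (auto simp: weighted_def)
  note [measurable] = m
  have i: "integrable lborel (\<lambda>\<xi>. 2 * ((1 + \<xi>\<^sup>2) powr q * (cmod (f \<xi>))\<^sup>2) + 2 * ((1 + \<xi>\<^sup>2) powr q * (cmod (g \<xi>))\<^sup>2))"
    using f g by (auto simp: weighted_def)
  have mm: "(\<lambda>\<xi>. (1 + \<xi>\<^sup>2) powr q * (cmod (f \<xi> - g \<xi>))\<^sup>2) \<in> borel_measurable borel" by measurable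
  have le: "(1 + \<xi>\<^sup>2) powr q * (cmod (f \<xi> - g \<xi>))\<^sup>2 \<le> 2 * ((1 + \<xi>\<^sup>2) powr q * (cmod (f \<xi>))\<^sup>2) + 2 * ((1 + \<xi>\<^sup>2) powr q * (cmod (g \<xi>))\<^sup>2)" for \<xi>
  proof -
    have "(cmod (f \<xi> - g \<xi>))\<^sup>2 \<le> (cmod (f \<xi>) + cmod (g \<xi>))\<^sup>2" by (intro power_mono norm_triangle_ineq4) auto
    also have "\<dots> \<le> 2 * (cmod (f \<xi>))\<^sup>2 + 2 * (cmod (g \<xi>))\<^sup>2"
      using sum_squares_bound[of "cmod (f \<xi>)" "cmod (g \<xi>)"] by (simp add: power2_sum)
    finally have "(1 + \<xi>\<^sup>2) powr q * (cmod (f \<xi> - g \<xi>))\<^sup>2 \<le> (1 + \<xi>\<^sup>2) powr q * (2 * (cmod (f \<xi>))\<^sup>2 + 2 * (cmod (g \<xi>))\<^sup>2)"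
      by (rule mult_left_mono) simp
    then show ?thesis by (simp add: algebra_simps)
  qed
  show ?thesis unfolding weighted_def
    by (intro conjI borel_measurable_diff m dominated_integral(1)[OF i mm _ le]) auto
qed

context exponent
begin

lemma dual_iff_weighted: "dual G \<longleftrightarrow> weighted (r - 1) G" by (simp add: dual_def weighted_def)

lemma nrm_eq_weighted: "nrm G = sqrt (weighted_sq (r - 1) G)" by (simp add: nrm_def weighted_sq_def)

lemma adm_mono: "adm R L M h \<Longrightarrow> L \<le> L' \<Longrightarrow> M \<le> M' \<Longrightarrow> adm R L' M' h"
  unfolding adm_def using cls_mono[of L M h L' M'] by auto

text \<open>Values on translated kernels determine the action on every admissible w: average them
  with weight w, move the mollifier onto w by \<open>pairing_conv\<close>, and let the scale tend to
  0. This is how tested identities are later multiplied by a coefficient.\<close>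

lemma pairing_mollify:
  assumes G: "dual G" and c: "cls Lc Mc c" "Lc \<ge> 0" "Mc \<ge> 0" and w: "adm R L M w"
  shows "integrable lborel (\<lambda>y. of_real (w y) * pairing G (\<lambda>x. c x * kern (1 / (real n + 1)) (x - y)))"
    "(\<lambda>n. LINT y|lborel. of_real (w y) * pairing G (\<lambda>x. c x * kern (1 / (real n + 1)) (x - y))) \<longlonglongrightarrow> pairing G (\<lambda>x. c x * w x)"
proof -
  have pos: "1 / (real n + 1) > 0" for n by simp
  note wD = admD[OF w]
  show "integrable lborel (\<lambda>y. of_real (w y) * pairing G (\<lambda>x. c x * kern (1 / (real n + 1)) (x - y)))"
    by (rule pairing_conv(1)[OF G c wD(1,4,7) pos])
  have eq: "(LINT y|lborel. of_real (w y) * pairing G (\<lambda>x. c x * kern (1 / (real n + 1)) (x - y))) =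
      pairing G (\<lambda>x. c x * conv (1 / (real n + 1)) w x)" for n
    by (rule pairing_conv(2)[OF G c wD(1,4,7) pos])
  have uw: "ucls UNIV (\<lambda>i::nat. w)" by (rule uclsI[OF wD(8,9,5)])
  have uc: "ucls UNIV (\<lambda>i::nat. c)" by (rule uclsI[OF c(2,3,1)])
  obtain L1 M1 where a1: "\<And>n::nat. adm (R + 1) L1 M1 (\<lambda>x. c x * conv (1 / (real n + 1)) w x)"
  proof (rule adm_of_ucls[OF ucls_mult[OF uc ucls_conv[OF uw, of "\<lambda>n. 1 / (real n + 1)"]]])
    show "R + 1 \<ge> 0" using wD(7) by simp
    fix n :: nat and x :: real assume x: "R + 1 < \<bar>x\<bar>"
    have "conv (1 / (real n + 1)) w x = 0"
    proof (rule conv_zero[OF wD(4) pos])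
      have "1 / (real n + 1) \<le> 1" by simp
      then show "R + 1 / (real n + 1) < \<bar>x\<bar>" using x by linarith
    qed
    then show "c x * conv (1 / (real n + 1)) w x = 0" by simp
  qed auto
  obtain L2 M2 where a2: "\<And>n::nat. adm (R + 1) L2 M2 (\<lambda>x. c x * w x)"
  proof (rule adm_of_ucls[OF ucls_mult[OF uc uw]])
    show "R + 1 \<ge> 0" using wD(7) by simp
  qed (use wD(4) in auto)
  have "(\<lambda>n. pairing G (\<lambda>x. c x * conv (1 / (real n + 1)) w x)) \<longlonglongrightarrow> pairing G (\<lambda>x. c x * w x)"
  proof (rule pairing_tendsto_right[OF G])
    show "adm (R + 1) (max L1 L2) (max M1 M2) (\<lambda>x. c x * conv (1 / (real n + 1)) w x)" for n by (rule adm_mono[OF a1]) auto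
    show "adm (R + 1) (max L1 L2) (max M1 M2) (\<lambda>x. c x * w x)" by (rule adm_mono[OF a2]) auto
    show "(\<lambda>n. c x * conv (1 / (real n + 1)) w x) \<longlonglongrightarrow> c x * w x" for x
    proof (rule tendsto_mult[OF tendsto_const])
      show "(\<lambda>n. conv (1 / (real n + 1)) w x) \<longlonglongrightarrow> w x"
      proof (rule conv_tendsto[where f = "\<lambda>n. w" and y = "\<lambda>n. x" and L = L])
        show "(\<lambda>n. w (X n)) \<longlonglongrightarrow> w x" if "X \<longlonglongrightarrow> x" for X
          using continuous_on_tendsto_compose[OF wD(1) that] by simp
        show "(\<lambda>n. 1 / (real n + 1)) \<longlonglongrightarrow> 0" by real_asymp
      qed (use wD(1,3) in auto)
    qed
  qed
  then show "(\<lambda>n. LINT y|lborel. of_real (w y) * pairing G (\<lambda>x. c x * kern (1 / (real n + 1)) (x - y))) \<longlonglongrightarrow> pairing G (\<lambda>x. c x * w x)"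
    unfolding eq .
qed

lemma adm_coefficient_kern:
  assumes c: "ucls UNIV c" and d: "d > 0" and R: "R \<ge> 0"
  obtains L M where "\<And>t y. \<bar>y\<bar> \<le> R \<Longrightarrow> adm (R + d) L M (\<lambda>x. c t x * kern d (x - y))"
proof -
  have u: "ucls {p. \<bar>snd p\<bar> \<le> R} (\<lambda>p x. c (fst p) x * kern d (x - snd p))"
    by (rule ucls_mult[OF ucls_reindex[OF c, of _ fst] ucls_reindex[OF ucls_kern[OF d], of _ snd]]) auto
  obtain L M where a: "\<And>p. p \<in> {p. \<bar>snd p\<bar> \<le> R} \<Longrightarrow> adm (R + d) L M (\<lambda>x. c (fst p) x * kern d (x - snd p))"
  proof (rule adm_of_ucls[OF u])
    show "R + d \<ge> 0" using R d by simp
    fix p :: "'a \<times> real" and x :: real assume p: "p \<in> {p. \<bar>snd p\<bar> \<le> R}" and x: "R + d < \<bar>x\<bar>"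
    from p have "\<bar>snd p\<bar> \<le> R" by simp
    then have "d \<le> \<bar>x - snd p\<bar>" using x by linarith
    then show "c (fst p) x * kern d (x - snd p) = 0" using kern_zero[OF d] by simp
  qed auto
  show thesis
  proof (rule that)
    show "adm (R + d) L M (\<lambda>x. c t x * kern d (x - y))" if "\<bar>y\<bar> \<le> R" for t y
      using a[of "(t, y)"] that by simp
  qed
qed

lemma pairing_kern_continuous:
  assumes G: "dual G" and c: "cls Lc Mc c" "Lc \<ge> 0" "Mc \<ge> 0" and d: "d > 0"
  shows "continuous_on UNIV (\<lambda>y. pairing G (\<lambda>x. c x * kern d (x - y)))"
proof (rule continuous_onI_sequentially)
  fix Y :: "nat \<Rightarrow> real" and y assume Y: "Y \<longlonglongrightarrow> y"
  obtain R where R: "R > 0" "\<And>n. \<bar>Y n\<bar> \<le> R" using convergent_imp_Bseq[OF convergentI[OF Y]] by (auto simp: Bseq_def)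
  have y: "\<bar>y\<bar> \<le> R" by (rule LIMSEQ_le_const2[OF tendsto_rabs[OF Y]]) (use R in auto)
  have u: "ucls UNIV (\<lambda>i::unit. c)" by (rule uclsI[OF c(2,3,1)])
  obtain L M where a: "\<And>t y. \<bar>y\<bar> \<le> R \<Longrightarrow> adm (R + d) L M (\<lambda>x. c x * kern d (x - y))"
    by (rule adm_coefficient_kern[OF u d, of R]) (use R in auto)
  show "(\<lambda>n. pairing G (\<lambda>x. c x * kern d (x - Y n))) \<longlonglongrightarrow> pairing G (\<lambda>x. c x * kern d (x - y))"
  proof (rule pairing_tendsto_right[OF G a[OF R(2)] a[OF y]])
    fix x
    show "(\<lambda>n. c x * kern d (x - Y n)) \<longlonglongrightarrow> c x * kern d (x - y)"
      by (intro tendsto_mult tendsto_const continuous_on_tendsto_compose[OF kern_continuous[OF d, of UNIV]] tendsto_diff Y) auto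
  qed
qed

lemma coefficient_pairing_continuous:
  assumes G: "\<And>t. dual (G t)" and lim: "\<And>\<tau> t. \<tau> \<longlonglongrightarrow> t \<Longrightarrow> (\<lambda>n. nrm (\<lambda>\<xi>. G (\<tau> n) \<xi> - G t \<xi>)) \<longlonglongrightarrow> 0"
    and c: "ucls UNIV c" and c_lim: "\<And>\<tau> t x. \<tau> \<longlonglongrightarrow> t \<Longrightarrow> (\<lambda>n. c (\<tau> n) x) \<longlonglongrightarrow> c t x" and d: "d > 0"
  shows "continuous_on UNIV (\<lambda>t::real. pairing (G t) (\<lambda>x. c t x * kern d (x - y)))"
proof (rule continuous_onI_sequentially)
  fix \<tau> :: "nat \<Rightarrow> real" and t assume \<tau>: "\<tau> \<longlonglongrightarrow> t"
  obtain L M where a: "\<And>t z. \<bar>z\<bar> \<le> \<bar>y\<bar> \<Longrightarrow> adm (\<bar>y\<bar> + d) L M (\<lambda>x. c t x * kern d (x - z))"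
    by (rule adm_coefficient_kern[OF c d, of "\<bar>y\<bar>"]) auto
  show "(\<lambda>n. pairing (G (\<tau> n)) (\<lambda>x. c (\<tau> n) x * kern d (x - y))) \<longlonglongrightarrow> pairing (G t) (\<lambda>x. c t x * kern d (x - y))"
    by (rule pairing_tendsto[OF G G lim[OF \<tau>] a a]) (auto intro!: tendsto_mult c_lim[OF \<tau>])
qed

end

text \<open>A bounded continuous curve in H^r, given by representatives f and transforms g; F below
  is its continuous representative and G the transform of its x derivative. Both u_x and u_t are
  instances.\<close>

locale sobolev_curve = exponent +
  fixes f :: "real \<Rightarrow> real \<Rightarrow> real" and g :: "real \<Rightarrow> real \<Rightarrow> complex" and E :: real
  assumes g: "\<And>t. weighted r (g t)" and E: "E \<ge> 0" "\<And>t. weighted_sq r (g t) \<le> E\<^sup>2"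
    and g_lim: "\<And>\<tau> t. \<tau> \<longlonglongrightarrow> t \<Longrightarrow> (\<lambda>n. weighted_sq r (\<lambda>\<xi>. g (\<tau> n) \<xi> - g t \<xi>)) \<longlonglongrightarrow> 0"
    and f: "\<And>t. f t \<in> borel_measurable borel" "\<And>t. AE x in lborel. complex_of_real (f t x) = inv_fourier (g t) x"
begin

definition F :: "real \<Rightarrow> real \<Rightarrow> real" where "F t x = Re (inv_fourier (g t) x)"

definition G :: "real \<Rightarrow> real \<Rightarrow> complex" where "G t \<xi> = \<i> * of_real \<xi> * g t \<xi>"

lemma g_measurable: "g t \<in> borel_measurable borel" and g_sq_integrable: "integrable lborel (\<lambda>\<xi>. (1 + \<xi>\<^sup>2) powr r * (cmod (g t \<xi>))\<^sup>2)"
  using g[of t] by (auto simp: weighted_def)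

lemma g_integrable: "integrable lborel (g t)"
  by (rule sobolev_embedding[OF g_measurable g_sq_integrable])

lemma F_cls: "cls (embed_const * E) (4 * E\<^sup>2) (F t)"
  unfolding F_def[abs_def]
  by (rule inv_fourier_cls[OF g_measurable g_sq_integrable]) (use E in \<open>auto simp: weighted_sq_def\<close>)

lemma F_ucls: "ucls UNIV F"
  by (rule uclsI[OF _ _ F_cls]) (use E embed_const_nonneg in auto)

lemma F_cont: "continuous_on UNIV (F t)" and F_small: "\<bar>F t x\<bar> \<le> embed_const * E"
  using F_cls[of t] by (auto simp: cls_def)

lemma F_AE: "AE x in lborel. f t x = F t x"
  using f(2)[of t] by eventually_elim (metis F_def Re_complex_of_real)

text \<open>The embedding bounds the difference of two times uniformly in x by their H^r distance,
  so continuity of the curve gives joint continuity.\<close>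

lemma F_lim:
  assumes \<tau>: "\<tau> \<longlonglongrightarrow> t" and X: "X \<longlonglongrightarrow> x"
  shows "(\<lambda>n. F (\<tau> n) (X n)) \<longlonglongrightarrow> F t x"
proof -
  have le: "\<bar>F (\<tau> n) y - F t y\<bar> \<le> embed_const * sqrt (weighted_sq r (\<lambda>\<xi>. g (\<tau> n) \<xi> - g t \<xi>))" for n y
  proof -
    have w: "weighted r (\<lambda>\<xi>. g (\<tau> n) \<xi> - g t \<xi>)" by (rule weighted_diff[OF g g])
    have "\<bar>F (\<tau> n) y - F t y\<bar> = \<bar>Re (inv_fourier (\<lambda>\<xi>. g (\<tau> n) \<xi> - g t \<xi>) y)\<bar>"
      by (simp add: F_def inv_fourier_diff[OF g_integrable g_integrable])
    moreover have "\<dots> \<le> (LINT \<xi>|lborel. cmod (g (\<tau> n) \<xi> - g t \<xi>))" by (rule order_trans[OF abs_Re_le_cmod inv_fourier_norm_le])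
    moreover have "\<dots> \<le> embed_const * sqrt (weighted_sq r (\<lambda>\<xi>. g (\<tau> n) \<xi> - g t \<xi>))"
      using w unfolding weighted_def weighted_sq_def by (intro sobolev_embedding(2)) auto
    ultimately show ?thesis by linarith
  qed
  have "(\<lambda>n. embed_const * sqrt (weighted_sq r (\<lambda>\<xi>. g (\<tau> n) \<xi> - g t \<xi>))) \<longlonglongrightarrow> embed_const * sqrt 0"
    by (intro tendsto_intros g_lim[OF \<tau>])
  then have "(\<lambda>n. embed_const * sqrt (weighted_sq r (\<lambda>\<xi>. g (\<tau> n) \<xi> - g t \<xi>))) \<longlonglongrightarrow> 0" by simp
  then have 1: "(\<lambda>n. F (\<tau> n) (X n) - F t (X n)) \<longlonglongrightarrow> 0" by (rule Lim_null_comparison[rotated]) (simp add: le)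
  have 2: "(\<lambda>n. F t (X n)) \<longlonglongrightarrow> F t x" by (rule continuous_on_tendsto_compose[OF F_cont X]) auto
  show ?thesis using tendsto_add[OF 1 2] by simp
qed

lemma F_measurable [measurable]: "(\<lambda>(t, x). F t x) \<in> borel_measurable (borel \<Otimes>\<^sub>M borel)"
proof -
  have "continuous_on UNIV (\<lambda>p. F (fst p) (snd p))"
    unfolding continuous_on_sequentially by (auto simp: comp_def intro!: F_lim dest: tendsto_fst tendsto_snd)
  then show ?thesis unfolding borel_prod case_prod_beta' by (rule borel_measurable_continuous_onI)
qed

lemma g_dual: "dual (g t)" and G_dual: "dual (G t)" and G_nrm: "nrm (G t) \<le> E"
proof -
  show "dual (g t)" unfolding dual_iff_weighted by (rule weighted_mono(1)[OF g]) simp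
  show "dual (G t)" unfolding dual_iff_weighted G_def[abs_def] by (rule weighted_deriv(1)[OF g]) simp
  have "weighted_sq (r - 1) (G t) \<le> weighted_sq r (g t)" unfolding G_def[abs_def] by (rule weighted_deriv(2)[OF g]) simp
  then have "weighted_sq (r - 1) (G t) \<le> E\<^sup>2" using E(2)[of t] by linarith
  then show "nrm (G t) \<le> E" unfolding nrm_eq_weighted using E(1) by (rule real_le_lsqrt[rotated])
qed

lemma g_nrm_lim: "\<tau> \<longlonglongrightarrow> t \<Longrightarrow> (\<lambda>n. nrm (\<lambda>\<xi>. g (\<tau> n) \<xi> - g t \<xi>)) \<longlonglongrightarrow> 0"
  and G_nrm_lim: "\<tau> \<longlonglongrightarrow> t \<Longrightarrow> (\<lambda>n. nrm (\<lambda>\<xi>. G (\<tau> n) \<xi> - G t \<xi>)) \<longlonglongrightarrow> 0"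
proof -
  assume \<tau>: "\<tau> \<longlonglongrightarrow> t"
  have 0: "(\<lambda>n. sqrt (weighted_sq r (\<lambda>\<xi>. g (\<tau> n) \<xi> - g t \<xi>))) \<longlonglongrightarrow> 0"
    using tendsto_real_sqrt[OF g_lim[OF \<tau>]] by simp
  have w: "weighted r (\<lambda>\<xi>. g (\<tau> n) \<xi> - g t \<xi>)" for n by (rule weighted_diff[OF g g])
  have "nrm (\<lambda>\<xi>. g (\<tau> n) \<xi> - g t \<xi>) \<le> sqrt (weighted_sq r (\<lambda>\<xi>. g (\<tau> n) \<xi> - g t \<xi>))" for n
    unfolding nrm_eq_weighted by (intro real_sqrt_le_mono weighted_mono(2)[OF w]) simp
  then show "(\<lambda>n. nrm (\<lambda>\<xi>. g (\<tau> n) \<xi> - g t \<xi>)) \<longlonglongrightarrow> 0"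
    by (intro Lim_null_comparison[OF _ 0]) (simp add: nrm_nonneg)
  have "nrm (\<lambda>\<xi>. G (\<tau> n) \<xi> - G t \<xi>) \<le> sqrt (weighted_sq r (\<lambda>\<xi>. g (\<tau> n) \<xi> - g t \<xi>))" for n
  proof -
    have "(\<lambda>\<xi>. G (\<tau> n) \<xi> - G t \<xi>) = (\<lambda>\<xi>. \<i> * of_real \<xi> * (g (\<tau> n) \<xi> - g t \<xi>))" by (simp add: G_def algebra_simps)
    then show ?thesis
      unfolding nrm_eq_weighted using weighted_deriv(2)[OF w, of "r - 1"] by simp
  qed
  then show "(\<lambda>n. nrm (\<lambda>\<xi>. G (\<tau> n) \<xi> - G t \<xi>)) \<longlonglongrightarrow> 0"
    by (intro Lim_null_comparison[OF _ 0]) (simp add: nrm_nonneg)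
qed

lemma F_rep: "AE x in lborel. complex_of_real (F t x) = inv_fourier (g t) x"
  using f(2)[of t] F_AE[of t] by eventually_elim simp

lemma F_section_measurable: "F t \<in> borel_measurable borel" by (rule borel_measurable_continuous_onI[OF F_cont])

lemma conv_F: "d > 0 \<Longrightarrow> complex_of_real (conv d (F t) y) = pairing (g t) (\<lambda>x. kern d (x - y))"
  by (rule conv_eq_pairing[OF F_rep F_section_measurable g_integrable])

lemma conv_F_deriv:
  "d > 0 \<Longrightarrow> (conv d (F t) has_real_derivative Re (pairing (G t) (\<lambda>x. kern d (x - y)))) (at y)"
  unfolding G_def[abs_def]
  by (rule conv_has_derivative[OF F_rep F_section_measurable g_integrable G_dual[unfolded G_def[abs_def]]])

lemma F_energy: "integrable lborel (\<lambda>x. (F t x)\<^sup>2)" "(LINT x|lborel. (F t x)\<^sup>2) \<le> weighted_sq r (g t)"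
proof -
  have w: "weighted 0 (g t)" "weighted_sq 0 (g t) \<le> weighted_sq r (g t)" using r by (auto intro!: weighted_mono[OF g])
  have i: "integrable lborel (\<lambda>\<xi>. (cmod (g t \<xi>))\<^sup>2)" and sq: "weighted_sq 0 (g t) = (LINT \<xi>|lborel. (cmod (g t \<xi>))\<^sup>2)"
    using w(1) unfolding weighted_def weighted_sq_def by (simp_all add: add_nonneg_eq_0_iff)
  have "(\<integral>\<^sup>+x. ennreal ((F t x)\<^sup>2) \<partial>lborel) \<le> (\<integral>\<^sup>+x. ennreal ((cmod (inv_fourier (g t) x))\<^sup>2) \<partial>lborel)"
  proof (intro nn_integral_mono ennreal_leI)
    fix x
    have "\<bar>F t x\<bar>\<^sup>2 \<le> (cmod (inv_fourier (g t) x))\<^sup>2" unfolding F_def by (intro power_mono abs_Re_le_cmod) auto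
    then show "(F t x)\<^sup>2 \<le> (cmod (inv_fourier (g t) x))\<^sup>2" by simp
  qed
  also have "\<dots> \<le> (\<integral>\<^sup>+\<xi>. ennreal ((cmod (g t \<xi>))\<^sup>2) \<partial>lborel)" by (rule bessel[OF g_integrable])
  also have "\<dots> = ennreal (weighted_sq 0 (g t))" unfolding sq by (rule nn_integral_eq_integral[OF i]) auto
  also have "\<dots> \<le> ennreal (weighted_sq r (g t))" by (rule ennreal_leI[OF w(2)])
  finally have le: "(\<integral>\<^sup>+x. ennreal ((F t x)\<^sup>2) \<partial>lborel) \<le> ennreal (weighted_sq r (g t))" .
  have [measurable]: "F t \<in> borel_measurable borel" by (rule F_section_measurable)
  show i: "integrable lborel (\<lambda>x. (F t x)\<^sup>2)"
    by (rule integrableI_bounded) (use le in \<open>auto intro: le_less_trans\<close>)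
  have "(\<integral>\<^sup>+x. ennreal ((F t x)\<^sup>2) \<partial>lborel) = ennreal (LINT x|lborel. (F t x)\<^sup>2)" by (rule nn_integral_eq_integral[OF i]) auto
  then show "(LINT x|lborel. (F t x)\<^sup>2) \<le> weighted_sq r (g t)"
    using le weighted_sq_nonneg by (simp add: ennreal_le_iff)
qed

end

section \<open>Solutions of the Born-Infeld equation as flows\<close>

lemma integrable_mult_smooth_cs:
  fixes F :: "real \<Rightarrow> complex"
  assumes F: "\<And>R. integrable lborel (\<lambda>t. indicator {-R..R} t * F t)" and \<eta>: "\<eta> \<in> smooth_cs"
  shows "integrable lborel (\<lambda>t. \<eta> t * F t)"
proof -
  obtain R where R: "\<And>x. R < \<bar>x\<bar> \<Longrightarrow> \<eta> x = 0" using smooth_cs_support[OF \<eta>] by blast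
  obtain M where M: "\<And>x. norm (\<eta> x) \<le> M" using smooth_cs_bounded[OF \<eta>] by blast
  have eq: "(\<lambda>t. \<eta> t * F t) = (\<lambda>t. \<eta> t * (indicator {-R..R} t * F t))"
  proof
    fix t show "\<eta> t * F t = \<eta> t * (indicator {-R..R} t * F t)" using R[of t] by (cases "R < \<bar>t\<bar>") (auto simp: indicator_def abs_le_iff not_less)
  qed
  note [measurable] = smooth_cs_measurable[OF \<eta>] borel_measurable_integrable[OF F[of R]]
  show ?thesis unfolding eq
  proof (rule Bochner_Integration.integrable_bound[of lborel "\<lambda>t. complex_of_real M * (indicator {-R..R} t * F t)"])
    show "integrable lborel (\<lambda>t. complex_of_real M * (indicator {-R..R} t * F t))" by (intro Bochner_Integration.integrable_mult_right F)
    show "AE t in lborel. norm (\<eta> t * (indicator {-R..R} t * F t)) \<le> norm (complex_of_real M * (indicator {-R..R} t * F t))"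
    proof (rule AE_I2)
      fix t
      have "norm (\<eta> t) \<le> \<bar>M\<bar>" using M[of t] by linarith
      then show "norm (\<eta> t * (indicator {-R..R} t * F t)) \<le> norm (complex_of_real M * (indicator {-R..R} t * F t))"
        unfolding norm_mult[of "\<eta> t"] norm_mult[of "complex_of_real M"] by (intro mult_right_mono) auto
    qed
  qed measurable
qed

locale solution = exponent +
  fixes s \<epsilon> :: real and u ux ut :: "real \<Rightarrow> real \<Rightarrow> real"
  assumes rs: "r \<le> s" and eps: "\<epsilon> \<ge> 0" "embed_const * \<epsilon> \<le> 1 / 4"
    and bi: "born_infeld_solution s u ux ut"
    and small: "\<And>t. pair_norm s (u t) (ut t) \<le> \<epsilon>"
begin

definition gu :: "real \<Rightarrow> real \<Rightarrow> complex" where "gu t = dist_fourier (reg_dist (u t))"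

definition ga :: "real \<Rightarrow> real \<Rightarrow> complex" where "ga t = (\<lambda>\<xi>. \<i> * of_real \<xi> * gu t \<xi>)"

definition gb :: "real \<Rightarrow> real \<Rightarrow> complex" where "gb t = dist_fourier (reg_dist (ut t))"

lemma solutionD:
  "sobolev (s + 1) (reg_dist (u t))" "square_integrable (u t)"
  "((\<lambda>t. sobolev_norm (s + 1) (dist_diff (reg_dist (u t)) (reg_dist (u t0)))) \<longlongrightarrow> 0) (at t0)"
  "sobolev s (reg_dist (ut t))" "square_integrable (ut t)"
  "((\<lambda>t. sobolev_norm s (dist_diff (reg_dist (ut t)) (reg_dist (ut t0)))) \<longlongrightarrow> 0) (at t0)"
  "weak_deriv (u t) (ux t)" "dist_deriv_t (\<lambda>t. reg_dist (u t)) (\<lambda>t. reg_dist (ut t))"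
  using bi unfolding born_infeld_solution_def sobolev_continuous_def by auto

lemma has_fourier_u: "has_fourier (reg_dist (u t)) (gu t)" and has_fourier_ut: "has_fourier (reg_dist (ut t)) (gb t)"
  using solutionD(1,4)[of t] has_fourier_dist_fourier unfolding sobolev_def gu_def gb_def by blast+

lemma has_fourier_ux: "has_fourier (dist_deriv (reg_dist (u t))) (ga t)"
  unfolding ga_def by (rule has_fourier_deriv[OF has_fourier_u])

lemma weighted_gu: "weighted (s + 1) (gu t)" and weighted_gb: "weighted s (gb t)"
  unfolding weighted_def
  using sobolev_integrable(1)[OF solutionD(1) has_fourier_u] sobolev_integrable(1)[OF solutionD(4) has_fourier_ut]
    has_fourier_measurable[OF has_fourier_u] has_fourier_measurable[OF has_fourier_ut] by auto

lemma energy_bound: "weighted_sq (s + 1) (gu t) + weighted_sq s (gb t) \<le> \<epsilon>\<^sup>2"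
proof -
  have "weighted_sq (s + 1) (gu t) + weighted_sq s (gb t) = (pair_norm s (u t) (ut t))\<^sup>2"
    unfolding pair_norm_def weighted_sq_def sobolev_norm_square[OF has_fourier_u, symmetric] sobolev_norm_square[OF has_fourier_ut, symmetric]
    by simp
  also have "\<dots> \<le> \<epsilon>\<^sup>2" using small[of t] by (intro power_mono) (auto simp: pair_norm_def)
  finally show ?thesis .
qed

text \<open>Continuity of the curve is stated as a punctured limit; as the difference vanishes at t
  itself, sequences may also take the value t.\<close>

lemma sequential_limit:
  assumes lim: "(f \<longlongrightarrow> 0) (at t)" and 0: "f t = 0" and \<tau>: "\<tau> \<longlonglongrightarrow> t" and sq: "\<And>n. (f (\<tau> n))\<^sup>2 = w n"
  shows "w \<longlonglongrightarrow> (0::real)"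
proof -
  have "(f \<longlongrightarrow> f t) (nhds t)" using lim 0 tendsto_at_iff_tendsto_nhds[of f t] by simp
  from filterlim_compose[OF this \<tau>] have "(\<lambda>n. f (\<tau> n)) \<longlonglongrightarrow> 0" using 0 by simp
  from tendsto_power[OF this, of 2] show ?thesis by (simp add: sq)
qed

lemma weighted_gu_lim: "\<tau> \<longlonglongrightarrow> t \<Longrightarrow> (\<lambda>n. weighted_sq (s + 1) (\<lambda>\<xi>. gu (\<tau> n) \<xi> - gu t \<xi>)) \<longlonglongrightarrow> 0"
  and weighted_gb_lim: "\<tau> \<longlonglongrightarrow> t \<Longrightarrow> (\<lambda>n. weighted_sq s (\<lambda>\<xi>. gb (\<tau> n) \<xi> - gb t \<xi>)) \<longlonglongrightarrow> 0"
proof -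
  assume \<tau>: "\<tau> \<longlonglongrightarrow> t"
  have 1: "(sobolev_norm (s + 1) (dist_diff (reg_dist (u t')) (reg_dist (u t))))\<^sup>2 = weighted_sq (s + 1) (\<lambda>\<xi>. gu t' \<xi> - gu t \<xi>)" for t'
    unfolding weighted_sq_def by (rule sobolev_norm_square[OF has_fourier_diff[OF has_fourier_u has_fourier_u]])
  have 2: "(sobolev_norm s (dist_diff (reg_dist (ut t')) (reg_dist (ut t))))\<^sup>2 = weighted_sq s (\<lambda>\<xi>. gb t' \<xi> - gb t \<xi>)" for t'
    unfolding weighted_sq_def by (rule sobolev_norm_square[OF has_fourier_diff[OF has_fourier_ut has_fourier_ut]])
  show "(\<lambda>n. weighted_sq (s + 1) (\<lambda>\<xi>. gu (\<tau> n) \<xi> - gu t \<xi>)) \<longlonglongrightarrow> 0"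
    by (rule sequential_limit[OF solutionD(3) _ \<tau> 1]) (use 1[of t] in \<open>simp add: weighted_sq_def\<close>)
  show "(\<lambda>n. weighted_sq s (\<lambda>\<xi>. gb (\<tau> n) \<xi> - gb t \<xi>)) \<longlonglongrightarrow> 0"
    by (rule sequential_limit[OF solutionD(6) _ \<tau> 2]) (use 2[of t] in \<open>simp add: weighted_sq_def\<close>)
qed

lemma weighted_ga: "weighted r (ga t)" "weighted_sq r (ga t) \<le> weighted_sq (s + 1) (gu t)"
  unfolding ga_def by (rule weighted_deriv[OF weighted_gu]; use rs in simp)+

lemma weighted_gb': "weighted r (gb t)" "weighted_sq r (gb t) \<le> weighted_sq s (gb t)"
  by (rule weighted_mono[OF weighted_gb rs])+

lemma square_integrable_ux: "square_integrable (ux t)"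
  using solutionD(7)[of t] by (simp add: weak_deriv_def)

lemma square_integrable_measurable: "square_integrable f \<Longrightarrow> f \<in> borel_measurable borel"
  by (simp add: square_integrable_def)

sublocale A: sobolev_curve r ux ga \<epsilon>
proof
  show "weighted r (ga t)" for t by (rule weighted_ga)
  show "0 \<le> \<epsilon>" by (rule eps)
  show "weighted_sq r (ga t) \<le> \<epsilon>\<^sup>2" for t
    using weighted_ga(2)[of t] energy_bound[of t] weighted_sq_nonneg[of s "gb t"] by linarith
  show "(\<lambda>n. weighted_sq r (\<lambda>\<xi>. ga (\<tau> n) \<xi> - ga t \<xi>)) \<longlonglongrightarrow> 0" if \<tau>: "\<tau> \<longlonglongrightarrow> t" for \<tau> t
  proof (rule Lim_null_comparison[OF always_eventually[OF allI] weighted_gu_lim[OF \<tau>]])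
    fix n
    have "(\<lambda>\<xi>. ga (\<tau> n) \<xi> - ga t \<xi>) = (\<lambda>\<xi>. \<i> * of_real \<xi> * (gu (\<tau> n) \<xi> - gu t \<xi>))" by (simp add: ga_def algebra_simps)
    then have "weighted_sq r (\<lambda>\<xi>. ga (\<tau> n) \<xi> - ga t \<xi>) \<le> weighted_sq (s + 1) (\<lambda>\<xi>. gu (\<tau> n) \<xi> - gu t \<xi>)"
      using weighted_deriv(2)[OF weighted_diff[OF weighted_gu weighted_gu], of r "\<tau> n" t] rs by simp
    then show "norm (weighted_sq r (\<lambda>\<xi>. ga (\<tau> n) \<xi> - ga t \<xi>)) \<le> weighted_sq (s + 1) (\<lambda>\<xi>. gu (\<tau> n) \<xi> - gu t \<xi>)"
      using weighted_sq_nonneg by simp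
  qed
  show "ux t \<in> borel_measurable borel" for t by (rule square_integrable_measurable[OF square_integrable_ux])
  show "AE x in lborel. complex_of_real (ux t x) = inv_fourier (ga t) x" for t
  proof (rule AE_eq_inv_fourier[OF square_integrable_ux])
    show "integrable lborel (ga t)" using weighted_ga(1)[of t] unfolding weighted_def by (intro sobolev_embedding(1)) auto
    fix \<rho> assume \<rho>: "\<rho> \<in> smooth_cs"
    have "reg_dist (ux t) \<rho> = dist_deriv (reg_dist (u t)) \<rho>"
      using solutionD(7)[of t] \<rho> smooth_cs_subset_schwartz by (auto simp: weak_deriv_def)
    then show "reg_dist (ux t) \<rho> = (LINT \<xi>|lborel. ga t \<xi> * inv_fourier \<rho> \<xi>)"
      using has_fourier_test(2)[OF has_fourier_ux \<rho>] by simp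
  qed
qed

sublocale B: sobolev_curve r ut gb \<epsilon>
proof
  show "weighted r (gb t)" for t by (rule weighted_gb')
  show "0 \<le> \<epsilon>" by (rule eps)
  show "weighted_sq r (gb t) \<le> \<epsilon>\<^sup>2" for t
    using weighted_gb'(2)[of t] energy_bound[of t] weighted_sq_nonneg[of "s + 1" "gu t"] by linarith
  show "(\<lambda>n. weighted_sq r (\<lambda>\<xi>. gb (\<tau> n) \<xi> - gb t \<xi>)) \<longlonglongrightarrow> 0" if \<tau>: "\<tau> \<longlonglongrightarrow> t" for \<tau> t
  proof (rule Lim_null_comparison[OF always_eventually[OF allI] weighted_gb_lim[OF \<tau>]])
    fix n
    show "norm (weighted_sq r (\<lambda>\<xi>. gb (\<tau> n) \<xi> - gb t \<xi>)) \<le> weighted_sq s (\<lambda>\<xi>. gb (\<tau> n) \<xi> - gb t \<xi>)"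
      using weighted_mono(2)[OF weighted_diff[OF weighted_gb weighted_gb] rs, of "\<tau> n" t] weighted_sq_nonneg by simp
  qed
  show "ut t \<in> borel_measurable borel" for t by (rule square_integrable_measurable[OF solutionD(5)])
  show "AE x in lborel. complex_of_real (ut t x) = inv_fourier (gb t) x" for t
  proof (rule AE_eq_inv_fourier[OF solutionD(5)])
    show "integrable lborel (gb t)" using weighted_gb'(1)[of t] unfolding weighted_def by (intro sobolev_embedding(1)) auto
    show "reg_dist (ut t) \<rho> = (LINT \<xi>|lborel. gb t \<xi> * inv_fourier \<rho> \<xi>)" if "\<rho> \<in> smooth_cs" for \<rho>
      by (rule has_fourier_test(2)[OF has_fourier_ut that])
  qed
qed

lemma has_fourier_uxx: "has_fourier (dist_deriv (dist_deriv (reg_dist (u t)))) (A.G t)"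
  unfolding A.G_def[abs_def] by (rule has_fourier_deriv[OF has_fourier_ux])

lemma has_fourier_utx: "has_fourier (dist_deriv (reg_dist (ut t))) (B.G t)"
  unfolding B.G_def[abs_def] by (rule has_fourier_deriv[OF has_fourier_ut])

lemma has_fourier_kern:
  assumes "has_fourier T g" "d > 0"
  shows "T (\<lambda>x. complex_of_real (kern d (x - y))) = pairing g (\<lambda>x. kern d (x - y))"
  unfolding pairing_def hat_def by (rule has_fourier_test(2)[OF assms(1) kern_smooth_cs[OF assms(2)]])

lemma curve_pairing_continuous:
  assumes d: "d > 0"
  shows "continuous_on UNIV (\<lambda>t. pairing (ga t) (\<lambda>x. kern d (x - y)))" "continuous_on UNIV (\<lambda>t. pairing (gb t) (\<lambda>x. kern d (x - y)))"
    "continuous_on UNIV (\<lambda>t. pairing (A.G t) (\<lambda>x. kern d (x - y)))" "continuous_on UNIV (\<lambda>t. pairing (B.G t) (\<lambda>x. kern d (x - y)))"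
  using coefficient_pairing_continuous[OF A.g_dual A.g_nrm_lim ucls_const[of UNIV 1] tendsto_const d]
    coefficient_pairing_continuous[OF B.g_dual B.g_nrm_lim ucls_const[of UNIV 1] tendsto_const d]
    coefficient_pairing_continuous[OF A.G_dual A.G_nrm_lim ucls_const[of UNIV 1] tendsto_const d]
    coefficient_pairing_continuous[OF B.G_dual B.G_nrm_lim ucls_const[of UNIV 1] tendsto_const d] by simp_all

lemma reg_dist_cmult: "reg_dist f (\<lambda>x. c * \<phi> x) = c * reg_dist f \<phi>"
proof -
  have "(LINT x|lborel. complex_of_real (f x) * (c * \<phi> x)) = (LINT x|lborel. c * (complex_of_real (f x) * \<phi> x))"
    by (simp add: mult_ac)
  then show ?thesis unfolding reg_dist_def by (simp only: integral_mult_right_zero)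
qed

text \<open>This is a_t = b_x. The relation between u and u_t is tested with a time factor times the
  x derivative of the kernel; the weak time derivative so obtained is continuous in t, hence
  classical.\<close>

lemma conv_A_deriv_t:
  assumes d: "d > 0"
  shows "((\<lambda>t. conv d (A.F t) y) has_real_derivative Re (pairing (B.G t) (\<lambda>x. kern d (x - y)))) (at t)"
proof -
  define k where "k = (\<lambda>x. complex_of_real (kern d (x - y)))"
  have k: "k \<in> smooth_cs" unfolding k_def by (rule kern_smooth_cs[OF d])
  have k': "vderiv k \<in> smooth_cs" by (rule smooth_cs_vderiv[OF k])
  have \<alpha>: "- reg_dist (u t) (vderiv k) = pairing (ga t) (\<lambda>x. kern d (x - y))" for t
    using has_fourier_kern[OF has_fourier_ux d] by (simp add: dist_deriv_def k_def)
  have \<beta>: "- reg_dist (ut t) (vderiv k) = pairing (B.G t) (\<lambda>x. kern d (x - y))" for t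
    using has_fourier_kern[OF has_fourier_utx d] by (simp add: dist_deriv_def k_def)
  note c = curve_pairing_continuous[OF d, of y]
  have "((\<lambda>t. pairing (ga t) (\<lambda>x. kern d (x - y))) has_vector_derivative pairing (B.G t) (\<lambda>x. kern d (x - y))) (at t)"
  proof (rule weak_derivative_classical[OF c(1) c(4) borel_measurable_continuous_onI[OF c(4)] AE_I2[OF refl]])
    fix \<eta> assume \<eta>: "\<eta> \<in> smooth_cs"
    note p = product_test_function[OF \<eta> k']
    have "spacetime (\<lambda>t. reg_dist (ut t)) (\<lambda>t x. \<eta> t * vderiv k x) = - spacetime (\<lambda>t. reg_dist (u t)) (\<lambda>t x. vderiv \<eta> t * vderiv k x)"
      using solutionD(8) p(1) unfolding dist_deriv_t_def p(2)[symmetric] by blast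
    then have "(LINT t|lborel. - (pairing (B.G t) (\<lambda>x. kern d (x - y)) * \<eta> t)) = - (LINT t|lborel. - (pairing (ga t) (\<lambda>x. kern d (x - y)) * vderiv \<eta> t))"
      unfolding spacetime_def reg_dist_cmult \<alpha>[symmetric] \<beta>[symmetric] by (simp add: mult.commute)
    then have e: "(LINT t|lborel. pairing (ga t) (\<lambda>x. kern d (x - y)) * vderiv \<eta> t) = - (LINT t|lborel. pairing (B.G t) (\<lambda>x. kern d (x - y)) * \<eta> t)"
      by simp
    show "(LINT t|lborel. pairing (B.G t) (\<lambda>x. kern d (x - y)) * \<eta> t) = - (LINT t|lborel. pairing (ga t) (\<lambda>x. kern d (x - y)) * vderiv \<eta> t)"
      unfolding e by simp
  qed
  from bounded_linear.has_vector_derivative[OF bounded_linear_Re this] show ?thesis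
    unfolding A.conv_F[OF d, symmetric] by (simp add: has_real_derivative_iff_has_vector_derivative)
qed

definition c1 :: "real \<Rightarrow> real \<Rightarrow> real" where "c1 t x = 1 - (B.F t x)\<^sup>2"

definition c2 :: "real \<Rightarrow> real \<Rightarrow> real" where "c2 t x = A.F t x * B.F t x"

definition c3 :: "real \<Rightarrow> real \<Rightarrow> real" where "c3 t x = 1 + (A.F t x)\<^sup>2"

lemma ucls_c: "ucls UNIV c1" "ucls UNIV c2" "ucls UNIV c3"
  unfolding c1_def[abs_def] c2_def[abs_def] c3_def[abs_def]
  by (intro ucls_diff ucls_add ucls_mult ucls_power ucls_const A.F_ucls B.F_ucls)+

lemma c_lim:
  assumes \<tau>: "\<tau> \<longlonglongrightarrow> t"
  shows "(\<lambda>n. c1 (\<tau> n) x) \<longlonglongrightarrow> c1 t x" "(\<lambda>n. c2 (\<tau> n) x) \<longlonglongrightarrow> c2 t x"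
  unfolding c1_def c2_def by (intro tendsto_intros A.F_lim[OF \<tau>] B.F_lim[OF \<tau>])+

lemma cls_c:
  obtains L M where "L \<ge> 0" "M \<ge> 0" "\<And>t. cls L M (c1 t)" "\<And>t. cls L M (c2 t)" "\<And>t. cls L M (c3 t)"
proof -
  obtain L1 M1 where 1: "L1 \<ge> 0" "M1 \<ge> 0" "\<And>t. cls L1 M1 (c1 t)" using uclsE[OF ucls_c(1)] by (metis UNIV_I)
  obtain L2 M2 where 2: "L2 \<ge> 0" "M2 \<ge> 0" "\<And>t. cls L2 M2 (c2 t)" using uclsE[OF ucls_c(2)] by (metis UNIV_I)
  obtain L3 M3 where 3: "L3 \<ge> 0" "M3 \<ge> 0" "\<And>t. cls L3 M3 (c3 t)" using uclsE[OF ucls_c(3)] by (metis UNIV_I)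
  show thesis
    by (rule that[of "L1 + L2 + L3" "M1 + M2 + M3"]; (rule cls_mono[OF 1(3)] cls_mono[OF 2(3)] cls_mono[OF 3(3)])?; use 1 2 3 in simp)
qed

text \<open>The right side of the equation solved for u_tt, tested with the kernel at y. Unlike u_tt
  it is visibly continuous in t.\<close>

definition W :: "real \<Rightarrow> real \<Rightarrow> real \<Rightarrow> complex" where
  "W d y t = pairing (A.G t) (\<lambda>x. speed (A.F t x) (B.F t x) * kern d (x - y)) +
     pairing (B.G t) (\<lambda>x. drift (A.F t x) (B.F t x) * kern d (x - y))"

lemma speed_lim: "\<tau> \<longlonglongrightarrow> t \<Longrightarrow> (\<lambda>n. speed (A.F (\<tau> n) x) (B.F (\<tau> n) x)) \<longlonglongrightarrow> speed (A.F t x) (B.F t x)"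
  and drift_lim: "\<tau> \<longlonglongrightarrow> t \<Longrightarrow> (\<lambda>n. drift (A.F (\<tau> n) x) (B.F (\<tau> n) x)) \<longlonglongrightarrow> drift (A.F t x) (B.F t x)"
proof -
  assume \<tau>: "\<tau> \<longlonglongrightarrow> t"
  have nz: "1 + (A.F t x)\<^sup>2 \<noteq> 0" by (simp add: add_nonneg_eq_0_iff)
  show "(\<lambda>n. speed (A.F (\<tau> n) x) (B.F (\<tau> n) x)) \<longlonglongrightarrow> speed (A.F t x) (B.F t x)"
    "(\<lambda>n. drift (A.F (\<tau> n) x) (B.F (\<tau> n) x)) \<longlonglongrightarrow> drift (A.F t x) (B.F t x)"
    unfolding speed_def drift_def by (intro tendsto_intros A.F_lim[OF \<tau>] B.F_lim[OF \<tau>] nz)+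
qed

lemma W_continuous: "d > 0 \<Longrightarrow> continuous_on UNIV (W d y)"
  unfolding W_def[abs_def]
  by (intro continuous_on_add coefficient_pairing_continuous[OF A.G_dual A.G_nrm_lim] coefficient_pairing_continuous[OF B.G_dual B.G_nrm_lim]
      ucls_coefficients[OF A.F_ucls B.F_ucls] speed_lim drift_lim)

text \<open>The terms of the undivided equation tested with a kernel at y, with continuous
  representatives in the coefficients: \<open>p1\<close> for u_xx, \<open>p2\<close> for the mixed
  derivative, and later \<open>p3\<close> for u_tt.\<close>

definition p1 :: "real \<Rightarrow> real \<Rightarrow> real \<Rightarrow> complex" where "p1 d y t = pairing (A.G t) (\<lambda>x. c1 t x * kern d (x - y))"

definition p2 :: "real \<Rightarrow> real \<Rightarrow> real \<Rightarrow> complex" where "p2 d y t = pairing (B.G t) (\<lambda>x. c2 t x * kern d (x - y))"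

lemma p12_continuous: "d > 0 \<Longrightarrow> continuous_on UNIV (p1 d y)" "d > 0 \<Longrightarrow> continuous_on UNIV (p2 d y)"
  unfolding p1_def[abs_def] p2_def[abs_def]
  by (intro coefficient_pairing_continuous[OF A.G_dual A.G_nrm_lim] coefficient_pairing_continuous[OF B.G_dual B.G_nrm_lim] ucls_c c_lim; assumption)+

section \<open>The equation solved for the second time derivative\<close>

context
  fixes utt :: "real \<Rightarrow> distribution"
  assumes utt: "sobolev_loc_integrable (s - 1) utt" and utt_deriv: "dist_deriv_t (\<lambda>t. reg_dist (ut t)) utt"
    and equation: "\<And>\<phi>. \<phi> \<in> test_functions \<Longrightarrow>
           spacetime (\<lambda>t. dist_mult (\<lambda>x. 1 - (ut t x)\<^sup>2) (dist_deriv (dist_deriv (reg_dist (u t))))) \<phi>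
           + 2 * spacetime (\<lambda>t. dist_mult (\<lambda>x. ux t x * ut t x) (dist_deriv (reg_dist (ut t)))) \<phi>
           - spacetime (\<lambda>t. dist_mult (\<lambda>x. 1 + (ux t x)\<^sup>2) (utt t)) \<phi> = 0"
begin

definition gT :: "real \<Rightarrow> real \<Rightarrow> complex" where "gT t = dist_fourier (utt t)"

definition p3 :: "real \<Rightarrow> real \<Rightarrow> real \<Rightarrow> complex" where "p3 d y t = pairing (gT t) (\<lambda>x. c3 t x * kern d (x - y))"

lemma has_fourier_utt: "has_fourier (utt t) (gT t)"
  using utt has_fourier_dist_fourier unfolding sobolev_loc_integrable_def sobolev_def gT_def by blast

lemma gT_dual: "dual (gT t)" and gT_nrm: "nrm (gT t) \<le> sobolev_norm (s - 1) (utt t)"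
proof -
  have "weighted (s - 1) (gT t)"
    unfolding weighted_def
    using has_fourier_measurable[OF has_fourier_utt] sobolev_integrable(1)[OF _ has_fourier_utt] utt by (auto simp: sobolev_loc_integrable_def)
  from weighted_mono[OF this, of "r - 1"] have w: "weighted (r - 1) (gT t)" "weighted_sq (r - 1) (gT t) \<le> weighted_sq (s - 1) (gT t)"
    using rs by auto
  show "dual (gT t)" unfolding dual_iff_weighted by (rule w)
  show "nrm (gT t) \<le> sobolev_norm (s - 1) (utt t)"
    using real_sqrt_le_mono[OF w(2)] by (simp add: nrm_eq_weighted sobolev_norm_def weighted_sq_def gT_def)
qed

text \<open>Weak measurability of \<open>utt\<close> concerns fixed test functions, but here the
  multiplier depends on t. By mollification \<open>p3\<close> is a limit of integrals in z of the
  multiplier against \<open>utt\<close> tested with a kernel at z; these integrands are jointly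
  measurable by the Caratheodory argument.\<close>

lemma p3_measurable:
  assumes d: "d > 0"
  shows "p3 d y \<in> borel_measurable borel"
proof -
  define P where "P n t z = pairing (gT t) (\<lambda>x. 1 * kern (1 / (real n + 1)) (x - z))" for n :: nat and t z
  have pos: "1 / (real n + 1) > 0" for n by simp
  have Pm: "(\<lambda>(t, z). P n t z) \<in> borel_measurable (borel \<Otimes>\<^sub>M borel)" for n
  proof (rule caratheodory_measurable)
    show "continuous_on UNIV (P n t)" for t
      unfolding P_def by (rule pairing_kern_continuous[OF gT_dual cls_one _ _ pos]) auto
    fix z
    have "(\<lambda>x. complex_of_real (kern (1 / (real n + 1)) (x - z))) \<in> schwartz"
      using kern_smooth_cs[OF pos] smooth_cs_subset_schwartz by blast
    then have "(\<lambda>t. utt t (\<lambda>x. complex_of_real (kern (1 / (real n + 1)) (x - z)))) \<in> borel_measurable borel"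
      using utt by (simp add: sobolev_loc_integrable_def)
    then show "(\<lambda>t. P n t z) \<in> borel_measurable borel"
      unfolding P_def has_fourier_kern[OF has_fourier_utt pos] by simp
  qed
  obtain L M where a: "\<And>t z. \<bar>z\<bar> \<le> \<bar>y\<bar> \<Longrightarrow> adm (\<bar>y\<bar> + d) L M (\<lambda>x. c3 t x * kern d (x - z))"
    by (rule adm_coefficient_kern[OF ucls_c(3) d, of "\<bar>y\<bar>"]) auto
  show ?thesis
  proof (rule borel_measurable_LIMSEQ_metric)
    fix n
    note [measurable] = Pm[of n] A.F_measurable
    show "(\<lambda>t. LINT z|lborel. complex_of_real (c3 t z * kern d (z - y)) * P n t z) \<in> borel_measurable borel"
      unfolding c3_def by measurable
  next
    fix t
    have "(\<lambda>n. LINT z|lborel. complex_of_real (c3 t z * kern d (z - y)) * P n t z) \<longlonglongrightarrow> pairing (gT t) (\<lambda>x. 1 * (c3 t x * kern d (x - y)))"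
      unfolding P_def by (rule pairing_mollify(2)[OF gT_dual cls_one _ _ a]) auto
    then show "(\<lambda>n. LINT z|lborel. complex_of_real (c3 t z * kern d (z - y)) * P n t z) \<longlonglongrightarrow> p3 d y t" by (simp add: p3_def)
  qed
qed

lemma p3_integrable:
  assumes d: "d > 0"
  shows "integrable lborel (\<lambda>t. indicator {-R..R} t * p3 d y t)"
proof -
  obtain L M where a: "\<And>t z. \<bar>z\<bar> \<le> \<bar>y\<bar> \<Longrightarrow> adm (\<bar>y\<bar> + d) L M (\<lambda>x. c3 t x * kern d (x - z))"
    by (rule adm_coefficient_kern[OF ucls_c(3) d, of "\<bar>y\<bar>"]) auto
  \<comment> \<open>The summand 1 makes C positive. After division by C the pairing is bounded by
    the Sobolev norm of \<open>utt\<close> alone, whose integral over {-R..R} is finite by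
    assumption.\<close>
  define C where "C = adm_const (\<bar>y\<bar> + d) L M + 1"
  have C: "C > 0" using adm_wsq(2)[OF a[OF order_refl]] by (simp add: C_def)
  have le: "cmod (p3 d y t / of_real C) \<le> sobolev_norm (s - 1) (utt t)" for t
  proof -
    have "cmod (p3 d y t) \<le> nrm (gT t) * adm_const (\<bar>y\<bar> + d) L M"
      unfolding p3_def by (rule pairing_bound[OF gT_dual a]) simp
    also have "\<dots> \<le> nrm (gT t) * C" by (intro mult_left_mono) (auto simp: C_def nrm_nonneg)
    also have "\<dots> \<le> sobolev_norm (s - 1) (utt t) * C" using C by (intro mult_right_mono gT_nrm) auto
    finally show ?thesis using C by (simp add: norm_divide divide_le_eq)
  qed
  note [measurable] = p3_measurable[OF d, of y]
  have "integrable lborel (\<lambda>t. indicator {-R..R} t * (p3 d y t / of_real C))"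
  proof (rule integrableI_bounded)
    have "(\<integral>\<^sup>+t. ennreal (norm (indicator {-R..R} t * (p3 d y t / of_real C))) \<partial>lborel) \<le> (\<integral>\<^sup>+t\<in>{-R..R}. ennreal (sobolev_norm (s - 1) (utt t)) \<partial>lborel)"
    proof (rule nn_integral_mono)
      fix t
      show "ennreal (norm (indicator {-R..R} t * (p3 d y t / of_real C))) \<le> ennreal (sobolev_norm (s - 1) (utt t)) * indicator {-R..R} t"
        using ennreal_leI[OF le[of t]] by (cases "t \<in> {-R..R}") auto
    qed
    also have "\<dots> < \<infinity>" using utt by (simp add: sobolev_loc_integrable_def)
    finally show "(\<integral>\<^sup>+t. ennreal (norm (indicator {-R..R} t * (p3 d y t / of_real C))) \<partial>lborel) < \<infinity>" .
  qed measurable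
  from Bochner_Integration.integrable_mult_right[OF this, of "of_real C"] show ?thesis using C by (simp add: mult_ac)
qed

text \<open>The time factor of the test function is arbitrary, so the fundamental lemma in t
  applies. The null set still depends on d and y.\<close>

lemma tested_equation:
  assumes d: "d > 0"
  shows "AE t in lborel. p1 d y t + 2 * p2 d y t - p3 d y t = 0"
proof (rule AE_zero_of_test_integrals)
  have i: "integrable lborel (\<lambda>t. indicator {-R..R} t * p1 d y t)" "integrable lborel (\<lambda>t. indicator {-R..R} t * p2 d y t)"
    "integrable lborel (\<lambda>t. indicator {-R..R} t * p3 d y t)" for R
    by (rule integrable_indicator_continuous[OF p12_continuous(1)[OF d]] integrable_indicator_continuous[OF p12_continuous(2)[OF d]] p3_integrable[OF d])+
  have "integrable lborel (\<lambda>t. indicator {-R..R} t * p1 d y t + 2 * (indicator {-R..R} t * p2 d y t) - indicator {-R..R} t * p3 d y t)" for R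
    by (intro Bochner_Integration.integrable_diff Bochner_Integration.integrable_add Bochner_Integration.integrable_mult_right i)
  then show "integrable lborel (\<lambda>t. indicator {-R..R} t * (p1 d y t + 2 * p2 d y t - p3 d y t))" for R by (simp add: algebra_simps)
  fix \<eta> assume \<eta>: "\<eta> \<in> smooth_cs"
  define k where "k x = kern d (x - y)" for x
  have k: "(\<lambda>x. complex_of_real (k x)) \<in> smooth_cs" unfolding k_def by (rule kern_smooth_cs[OF d])
  have km: "k \<in> borel_measurable borel" unfolding k_def[abs_def] by measurable
  note m = A.f(1) B.f(1) A.F_section_measurable B.F_section_measurable
  note [measurable] = m
  have "AE x in lborel. 1 - (ut t x)\<^sup>2 = c1 t x" for t using B.F_AE[of t] by eventually_elim (simp add: c1_def)
  then have e1: "dist_mult (\<lambda>x. 1 - (ut t x)\<^sup>2) (dist_deriv (dist_deriv (reg_dist (u t)))) (\<lambda>x. \<eta> t * complex_of_real (k x)) = \<eta> t * p1 d y t" for t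
    unfolding p1_def pairing_def hat_def k_def[symmetric] by (intro dist_mult_eq[OF has_fourier_uxx _ _ _ km]) (auto simp: c1_def[abs_def])
  have "AE x in lborel. ux t x * ut t x = c2 t x" for t using A.F_AE[of t] B.F_AE[of t] by eventually_elim (simp add: c2_def)
  then have e2: "dist_mult (\<lambda>x. ux t x * ut t x) (dist_deriv (reg_dist (ut t))) (\<lambda>x. \<eta> t * complex_of_real (k x)) = \<eta> t * p2 d y t" for t
    unfolding p2_def pairing_def hat_def k_def[symmetric] by (intro dist_mult_eq[OF has_fourier_utx _ _ _ km]) (auto simp: c2_def[abs_def])
  have "AE x in lborel. 1 + (ux t x)\<^sup>2 = c3 t x" for t using A.F_AE[of t] by eventually_elim (simp add: c3_def)
  then have e3: "dist_mult (\<lambda>x. 1 + (ux t x)\<^sup>2) (utt t) (\<lambda>x. \<eta> t * complex_of_real (k x)) = \<eta> t * p3 d y t" for t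
    unfolding p3_def pairing_def hat_def k_def[symmetric] by (intro dist_mult_eq[OF has_fourier_utt _ _ _ km]) (auto simp: c3_def[abs_def])
  have I: "integrable lborel (\<lambda>t. \<eta> t * p1 d y t)" "integrable lborel (\<lambda>t. \<eta> t * p2 d y t)" "integrable lborel (\<lambda>t. \<eta> t * p3 d y t)"
    by (rule integrable_mult_smooth_cs[OF i(1) \<eta>] integrable_mult_smooth_cs[OF i(2) \<eta>] integrable_mult_smooth_cs[OF i(3) \<eta>])+
  have "(LINT t|lborel. \<eta> t * p1 d y t) + 2 * (LINT t|lborel. \<eta> t * p2 d y t) - (LINT t|lborel. \<eta> t * p3 d y t) = 0"
    using equation[OF product_test_function(1)[OF \<eta> k]] unfolding spacetime_def e1 e2 e3 .
  moreover have "(LINT t|lborel. (p1 d y t + 2 * p2 d y t - p3 d y t) * \<eta> t) =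
      (LINT t|lborel. \<eta> t * p1 d y t + 2 * (\<eta> t * p2 d y t) - \<eta> t * p3 d y t)" by (simp add: algebra_simps)
  moreover have "\<dots> = (LINT t|lborel. \<eta> t * p1 d y t) + 2 * (LINT t|lborel. \<eta> t * p2 d y t) - (LINT t|lborel. \<eta> t * p3 d y t)"
    using I by simp
  ultimately show "(LINT t|lborel. (p1 d y t + 2 * p2 d y t - p3 d y t) * \<eta> t) = 0" by simp
qed

text \<open>Division by 1 + u_x^2 at one fixed t. Continuity extends the tested identity from
  rational to all centres; averaging over centres with a suitable weight and letting the scale tend
  to 0 replaces the kernels by that weight.\<close>

lemma pointwise_equation:
  assumes eq: "\<And>n::nat. \<And>z. z \<in> \<rat> \<Longrightarrow> p1 (1 / (real n + 1)) z t + 2 * p2 (1 / (real n + 1)) z t - p3 (1 / (real n + 1)) z t = 0" and d: "d > 0"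
  shows "pairing (gT t) (\<lambda>x. kern d (x - y)) = W d y t"
proof -
  have pos: "1 / (real n + 1) > 0" for n by simp
  obtain L M where c: "L \<ge> 0" "M \<ge> 0" "cls L M (c1 t)" "cls L M (c2 t)" "cls L M (c3 t)"
    by (rule cls_c) blast
  have all: "p1 (1 / (real n + 1)) z t + 2 * p2 (1 / (real n + 1)) z t - p3 (1 / (real n + 1)) z t = 0" for n :: nat and z
  proof (rule continuous_vanish_of_rational[where f = "\<lambda>z. p1 (1 / (real n + 1)) z t + 2 * p2 (1 / (real n + 1)) z t - p3 (1 / (real n + 1)) z t"])
    show "continuous_on UNIV (\<lambda>z. p1 (1 / (real n + 1)) z t + 2 * p2 (1 / (real n + 1)) z t - p3 (1 / (real n + 1)) z t)"
      unfolding p1_def p2_def p3_def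
      by (intro continuous_on_diff continuous_on_add continuous_on_mult continuous_on_const
          pairing_kern_continuous[OF A.G_dual c(3,1,2) pos] pairing_kern_continuous[OF B.G_dual c(4,1,2) pos] pairing_kern_continuous[OF gT_dual c(5,1,2) pos])
  qed (rule eq)
  \<comment> \<open>Chosen so that \<open>c3 t x * w x\<close> is the kernel itself. The division
    takes place in the multiplier because u_tt is only a distribution.\<close>
  define w where "w x = 1 / (1 + (A.F t x)\<^sup>2) * kern d (x - y)" for x
  obtain Lw Mw where w: "adm (\<bar>y\<bar> + d) Lw Mw w"
    using adm_coefficient_kern[OF ucls_coefficients(1)[OF A.F_ucls B.F_ucls] d, of "\<bar>y\<bar>"] unfolding w_def[abs_def]
    by (metis abs_ge_zero order_refl)
  note m1 = pairing_mollify[OF A.G_dual[of t] c(3,1,2) w] and m2 = pairing_mollify[OF B.G_dual[of t] c(4,1,2) w] and m3 = pairing_mollify[OF gT_dual[of t] c(5,1,2) w]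
  have 0: "(LINT z|lborel. of_real (w z) * pairing (A.G t) (\<lambda>x. c1 t x * kern (1 / (real n + 1)) (x - z))) +
      2 * (LINT z|lborel. of_real (w z) * pairing (B.G t) (\<lambda>x. c2 t x * kern (1 / (real n + 1)) (x - z))) -
      (LINT z|lborel. of_real (w z) * pairing (gT t) (\<lambda>x. c3 t x * kern (1 / (real n + 1)) (x - z))) = 0" (is "?J n = 0") for n :: nat
  proof -
    have "?J n = (LINT z|lborel. of_real (w z) * pairing (A.G t) (\<lambda>x. c1 t x * kern (1 / (real n + 1)) (x - z)) +
      2 * (of_real (w z) * pairing (B.G t) (\<lambda>x. c2 t x * kern (1 / (real n + 1)) (x - z))) -
      of_real (w z) * pairing (gT t) (\<lambda>x. c3 t x * kern (1 / (real n + 1)) (x - z)))"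
      using m1(1)[of n] m2(1)[of n] m3(1)[of n] by simp
    moreover have "of_real (w z) * pairing (A.G t) (\<lambda>x. c1 t x * kern (1 / (real n + 1)) (x - z)) +
      2 * (of_real (w z) * pairing (B.G t) (\<lambda>x. c2 t x * kern (1 / (real n + 1)) (x - z))) -
      of_real (w z) * pairing (gT t) (\<lambda>x. c3 t x * kern (1 / (real n + 1)) (x - z)) = 0" for z
    proof -
      have "of_real (w z) * (p1 (1 / (real n + 1)) z t + 2 * p2 (1 / (real n + 1)) z t - p3 (1 / (real n + 1)) z t) = 0" by (simp only: all mult_zero_right)
      then show ?thesis by (simp only: p1_def p2_def p3_def) (simp add: algebra_simps)
    qed
    ultimately show ?thesis by simp
  qed
  have "?J \<longlonglongrightarrow> pairing (A.G t) (\<lambda>x. c1 t x * w x) + 2 * pairing (B.G t) (\<lambda>x. c2 t x * w x) - pairing (gT t) (\<lambda>x. c3 t x * w x)"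
    by (intro tendsto_intros m1(2) m2(2) m3(2))
  then have lim: "pairing (A.G t) (\<lambda>x. c1 t x * w x) + 2 * pairing (B.G t) (\<lambda>x. c2 t x * w x) - pairing (gT t) (\<lambda>x. c3 t x * w x) = 0"
    unfolding 0 by (rule LIMSEQ_unique[OF _ tendsto_const])
  have 1: "(\<lambda>x. c1 t x * w x) = (\<lambda>x. speed (A.F t x) (B.F t x) * kern d (x - y))"
    by (simp add: c1_def w_def speed_def)
  have 2: "2 * pairing (B.G t) (\<lambda>x. c2 t x * w x) = pairing (B.G t) (\<lambda>x. drift (A.F t x) (B.F t x) * kern d (x - y))"
  proof -
    have "(\<lambda>x. drift (A.F t x) (B.F t x) * kern d (x - y)) = (\<lambda>x. 2 * (c2 t x * w x))" by (simp add: c2_def w_def drift_def mult_ac)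
    then show ?thesis by (simp add: pairing_cmult)
  qed
  have 3: "(\<lambda>x. c3 t x * w x) = (\<lambda>x. kern d (x - y))"
  proof
    fix x
    have "1 + (A.F t x)\<^sup>2 \<noteq> 0" by (simp add: add_nonneg_eq_0_iff)
    then show "c3 t x * w x = kern d (x - y)" by (simp add: c3_def w_def)
  qed
  show ?thesis using lim unfolding 1 2 3 W_def by simp
qed

text \<open>For almost every t the tested u_tt equals \<open>W\<close>, which is continuous in t;
  the weak derivative is therefore a classical one at every time.\<close>

lemma conv_B_deriv_aux:
  assumes d: "d > 0"
  shows "((\<lambda>t. conv d (B.F t) y) has_real_derivative Re (W d y t)) (at t)"
proof -
  define k where "k = (\<lambda>x. complex_of_real (kern d (x - y)))"
  have k: "k \<in> smooth_cs" unfolding k_def by (rule kern_smooth_cs[OF d])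
  have \<alpha>: "reg_dist (ut t) k = pairing (gb t) (\<lambda>x. kern d (x - y))" for t
    unfolding k_def by (rule has_fourier_kern[OF has_fourier_ut d])
  have \<beta>: "utt t (\<lambda>x. c * k x) = c * utt t k" for t c
    unfolding has_fourier_test(2)[OF has_fourier_utt smooth_cs_cmult[OF k]] has_fourier_test(2)[OF has_fourier_utt k] inv_fourier_cmult
    by (simp add: mult.left_commute)
  have "((\<lambda>t. pairing (gb t) (\<lambda>x. kern d (x - y))) has_vector_derivative W d y t) (at t)"
  proof (rule weak_derivative_classical[OF curve_pairing_continuous(2)[OF d] W_continuous[OF d]])
    show "(\<lambda>t. utt t k) \<in> borel_measurable borel"
      using utt k smooth_cs_subset_schwartz by (auto simp: sobolev_loc_integrable_def)
    \<comment> \<open>Scales 1 / (n + 1) and rational centres are countably many, so one null set of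
      times serves for all of them.\<close>
    have "AE t in lborel. \<forall>n::nat. \<forall>z\<in>\<rat>. p1 (1 / (real n + 1)) z t + 2 * p2 (1 / (real n + 1)) z t - p3 (1 / (real n + 1)) z t = 0"
      unfolding AE_all_countable AE_ball_countable[OF countable_rat] by (intro allI ballI tested_equation) simp
    then show "AE t in lborel. utt t k = W d y t"
    proof eventually_elim
      case (elim t)
      then show ?case unfolding k_def has_fourier_kern[OF has_fourier_utt d] by (intro pointwise_equation[OF _ d]) blast
    qed
    fix \<eta> assume \<eta>: "\<eta> \<in> smooth_cs"
    note p = product_test_function[OF \<eta> k]
    have "spacetime utt (\<lambda>t x. \<eta> t * k x) = - spacetime (\<lambda>t. reg_dist (ut t)) (\<lambda>t x. vderiv \<eta> t * k x)"
      using utt_deriv p(1) unfolding dist_deriv_t_def p(2)[symmetric] by blast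
    then show "(LINT t|lborel. utt t k * \<eta> t) = - (LINT t|lborel. pairing (gb t) (\<lambda>x. kern d (x - y)) * vderiv \<eta> t)"
      unfolding spacetime_def reg_dist_cmult \<alpha> \<beta> by (simp add: mult.commute)
  qed
  from bounded_linear.has_vector_derivative[OF bounded_linear_Re this] show ?thesis
    unfolding B.conv_F[OF d, symmetric] by (simp add: has_real_derivative_iff_has_vector_derivative)
qed

end

lemma conv_B_deriv_t:
  assumes d: "d > 0"
  shows "((\<lambda>t. conv d (B.F t) y) has_real_derivative
     Re (pairing (A.G t) (\<lambda>x. speed (A.F t x) (B.F t x) * kern d (x - y))) +
     Re (pairing (B.G t) (\<lambda>x. drift (A.F t x) (B.F t x) * kern d (x - y)))) (at t)"
proof -
  obtain utt where "sobolev_loc_integrable (s - 1) utt" "dist_deriv_t (\<lambda>t. reg_dist (ut t)) utt"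
    "\<forall>\<phi>\<in>test_functions.
           spacetime (\<lambda>t. dist_mult (\<lambda>x. 1 - (ut t x)\<^sup>2) (dist_deriv (dist_deriv (reg_dist (u t))))) \<phi>
           + 2 * spacetime (\<lambda>t. dist_mult (\<lambda>x. ux t x * ut t x) (dist_deriv (reg_dist (ut t)))) \<phi>
           - spacetime (\<lambda>t. dist_mult (\<lambda>x. 1 + (ux t x)\<^sup>2) (utt t)) \<phi> = 0"
    using bi unfolding born_infeld_solution_def by blast
  from conv_B_deriv_aux[OF this(1,2) bspec[OF this(3)] d, of y t] show ?thesis by (simp add: W_def)
qed

sublocale flow r A.F B.F A.G B.G \<epsilon>
proof
  show "\<bar>A.F t x\<bar> \<le> 1 / 4" "\<bar>B.F t x\<bar> \<le> 1 / 4" for t x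
    using A.F_small[of t x] B.F_small[of t x] eps(2) by linarith+
qed (use A.F_ucls B.F_ucls A.F_lim B.F_lim A.G_dual B.G_dual A.G_nrm B.G_nrm A.conv_F_deriv B.conv_F_deriv conv_A_deriv_t conv_B_deriv_t in \<open>simp_all\<close>)

theorem local_energy_decay:
  assumes lam: "lam > 0"
  shows "(\<integral>\<^sup>+t\<in>{2..}. (\<integral>\<^sup>+x. ennreal ((1 / cosh (x / lam))\<^sup>2 * ((ux t x)\<^sup>2 + (ut t x)\<^sup>2)) \<partial>lborel) \<partial>lborel)
      \<le> ennreal (8 * lam * \<epsilon>\<^sup>2)"
proof -
  have "(\<integral>\<^sup>+x. ennreal ((1 / cosh (x / lam))\<^sup>2 * ((ux t x)\<^sup>2 + (ut t x)\<^sup>2)) \<partial>lborel) =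
      (\<integral>\<^sup>+x. ennreal ((1 / cosh (x / lam))\<^sup>2 * ((A.F t x)\<^sup>2 + (B.F t x)\<^sup>2)) \<partial>lborel)" for t
  proof (rule nn_integral_cong_AE)
    show "AE x in lborel. ennreal ((1 / cosh (x / lam))\<^sup>2 * ((ux t x)\<^sup>2 + (ut t x)\<^sup>2)) =
        ennreal ((1 / cosh (x / lam))\<^sup>2 * ((A.F t x)\<^sup>2 + (B.F t x)\<^sup>2))"
      using A.F_AE[of t] B.F_AE[of t] by eventually_elim simp
  qed
  moreover have "(LINT x|lborel. (A.F t x)\<^sup>2 + (B.F t x)\<^sup>2) \<le> \<epsilon>\<^sup>2" for t
  proof -
    have "(LINT x|lborel. (A.F t x)\<^sup>2 + (B.F t x)\<^sup>2) = (LINT x|lborel. (A.F t x)\<^sup>2) + (LINT x|lborel. (B.F t x)\<^sup>2)"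
      by (rule Bochner_Integration.integral_add[OF A.F_energy(1) B.F_energy(1)])
    then show ?thesis
      using A.F_energy(2)[of t] B.F_energy(2)[of t] weighted_ga(2)[of t] weighted_gb'(2)[of t] energy_bound[of t] by linarith
  qed
  ultimately show ?thesis
    using virial[OF lam zero_le_power2 Bochner_Integration.integrable_add[OF A.F_energy(1) B.F_energy(1)], of "\<epsilon>"] by simp
qed

end

text \<open>The supremum is taken in \<open>ereal\<close> and the integrals in
  \<open>ennreal\<close>: a curve of unbounded norm cannot meet the hypothesis through a default
  value, and finiteness of the left side is part of the claim.\<close>

theorem mainTheorem2:
  fixes s :: real
  assumes "s > 1 / 2"
  shows "\<exists>\<epsilon>0 > 0. \<exists>K > 0. \<forall>\<epsilon> (lam0 :: real) (u :: real \<Rightarrow> real \<Rightarrow> real) ux ut.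
    0 < \<epsilon> \<and> \<epsilon> < \<epsilon>0 \<and> 0 < lam0 \<and> born_infeld_solution s u ux ut \<and>
    (SUP t. ereal (pair_norm s (u t) (ut t))) < ereal \<epsilon> \<longrightarrow>
    (\<integral>\<^sup>+t\<in>{2..}. (\<integral>\<^sup>+x. ennreal ((1 / cosh (x / lam0))\<^sup>2 * ((ux t x)\<^sup>2 + (ut t x)\<^sup>2)) \<partial>lborel) \<partial>lborel)
      \<le> ennreal (K * lam0 * \<epsilon>\<^sup>2)"
proof -
  define r where "r = min s 1"
  interpret exponent r by standard (use assms in \<open>auto simp: r_def\<close>)
  \<comment> \<open>Small enough that the embedding bounds |u_x| and |u_t| by 1/4, the size for
    which the density estimates were made; the summand 1 keeps the denominator positive.\<close>
  define \<epsilon>0 where "\<epsilon>0 = 1 / (4 * (embed_const + 1))"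
  have \<epsilon>0: "\<epsilon>0 > 0" using embed_const_nonneg by (simp add: \<epsilon>0_def)
  have "(\<integral>\<^sup>+t\<in>{2..}. (\<integral>\<^sup>+x. ennreal ((1 / cosh (x / lam0))\<^sup>2 * ((ux t x)\<^sup>2 + (ut t x)\<^sup>2)) \<partial>lborel) \<partial>lborel)
      \<le> ennreal (8 * lam0 * \<epsilon>\<^sup>2)"
    if h: "0 < \<epsilon>" "\<epsilon> < \<epsilon>0" "0 < lam0" "born_infeld_solution s u ux ut" "(SUP t. ereal (pair_norm s (u t) (ut t))) < ereal \<epsilon>"
    for \<epsilon> lam0 :: real and u ux ut :: "real \<Rightarrow> real \<Rightarrow> real"
  proof -
    interpret solution r s \<epsilon> u ux ut
    proof
      show "r \<le> s" by (simp add: r_def)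
      show "0 \<le> \<epsilon>" using h(1) by simp
      have "embed_const * \<epsilon> \<le> embed_const * \<epsilon>0" using h(2) embed_const_nonneg by (intro mult_left_mono) auto
      also have "\<dots> \<le> 1 / 4" using embed_const_nonneg by (simp add: \<epsilon>0_def field_simps)
      finally show "embed_const * \<epsilon> \<le> 1 / 4" .
      show "born_infeld_solution s u ux ut" by (rule h)
      show "pair_norm s (u t) (ut t) \<le> \<epsilon>" for t
      proof -
        have "ereal (pair_norm s (u t) (ut t)) \<le> (SUP t. ereal (pair_norm s (u t) (ut t)))" by (rule SUP_upper) simp
        also have "\<dots> < ereal \<epsilon>" by (rule h)
        finally show ?thesis by simp
      qed
    qed
    show ?thesis by (rule local_energy_decay[OF h(3)])
  qed
  then have "\<forall>\<epsilon> (lam0 :: real) (u :: real \<Rightarrow> real \<Rightarrow> real) ux ut.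
    0 < \<epsilon> \<and> \<epsilon> < \<epsilon>0 \<and> 0 < lam0 \<and> born_infeld_solution s u ux ut \<and>
    (SUP t. ereal (pair_norm s (u t) (ut t))) < ereal \<epsilon> \<longrightarrow>
    (\<integral>\<^sup>+t\<in>{2..}. (\<integral>\<^sup>+x. ennreal ((1 / cosh (x / lam0))\<^sup>2 * ((ux t x)\<^sup>2 + (ut t x)\<^sup>2)) \<partial>lborel) \<partial>lborel)
      \<le> ennreal (8 * lam0 * \<epsilon>\<^sup>2)" by blast
  then show ?thesis by (intro exI[of _ \<epsilon>0] exI[of _ 8] conjI \<epsilon>0) simp_all
qed

end
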